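(* Let $\mathbb{G}_1,\mathbb{G}_2$ be monoidally equivalent compact quantum groups with monoidal equivalence $\varphi:\mathbb{G}_2\to\mathbb{G}_1$, von Neumann algebraic link algebra $B$, commuting actions $\delta_1,\delta_2$ on $B$, and unitary $\mathbb{X}=\bigoplus_{x\in\mathrm{Irred}(\mathbb{G}_2)}X^x$. Let $\mu$ be a generating probability measure on $\mathrm{Irred}(\mathbb{G}_1)$ (also viewed, through $\varphi$, as a measure on $\mathrm{Irred}(\mathbb{G}_2)$). Then $$\rho:H^\infty(\widehat{\mathbb{G}}_2,\mu)\to H^\infty(\widehat{\mathbb{G}}_1,\mu)\boxtimes^{\alpha_{\mathbb{G}_1}}B,\qquad \rho(b)=\mathbb{X}(b\otimes1)\mathbb{X}^*,$$ is a $^*$-isomorphism. Moreover, this $^*$-isomorphism intertwines the action $\mathrm{id}\boxtimes\delta_2$ with the adjoint action $\alpha_{\mathbb{G}_2}$.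
   Context: Compact quantum groups are in Woronowicz's sense. For such $\mathbb{G}$ with comultiplication $\Delta$ and Haar state $h$: unitary representations satisfy $(\mathrm{id}\otimes\Delta)(U)=U_{12}U_{13}$; $\mathrm{Mor}(U^1,U^2)=\{T\in\mathcal{L}(H_2,H_1)\mid U^1(T\otimes1)=(T\otimes1)U^2\}$; the tensor product of representations is $U^1_{13}U^2_{23}$; $\mathrm{Irred}(\mathbb{G})$ has representatives $U^x$ on $H_x$; $x\otimes y$ is the tensor product of $U^x,U^y$; $\varepsilon$ is trivial; $\mathcal{C}(\mathbb{G})$ is the Hopf $^*$-algebra of coefficients; $L^\infty(\mathbb{G})$ is the von Neumann algebra generated by $\mathcal{C}(\mathbb{G})$ in the GNS representation of $h$. Monoidal equivalence and link algebra. A monoidal equivalence $\varphi:\mathbb{G}_2\to\mathbb{G}_1$ is a bijection $\varphi:\mathrm{Irred}(\mathbb{G}_2)\to\mathrm{Irred}(\mathbb{G}_1)$ with $\varphi(\varepsilon)=\varepsilon$ together with linear isomorphisms $\varphi:\mathrm{Mor}(x_1\otimes\cdots\otimes x_r,y_1\otimes\cdots\otimes y_k)\to\mathrm{Mor}(\varphi(x_1)\otimes\cdots\otimes\varphi(x_r),\varphi(y_1)\otimes\cdots\otimes\varphi(y_k))$ compatible with units, tensor products, adjoints and composition. Its link algebra (known to exist and be unique) is the unital $^*$-algebra $\mathcal{B}$ with faithful state $\omega$ and unitaries $X^x\in\mathcal{L}(H_x,H_{\varphi(x)})\otimes\mathcal{B}$, $x\in\mathrm{Irred}(\mathbb{G}_2)$,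 with $X^y_{13}X^z_{23}(S\otimes1)=(\varphi(S)\otimes1)X^x$ for $S\in\mathrm{Mor}(y\otimes z,x)$, coefficients of the $X^x$ forming a linear basis of $\mathcal{B}$, and $(\mathrm{id}\otimes\omega)(X^x)=0$ for $x\ne\varepsilon$. It carries unique commuting ergodic $\omega$-invariant actions $\delta_1:\mathcal{B}\to\mathcal{C}(\mathbb{G}_1)\otimes_{\rm alg}\mathcal{B}$, $\delta_2:\mathcal{B}\to\mathcal{B}\otimes_{\rm alg}\mathcal{C}(\mathbb{G}_2)$ with $(\mathrm{id}\otimes\delta_1)(X^x)=U^{\varphi(x)}_{12}X^x_{13}$, $(\mathrm{id}\otimes\delta_2)(X^x)=X^x_{12}U^x_{13}$. $B=(\mathcal{B},\omega)''$ is the von Neumann algebra generated by $\mathcal{B}$ in the GNS representation of $\omega$, and $\delta_1,\delta_2$ extend to $B$. Dual and Poisson boundary. $\ell^\infty(\widehat{\mathbb{G}})=\prod_{x\in\mathrm{Irred}(\mathbb{G})}\mathcal{L}(H_x)$, $\mathbb{V}=\bigoplus_xU^x$, and $\hat\Delta$ is the comultiplication with $(\hat\Delta\otimes\mathrm{id})(\mathbb{V})=\mathbb{V}_{13}\mathbb{V}_{23}$. The state $\psi_x$ on $\mathcal{L}(H_x)$ is $\psi_x(A)1=(\mathrm{id}\otimes h)(U^x(A\otimes1)(U^x)^* )$. For a probability measure $\mu$ on $\mathrm{Irred}(\mathbb{G})$, $\psi_\mu=\sum_x\mu(x)\psi_x$, $P_\mu(a)=(\mathrm{id}\otimes\psi_\mu)\hat\Delta(a)$;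 the convolution satisfies $\psi_{\mu*\nu}=(\psi_\mu\otimes\psi_\nu)\hat\Delta$; $\mu$ is generating if for every $x$ there is $n\ge1$ with $\mu^{*n}(x)\ne0$. The Poisson boundary is $H^\infty(\widehat{\mathbb{G}},\mu)=\{a\in\ell^\infty(\widehat{\mathbb{G}})\mid P_\mu(a)=a\}$, a von Neumann algebra with product $a\cdot b=w^*\text{-}\lim_n\frac1n\sum_{k=1}^nP_\mu^k(ab)$ and involution, norm and $\sigma$-weak topology inherited from $\ell^\infty(\widehat{\mathbb{G}})$. The adjoint action $\alpha_{\mathbb{G}}(a)=\mathbb{V}(a\otimes1)\mathbb{V}^*$ on $\ell^\infty(\widehat{\mathbb G})$ restricts to an action of $\mathbb{G}$ on $H^\infty(\widehat{\mathbb{G}},\mu)$. For a von Neumann algebraic action $\alpha:N\to N\overline\otimes L^\infty(\mathbb{G}_1)$, $N\boxtimes^\alpha B=\{a\in N\overline\otimes B\mid(\alpha\otimes\mathrm{id})(a)=(\mathrm{id}\otimes\delta_1)(a)\}$, and $\mathrm{id}\boxtimes\delta_2$ is the restriction of $\mathrm{id}\otimes\delta_2$ to it, an action of $\mathbb{G}_2$. Here $H^\infty(\widehat{\mathbb{G}}_1,\mu)\overline\otimes B$ is viewed, as a weakly closed subspace, as $\{a\in\ell^\infty(\widehat{\mathbb{G}}_1)\overline\otimes B\mid(P_\mu\otimes\mathrm{id})(a)=a\}$ with product $w^*\text{-}\lim_n\frac1n\sum_{k=1}^n(P_\mu^k\otimes\mathrm{id})(ab)$. *)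

theory Defs
  imports "HOL-Analysis.Analysis" "HOL-Probability.Probability_Mass_Function"
begin

section \<open>Hilbert spaces and bounded operators\<close>

text \<open>Every complex Hilbert space is, after the choice of an orthonormal basis, the space of
  square-summable families over some index type. All Hilbert spaces below are of this form, so that
  the Hilbert space tensor product corresponds to the product of index types.\<close>

typedef 'i ell2 = "{f :: 'i \<Rightarrow> complex. (\<lambda>i. (cmod (f i))\<^sup>2) summable_on UNIV}"
  morphisms coord Abs_ell2
  by (rule exI[of _ "\<lambda>_. 0"]) simp

setup_lifting type_definition_ell2

lemma sq_summable_plus:
  fixes f g :: "'i \<Rightarrow> complex"
  assumes "(\<lambda>i. (cmod (f i))\<^sup>2) summable_on UNIV" "(\<lambda>i. (cmod (g i))\<^sup>2) summable_on UNIV"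
  shows "(\<lambda>i. (cmod (f i + g i))\<^sup>2) summable_on UNIV"
proof (rule summable_on_comparison_test)
  show "(\<lambda>i. 2 * (cmod (f i))\<^sup>2 + 2 * (cmod (g i))\<^sup>2) summable_on UNIV"
    by (intro summable_on_add summable_on_cmult_right assms)
  fix i
  have "(cmod (f i + g i))\<^sup>2 \<le> (cmod (f i) + cmod (g i))\<^sup>2"
    by (intro power_mono norm_triangle_ineq) auto
  also have "\<dots> \<le> 2 * (cmod (f i))\<^sup>2 + 2 * (cmod (g i))\<^sup>2"
    using zero_le_power2[of "cmod (f i) - cmod (g i)"]
    by (simp add: power2_sum power2_diff)
  finally show "(cmod (f i + g i))\<^sup>2 \<le> 2 * (cmod (f i))\<^sup>2 + 2 * (cmod (g i))\<^sup>2" .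
qed simp

lemma sq_summable_scale:
  fixes f :: "'i \<Rightarrow> complex"
  assumes "(\<lambda>i. (cmod (f i))\<^sup>2) summable_on UNIV"
  shows "(\<lambda>i. (cmod (c * f i))\<^sup>2) summable_on UNIV"
  using summable_on_cmult_right[OF assms, of "(cmod c)\<^sup>2"]
  by (simp add: norm_mult power_mult_distrib)

lemma sq_summable_prod:
  fixes f g :: "'i \<Rightarrow> complex"
  assumes "(\<lambda>i. (cmod (f i))\<^sup>2) summable_on UNIV" "(\<lambda>i. (cmod (g i))\<^sup>2) summable_on UNIV"
  shows "(\<lambda>i. cnj (f i) * g i) summable_on UNIV"
proof (rule abs_summable_summable, rule summable_on_comparison_test)
  show "(\<lambda>i. (cmod (f i))\<^sup>2 + (cmod (g i))\<^sup>2) summable_on UNIV"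
    by (intro summable_on_add assms)
  fix i
  have "2 * (cmod (f i) * cmod (g i)) \<le> (cmod (f i))\<^sup>2 + (cmod (g i))\<^sup>2"
    using sum_squares_bound[of "cmod (f i)" "cmod (g i)"] by simp
  moreover have "0 \<le> cmod (f i) * cmod (g i)" by simp
  ultimately show "cmod (cnj (f i) * g i) \<le> (cmod (f i))\<^sup>2 + (cmod (g i))\<^sup>2"
    unfolding norm_mult complex_mod_cnj by linarith
qed simp

text \<open>Inner products are linear in the second argument.\<close>

definition cinner :: "'i ell2 \<Rightarrow> 'i ell2 \<Rightarrow> complex" where
  "cinner x y = (\<Sum>\<^sub>\<infinity>i. cnj (coord x i) * coord y i)"

lift_definition cscale :: "complex \<Rightarrow> 'i ell2 \<Rightarrow> 'i ell2" is "\<lambda>c f i. c * f i"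
  by (rule sq_summable_scale)

instantiation ell2 :: (type) real_inner
begin

lift_definition zero_ell2 :: "'a ell2" is "\<lambda>_. 0" by simp
lift_definition plus_ell2 :: "'a ell2 \<Rightarrow> 'a ell2 \<Rightarrow> 'a ell2" is "\<lambda>f g i. f i + g i"
  by (rule sq_summable_plus)
lift_definition uminus_ell2 :: "'a ell2 \<Rightarrow> 'a ell2" is "\<lambda>f i. - f i" by simp
lift_definition minus_ell2 :: "'a ell2 \<Rightarrow> 'a ell2 \<Rightarrow> 'a ell2" is "\<lambda>f g i. f i - g i"
  using sq_summable_plus[where g = "\<lambda>i. - g i" for g] by simp
lift_definition scaleR_ell2 :: "real \<Rightarrow> 'a ell2 \<Rightarrow> 'a ell2" is "\<lambda>r f i. of_real r * f i"
  by (rule sq_summable_scale)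
definition inner_ell2 :: "'a ell2 \<Rightarrow> 'a ell2 \<Rightarrow> real" where
  "inner_ell2 x y = Re (cinner x y)"
definition norm_ell2 :: "'a ell2 \<Rightarrow> real" where
  "norm_ell2 x = sqrt (inner x x)"
definition sgn_ell2 :: "'a ell2 \<Rightarrow> 'a ell2" where
  "sgn_ell2 x = scaleR (inverse (norm x)) x"
definition dist_ell2 :: "'a ell2 \<Rightarrow> 'a ell2 \<Rightarrow> real" where
  "dist_ell2 x y = norm (x - y)"
definition uniformity_ell2 :: "('a ell2 \<times> 'a ell2) filter" where
  "uniformity_ell2 = (INF e\<in>{0<..}. principal {(x, y). dist x y < e})"
definition open_ell2 :: "'a ell2 set \<Rightarrow> bool" where
  "open_ell2 U \<longleftrightarrow> (\<forall>x\<in>U. \<forall>\<^sub>F (x', y) in uniformity. x' = x \<longrightarrow> y \<in> U)"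

instance
proof
  have summ: "(\<lambda>i. cnj (coord x i) * coord y i) summable_on UNIV" for x y :: "'a ell2"
    using coord[of x] coord[of y] by (intro sq_summable_prod) auto
  have inner_alt: "inner x y = (\<Sum>\<^sub>\<infinity>i. Re (cnj (coord x i) * coord y i))" for x y :: "'a ell2"
    unfolding inner_ell2_def cinner_def using infsum_Re[OF summ] by simp
  have summR: "(\<lambda>i. Re (cnj (coord x i) * coord y i)) summable_on UNIV" for x y :: "'a ell2"
    using summable_on_Re[OF summ] .
  fix x y z :: "'a ell2" and a b r :: real
  show "x + y + z = x + (y + z)" by transfer (simp add: add.assoc)
  show "x + y = y + x" by transfer (simp add: add.commute)
  show "0 + x = x" by transfer simp
  show "- x + x = 0" by transfer simp
  show "x - y = x + - y" by transfer simp
  show "a *\<^sub>R (x + y) = a *\<^sub>R x + a *\<^sub>R y" by transfer (simp add: algebra_simps)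
  show "(a + b) *\<^sub>R x = a *\<^sub>R x + b *\<^sub>R x" by transfer (simp add: algebra_simps)
  show "a *\<^sub>R b *\<^sub>R x = (a * b) *\<^sub>R x" by transfer (simp add: algebra_simps)
  show "1 *\<^sub>R x = x" by transfer simp
  show "sgn x = scaleR (inverse (norm x)) x" by (rule sgn_ell2_def)
  show "dist x y = norm (x - y)" by (rule dist_ell2_def)
  show "uniformity = (INF e\<in>{0<..}. principal {(x :: 'a ell2, y). dist x y < e})"
    by (rule uniformity_ell2_def)
  show "open U \<longleftrightarrow> (\<forall>x\<in>U. \<forall>\<^sub>F (x', y) in uniformity. x' = x \<longrightarrow> y \<in> U)"
    for U :: "'a ell2 set" by (rule open_ell2_def)
  show "norm x = sqrt (inner x x)" by (rule norm_ell2_def)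
  show "inner x y = inner y x"
    unfolding inner_alt by (simp add: mult.commute)
  show "inner (x + y) z = inner x z + inner y z"
  proof -
    have "Re (cnj (coord (x + y) i) * coord z i)
        = Re (cnj (coord x i) * coord z i) + Re (cnj (coord y i) * coord z i)" for i
      by (simp add: plus_ell2.rep_eq algebra_simps)
    then show ?thesis
      unfolding inner_alt by (simp only: infsum_add[OF summR summR])
  qed
  show "inner (r *\<^sub>R x) y = r * inner x y"
  proof -
    have "Re (cnj (coord (r *\<^sub>R x) i) * coord y i) = r * Re (cnj (coord x i) * coord y i)" for i
      by (simp add: scaleR_ell2.rep_eq algebra_simps)
    then show ?thesis
      unfolding inner_alt by (simp only: infsum_cmult_right')
  qed
  have sq: "Re (cnj (coord x i) * coord x i) = (cmod (coord x i))\<^sup>2" for i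
    unfolding cmod_power2 by (simp add: power2_eq_square)
  show "0 \<le> inner x x"
    unfolding inner_alt sq by (intro infsum_nonneg) simp
  show "inner x x = 0 \<longleftrightarrow> x = 0"
  proof
    assume "inner x x = 0"
    then have "(\<Sum>\<^sub>\<infinity>i. (cmod (coord x i))\<^sup>2) = 0"
      unfolding inner_alt sq .
    then have "(cmod (coord x i))\<^sup>2 = 0" for i
      using nonneg_infsum_le_0D[where f = "\<lambda>i. (cmod (coord x i))\<^sup>2" and A = UNIV and x = i]
        coord[of x] by auto
    then show "x = 0" by transfer auto
  next
    assume "x = 0"
    then show "inner x x = 0" unfolding inner_alt by (simp add: zero_ell2.rep_eq)
  qed
qed

end

definition basis_vec :: "'i \<Rightarrow> 'i ell2" where
  "basis_vec i = Abs_ell2 (\<lambda>j. if j = i then 1 else 0)"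

definition vec_tensor :: "'i ell2 \<Rightarrow> 'j ell2 \<Rightarrow> ('i \<times> 'j) ell2" (infixr "\<otimes>\<^sub>v" 75) where
  "x \<otimes>\<^sub>v y = Abs_ell2 (\<lambda>(i, j). coord x i * coord y j)"

text \<open>The library's bounded linear maps are only real linear; all operator algebras below are
  required to consist of complex linear ones.\<close>

type_synonym ('i, 'j) hom = "'i ell2 \<Rightarrow>\<^sub>L 'j ell2"
type_synonym 'i op = "('i, 'i) hom"

definition clin :: "('i, 'j) hom set" where
  "clin = {T. \<forall>c x. blinfun_apply T (cscale c x) = cscale c (blinfun_apply T x)}"

definition scaleC :: "complex \<Rightarrow> ('i, 'j) hom \<Rightarrow> ('i, 'j) hom" (infixr "*\<^sub>C" 75) where
  "c *\<^sub>C T = Blinfun (cscale c) o\<^sub>L T"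

definition adj :: "('i, 'j) hom \<Rightarrow> ('j, 'i) hom" where
  "adj T = (THE S. \<forall>x y. cinner (blinfun_apply S x) y = cinner x (blinfun_apply T y))"

definition op_tensor :: "('i, 'k) hom \<Rightarrow> ('j, 'l) hom \<Rightarrow> ('i \<times> 'j, 'k \<times> 'l) hom"
    (infixr "\<otimes>\<^sub>o" 75) where
  "S \<otimes>\<^sub>o T = (THE R. \<forall>x y. blinfun_apply R (x \<otimes>\<^sub>v y) = blinfun_apply S x \<otimes>\<^sub>v blinfun_apply T y)"

definition entry :: "'i op \<Rightarrow> 'i \<Rightarrow> 'i \<Rightarrow> complex" where
  "entry T i j = cinner (basis_vec i) (blinfun_apply T (basis_vec j))"

definition block_op :: "('e \<Rightarrow> 'f \<Rightarrow> 'i op) \<Rightarrow> ('f \<times> 'i, 'e \<times> 'i) hom" where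
  "block_op m = (THE T. T \<in> clin \<and> (\<forall>e f x y.
     cinner (basis_vec e \<otimes>\<^sub>v y) (blinfun_apply T (basis_vec f \<otimes>\<^sub>v x))
       = cinner y (blinfun_apply (m e f) x)))"

text \<open>For a bijection \<open>p\<close> of index types, transport of operators along the unitary which sends the
  basis vector at \<open>i\<close> to the basis vector at \<open>p i\<close>; it is used for leg numbering.\<close>

definition basis_map :: "('i \<Rightarrow> 'j) \<Rightarrow> ('i, 'j) hom" where
  "basis_map p = Blinfun (\<lambda>x. Abs_ell2 (\<lambda>j. coord x (inv p j)))"

definition relabel :: "('i \<Rightarrow> 'j) \<Rightarrow> 'i op \<Rightarrow> 'j op" where
  "relabel p T = basis_map p o\<^sub>L T o\<^sub>L adj (basis_map p)"

definition assoc_op :: "(('i \<times> 'j) \<times> 'k) op \<Rightarrow> ('i \<times> 'j \<times> 'k) op" where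
  "assoc_op = relabel (\<lambda>((i, j), k). (i, j, k))"

definition leg13 :: "('i \<times> 'k) op \<Rightarrow> (('i \<times> 'j) \<times> 'k) op" where
  "leg13 T = relabel (\<lambda>(j, i, k). ((i, j), k)) (id_blinfun \<otimes>\<^sub>o T)"

definition leg23 :: "('j \<times> 'k) op \<Rightarrow> (('i \<times> 'j) \<times> 'k) op" where
  "leg23 T = relabel (\<lambda>(i, j, k). ((i, j), k)) (id_blinfun \<otimes>\<^sub>o T)"

section \<open>Operator algebras\<close>

definition unital_star_algebra :: "'i op set \<Rightarrow> bool" where
  "unital_star_algebra A \<longleftrightarrow> A \<subseteq> clin \<and> id_blinfun \<in> A \<and>
     (\<forall>a\<in>A. \<forall>b\<in>A. a + b \<in> A \<and> a o\<^sub>L b \<in> A) \<and> (\<forall>a\<in>A. adj a \<in> A \<and> (\<forall>c. c *\<^sub>C a \<in> A))"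

definition linear_map_on :: "'i op set \<Rightarrow> ('i op \<Rightarrow> 'j op) \<Rightarrow> bool" where
  "linear_map_on A F \<longleftrightarrow> (\<forall>a\<in>A. \<forall>b\<in>A. F (a + b) = F a + F b) \<and> (\<forall>c. \<forall>a\<in>A. F (c *\<^sub>C a) = c *\<^sub>C F a)"

definition unital_star_hom :: "'i op set \<Rightarrow> 'j op set \<Rightarrow> ('i op \<Rightarrow> 'j op) \<Rightarrow> bool" where
  "unital_star_hom A B F \<longleftrightarrow> F ` A \<subseteq> B \<and> linear_map_on A F \<and> F id_blinfun = id_blinfun \<and>
     (\<forall>a\<in>A. \<forall>b\<in>A. F (a o\<^sub>L b) = F a o\<^sub>L F b) \<and> (\<forall>a\<in>A. F (adj a) = adj (F a))"

definition state_on :: "'i op set \<Rightarrow> ('i op \<Rightarrow> complex) \<Rightarrow> bool" where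
  "state_on A w \<longleftrightarrow> (\<forall>a\<in>A. \<forall>b\<in>A. w (a + b) = w a + w b) \<and> (\<forall>c. \<forall>a\<in>A. w (c *\<^sub>C a) = c * w a) \<and>
     w id_blinfun = 1 \<and> (\<forall>a\<in>A. w (adj a o\<^sub>L a) \<in> \<real>\<^sub>\<ge>\<^sub>0)"

definition faithful_on :: "'i op set \<Rightarrow> ('i op \<Rightarrow> complex) \<Rightarrow> bool" where
  "faithful_on A w \<longleftrightarrow> (\<forall>a\<in>A. w (adj a o\<^sub>L a) = 0 \<longrightarrow> a = 0)"

definition gns_rep :: "'k op set \<Rightarrow> ('k op \<Rightarrow> complex) \<Rightarrow> ('k op \<Rightarrow> 'i op) \<Rightarrow> bool" where
  "gns_rep A w \<pi> \<longleftrightarrow> unital_star_hom A clin \<pi> \<and>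
     (\<exists>\<xi>. (\<forall>a\<in>A. w a = cinner \<xi> (blinfun_apply (\<pi> a) \<xi>)) \<and>
          closure ((\<lambda>a. blinfun_apply (\<pi> a) \<xi>) ` A) = UNIV)"

subsection \<open>C*-algebras\<close>

text \<open>The real span of the elementary tensors is already a complex subspace, since the first
  factor is one. For algebras of operators, the closure below is the minimal tensor product.\<close>

definition elem_tensors :: "'i op set \<Rightarrow> 'j op set \<Rightarrow> ('i \<times> 'j) op set" where
  "elem_tensors A B = {a \<otimes>\<^sub>o b | a b. a \<in> A \<and> b \<in> B}"

definition min_tensor :: "'i op set \<Rightarrow> 'j op set \<Rightarrow> ('i \<times> 'j) op set" where
  "min_tensor A B = closure (span (elem_tensors A B))"

text \<open>The norm continuous linear extension to the minimal tensor product of a map prescribed on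
  elementary tensors.\<close>

definition norm_ext :: "'i op set \<Rightarrow> 'j op set \<Rightarrow> ('i op \<Rightarrow> 'j op \<Rightarrow> 'l op) \<Rightarrow> ('i \<times> 'j) op \<Rightarrow> 'l op" where
  "norm_ext A B f = (THE F. F \<in> extensional (min_tensor A B) \<and> linear_map_on (min_tensor A B) F \<and>
     continuous_on (min_tensor A B) F \<and> (\<forall>a\<in>A. \<forall>b\<in>B. F (a \<otimes>\<^sub>o b) = f a b))"

subsection \<open>Von Neumann algebras\<close>

definition commutant :: "'i op set \<Rightarrow> 'i op set" where
  "commutant S = {T \<in> clin. \<forall>s\<in>S. T o\<^sub>L s = s o\<^sub>L T}"

definition vn_generated :: "'i op set \<Rightarrow> 'i op set" where
  "vn_generated S = commutant (commutant S)"

definition vn_tensor :: "'i op set \<Rightarrow> 'j op set \<Rightarrow> ('i \<times> 'j) op set" (infixr "\<otimes>\<^sub>v\<^sub>N" 75) where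
  "N \<otimes>\<^sub>v\<^sub>N M = vn_generated (elem_tensors N M)"

definition sigma_weak_functionals :: "('i op \<Rightarrow> complex) set" where
  "sigma_weak_functionals = {\<lambda>T. \<Sum>n. cinner (x n) (blinfun_apply T (y n)) | x y :: nat \<Rightarrow> 'i ell2.
     summable (\<lambda>n. (norm (x n))\<^sup>2) \<and> summable (\<lambda>n. (norm (y n))\<^sup>2)}"

definition sigma_weak :: "'i op topology" where
  "sigma_weak = topology_generated_by {w -` U | w U. w \<in> sigma_weak_functionals \<and> open U}"

definition normal_on :: "'i op set \<Rightarrow> ('i op \<Rightarrow> 'j op) \<Rightarrow> bool" where
  "normal_on N F \<longleftrightarrow> continuous_map (subtopology sigma_weak N) sigma_weak F"

text \<open>The normal linear extension to the von Neumann algebraic tensor product of a map prescribed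
  on elementary tensors.\<close>

definition normal_ext :: "'i op set \<Rightarrow> 'j op set \<Rightarrow> ('i op \<Rightarrow> 'j op \<Rightarrow> 'l op) \<Rightarrow> ('i \<times> 'j) op \<Rightarrow> 'l op" where
  "normal_ext N M f = (THE F. F \<in> extensional (N \<otimes>\<^sub>v\<^sub>N M) \<and> linear_map_on (N \<otimes>\<^sub>v\<^sub>N M) F \<and>
     normal_on (N \<otimes>\<^sub>v\<^sub>N M) F \<and> (\<forall>a\<in>N. \<forall>b\<in>M. F (a \<otimes>\<^sub>o b) = f a b))"

definition tensor_map ::
    "'i op set \<Rightarrow> 'j op set \<Rightarrow> ('i op \<Rightarrow> 'k op) \<Rightarrow> ('j op \<Rightarrow> 'l op) \<Rightarrow> ('i \<times> 'j) op \<Rightarrow> ('k \<times> 'l) op" where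
  "tensor_map N M F G = normal_ext N M (\<lambda>a b. F a \<otimes>\<^sub>o G b)"

section \<open>Compact quantum groups\<close>

text \<open>\<open>C(\<G>)\<close> is given as an algebra of operators on some Hilbert space, which is no restriction by
  the Gelfand--Naimark theorem.\<close>

record 'k cqg =
  calg :: "'k op set"
  comult :: "'k op \<Rightarrow> ('k \<times> 'k) op"

definition compact_quantum_group :: "('k, 'z) cqg_scheme \<Rightarrow> bool" where
  "compact_quantum_group G \<longleftrightarrow> (let A = calg G; \<Delta> = comult G in
     unital_star_algebra A \<and> closed A \<and> unital_star_hom A (min_tensor A A) \<Delta> \<and>
     (\<forall>a\<in>A. assoc_op (norm_ext A A (\<lambda>b c. \<Delta> b \<otimes>\<^sub>o c) (\<Delta> a)) = norm_ext A A (\<lambda>b c. b \<otimes>\<^sub>o \<Delta> c) (\<Delta> a)) \<and>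
     closure (span {\<Delta> a o\<^sub>L (id_blinfun \<otimes>\<^sub>o b) | a b. a \<in> A \<and> b \<in> A}) = min_tensor A A \<and>
     closure (span {\<Delta> a o\<^sub>L (b \<otimes>\<^sub>o id_blinfun) | a b. a \<in> A \<and> b \<in> A}) = min_tensor A A)"

definition haar_state :: "('k, 'z) cqg_scheme \<Rightarrow> ('k op \<Rightarrow> complex) \<Rightarrow> bool" where
  "haar_state G h \<longleftrightarrow> (let A = calg G; \<Delta> = comult G in
     state_on A h \<and>
     (\<forall>a\<in>A. norm_ext A A (\<lambda>b c. h c *\<^sub>C b) (\<Delta> a) = h a *\<^sub>C id_blinfun \<and>
            norm_ext A A (\<lambda>b c. h b *\<^sub>C c) (\<Delta> a) = h a *\<^sub>C id_blinfun))"

subsection \<open>Finite dimensional representations\<close>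

text \<open>A representation on the Hilbert space with orthonormal basis indexed by the finite set \<open>I\<close> is
  given by its matrix of coefficients in \<open>C(\<G>)\<close>. Linear maps between such Hilbert spaces are
  complex matrices, which vanish outside of the relevant index sets.\<close>

definition unitary_matrix :: "'a set \<Rightarrow> 'b set \<Rightarrow> ('a \<Rightarrow> 'b \<Rightarrow> 'k op) \<Rightarrow> bool" where
  "unitary_matrix I J u \<longleftrightarrow>
     (\<forall>i\<in>I. \<forall>j\<in>I. (\<Sum>k\<in>J. u i k o\<^sub>L adj (u j k)) = (if i = j then id_blinfun else 0)) \<and>
     (\<forall>i\<in>J. \<forall>j\<in>J. (\<Sum>k\<in>I. adj (u k i) o\<^sub>L u k j) = (if i = j then id_blinfun else 0))"

definition unitary_rep :: "('k, 'z) cqg_scheme \<Rightarrow> 'a set \<Rightarrow> ('a \<Rightarrow> 'a \<Rightarrow> 'k op) \<Rightarrow> bool" where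
  "unitary_rep G I u \<longleftrightarrow> finite I \<and> (\<forall>i\<in>I. \<forall>j\<in>I. u i j \<in> calg G) \<and> unitary_matrix I I u \<and>
     (\<forall>i\<in>I. \<forall>j\<in>I. comult G (u i j) = (\<Sum>k\<in>I. u i k \<otimes>\<^sub>o u k j))"

type_synonym ('a, 'b) mat = "'a \<Rightarrow> 'b \<Rightarrow> complex"

definition supported :: "'a set \<Rightarrow> 'b set \<Rightarrow> ('a, 'b) mat \<Rightarrow> bool" where
  "supported I J T \<longleftrightarrow> (\<forall>i j. T i j \<noteq> 0 \<longrightarrow> i \<in> I \<and> j \<in> J)"

definition id_mat :: "'a set \<Rightarrow> ('a, 'a) mat" where
  "id_mat I i j = (if i = j \<and> i \<in> I then 1 else 0)"

definition adj_mat :: "('a, 'b) mat \<Rightarrow> ('b, 'a) mat" where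
  "adj_mat T i j = cnj (T j i)"

definition mult_mat :: "'b set \<Rightarrow> ('a, 'b) mat \<Rightarrow> ('b, 'c) mat \<Rightarrow> ('a, 'c) mat" where
  "mult_mat J S T i k = (\<Sum>j\<in>J. S i j * T j k)"

definition Mor :: "'a set \<Rightarrow> ('a \<Rightarrow> 'a \<Rightarrow> 'k op) \<Rightarrow> 'b set \<Rightarrow> ('b \<Rightarrow> 'b \<Rightarrow> 'k op) \<Rightarrow> ('a, 'b) mat set" where
  "Mor I u J v = {T. supported I J T \<and>
     (\<forall>i\<in>I. \<forall>j\<in>J. (\<Sum>k\<in>I. T k j *\<^sub>C u i k) = (\<Sum>k\<in>J. T i k *\<^sub>C v k j))}"

definition irreducible_rep :: "'a set \<Rightarrow> ('a \<Rightarrow> 'a \<Rightarrow> 'k op) \<Rightarrow> bool" where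
  "irreducible_rep I u \<longleftrightarrow> I \<noteq> {} \<and> Mor I u I u = range (\<lambda>c i j. c * id_mat I i j)"

definition equivalent_reps :: "'a set \<Rightarrow> ('a \<Rightarrow> 'a \<Rightarrow> 'k op) \<Rightarrow> 'b set \<Rightarrow> ('b \<Rightarrow> 'b \<Rightarrow> 'k op) \<Rightarrow> bool" where
  "equivalent_reps I u J v \<longleftrightarrow> (\<exists>T\<in>Mor I u J v.
     mult_mat J T (adj_mat T) = id_mat I \<and> mult_mat I (adj_mat T) T = id_mat J)"

text \<open>A compact quantum group together with its Haar state, the GNS representation of the latter,
  and representatives of the irreducible representations. The type \<open>'x\<close> is the set of classes, and
  \<open>'e\<close> indexes the disjoint union of orthonormal bases of all the spaces \<open>H\<^sub>x\<close>: the basis of \<open>H\<^sub>x\<close>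
  consists of those \<open>e\<close> with \<open>lab G e = x\<close>. Thus the direct sum of the \<open>H\<^sub>x\<close> is \<open>'e ell2\<close>.\<close>

record ('k, 'x, 'e, 'i) cqg_reps = "'k cqg" +
  haar :: "'k op \<Rightarrow> complex"
  gns :: "'k op \<Rightarrow> 'i op"
  lab :: "'e \<Rightarrow> 'x"
  triv :: 'x
  coef :: "'e \<Rightarrow> 'e \<Rightarrow> 'k op"

definition fib :: "('k, 'x, 'e, 'i) cqg_reps \<Rightarrow> 'x \<Rightarrow> 'e set" where
  "fib G x = {e. lab G e = x}"

definition irred_representatives :: "('k, 'x, 'e, 'i) cqg_reps \<Rightarrow> bool" where
  "irred_representatives G \<longleftrightarrow>
     (\<forall>x. unitary_rep G (fib G x) (coef G) \<and> irreducible_rep (fib G x) (coef G)) \<and>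
     (\<forall>x y. equivalent_reps (fib G x) (coef G) (fib G y) (coef G) \<longrightarrow> x = y) \<and>
     (\<forall>(n :: nat) v. unitary_rep G {..<n} v \<and> irreducible_rep {..<n} v \<longrightarrow>
        (\<exists>x. equivalent_reps (fib G x) (coef G) {..<n} v)) \<and>
     (\<exists>e. fib G (triv G) = {e} \<and> coef G e e = id_blinfun)"

definition cqg_with_reps :: "('k, 'x, 'e, 'i) cqg_reps \<Rightarrow> bool" where
  "cqg_with_reps G \<longleftrightarrow> compact_quantum_group G \<and> haar_state G (haar G) \<and>
     gns_rep (calg G) (haar G) (gns G) \<and> irred_representatives G"

text \<open>The Hopf *-algebra of coefficients; every coefficient of a finite dimensional representation
  is a combination of those of the irreducible representatives.\<close>

definition coef_algebra :: "('k, 'x, 'e, 'i) cqg_reps \<Rightarrow> 'k op set" where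
  "coef_algebra G = span {c *\<^sub>C coef G e f | c e f. lab G e = lab G f}"

definition Linf :: "('k, 'x, 'e, 'i) cqg_reps \<Rightarrow> 'i op set" where
  "Linf G = vn_generated (gns G ` coef_algebra G)"

section \<open>Monoidal equivalence and the link algebra\<close>

text \<open>The basis of \<open>H\<^bsub>x\<^sub>1\<^esub> \<otimes> \<dots> \<otimes> H\<^bsub>x\<^sub>r\<^esub>\<close> is indexed by the lists \<open>[e\<^sub>1, \<dots>, e\<^sub>r]\<close> with
  \<open>lab G e\<^sub>i = x\<^sub>i\<close>.\<close>

definition fibs :: "('k, 'x, 'e, 'i) cqg_reps \<Rightarrow> 'x list \<Rightarrow> 'e list set" where
  "fibs G xs = {es. map (lab G) es = xs}"

definition coefs :: "('k, 'x, 'e, 'i) cqg_reps \<Rightarrow> 'e list \<Rightarrow> 'e list \<Rightarrow> 'k op" where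
  "coefs G es fs = foldr (o\<^sub>L) (map2 (coef G) es fs) id_blinfun"

definition Mors :: "('k, 'x, 'e, 'i) cqg_reps \<Rightarrow> 'x list \<Rightarrow> 'x list \<Rightarrow> ('e list, 'e list) mat set" where
  "Mors G xs ys = Mor (fibs G xs) (coefs G) (fibs G ys) (coefs G)"

definition tensor_mat ::
    "nat \<Rightarrow> nat \<Rightarrow> ('e list, 'e list) mat \<Rightarrow> ('e list, 'e list) mat \<Rightarrow> ('e list, 'e list) mat" where
  "tensor_mat m n S T es fs = S (take m es) (take n fs) * T (drop m es) (drop n fs)"

text \<open>The identity of \<open>H\<^sub>x\<close>, viewed in \<open>Mor(x \<otimes> \<epsilon>, x)\<close> and in \<open>Mor(\<epsilon> \<otimes> x, x)\<close>.\<close>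

definition right_unit :: "('k, 'x, 'e, 'i) cqg_reps \<Rightarrow> 'x \<Rightarrow> ('e list, 'e list) mat" where
  "right_unit G x es fs = (if es \<in> fibs G [x, triv G] \<and> fs \<in> fibs G [x] \<and> es ! 0 = fs ! 0 then 1 else 0)"

definition left_unit :: "('k, 'x, 'e, 'i) cqg_reps \<Rightarrow> 'x \<Rightarrow> ('e list, 'e list) mat" where
  "left_unit G x es fs = (if es \<in> fibs G [triv G, x] \<and> fs \<in> fibs G [x] \<and> es ! 1 = fs ! 0 then 1 else 0)"

definition monoidal_equivalence ::
    "('k2, 'x2, 'e2, 'i2) cqg_reps \<Rightarrow> ('k1, 'x1, 'e1, 'i1) cqg_reps \<Rightarrow> ('x2 \<Rightarrow> 'x1) \<Rightarrow>
     ('x2 list \<Rightarrow> 'x2 list \<Rightarrow> ('e2 list, 'e2 list) mat \<Rightarrow> ('e1 list, 'e1 list) mat) \<Rightarrow> bool" where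
  "monoidal_equivalence G2 G1 \<phi> \<Phi> \<longleftrightarrow>
     bij \<phi> \<and> \<phi> (triv G2) = triv G1 \<and>
     (\<forall>xs ys. xs \<noteq> [] \<and> ys \<noteq> [] \<longrightarrow>
        bij_betw (\<Phi> xs ys) (Mors G2 xs ys) (Mors G1 (map \<phi> xs) (map \<phi> ys)) \<and>
        (\<forall>S\<in>Mors G2 xs ys. \<forall>T\<in>Mors G2 xs ys.
           \<Phi> xs ys (\<lambda>e f. S e f + T e f) = (\<lambda>e f. \<Phi> xs ys S e f + \<Phi> xs ys T e f)) \<and>
        (\<forall>S\<in>Mors G2 xs ys. \<forall>c. \<Phi> xs ys (\<lambda>e f. c * S e f) = (\<lambda>e f. c * \<Phi> xs ys S e f)) \<and>
        (\<forall>S\<in>Mors G2 xs ys. \<Phi> ys xs (adj_mat S) = adj_mat (\<Phi> xs ys S))) \<and>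
     (\<forall>x. \<Phi> [x] [x] (id_mat (fibs G2 [x])) = id_mat (fibs G1 [\<phi> x]) \<and>
          \<Phi> [x, triv G2] [x] (right_unit G2 x) = right_unit G1 (\<phi> x) \<and>
          \<Phi> [triv G2, x] [x] (left_unit G2 x) = left_unit G1 (\<phi> x)) \<and>
     (\<forall>xs ys xs' ys'. xs \<noteq> [] \<and> ys \<noteq> [] \<and> xs' \<noteq> [] \<and> ys' \<noteq> [] \<longrightarrow>
        (\<forall>S\<in>Mors G2 xs ys. \<forall>T\<in>Mors G2 xs' ys'.
           \<Phi> (xs @ xs') (ys @ ys') (tensor_mat (length xs) (length ys) S T) =
             tensor_mat (length xs) (length ys) (\<Phi> xs ys S) (\<Phi> xs' ys' T))) \<and>
     (\<forall>xs ys zs. xs \<noteq> [] \<and> ys \<noteq> [] \<and> zs \<noteq> [] \<longrightarrow>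
        (\<forall>S\<in>Mors G2 xs ys. \<forall>T\<in>Mors G2 ys zs.
           \<Phi> xs zs (mult_mat (fibs G2 ys) S T) =
             mult_mat (fibs G1 (map \<phi> ys)) (\<Phi> xs ys S) (\<Phi> ys zs T)))"

text \<open>The link algebra \<open>lalg\<close> with its state \<open>lstate\<close>, the GNS representation \<open>lgns\<close> of the latter,
  and the entries \<open>lcoef L a c\<close> of the unitaries \<open>X\<^sup>x\<close>, where \<open>lab G1 a = \<phi> x\<close> and \<open>lab G2 c = x\<close>.
  Since the state is faithful and the algebra is spanned by entries of unitaries, its GNS
  representation is faithful and bounded, so it is no restriction to consider algebras of bounded
  operators.\<close>

record ('b, 'j, 'e1, 'e2) link =
  lalg :: "'b op set"
  lstate :: "'b op \<Rightarrow> complex"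
  lgns :: "'b op \<Rightarrow> 'j op"
  lcoef :: "'e1 \<Rightarrow> 'e2 \<Rightarrow> 'b op"

definition link_index ::
    "('k1, 'x1, 'e1, 'i1) cqg_reps \<Rightarrow> ('k2, 'x2, 'e2, 'i2) cqg_reps \<Rightarrow> ('x2 \<Rightarrow> 'x1) \<Rightarrow> ('e1 \<times> 'e2) set" where
  "link_index G1 G2 \<phi> = {(a, c). lab G1 a = \<phi> (lab G2 c)}"

definition link_algebra ::
    "('k1, 'x1, 'e1, 'i1) cqg_reps \<Rightarrow> ('k2, 'x2, 'e2, 'i2) cqg_reps \<Rightarrow> ('x2 \<Rightarrow> 'x1) \<Rightarrow>
     ('x2 list \<Rightarrow> 'x2 list \<Rightarrow> ('e2 list, 'e2 list) mat \<Rightarrow> ('e1 list, 'e1 list) mat) \<Rightarrow>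
     ('b, 'j, 'e1, 'e2) link \<Rightarrow> bool" where
  "link_algebra G1 G2 \<phi> \<Phi> L \<longleftrightarrow> (let X = lcoef L in
     unital_star_algebra (lalg L) \<and>
     state_on (lalg L) (lstate L) \<and> faithful_on (lalg L) (lstate L) \<and>
     gns_rep (lalg L) (lstate L) (lgns L) \<and>
     (\<forall>(a, c)\<in>link_index G1 G2 \<phi>. X a c \<in> lalg L) \<and>
     (\<forall>x. unitary_matrix (fib G1 (\<phi> x)) (fib G2 x) X) \<and>
     (\<forall>x y z. \<forall>S\<in>Mors G2 [y, z] [x]. \<forall>a\<in>fib G1 (\<phi> y). \<forall>b\<in>fib G1 (\<phi> z). \<forall>c\<in>fib G2 x.
        (\<Sum>p\<in>fib G2 y. \<Sum>q\<in>fib G2 z. S [p, q] [c] *\<^sub>C (X a p o\<^sub>L X b q)) =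
        (\<Sum>d\<in>fib G1 (\<phi> x). \<Phi> [y, z] [x] S [a, b] [d] *\<^sub>C X d c)) \<and>
     (\<forall>b\<in>lalg L. \<exists>!t. finite {p. t p \<noteq> 0} \<and> {p. t p \<noteq> 0} \<subseteq> link_index G1 G2 \<phi> \<and>
        b = (\<Sum>(a, c)\<in>{p. t p \<noteq> 0}. t (a, c) *\<^sub>C X a c)) \<and>
     (\<forall>(a, c)\<in>link_index G1 G2 \<phi>. lab G2 c \<noteq> triv G2 \<longrightarrow> lstate L (X a c) = 0))"

definition link_vn :: "('b, 'j, 'e1, 'e2) link \<Rightarrow> 'j op set" where
  "link_vn L = vn_generated (lgns L ` lalg L)"

text \<open>The extensions to the von Neumann algebraic link algebra of the two commuting ergodic actions.
  As the \<open>X\<^sup>x\<close> have entries which span a dense subalgebra, these normal homomorphisms are uniquely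
  determined by \<open>(id \<otimes> \<delta>\<^sub>1)(X\<^sup>x) = U\<^sup>\<phi>\<^sup>x\<^sub>1\<^sub>2 X\<^sup>x\<^sub>1\<^sub>3\<close> and \<open>(id \<otimes> \<delta>\<^sub>2)(X\<^sup>x) = X\<^sup>x\<^sub>1\<^sub>2 U\<^sup>x\<^sub>1\<^sub>3\<close>, which also give
  all of their other properties.\<close>

definition link_action1 ::
    "('k1, 'x1, 'e1, 'i1) cqg_reps \<Rightarrow> ('k2, 'x2, 'e2, 'i2) cqg_reps \<Rightarrow> ('x2 \<Rightarrow> 'x1) \<Rightarrow>
     ('b, 'j, 'e1, 'e2) link \<Rightarrow> ('j op \<Rightarrow> ('i1 \<times> 'j) op) \<Rightarrow> bool" where
  "link_action1 G1 G2 \<phi> L \<delta> \<longleftrightarrow>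
     unital_star_hom (link_vn L) (Linf G1 \<otimes>\<^sub>v\<^sub>N link_vn L) \<delta> \<and> normal_on (link_vn L) \<delta> \<and>
     (\<forall>(a, c)\<in>link_index G1 G2 \<phi>. \<delta> (lgns L (lcoef L a c)) =
        (\<Sum>d\<in>fib G1 (lab G1 a). gns G1 (coef G1 a d) \<otimes>\<^sub>o lgns L (lcoef L d c)))"

definition link_action2 ::
    "('k1, 'x1, 'e1, 'i1) cqg_reps \<Rightarrow> ('k2, 'x2, 'e2, 'i2) cqg_reps \<Rightarrow> ('x2 \<Rightarrow> 'x1) \<Rightarrow>
     ('b, 'j, 'e1, 'e2) link \<Rightarrow> ('j op \<Rightarrow> ('j \<times> 'i2) op) \<Rightarrow> bool" where
  "link_action2 G1 G2 \<phi> L \<delta> \<longleftrightarrow>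
     unital_star_hom (link_vn L) (link_vn L \<otimes>\<^sub>v\<^sub>N Linf G2) \<delta> \<and> normal_on (link_vn L) \<delta> \<and>
     (\<forall>(a, c)\<in>link_index G1 G2 \<phi>. \<delta> (lgns L (lcoef L a c)) =
        (\<Sum>d\<in>fib G2 (lab G2 c). lgns L (lcoef L a d) \<otimes>\<^sub>o gns G2 (coef G2 d c)))"

definition link_unitary ::
    "('k1, 'x1, 'e1, 'i1) cqg_reps \<Rightarrow> ('k2, 'x2, 'e2, 'i2) cqg_reps \<Rightarrow> ('x2 \<Rightarrow> 'x1) \<Rightarrow>
     ('b, 'j, 'e1, 'e2) link \<Rightarrow> ('e2 \<times> 'j, 'e1 \<times> 'j) hom" where
  "link_unitary G1 G2 \<phi> L =
     block_op (\<lambda>a c. if (a, c) \<in> link_index G1 G2 \<phi> then lgns L (lcoef L a c) else 0)"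

section \<open>The discrete dual and the Poisson boundary\<close>

text \<open>The product of the matrix algebras \<open>L(H\<^sub>x)\<close>, as bounded block diagonal operators on the direct
  sum of the \<open>H\<^sub>x\<close>.\<close>

definition linf :: "('k, 'x, 'e, 'i) cqg_reps \<Rightarrow> 'e op set" where
  "linf G = {a \<in> clin. \<forall>e f. lab G e \<noteq> lab G f \<longrightarrow> entry a e f = 0}"

definition mult_unitary :: "('k, 'x, 'e, 'i) cqg_reps \<Rightarrow> ('e \<times> 'i) op" where
  "mult_unitary G = block_op (\<lambda>e f. if lab G e = lab G f then gns G (coef G e f) else 0)"

definition dual_comult :: "('k, 'x, 'e, 'i) cqg_reps \<Rightarrow> 'e op \<Rightarrow> ('e \<times> 'e) op" where
  "dual_comult G = (THE D. D \<in> extensional (linf G) \<and>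
     unital_star_hom (linf G) (linf G \<otimes>\<^sub>v\<^sub>N linf G) D \<and> normal_on (linf G) D \<and>
     tensor_map (linf G) (Linf G) D (\<lambda>b. b) (mult_unitary G) =
       leg13 (mult_unitary G) o\<^sub>L leg23 (mult_unitary G))"

definition adjoint_action :: "('k, 'x, 'e, 'i) cqg_reps \<Rightarrow> 'e op \<Rightarrow> ('e \<times> 'i) op" where
  "adjoint_action G a = mult_unitary G o\<^sub>L (a \<otimes>\<^sub>o id_blinfun) o\<^sub>L adj (mult_unitary G)"

text \<open>The scalar \<open>c\<close> with \<open>(id \<otimes> h)(U\<^sup>x (a\<^sub>x \<otimes> 1) (U\<^sup>x)\<^sup>*) = c 1\<close>, where \<open>a\<^sub>x\<close> is the component of \<open>a\<close> in
  \<open>L(H\<^sub>x)\<close>.\<close>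

definition psi :: "('k, 'x, 'e, 'i) cqg_reps \<Rightarrow> 'x \<Rightarrow> 'e op \<Rightarrow> complex" where
  "psi G x a = (THE c. \<forall>e\<in>fib G x. \<forall>e'\<in>fib G x.
     (\<Sum>f\<in>fib G x. \<Sum>f'\<in>fib G x. entry a f f' * haar G (coef G e f o\<^sub>L adj (coef G e' f'))) =
     (if e = e' then c else 0))"

definition psi_measure :: "('k, 'x, 'e, 'i) cqg_reps \<Rightarrow> 'x pmf \<Rightarrow> 'e op \<Rightarrow> complex" where
  "psi_measure G \<mu> a = (\<Sum>\<^sub>\<infinity>x. of_real (pmf \<mu> x) * psi G x a)"

definition markov :: "('k, 'x, 'e, 'i) cqg_reps \<Rightarrow> 'x pmf \<Rightarrow> 'e op \<Rightarrow> 'e op" where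
  "markov G \<mu> a = normal_ext (linf G) (linf G) (\<lambda>b c. psi_measure G \<mu> c *\<^sub>C b) (dual_comult G a)"

text \<open>Since \<open>(\<psi>\<^sub>\<mu> \<otimes> \<psi>\<^sub>\<nu>) \<Delta>(a) = \<psi>\<^sub>\<mu>((id \<otimes> \<psi>\<^sub>\<nu>) \<Delta>(a))\<close>, the convolution satisfies \<open>\<psi>\<^sub>\<kappa> = (\<psi>\<^sub>\<mu> \<otimes> \<psi>\<^sub>\<nu>) \<Delta>\<close>.\<close>

definition convolution :: "('k, 'x, 'e, 'i) cqg_reps \<Rightarrow> 'x pmf \<Rightarrow> 'x pmf \<Rightarrow> 'x pmf" where
  "convolution G \<mu> \<nu> =
     (THE \<kappa>. \<forall>a\<in>linf G. psi_measure G \<kappa> a = psi_measure G \<mu> (markov G \<nu> a))"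

text \<open>\<open>(convolution G \<mu> ^^ n) \<mu>\<close> is the convolution power of \<open>\<mu>\<close> with exponent \<open>n + 1\<close>.\<close>

definition generating :: "('k, 'x, 'e, 'i) cqg_reps \<Rightarrow> 'x pmf \<Rightarrow> bool" where
  "generating G \<mu> \<longleftrightarrow> (\<forall>x. \<exists>n. pmf ((convolution G \<mu> ^^ n) \<mu>) x \<noteq> 0)"

definition poisson_boundary :: "('k, 'x, 'e, 'i) cqg_reps \<Rightarrow> 'x pmf \<Rightarrow> 'e op set" where
  "poisson_boundary G \<mu> = {a \<in> linf G. markov G \<mu> a = a}"

definition poisson_prod :: "('i op \<Rightarrow> 'i op) \<Rightarrow> 'i op \<Rightarrow> 'i op \<Rightarrow> 'i op" where
  "poisson_prod P a b = (THE c. limitin sigma_weak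
     (\<lambda>n. (1 / real n) *\<^sub>R (\<Sum>k = 1..n. (P ^^ k) (a o\<^sub>L b))) c sequentially)"

text \<open>\<open>P\<^sub>\<mu> \<otimes> id\<close> on the tensor product with a von Neumann algebra \<open>B\<close>, and the subspace
  of it fixed by this map, which is the tensor product of the Poisson boundary with \<open>B\<close>.\<close>

definition markov_amp :: "('k, 'x, 'e, 'i) cqg_reps \<Rightarrow> 'x pmf \<Rightarrow> 'j op set \<Rightarrow> ('e \<times> 'j) op \<Rightarrow> ('e \<times> 'j) op" where
  "markov_amp G \<mu> B = tensor_map (linf G) B (markov G \<mu>) (\<lambda>b. b)"

definition poisson_tensor :: "('k, 'x, 'e, 'i) cqg_reps \<Rightarrow> 'x pmf \<Rightarrow> 'j op set \<Rightarrow> ('e \<times> 'j) op set" where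
  "poisson_tensor G \<mu> B = {a \<in> linf G \<otimes>\<^sub>v\<^sub>N B. markov_amp G \<mu> B a = a}"

definition poisson_boxtimes ::
    "('k, 'x, 'e, 'i) cqg_reps \<Rightarrow> 'x pmf \<Rightarrow> 'j op set \<Rightarrow> ('j op \<Rightarrow> ('i \<times> 'j) op) \<Rightarrow> ('e \<times> 'j) op set" where
  "poisson_boxtimes G \<mu> B \<delta> = {a \<in> poisson_tensor G \<mu> B.
     assoc_op (tensor_map (linf G) B (adjoint_action G) (\<lambda>b. b) a) =
       tensor_map (linf G) B (\<lambda>b. b) \<delta> a}"

end

(* The fusion coefficients of both quantum groups are read off from the products X_13 X_23 in the link
   algebra, so conjugation by X turns the comultiplication of one dual, and hence its Markov operator, into
   that of the other; fixed points correspond. A tensor a invariant under the two actions of the first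
   quantum group is reached because the blocks of X* (a) X are fixed by the ergodic action delta_1, hence
   scalar. All actions and slices are spatial, so they commute with the weak limits defining the product. *)

theory Submission
  imports Defs
begin

text \<open>The dual comultiplication, the extensions to tensor products, \<open>psi\<close> and the
  product of the boundary are given by definite descriptions, so nothing can be computed with them
  before existence and uniqueness of the described objects are known. Uniqueness comes from density.
  Existence is reduced to one spatial form, \<open>P (T \<otimes> 1) Q\<close> with fixed bounded
  operators, which is visibly normal and can be tensored with an identity; identities are then
  tested on slices or blocks. The second obstacle is that both groups need linear independence of
  their coefficients. It is not developed inside either group: the entries of \<open>X\<close> are a
  linear basis by hypothesis, and averaging over each action is the state of the link algebra, so
  the Gram matrices of coefficients are those of entries of \<open>X\<close> and independence is
  transported. For the same reason the coordinates of products of entries in this basis can serve as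
  intertwiners of both groups, in place of a decomposition into irreducibles.\<close>

notation blinfun_compose (infixl "\<cdot>" 55) and op_tensor (infixr "\<otimes>" 75) and id_blinfun ("\<one>")

section \<open>Hilbert spaces\<close>

lemma coord_simps [simp]: "coord (x + y) i = coord x i + coord y i" "coord (x - y) i = coord x i - coord y i"
  "coord (- x) i = - coord x i" "coord 0 i = 0" "coord (cscale c x) i = c * coord x i"
  "coord (r *\<^sub>R x) i = of_real r * coord x i"
  by (simp_all add: plus_ell2.rep_eq minus_ell2.rep_eq uminus_ell2.rep_eq zero_ell2.rep_eq cscale.rep_eq scaleR_ell2.rep_eq)

lemma coord_eqI: "(\<And>i. coord x i = coord y i) \<Longrightarrow> x = y"
  using coord_inject[of x y] by auto

lemma coord_summable: "(\<lambda>i. cnj (coord x i) * coord y i) summable_on UNIV"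
  using coord[of x] coord[of y] by (intro sq_summable_prod) auto

lemma cscale_simps [simp]: "cscale c (cscale d x) = cscale (c * d) x" "cscale 1 x = x" "cscale 0 x = 0" "cscale c 0 = 0"
  "cscale (of_real r) x = r *\<^sub>R x"
  by (auto intro!: coord_eqI)

lemma cinner_add_left: "cinner (x + y) z = cinner x z + cinner y z"
  unfolding cinner_def using infsum_add[OF coord_summable coord_summable, of x z y z] by (simp add: algebra_simps)

lemma cinner_cnj: "cnj (cinner x y) = cinner y x"
  unfolding cinner_def infsum_cnj[symmetric] by (simp add: mult.commute)

lemma cinner_add_right: "cinner z (x + y) = cinner z x + cinner z y"
  using cinner_add_left[of x y z] by (metis cinner_cnj complex_cnj_add)

lemma cinner_cscale_right [simp]: "cinner x (cscale c y) = c * cinner x y"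
  unfolding cinner_def by (simp add: infsum_cmult_right'[symmetric] mult.left_commute)

lemma cinner_cscale_left [simp]: "cinner (cscale c x) y = cnj c * cinner x y"
  by (metis cinner_cnj cinner_cscale_right complex_cnj_mult)

lemma cinner_self: "cinner x x = of_real ((norm x)\<^sup>2)"
proof -
  have "cnj (cinner x x) = cinner x x" by (rule cinner_cnj)
  then have "cinner x x = of_real (Re (cinner x x))" by (metis Reals_cnj_iff of_real_Re)
  then show ?thesis by (metis inner_ell2_def power2_norm_eq_inner)
qed

lemma norm_cscale [simp]: "norm (cscale c x) = cmod c * norm x"
proof -
  have "complex_of_real ((norm (cscale c x))\<^sup>2) = cnj c * c * cinner x x"
    by (simp add: cinner_self[symmetric] mult.assoc del: of_real_power)
  also have "\<dots> = of_real ((cmod c * norm x)\<^sup>2)"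
    unfolding cinner_self power_mult_distrib of_real_mult complex_norm_square[of c] by (simp add: mult.commute)
  finally have "(norm (cscale c x))\<^sup>2 = (cmod c * norm x)\<^sup>2" using of_real_eq_iff by blast
  then show ?thesis by (simp add: power2_eq_iff_nonneg)
qed

lemma cinner_bound: "cmod (cinner x y) \<le> norm x * norm y"
proof (cases "cinner x y = 0")
  case False
  \<comment> \<open>The phase \<open>u\<close> rotates \<open>y\<close> until the complex inner
    product equals its modulus; the real Cauchy--Schwarz inequality of \<open>real_inner\<close>
    then gives the bound.\<close>
  define u where "u = cnj (cinner x y) / of_real (cmod (cinner x y))"
  have u: "cmod u = 1" using False by (simp add: u_def norm_divide)
  have "cinner x (cscale u y) = of_real (cmod (cinner x y))"
    using False complex_norm_square[of "cinner x y", symmetric] by (simp add: u_def power2_eq_square mult.commute)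
  then have "cmod (cinner x y) = inner x (cscale u y)" by (simp add: inner_ell2_def)
  also have "\<dots> \<le> norm x * norm (cscale u y)" by (rule norm_cauchy_schwarz)
  finally show ?thesis by (simp add: u)
qed simp

interpretation cinner: bounded_bilinear cinner
proof
  show "\<exists>K. \<forall>a b. norm (cinner a b) \<le> norm a * norm b * K" using cinner_bound by (intro exI[of _ 1]) auto
qed (use cinner_cscale_left[of "of_real r" for r] cinner_cscale_right[of _ "of_real r" for r] in
    \<open>auto simp: cinner_add_left cinner_add_right scaleR_conv_of_real simp del: cinner_cscale_left cinner_cscale_right\<close>)

interpretation cscale: bounded_bilinear cscale
proof
  show "\<exists>K. \<forall>a b. norm (cscale a b) \<le> norm a * norm b * K" by (intro exI[of _ 1]) auto
qed (auto intro!: coord_eqI simp: algebra_simps scaleR_conv_of_real)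

interpretation blinfun_compose: bounded_bilinear blinfun_compose
  by (rule bounded_bilinear_blinfun_compose)

lemma mult_cnj_cmod: "z * cnj z = (complex_of_real (cmod z))\<^sup>2" "cnj z * z = (complex_of_real (cmod z))\<^sup>2"
  using complex_norm_square[of z] by (simp_all add: mult.commute)

lemma cinner_zero_iff [simp]: "cinner x x = 0 \<longleftrightarrow> x = 0" by (simp add: cinner_self)

lemma cinner_eqI: "(\<And>z. cinner z x = cinner z y) \<Longrightarrow> x = y"
  by (metis cinner.diff_right cinner_zero_iff right_minus_eq)

lemma norm_le_cinnerI: assumes "\<And>z. cmod (cinner z x) \<le> C * norm z" "0 \<le> C" shows "norm x \<le> C"
proof (cases "x = 0")
  case False
  have "norm x * norm x \<le> C * norm x" using assms(1)[of x] by (simp add: cinner_self power2_eq_square norm_mult)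
  then show ?thesis using False by simp
qed (use assms in simp)

lemma coord_basis: "coord (basis_vec i) j = (if j = i then 1 else 0)"
proof -
  have "(\<lambda>k. (cmod (if k = i then 1 else 0))\<^sup>2) summable_on UNIV"
    by (rule summable_on_cong_neutral[where T="{i}", THEN iffD2]) (auto intro: summable_on_finite)
  then show ?thesis unfolding basis_vec_def by (subst Abs_ell2_inverse) auto
qed

lemma cinner_basis_left [simp]: "cinner (basis_vec i) x = coord x i"
proof -
  have "cinner (basis_vec i) x = (\<Sum>\<^sub>\<infinity>j\<in>{i}. coord x j)"
    unfolding cinner_def by (rule infsum_cong_neutral) (auto simp: coord_basis)
  then show ?thesis by simp
qed

lemma cinner_basis_right [simp]: "cinner x (basis_vec i) = cnj (coord x i)"
  by (metis cinner_basis_left cinner_cnj)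

lemma norm_basis [simp]: "norm (basis_vec i) = 1"
proof -
  have "complex_of_real ((norm (basis_vec i))\<^sup>2) = 1" by (simp add: cinner_self[symmetric] coord_basis del: of_real_power)
  then have "(norm (basis_vec i))\<^sup>2 = 1" using of_real_eq_1_iff by blast
  then show ?thesis using power2_eq_1_iff[of "norm (basis_vec i)"] norm_ge_zero[of "basis_vec i"] by linarith
qed


lemma coord_sum: "coord (\<Sum>p\<in>F. f p) i = (\<Sum>p\<in>F. coord (f p) i)"
  using cinner.sum_right[of "basis_vec i" f F] by simp

lemma cscale_sum_right: "cscale c (\<Sum>p\<in>F. f p) = (\<Sum>p\<in>F. cscale c (f p))"
  by (rule cscale.sum_right)

lemma norm_sq_has_sum: "((\<lambda>i. (cmod (coord x i))\<^sup>2) has_sum (norm x)\<^sup>2) UNIV"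
proof -
  have "((\<lambda>i. cnj (coord x i) * coord x i) has_sum cinner x x) UNIV"
    unfolding cinner_def by (rule has_sum_infsum[OF coord_summable])
  then have "((\<lambda>i. Re (cnj (coord x i) * coord x i)) has_sum Re (cinner x x)) UNIV" by (rule has_sum_Re)
  moreover have "Re (cnj (coord x i) * coord x i) = (cmod (coord x i))\<^sup>2" for i
    unfolding cmod_power2 by (simp add: power2_eq_square)
  ultimately show ?thesis unfolding cinner_self by simp
qed

lemma norm_basis_residue:
  assumes "finite F"
  shows "(norm (x - (\<Sum>i\<in>F. cscale (coord x i) (basis_vec i))))\<^sup>2 = (norm x)\<^sup>2 - (\<Sum>i\<in>F. (cmod (coord x i))\<^sup>2)"
proof -
  let ?v = "\<Sum>i\<in>F. cscale (coord x i) (basis_vec i)"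
  have c: "coord ?v j = (if j \<in> F then coord x j else 0)" for j
    using assms by (simp add: coord_sum coord_basis if_distrib cong: if_cong)
  have xv: "cinner x ?v = (\<Sum>i\<in>F. (cmod (coord x i))\<^sup>2)"
    using assms by (simp add: cinner.sum_right mult_cnj_cmod)
  have vx: "cinner ?v x = (\<Sum>i\<in>F. (cmod (coord x i))\<^sup>2)" by (metis xv cinner_cnj complex_cnj_complex_of_real)
  have vv: "cinner ?v ?v = (\<Sum>i\<in>F. (cmod (coord x i))\<^sup>2)"
    using assms c by (subst cinner.sum_left) (simp add: mult_cnj_cmod)
  have "complex_of_real ((norm (x - ?v))\<^sup>2) = of_real ((norm x)\<^sup>2 - (\<Sum>i\<in>F. (cmod (coord x i))\<^sup>2))"
    unfolding cinner_self[symmetric] of_real_diff cinner.diff_left cinner.diff_right xv vx vv by simp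
  then show ?thesis using of_real_eq_iff by blast
qed

lemma has_sum_basis: "((\<lambda>i. cscale (coord x i) (basis_vec i)) has_sum x) UNIV"
proof -
  let ?S = "\<lambda>F. \<Sum>i\<in>F. cscale (coord x i) (basis_vec i)"
  have "((\<lambda>F. (norm x)\<^sup>2 - (\<Sum>i\<in>F. (cmod (coord x i))\<^sup>2)) \<longlongrightarrow> (norm x)\<^sup>2 - (norm x)\<^sup>2) (finite_subsets_at_top UNIV)"
    by (intro tendsto_intros norm_sq_has_sum[unfolded has_sum_def])
  then have "((\<lambda>F. sqrt ((norm x)\<^sup>2 - (\<Sum>i\<in>F. (cmod (coord x i))\<^sup>2))) \<longlongrightarrow> sqrt 0) (finite_subsets_at_top UNIV)"
    by (intro tendsto_real_sqrt) simp
  then have "((\<lambda>F. norm (x - ?S F)) \<longlongrightarrow> 0) (finite_subsets_at_top UNIV)"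
    by (subst (asm) tendsto_cong[where g="\<lambda>F. norm (x - ?S F)"])
      (auto simp: norm_basis_residue[symmetric] intro!: eventually_finite_subsets_at_top_weakI)
  then show ?thesis unfolding has_sum_def
    by (subst tendsto_dist_iff) (simp add: dist_norm norm_minus_commute)
qed

text \<open>The maps are only real linear, so they are compared on all complex multiples of basis
  vectors. In this form the lemma serves linear and conjugate linear functionals alike.\<close>

lemma bounded_linear_basis_eqI:
  fixes f g :: "'i ell2 \<Rightarrow> 'b::real_normed_vector"
  assumes "bounded_linear f" "bounded_linear g" "\<And>c i. f (cscale c (basis_vec i)) = g (cscale c (basis_vec i))"
  shows "f x = g x"
  using has_sum_bounded_linear[OF assms(1) has_sum_basis[of x]] has_sum_bounded_linear[OF assms(2) has_sum_basis[of x]]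
    assms(3) by (metis (no_types, lifting) comp_apply has_sum_cong has_sum_unique)

subsection \<open>Complex linear operators\<close>

lemma clinD: "T \<in> clin \<Longrightarrow> T (cscale c x) = cscale c (T x)" by (auto simp: clin_def)

lemma scaleC_apply [simp]: "(c *\<^sub>C T) x = cscale c (T x)"
  unfolding scaleC_def by (simp add: bounded_linear_Blinfun_apply cscale.bounded_linear_right)

lemma clin_intros [simp, intro]: "0 \<in> clin" "\<one> \<in> clin" "S \<in> clin \<Longrightarrow> T \<in> clin \<Longrightarrow> S + T \<in> clin"
  "S \<in> clin \<Longrightarrow> T \<in> clin \<Longrightarrow> S - T \<in> clin" "S' \<in> clin \<Longrightarrow> T \<in> clin \<Longrightarrow> S' \<cdot> T \<in> clin" "T \<in> clin \<Longrightarrow> c *\<^sub>C T \<in> clin"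
  "T \<in> clin \<Longrightarrow> r *\<^sub>R T \<in> clin" "T \<in> clin \<Longrightarrow> - T \<in> clin"
  by (auto simp: clin_def blinfun.add_left blinfun.diff_left blinfun.scaleR_left blinfun.minus_left cscale.add_right
      cscale.diff_right cscale.minus_right mult.commute intro!: coord_eqI)

lemma clin_sum [simp, intro]: "(\<And>p. p \<in> F \<Longrightarrow> T p \<in> clin) \<Longrightarrow> (\<Sum>p\<in>F. T p) \<in> clin"
  by (induction F rule: infinite_finite_induct) auto

lemma clin_eqI:
  assumes "S \<in> clin" "T \<in> clin" "\<And>i. S (basis_vec i) = T (basis_vec i)" shows "S = T"
proof (rule blinfun_eqI)
  fix x show "S x = T x"
    by (rule bounded_linear_basis_eqI) (use assms in \<open>auto simp: clinD intro: blinfun.bounded_linear_right\<close>)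
qed

lemma scaleC_simps [simp]: "c *\<^sub>C d *\<^sub>C T = (c * d) *\<^sub>C T" "1 *\<^sub>C T = T" "0 *\<^sub>C T = 0" "c *\<^sub>C 0 = 0"
  "of_real r *\<^sub>C T = r *\<^sub>R T" "(c *\<^sub>C R) \<cdot> T = c *\<^sub>C (R \<cdot> T)" "(- 1) *\<^sub>C T = - T"
  by (auto intro!: blinfun_eqI simp: blinfun.scaleR_left cscale.minus_left blinfun.minus_left)

lemma scaleC_compose_right [simp]: "S \<in> clin \<Longrightarrow> S \<cdot> (c *\<^sub>C T) = c *\<^sub>C (S \<cdot> T)"
  by (auto intro!: blinfun_eqI simp: clinD)

lemma scaleC_add: "c *\<^sub>C (S + T) = c *\<^sub>C S + c *\<^sub>C T" "(c + d) *\<^sub>C T = c *\<^sub>C T + d *\<^sub>C T"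
  by (auto intro!: blinfun_eqI simp: blinfun.add_left cscale.add_left cscale.add_right)

lemma scaleC_sum: "c *\<^sub>C (\<Sum>p\<in>F. T p) = (\<Sum>p\<in>F. c *\<^sub>C T p)" "(\<Sum>p\<in>F. g p) *\<^sub>C R = (\<Sum>p\<in>F. g p *\<^sub>C R)"
  by (induction F rule: infinite_finite_induct) (auto simp: scaleC_add)

lemma norm_scaleC: "norm (c *\<^sub>C T) = cmod c * norm T"
proof (rule antisym)
  have le: "norm (d *\<^sub>C R) \<le> cmod d * norm R" for d and R :: "('a, 'b) hom"
    by (rule norm_blinfun_bound) (auto simp: mult.assoc intro: mult_left_mono norm_blinfun)
  show "norm (c *\<^sub>C T) \<le> cmod c * norm T" by (rule le)
  show "cmod c * norm T \<le> norm (c *\<^sub>C T)"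
  proof (cases "c = 0")
    case False
    have "norm T \<le> cmod (inverse c) * norm (c *\<^sub>C T)" using le[of "inverse c" "c *\<^sub>C T"] False by simp
    then show ?thesis using False by (simp add: norm_divide field_simps)
  qed simp
qed

text \<open>The representing vector must have the numbers \<open>f (basis_vec i)\<close> as
  coordinates. On a finite truncation of it \<open>f\<close> takes the value of the squared norm, so
  boundedness of \<open>f\<close> bounds all truncations by one constant and the coordinates are
  square summable. Since inner products are linear in the second argument, it is the conjugate
  linear functionals that are represented in this form.\<close>

lemma Riesz:
  assumes f: "bounded_linear f" and c: "\<And>c x. f (cscale c x) = cnj c * f x"
  shows "\<exists>v. \<forall>x. cinner x v = f x"
proof -
  obtain K where K: "\<And>x. cmod (f x) \<le> norm x * K" using bounded_linear.bounded[OF f] by auto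
  let ?g = "\<lambda>i. f (basis_vec i)"
  have "(\<Sum>i\<in>F. (cmod (?g i))\<^sup>2) \<le> K\<^sup>2" if "finite F" for F
  proof -
    let ?s = "\<Sum>i\<in>F. (cmod (?g i))\<^sup>2" and ?v = "\<Sum>i\<in>F. cscale (?g i) (basis_vec i)"
    have s: "(norm ?v)\<^sup>2 = ?s"
    proof -
      have "coord ?v j = (if j \<in> F then ?g j else 0)" for j
        using that by (simp add: coord_sum coord_basis if_distrib cong: if_cong)
      then have "complex_of_real ((norm ?v)\<^sup>2) = of_real ?s"
        using that unfolding cinner_self[symmetric] by (simp add: cinner.sum_left mult_cnj_cmod)
      then show ?thesis using of_real_eq_iff by blast
    qed
    have "f ?v = of_real ?s" unfolding linear_sum[OF bounded_linear.linear[OF f]] by (simp add: c mult_cnj_cmod)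
    then have "norm ?v * norm ?v \<le> norm ?v * K" using K[of ?v] s by (simp add: sum_nonneg power2_eq_square norm_of_real del: of_real_sum)
    then have "norm ?v \<le> \<bar>K\<bar>" by (cases "norm ?v = 0") (auto simp: mult_le_cancel_left)
    then have "(norm ?v)\<^sup>2 \<le> \<bar>K\<bar>\<^sup>2" by (intro power_mono) auto
    then show ?thesis unfolding s by simp
  qed
  then have "(\<lambda>i. (cmod (?g i))\<^sup>2) summable_on UNIV"
    by (intro nonneg_bdd_above_summable_on) (auto intro!: bdd_aboveI2)
  then have co: "coord (Abs_ell2 ?g) = ?g" by (simp add: Abs_ell2_inverse)
  have "cinner x (Abs_ell2 ?g) = f x" for x
    by (rule bounded_linear_basis_eqI[OF cinner.bounded_linear_left f]) (simp add: co c)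
  then show ?thesis by blast
qed

text \<open>The limit is found weakly: the limits of \<open>cinner x (X n)\<close> form a bounded
  conjugate linear functional of \<open>x\<close>, and its Riesz vector is the candidate. Testing
  against all \<open>z\<close> turns the Cauchy estimate into convergence in norm.\<close>

instance ell2 :: (type) banach
proof
  fix X :: "nat \<Rightarrow> 'a ell2" assume X: "Cauchy X"
  have conv: "convergent (\<lambda>n. cinner x (X n))" for x
    using bounded_linear.Cauchy[OF cinner.bounded_linear_right X] by (simp add: Cauchy_convergent_iff)
  define f where "f x = lim (\<lambda>n. cinner x (X n))" for x
  have f: "(\<lambda>n. cinner x (X n)) \<longlonglongrightarrow> f x" for x using conv f_def convergent_LIMSEQ_iff by auto
  obtain K where K: "\<And>n. norm (X n) \<le> K" "K > 0" using cauchy_imp_bounded[OF X] by (auto simp: bounded_pos)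
  have fb: "bounded_linear f"
  proof (rule bounded_linear_intro)
    show "f (x + y) = f x + f y" for x y
      using tendsto_add[OF f[of x] f[of y]] f[of "x + y"] by (auto simp: cinner.add_left intro: LIMSEQ_unique)
    show "f (r *\<^sub>R x) = r *\<^sub>R f x" for r x
      using tendsto_scaleR[OF tendsto_const[of r] f[of x]] f[of "r *\<^sub>R x"] by (auto simp: cinner.scaleR_left intro: LIMSEQ_unique)
    show "norm (f x) \<le> norm x * K" for x
      using K by (intro LIMSEQ_le_const2[OF tendsto_norm[OF f[of x]]])
        (auto intro!: exI[of _ 0] order_trans[OF cinner_bound] mult_left_mono)
  qed
  have fc: "f (cscale c x) = cnj c * f x" for c x
    using tendsto_mult[OF tendsto_const[of "cnj c"] f[of x]] f[of "cscale c x"] by (auto intro: LIMSEQ_unique)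
  obtain v where v: "\<And>x. cinner x v = f x" using Riesz[OF fb fc] by auto
  have "X \<longlonglongrightarrow> v"
  proof (rule LIMSEQ_I)
    fix e :: real assume e: "e > 0"
    obtain M where M: "\<And>m n. m \<ge> M \<Longrightarrow> n \<ge> M \<Longrightarrow> norm (X m - X n) < e / 2" using X e unfolding Cauchy_iff by (metis half_gt_zero)
    have "norm (X n - v) \<le> e / 2" if "n \<ge> M" for n
    proof (rule norm_le_cinnerI)
      fix z
      have "(\<lambda>m. cinner z (X n - X m)) \<longlonglongrightarrow> cinner z (X n - v)"
        unfolding cinner.diff_right v by (intro tendsto_intros f)
      then show "cmod (cinner z (X n - v)) \<le> e / 2 * norm z"
      proof (rule LIMSEQ_le_const2[OF tendsto_norm], intro exI allI impI)
        fix m assume "M \<le> m"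
        then have "norm z * norm (X n - X m) \<le> norm z * (e / 2)" using M[OF that] by (intro mult_left_mono) (auto intro: less_imp_le)
        then show "cmod (cinner z (X n - X m)) \<le> e / 2 * norm z" using cinner_bound[of z "X n - X m"] by (simp add: mult.commute)
      qed
    qed (use e in auto)
    then show "\<exists>M. \<forall>n\<ge>M. norm (X n - v) < e" using e by (intro exI[of _ M]) (force intro: le_less_trans)
  qed
  then show "convergent X" by (auto simp: convergent_def)
qed

lemma form_op:
  assumes B: "bounded_bilinear B" and "\<And>c x y. B (cscale c x) y = cnj c * B x y" "\<And>c x y. B x (cscale c y) = c * B x y"
  shows "\<exists>T\<in>clin. \<forall>x y. cinner x (blinfun_apply T y) = B x y"
proof -
  have "\<exists>v. \<forall>x. cinner x v = B x y" for y
    by (rule Riesz) (use assms bounded_bilinear.bounded_linear_left in auto)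
  then obtain T where T: "\<And>x y. cinner x (T y) = B x y" by metis
  obtain K where K: "\<And>x y. cmod (B x y) \<le> norm x * norm y * K" "K > 0" using bounded_bilinear.pos_bounded[OF B] by blast
  have "bounded_linear T"
  proof (rule bounded_linear_intro)
    show "T (x + y) = T x + T y" "T (r *\<^sub>R x) = r *\<^sub>R T x" for x y r
      by (auto intro!: cinner_eqI simp: cinner.add_right cinner.scaleR_right T bounded_bilinear.add_right[OF B] bounded_bilinear.scaleR_right[OF B])
    show "norm (T x) \<le> norm x * K" for x
      by (rule norm_le_cinnerI) (use K in \<open>auto simp: T mult.commute mult.left_commute\<close>)
  qed
  moreover have "T (cscale c x) = cscale c (T x)" for c x by (rule cinner_eqI) (simp add: T assms)
  ultimately show ?thesis by (intro bexI[of _ "Blinfun T"]) (auto simp: T clin_def bounded_linear_Blinfun_apply)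
qed

lemma adj_exists:
  assumes "T \<in> clin" shows "adj T \<in> clin \<and> (\<forall>x y. cinner (adj T x) y = cinner x (T y))"
proof -
  have "bounded_bilinear (\<lambda>x y. cinner (T x) y)"
    using bounded_bilinear.comp[OF cinner.bounded_bilinear_axioms blinfun.bounded_linear_right bounded_linear_ident, of T] by simp
  then obtain S where S: "S \<in> clin" "\<And>x y. cinner x (blinfun_apply S y) = cinner (T x) y"
    using form_op[of "\<lambda>x y. cinner (T x) y"] assms by (auto simp: clinD)
  have *: "\<forall>x y. cinner (S x) y = cinner x (T y)" using S by (metis cinner_cnj)
  have "adj T = S" unfolding adj_def
  proof (rule the_equality)
    show "\<forall>x y. cinner (blinfun_apply S x) y = cinner x (T y)" by (rule *)
    fix S' assume "\<forall>x y. cinner (blinfun_apply S' x) y = cinner x (T y)"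
    then have "cinner y (S' x) = cinner y (S x)" for x y using * by (metis cinner_cnj)
    then show "S' = S" by (intro blinfun_eqI cinner_eqI)
  qed
  then show ?thesis using S * by simp
qed

lemma adj_clin [simp, intro]: "T \<in> clin \<Longrightarrow> adj T \<in> clin"
  and cinner_adj_left: "T \<in> clin \<Longrightarrow> cinner (adj T x) y = cinner x (T y)"
  using adj_exists by auto

lemma cinner_adj_right: "T \<in> clin \<Longrightarrow> cinner x (adj T y) = cinner (T x) y"
  by (metis cinner_adj_left cinner_cnj)

text \<open>The adjoint relation by itself forces both operators to be complex linear, so membership
  in \<open>clin\<close> is a consequence rather than an assumption.\<close>

lemma adj_eqI:
  assumes "\<And>x y. cinner (blinfun_apply S x) y = cinner x (blinfun_apply T y)" shows "adj T = S"
proof -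
  have "S (cscale c x) = cscale c (S x)" for c x
    by (rule cinner_eqI) (metis assms cinner_cnj cinner_cscale_left cinner_cscale_right complex_cnj_cnj)
  then have S: "S \<in> clin" by (simp add: clin_def)
  have "T (cscale c x) = cscale c (T x)" for c x
    by (rule cinner_eqI) (metis assms cinner_cscale_right)
  then have "T \<in> clin" by (simp add: clin_def)
  then have "cinner y (adj T x) = cinner y (S x)" for x y using assms[of x y] cinner_adj_left[of T x y] by (metis cinner_cnj)
  then show ?thesis by (intro blinfun_eqI cinner_eqI)
qed

lemma hom_eqI: "(\<And>x y. cinner x (blinfun_apply S y) = cinner x (blinfun_apply T y)) \<Longrightarrow> S = T"
  by (intro blinfun_eqI cinner_eqI)

lemma adj_adj [simp]: "T \<in> clin \<Longrightarrow> adj (adj T) = T"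
  by (rule adj_eqI) (simp add: cinner_adj_right)

lemma adj_compose [simp]: "S \<in> clin \<Longrightarrow> T \<in> clin \<Longrightarrow> adj (S \<cdot> T) = adj T \<cdot> adj S"
  by (rule adj_eqI) (simp add: cinner_adj_left)

lemma adj_add [simp]: "S \<in> clin \<Longrightarrow> T \<in> clin \<Longrightarrow> adj (S + T) = adj S + adj T"
  by (rule adj_eqI) (simp add: cinner_adj_left blinfun.add_left cinner_add_left cinner_add_right)

lemma adj_scaleC [simp]: "T \<in> clin \<Longrightarrow> adj (c *\<^sub>C T) = cnj c *\<^sub>C adj T"
  by (rule adj_eqI) (simp add: cinner_adj_left)

lemma adj_simps [simp]: "adj (0 :: ('i, 'j) hom) = 0" "adj (\<one> :: 'i op) = \<one>"
  by (rule adj_eqI, simp add: cinner.zero_left cinner.zero_right)+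

lemma adj_minus [simp]: "T \<in> clin \<Longrightarrow> adj (- T) = - adj T"
  by (rule adj_eqI) (simp add: cinner_adj_left blinfun.minus_left cinner.minus_left cinner.minus_right)

lemma adj_diff [simp]: "S \<in> clin \<Longrightarrow> T \<in> clin \<Longrightarrow> adj (S - T) = adj S - adj T"
  by (rule adj_eqI) (simp add: cinner_adj_left blinfun.diff_left cinner.diff_left cinner.diff_right)

lemma adj_sum: "(\<And>p. p \<in> F \<Longrightarrow> T p \<in> clin) \<Longrightarrow> adj (\<Sum>p\<in>F. T p) = (\<Sum>p\<in>F. adj (T p))"
  by (induction F rule: infinite_finite_induct) auto

lemma norm_sq_le_iff_cinner: "norm x = norm y \<longleftrightarrow> cinner x x = cinner y y"
  by (simp add: cinner_self of_real_power[symmetric] power2_eq_iff_nonneg del: of_real_power)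

lemma compose_sum_left: "(\<Sum>p\<in>F. S p) \<cdot> T = (\<Sum>p\<in>F. S p \<cdot> T)"
  by (induction F rule: infinite_finite_induct) (auto simp: blinfun_compose.add_left)

lemma compose_sum_right: "T \<cdot> (\<Sum>p\<in>F. S p) = (\<Sum>p\<in>F. T \<cdot> S p)"
  by (induction F rule: infinite_finite_induct) (auto simp: blinfun_compose.add_right)

lemmas compose_sum = compose_sum_left compose_sum_right

lemma sum_apply: "blinfun_apply (\<Sum>p\<in>F. S p) x = (\<Sum>p\<in>F. blinfun_apply (S p) x)"
  by (induction F rule: infinite_finite_induct) (auto simp: blinfun.add_left)

lemma norm_adj_le: "T \<in> clin \<Longrightarrow> norm (adj T) \<le> norm T"
proof (rule norm_blinfun_bound)
  fix x assume T: "T \<in> clin"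
  show "norm (adj T x) \<le> norm T * norm x"
  proof (rule norm_le_cinnerI)
    fix z show "cmod (cinner z (adj T x)) \<le> norm T * norm x * norm z"
      using cinner_bound[of "T z" x] mult_right_mono[OF norm_blinfun[of T z] norm_ge_zero[of x]] T
      by (simp add: cinner_adj_right mult.commute mult.left_commute)
  qed simp
qed simp

subsection \<open>Projections and isometries\<close>

definition csubspace_on :: "'i ell2 set \<Rightarrow> bool" where
  "csubspace_on K \<longleftrightarrow> 0 \<in> K \<and> (\<forall>x\<in>K. \<forall>y\<in>K. x + y \<in> K) \<and> (\<forall>c. \<forall>x\<in>K. cscale c x \<in> K)"

lemma csubspace_diff: "csubspace_on K \<Longrightarrow> x \<in> K \<Longrightarrow> y \<in> K \<Longrightarrow> x - y \<in> K"
  by (metis csubspace_on_def cscale.minus_left cscale_simps(2) uminus_add_conv_diff add.commute)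

lemma csubspace_closure:
  assumes "csubspace_on K" shows "csubspace_on (closure K)"
proof -
  have "x + y \<in> closure K" if x: "x \<in> closure K" and y: "y \<in> closure K" for x y
  proof -
    obtain X where "\<forall>n. X n \<in> K" "X \<longlonglongrightarrow> x" using x unfolding closure_sequential by blast
    moreover obtain Y where "\<forall>n. Y n \<in> K" "Y \<longlonglongrightarrow> y" using y unfolding closure_sequential by blast
    ultimately show ?thesis using assms unfolding closure_sequential csubspace_on_def
      by (intro exI[of _ "\<lambda>n. X n + Y n"]) (auto intro: tendsto_add)
  qed
  moreover have "cscale c x \<in> closure K" if x: "x \<in> closure K" for c x
  proof -
    obtain X where "\<forall>n. X n \<in> K" "X \<longlonglongrightarrow> x" using x unfolding closure_sequential by blast
    then show ?thesis using assms unfolding closure_sequential csubspace_on_def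
      by (intro exI[of _ "\<lambda>n. cscale c (X n)"]) (auto intro: bounded_linear.tendsto[OF cscale.bounded_linear_right])
  qed
  ultimately show ?thesis using assms closure_subset unfolding csubspace_on_def by blast
qed

lemma nearest_point_orthogonal:
  assumes K: "csubspace_on K" and k: "k \<in> K" and le: "\<And>z. z \<in> K \<Longrightarrow> norm (x - k) \<le> norm (x - z)" and z: "z \<in> K"
  shows "cinner z (x - k) = 0"
proof (cases "z = 0")
  case False
  define w where "w = x - k"
  \<comment> \<open>\<open>cscale t z\<close> is the projection of \<open>w\<close> onto the line of
    \<open>z\<close>. Moving \<open>k\<close> by it would lower the squared distance by
    \<open>|<z, w>|^2 / |z|^2\<close>, which minimality allows only when the inner product
    vanishes.\<close>
  define t where "t = cinner z w / of_real ((norm z)\<^sup>2)"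
  have nz: "of_real ((norm z)\<^sup>2) \<noteq> (0 :: complex)" using False by simp
  have "k + cscale t z \<in> K" using K k z by (auto simp: csubspace_on_def)
  from le[OF this] have "norm w \<le> norm (w - cscale t z)" by (simp add: w_def algebra_simps)
  then have "(norm w)\<^sup>2 \<le> (norm (w - cscale t z))\<^sup>2" by (intro power_mono) auto
  moreover have "complex_of_real ((norm (w - cscale t z))\<^sup>2) = of_real ((norm w)\<^sup>2 - (cmod (cinner z w))\<^sup>2 / (norm z)\<^sup>2)"
  proof -
    have "cinner w z = cnj (cinner z w)" by (simp add: cinner_cnj)
    then have "cinner (w - cscale t z) (w - cscale t z)
        = cinner w w - t * cnj (cinner z w) - cnj t * cinner z w + cnj t * t * cinner z z"
      by (simp add: cinner.diff_left cinner.diff_right algebra_simps)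
    also have "cnj t * t * cinner z z = cnj t * cinner z w"
    proof -
      have "t * cinner z z = cinner z w" unfolding t_def cinner_self using nz by (simp del: of_real_power)
      then show ?thesis by (simp add: mult.assoc)
    qed
    also have "cinner w w - t * cnj (cinner z w) - cnj t * cinner z w + cnj t * cinner z w
        = of_real ((norm w)\<^sup>2 - (cmod (cinner z w))\<^sup>2 / (norm z)\<^sup>2)"
      by (simp add: t_def cinner_self mult_cnj_cmod)
    finally show ?thesis by (simp only: cinner_self)
  qed
  ultimately have "(cmod (cinner z w))\<^sup>2 / (norm z)\<^sup>2 \<le> 0" by (metis diff_ge_0_iff_ge of_real_eq_iff add.commute le_diff_eq add_le_same_cancel2)
  then have "(cmod (cinner z w))\<^sup>2 \<le> 0" using False by (simp add: divide_le_0_iff)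
  then show ?thesis by (simp add: w_def)
qed (simp add: cinner.zero_left)

lemma projection_point:
  assumes K: "csubspace_on K" "closed K"
  shows "\<exists>k\<in>K. \<forall>z\<in>K. cinner z (x - k) = 0"
proof -
  have ne: "K \<noteq> {}" using K by (auto simp: csubspace_on_def)
  define d where "d = infdist x K"
  have d: "d \<le> norm (x - z)" if "z \<in> K" for z using infdist_le[OF that, of x] by (simp add: d_def dist_norm)
  have "\<exists>z\<in>K. norm (x - z) < d + 1 / Suc n" for n
  proof (rule ccontr)
    assume "\<not> ?thesis"
    then have "d + 1 / Suc n \<le> dist x z" if "z \<in> K" for z using that by (force simp: dist_norm)
    then have "d + 1 / Suc n \<le> infdist x K" unfolding infdist_notempty[OF ne] by (rule cINF_greatest[OF ne])
    then have "d + 1 / Suc n \<le> d" unfolding d_def .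
    then show False by simp
  qed
  then obtain k where k: "\<And>n. k n \<in> K" "\<And>n. norm (x - k n) < d + 1 / Suc n" by metis
  have d0: "0 \<le> d" by (simp add: d_def infdist_nonneg)
  \<comment> \<open>Parallelogram law: the midpoint still has distance at least \<open>d\<close>, so
    the left-hand side is at most four times the excess of the squared distances over
    \<open>d^2\<close>. That excess is at most \<open>(2 d + 1) / (N + 1)\<close> because
    \<open>1 / (N + 1) \<le> 1\<close>.\<close>
  have par: "(norm (k m - k n))\<^sup>2 \<le> 4 * (2 * d + 1) * (1 / Suc N)" if mn: "m \<ge> N" "n \<ge> N" for m n N
  proof -
    have le: "(norm (x - k j))\<^sup>2 \<le> d\<^sup>2 + (2 * d + 1) * (1 / Suc N)" if "j \<ge> N" for j
    proof -
      have a: "1 / real (Suc j) \<le> 1 / real (Suc N)" using that by (simp add: frac_le)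
      have b: "1 / real (Suc N) \<le> 1" by simp
      have "norm (x - k j) \<le> d + 1 / real (Suc N)" using k(2)[of j] a by linarith
      then have "(norm (x - k j))\<^sup>2 \<le> (d + 1 / real (Suc N))\<^sup>2" by (intro power_mono) auto
      also have "\<dots> \<le> d\<^sup>2 + (2 * d + 1) * (1 / Suc N)"
        using mult_left_mono[OF b, of "1 / real (Suc N)"] by (simp add: power2_eq_square algebra_simps)
      finally show ?thesis .
    qed
    have mid: "(1/2) *\<^sub>R (k m + k n) \<in> K"
      using K k(1)[of m] k(1)[of n] cscale_simps(5)[of "1/2" "k m + k n"] unfolding csubspace_on_def by metis
    have "d\<^sup>2 \<le> (norm (x - (1/2) *\<^sub>R (k m + k n)))\<^sup>2" using d[OF mid] d0 by (intro power_mono) auto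
    moreover have "(norm (k m - k n))\<^sup>2 = 2 * (norm (x - k m))\<^sup>2 + 2 * (norm (x - k n))\<^sup>2 - 4 * (norm (x - (1/2) *\<^sub>R (k m + k n)))\<^sup>2"
      unfolding power2_norm_eq_inner by (simp add: inner_diff_left inner_diff_right inner_add_left inner_add_right inner_commute algebra_simps)
    ultimately show ?thesis using le[OF mn(1)] le[OF mn(2)] by linarith
  qed
  have "Cauchy k"
  proof (rule CauchyI)
    fix e :: real assume e: "e > 0"
    have "(\<lambda>N. 4 * (2 * d + 1) * (1 / real (Suc N))) \<longlonglongrightarrow> 4 * (2 * d + 1) * 0"
      by (intro tendsto_intros LIMSEQ_Suc[OF lim_1_over_n])
    then have "\<forall>\<^sub>F N in sequentially. 4 * (2 * d + 1) * (1 / real (Suc N)) < e\<^sup>2"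
      by (intro order_tendstoD(2)[of _ 0]) (use e in auto)
    then obtain N where N: "4 * (2 * d + 1) * (1 / real (Suc N)) < e\<^sup>2" by (auto simp: eventually_sequentially)
    have "norm (k m - k n) < e" if "m \<ge> N" "n \<ge> N" for m n
      using le_less_trans[OF par[OF that] N] e by (simp add: power2_less_imp_less)
    then show "\<exists>M. \<forall>m\<ge>M. \<forall>n\<ge>M. norm (k m - k n) < e" by blast
  qed
  then obtain l where l: "k \<longlonglongrightarrow> l" by (auto simp: Cauchy_convergent_iff convergent_def)
  have lK: "l \<in> K" using K(2) k(1) l closed_sequentially by blast
  have "norm (x - l) \<le> d + 0"
  proof (rule LIMSEQ_le)
    show "(\<lambda>n. norm (x - k n)) \<longlonglongrightarrow> norm (x - l)" by (intro tendsto_intros l)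
    show "(\<lambda>n. d + 1 / Suc n) \<longlonglongrightarrow> d + 0" by (intro tendsto_intros LIMSEQ_Suc[OF lim_1_over_n])
  qed (use k(2) in \<open>auto intro: less_imp_le\<close>)
  then have "norm (x - l) \<le> norm (x - z)" if "z \<in> K" for z using d[OF that] by simp
  then show ?thesis using nearest_point_orthogonal[OF K(1) lK] lK by blast
qed

lemma projection_exists:
  assumes K: "csubspace_on K" "closed K"
  shows "\<exists>P\<in>clin. \<forall>x. blinfun_apply P x \<in> K \<and> (\<forall>z\<in>K. cinner z (x - blinfun_apply P x) = 0)"
proof -
  obtain P where P: "\<And>x. P x \<in> K" "\<And>x z. z \<in> K \<Longrightarrow> cinner z (x - P x) = 0"
    using projection_point[OF K] by metis
  \<comment> \<open>A point of \<open>K\<close> with orthogonal residue is unique; additivity and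
    homogeneity of \<open>P\<close> are instances of this.\<close>
  have uniq: "P x = k" if "k \<in> K" "\<And>z. z \<in> K \<Longrightarrow> cinner z (x - k) = 0" for x k
  proof -
    have m: "P x - k \<in> K" using csubspace_diff[OF K(1)] P that by blast
    have "cinner (P x - k) (P x - k) = cinner (P x - k) (x - k) - cinner (P x - k) (x - P x)" by (simp add: cinner.diff_right)
    then show ?thesis using P(2)[OF m] that(2)[OF m] by simp
  qed
  have add: "P (x + y) = P x + P y" for x y
    by (rule uniq) (use K P in \<open>auto simp: csubspace_on_def add_diff_add cinner.add_right\<close>)
  have sc: "P (cscale c x) = cscale c (P x)" for c x
    by (rule uniq) (use K P in \<open>auto simp: csubspace_on_def cscale.diff_right[symmetric]\<close>)
  have "norm (P x) \<le> norm x" for x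
  proof (cases "P x = 0")
    case False
    have "cinner (P x) (P x) = cinner (P x) x" using P(2)[OF P(1)[of x], of x] by (simp add: cinner.diff_right)
    moreover have "cmod (cinner (P x) (P x)) = norm (P x) * norm (P x)" by (simp add: cinner_self norm_mult power2_eq_square)
    ultimately have "norm (P x) * norm (P x) \<le> norm (P x) * norm x" using cinner_bound[of "P x" x] by simp
    then show ?thesis using False by simp
  qed simp
  then have "bounded_linear P"
    using add sc[of "of_real r" for r] by (intro bounded_linear_intro[of _ 1]) auto
  then show ?thesis using P sc by (intro bexI[of _ "Blinfun P"]) (auto simp: bounded_linear_Blinfun_apply clin_def)
qed

lemma dense_if_orthogonal_zero:
  assumes K: "csubspace_on K" and 0: "\<And>x. (\<And>z. z \<in> K \<Longrightarrow> cinner z x = 0) \<Longrightarrow> x = 0"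
  shows "closure K = UNIV"
proof -
  have "x \<in> closure K" for x
  proof -
    obtain k where k: "k \<in> closure K" "\<And>z. z \<in> closure K \<Longrightarrow> cinner z (x - k) = 0"
      using projection_point[OF csubspace_closure[OF K] closed_closure] by blast
    then have "x - k = 0" using 0[of "x - k"] closure_subset[of K] by blast
    then show ?thesis using k by simp
  qed
  then show ?thesis by blast
qed

text \<open>Linear combinations are coded by lists with possible repetitions, so that sums and
  multiples correspond to explicit lists and no independence of the family is needed to speak about
  them.\<close>

definition combo :: "('p \<Rightarrow> 'i ell2) \<Rightarrow> (complex \<times> 'p) list \<Rightarrow> 'i ell2" where
  "combo s l = (\<Sum>(c, p)\<leftarrow>l. cscale c (s p))"

lemma combo_simps: "combo s [] = 0" "combo s ((c, p) # l) = cscale c (s p) + combo s l"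
  "combo s (l @ l') = combo s l + combo s l'" "combo s (map (\<lambda>(d, p). (c * d, p)) l) = cscale c (combo s l)"
proof -
  show "combo s (map (\<lambda>(d, p). (c * d, p)) l) = cscale c (combo s l)"
    by (induction l) (auto simp: combo_def cscale.add_right)
qed (simp_all add: combo_def)

lemma combo_gram:
  assumes "\<And>p q. cinner (s p) (s q) = cinner (t p) (t q)"
  shows "cinner (combo s l) (combo s l') = cinner (combo t l) (combo t l')"
proof -
  have "cinner (s p) (combo s l') = cinner (t p) (combo t l')" for p
    by (induction l') (auto simp: combo_simps cinner.zero_right cinner.add_right assms)
  then show ?thesis by (induction l) (auto simp: combo_simps cinner.zero_left cinner.add_left)
qed

lemma combo_dense:
  assumes "\<And>x. (\<And>p. cinner (s p) x = 0) \<Longrightarrow> x = 0"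
  shows "closure (range (combo s)) = UNIV"
proof (rule dense_if_orthogonal_zero)
  show "csubspace_on (range (combo s))"
    unfolding csubspace_on_def by (auto simp: combo_simps(3,4)[symmetric]) (metis combo_simps(1) rangeI)
  fix x assume "\<And>z. z \<in> range (combo s) \<Longrightarrow> cinner z x = 0"
  then have "cinner (combo s [(1, p)]) x = 0" for p by blast
  then show "x = 0" using assms[of x] by (simp add: combo_simps)
qed

lemma combo_diff: "combo u l - combo u l' = combo u (l @ map (\<lambda>(d, p). (- 1 * d, p)) l')"
  unfolding combo_simps by (simp add: cscale.minus_left)

text \<open>Equal Gram matrices make the norms of differences of combinations agree, so sending a
  combination of \<open>s\<close> to the same combination of \<open>t\<close> is well defined and
  isometric even for dependent families; totality of \<open>s\<close> lets it extend by limits. The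
  dilations and implementing unitaries below are produced in this way.\<close>

lemma isometry_extension:
  fixes s :: "'p \<Rightarrow> 'i ell2" and t :: "'p \<Rightarrow> 'j ell2"
  assumes gram: "\<And>p q. cinner (s p) (s q) = cinner (t p) (t q)"
    and total: "\<And>x. (\<And>p. cinner (s p) x = 0) \<Longrightarrow> x = 0"
  shows "\<exists>T\<in>clin. (\<forall>p. blinfun_apply T (s p) = t p) \<and> adj T \<cdot> T = \<one>"
proof -
  have dist: "norm (combo t l - combo t l') = norm (combo s l - combo s l')" for l l'
    unfolding combo_diff norm_sq_le_iff_cinner by (rule combo_gram[OF gram, symmetric])
  have "\<exists>X. (\<lambda>n. combo s (X n)) \<longlonglongrightarrow> x" for x
  proof -
    have "x \<in> closure (range (combo s))" using combo_dense[of s] total by blast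
    then obtain Z where Z: "\<forall>n. Z n \<in> range (combo s)" "Z \<longlonglongrightarrow> x" unfolding closure_sequential by blast
    have "\<forall>n. \<exists>l. Z n = combo s l" using Z(1) by blast
    then obtain X where "\<forall>n. Z n = combo s (X n)" by metis
    then have "Z = (\<lambda>n. combo s (X n))" by auto
    then show ?thesis using Z by blast
  qed
  then obtain X where X: "\<And>x. (\<lambda>n. combo s (X x n)) \<longlonglongrightarrow> x" by metis
  define T where "T x = lim (\<lambda>n. combo t (X x n))" for x
  have T: "(\<lambda>n. combo t (X x n)) \<longlonglongrightarrow> T x" for x
  proof -
    have "Cauchy (\<lambda>n. combo s (X x n))" using X by (rule LIMSEQ_imp_Cauchy)
    then have "Cauchy (\<lambda>n. combo t (X x n))" unfolding Cauchy_def dist_norm dist .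
    then show ?thesis unfolding T_def by (simp add: Cauchy_convergent_iff convergent_LIMSEQ_iff)
  qed
  have uniq: "T x = y" if "(\<lambda>n. combo s (Y n)) \<longlonglongrightarrow> x" "(\<lambda>n. combo t (Y n)) \<longlonglongrightarrow> y" for x y Y
  proof -
    have "(\<lambda>n. norm (combo s (X x n) - combo s (Y n))) \<longlonglongrightarrow> norm (x - x)" by (intro tendsto_intros X that)
    moreover have "(\<lambda>n. norm (combo t (X x n) - combo t (Y n))) \<longlonglongrightarrow> norm (T x - y)" by (intro tendsto_intros T that)
    ultimately have "norm (T x - y) = norm (x - x)" unfolding dist by (rule LIMSEQ_unique[rotated])
    then show ?thesis by simp
  qed
  have iso: "cinner (T x) (T y) = cinner x y" for x y
  proof (rule LIMSEQ_unique)
    show "(\<lambda>n. cinner (combo t (X x n)) (combo t (X y n))) \<longlonglongrightarrow> cinner (T x) (T y)" by (intro cinner.tendsto T)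
    show "(\<lambda>n. cinner (combo t (X x n)) (combo t (X y n))) \<longlonglongrightarrow> cinner x y"
      unfolding combo_gram[OF gram, symmetric] by (intro cinner.tendsto X)
  qed
  have "T (x + y) = T x + T y" for x y
    by (rule uniq[of "\<lambda>n. X x n @ X y n"]) (auto simp: combo_simps intro: tendsto_add X T)
  moreover have sc: "T (cscale c x) = cscale c (T x)" for c x
    by (rule uniq[of "\<lambda>n. map (\<lambda>(d, p). (c * d, p)) (X x n)"])
      (auto simp: combo_simps intro: bounded_linear.tendsto[OF cscale.bounded_linear_right] X T)
  moreover have "norm (T x) = norm x" for x using iso by (simp add: norm_sq_le_iff_cinner)
  ultimately have bl: "bounded_linear T" using sc[of "of_real r" for r] by (intro bounded_linear_intro[of _ 1]) auto
  have "T (s p) = t p" for p by (rule uniq[of "\<lambda>_. [(1, p)]"]) (auto simp: combo_simps)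
  moreover have "Blinfun T \<in> clin" using bl sc by (simp add: clin_def bounded_linear_Blinfun_apply)
  moreover from this have "adj (Blinfun T) \<cdot> Blinfun T = \<one>"
    by (intro hom_eqI) (simp add: cinner_adj_right bounded_linear_Blinfun_apply[OF bl] iso)
  ultimately show ?thesis using bl by (intro bexI[of _ "Blinfun T"]) (auto simp: bounded_linear_Blinfun_apply)
qed

lemma isometry_surj_unitary:
  assumes T: "T \<in> clin" "adj T \<cdot> T = \<one>" and s: "\<And>x. (\<And>p. cinner (T (s p)) x = 0) \<Longrightarrow> x = 0"
  shows "T \<cdot> adj T = \<one>"
proof (rule blinfun_eqI)
  fix x
  have *: "adj T (T y) = y" for y using T(2) by (metis blinfun_apply_blinfun_compose id_blinfun.rep_eq)
  have "cinner (T (s p)) (x - T (adj T x)) = 0" for p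
    using T by (simp add: cinner.diff_right cinner_adj_left[symmetric] * cinner_adj_right)
  then have "x - T (adj T x) = 0" by (rule s)
  then show "(T \<cdot> adj T) x = \<one> x" by simp
qed

subsection \<open>Tensor products\<close>

lemma coord_vec_tensor [simp]: "coord (x \<otimes>\<^sub>v y) (i, j) = coord x i * coord y j"
proof -
  have "(\<lambda>p. (cmod (case p of (i, j) \<Rightarrow> coord x i * coord y j))\<^sup>2) summable_on Sigma UNIV (\<lambda>_. UNIV)"
    by (rule summable_on_SigmaI[where g="\<lambda>i. (cmod (coord x i))\<^sup>2 * (norm y)\<^sup>2"])
      (auto simp: norm_mult power_mult_distrib intro!: has_sum_cmult_right norm_sq_has_sum summable_on_cmult_left
        has_sum_imp_summable[OF norm_sq_has_sum])
  then show ?thesis unfolding vec_tensor_def by (subst Abs_ell2_inverse) auto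
qed

lemma basis_tensor [simp]: "basis_vec i \<otimes>\<^sub>v basis_vec j = basis_vec (i, j)"
  by (rule coord_eqI) (auto simp: coord_basis split: prod.splits if_splits)

lemma vec_tensor_simps: "(x + x') \<otimes>\<^sub>v y = x \<otimes>\<^sub>v y + x' \<otimes>\<^sub>v y" "x \<otimes>\<^sub>v (y + y') = x \<otimes>\<^sub>v y + x \<otimes>\<^sub>v y'"
  "cscale c x \<otimes>\<^sub>v y = cscale c (x \<otimes>\<^sub>v y)" "x \<otimes>\<^sub>v cscale c y = cscale c (x \<otimes>\<^sub>v y)"
  by (rule coord_eqI, auto simp: algebra_simps split: prod.splits; (case_tac i)?, simp add: algebra_simps)+

lemma norm_vec_tensor [simp]: "norm (x \<otimes>\<^sub>v y) = norm x * norm y"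
proof -
  have "((\<lambda>p. (cmod (coord (x \<otimes>\<^sub>v y) p))\<^sup>2) has_sum (norm x)\<^sup>2 * (norm y)\<^sup>2) (Sigma UNIV (\<lambda>_. UNIV))"
  proof (rule has_sum_SigmaI)
    show "((\<lambda>j. (cmod (coord (x \<otimes>\<^sub>v y) (i, j)))\<^sup>2) has_sum (cmod (coord x i))\<^sup>2 * (norm y)\<^sup>2) UNIV" for i
      by (auto simp: norm_mult power_mult_distrib intro!: has_sum_cmult_right norm_sq_has_sum)
    show "((\<lambda>i. (cmod (coord x i))\<^sup>2 * (norm y)\<^sup>2) has_sum (norm x)\<^sup>2 * (norm y)\<^sup>2) UNIV"
      by (intro has_sum_cmult_left norm_sq_has_sum)
    show "(\<lambda>p. (cmod (coord (x \<otimes>\<^sub>v y) p))\<^sup>2) summable_on Sigma UNIV (\<lambda>_. UNIV)"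
      using has_sum_imp_summable[OF norm_sq_has_sum] by simp
  qed
  then have "(norm x * norm y)\<^sup>2 = (norm (x \<otimes>\<^sub>v y))\<^sup>2"
    using has_sum_unique[OF _ norm_sq_has_sum] by (simp add: power_mult_distrib)
  then show ?thesis by (simp add: power2_eq_iff_nonneg)
qed

interpretation vec_tensor: bounded_bilinear vec_tensor
proof
  show "\<exists>K. \<forall>a b. norm (a \<otimes>\<^sub>v b) \<le> norm a * norm b * K" by (intro exI[of _ 1]) auto
qed (use vec_tensor_simps(3)[of "of_real r" for r] vec_tensor_simps(4)[of _ "of_real r" for r] in \<open>auto simp: vec_tensor_simps\<close>)

declare blinfun_compose.zero_left [simp] blinfun_compose.zero_right [simp] blinfun.zero_right [simp] cinner.zero_left [simp]
  cinner.zero_right [simp] vec_tensor.zero_left [simp] vec_tensor.zero_right [simp]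

lemma cinner_vec_tensor [simp]: "cinner (x \<otimes>\<^sub>v y) (x' \<otimes>\<^sub>v y') = cinner x x' * cinner y y'"
proof -
  have r: "cinner (basis_vec i \<otimes>\<^sub>v y) (x' \<otimes>\<^sub>v y') = coord x' i * cinner y y'" for i
  proof (rule bounded_linear_basis_eqI[where x=y])
    show "bounded_linear (\<lambda>y. cinner (basis_vec i \<otimes>\<^sub>v y) (x' \<otimes>\<^sub>v y'))"
      by (rule bounded_linear_compose[OF cinner.bounded_linear_left vec_tensor.bounded_linear_right])
    show "bounded_linear (\<lambda>y. coord x' i * cinner y y')"
      by (rule bounded_linear_compose[OF bounded_linear_mult_right cinner.bounded_linear_left])
  qed (simp add: vec_tensor_simps)
  show ?thesis
  proof (rule bounded_linear_basis_eqI[where x=x])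
    show "bounded_linear (\<lambda>x. cinner (x \<otimes>\<^sub>v y) (x' \<otimes>\<^sub>v y'))"
      by (rule bounded_linear_compose[OF cinner.bounded_linear_left vec_tensor.bounded_linear_left])
    show "bounded_linear (\<lambda>x. cinner x x' * cinner y y')"
      by (rule bounded_linear_compose[OF bounded_linear_mult_left cinner.bounded_linear_left])
  qed (simp add: vec_tensor_simps r)
qed

lemma hom_eq_tensorI:
  assumes "S \<in> clin" "T \<in> clin" "\<And>x y. blinfun_apply S (x \<otimes>\<^sub>v y) = blinfun_apply T (x \<otimes>\<^sub>v y)" shows "S = T"
  using assms(3)[of "basis_vec _" "basis_vec _"] by (intro clin_eqI[OF assms(1,2)]) (metis basis_tensor surj_pair)

lemma hom_eq_tensorI2:
  assumes "S \<in> clin" "T \<in> clin"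
    "\<And>x y x' y'. cinner (x' \<otimes>\<^sub>v y') (blinfun_apply S (x \<otimes>\<^sub>v y)) = cinner (x' \<otimes>\<^sub>v y') (blinfun_apply T (x \<otimes>\<^sub>v y))" shows "S = T"
proof (rule hom_eq_tensorI[OF assms(1,2)], rule coord_eqI)
  fix x y p show "coord (S (x \<otimes>\<^sub>v y)) p = coord (T (x \<otimes>\<^sub>v y)) p"
    using assms(3)[of "basis_vec (fst p)" "basis_vec (snd p)" x y] by simp
qed

lemma tensor_orthogonal_zero: "(\<And>x y. cinner (x \<otimes>\<^sub>v y) z = 0) \<Longrightarrow> z = 0"
  by (rule coord_eqI) (metis basis_tensor cinner_basis_left coord_simps(4) surj_pair)

definition lvec :: "'i ell2 \<Rightarrow> ('j, 'i \<times> 'j) hom" where "lvec u = Blinfun (\<lambda>y. u \<otimes>\<^sub>v y)"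
definition rvec :: "'j ell2 \<Rightarrow> ('i, 'i \<times> 'j) hom" where "rvec v = Blinfun (\<lambda>x. x \<otimes>\<^sub>v v)"

lemma lvec_apply [simp]: "lvec u y = u \<otimes>\<^sub>v y" and rvec_apply [simp]: "rvec v x = x \<otimes>\<^sub>v v"
  by (simp_all add: lvec_def rvec_def bounded_linear_Blinfun_apply vec_tensor.bounded_linear_left vec_tensor.bounded_linear_right)

lemma lvec_clin [simp]: "lvec u \<in> clin" and rvec_clin [simp]: "rvec v \<in> clin"
  by (simp_all add: clin_def vec_tensor_simps)

lemma adj_lvec_tensor [simp]: "adj (lvec u) (x \<otimes>\<^sub>v y) = cscale (cinner u x) y"
  and adj_rvec_tensor [simp]: "adj (rvec v) (x \<otimes>\<^sub>v y) = cscale (cinner v y) x"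
  by (rule cinner_eqI; simp add: cinner_adj_right)+

text \<open>Slices of an operator on a tensor product by vector functionals on the first and on the second leg.\<close>

definition ls :: "'i ell2 \<Rightarrow> 'i ell2 \<Rightarrow> ('i \<times> 'j) op \<Rightarrow> 'j op" where "ls u v T = adj (lvec u) \<cdot> T \<cdot> lvec v"
definition rs :: "'j ell2 \<Rightarrow> 'j ell2 \<Rightarrow> ('i \<times> 'j) op \<Rightarrow> 'i op" where "rs u v T = adj (rvec u) \<cdot> T \<cdot> rvec v"

lemma cinner_ls: "cinner x (ls u v T y) = cinner (u \<otimes>\<^sub>v x) (T (v \<otimes>\<^sub>v y))"
  and cinner_rs: "cinner x' (rs u' v' T y') = cinner (x' \<otimes>\<^sub>v u') (T (y' \<otimes>\<^sub>v v'))"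
  by (simp_all add: ls_def rs_def cinner_adj_right)

lemma slice_clin [simp]: "T \<in> clin \<Longrightarrow> ls u v T \<in> clin" "T \<in> clin \<Longrightarrow> rs u' v' T \<in> clin" by (simp_all add: ls_def rs_def)

lemma basis_map_apply:
  assumes "bij p" shows "coord (basis_map p x) j = coord x (inv p j)" "basis_map p \<in> clin" "norm (basis_map p x) = norm x"
proof -
  let ?f = "\<lambda>x j. coord x (inv p j)"
  have hs: "((\<lambda>j. (cmod (?f x j))\<^sup>2) has_sum (norm x)\<^sup>2) UNIV" for x
    using norm_sq_has_sum[of x] by (subst has_sum_reindex_bij_betw[OF bij_imp_bij_inv[OF assms], where f="\<lambda>i. (cmod (coord x i))\<^sup>2"])
  define F where "F x = Abs_ell2 (?f x)" for x
  have co: "coord (F x) = ?f x" for x unfolding F_def using hs by (intro Abs_ell2_inverse) (auto dest: has_sum_imp_summable)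
  have n: "norm (F x) = norm x" for x
    using has_sum_unique[OF norm_sq_has_sum[of "F x", unfolded co] hs[of x]] by (simp add: power2_eq_iff_nonneg)
  have bl: "bounded_linear F"
    by (rule bounded_linear_intro[of _ 1]) (auto simp: n intro!: coord_eqI simp: co)
  have ap: "basis_map p x = F x" for x
    using bl unfolding basis_map_def F_def by (simp add: bounded_linear_Blinfun_apply)
  show "coord (basis_map p x) j = coord x (inv p j)" "norm (basis_map p x) = norm x" by (simp_all add: ap co n)
  show "basis_map p \<in> clin" by (auto simp: clin_def ap co intro!: coord_eqI)
qed

lemma basis_map_basis: "bij p \<Longrightarrow> basis_map p (basis_vec i) = basis_vec (p i)"
  by (rule coord_eqI) (auto simp: basis_map_apply coord_basis bij_is_surj bij_is_inj surj_f_inv_f)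

lemma adj_basis_map: "bij p \<Longrightarrow> adj (basis_map p) = basis_map (inv p)"
proof (rule clin_eqI)
  fix j assume p: "bij p"
  have "basis_map (inv p) (basis_vec j) = basis_vec (inv p j)" by (rule basis_map_basis[OF bij_imp_bij_inv[OF p]])
  moreover have "adj (basis_map p) (basis_vec j) = basis_vec (inv p j)"
  proof (rule coord_eqI)
    fix i
    have "cinner (basis_vec i) (adj (basis_map p) (basis_vec j)) = cinner (basis_map p (basis_vec i)) (basis_vec j)"
      using p by (intro cinner_adj_right basis_map_apply)
    then show "coord (adj (basis_map p) (basis_vec j)) i = coord (basis_vec (inv p j)) i"
      using p by (auto simp: basis_map_basis coord_basis bij_is_surj bij_is_inj surj_f_inv_f)
  qed
  ultimately show "adj (basis_map p) (basis_vec j) = basis_map (inv p) (basis_vec j)" by simp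
qed (auto simp: basis_map_apply bij_imp_bij_inv)

lemma basis_map_unitary: "bij p \<Longrightarrow> adj (basis_map p) \<cdot> basis_map p = \<one>" "bij p \<Longrightarrow> basis_map p \<cdot> adj (basis_map p) = \<one>"
  by (rule clin_eqI; simp add: basis_map_apply adj_basis_map bij_imp_bij_inv basis_map_basis bij_is_surj bij_is_inj surj_f_inv_f)+

lemma relabel_clin [simp]: "bij p \<Longrightarrow> T \<in> clin \<Longrightarrow> relabel p T \<in> clin" by (simp add: relabel_def basis_map_apply)

lemma cinner_relabel: "bij p \<Longrightarrow> cinner (basis_map p x) (relabel p T (basis_map p y)) = cinner x (T y)"
proof -
  assume p: "bij p"
  have *: "adj (basis_map p) (basis_map p z) = z" for z
    using basis_map_unitary(1)[OF p] by (metis blinfun_apply_blinfun_compose id_blinfun.rep_eq)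
  show ?thesis using p by (simp add: relabel_def * basis_map_apply flip: cinner_adj_right)
qed

lemma swap_tensor: "basis_map prod.swap (x \<otimes>\<^sub>v y) = y \<otimes>\<^sub>v x"
  by (rule coord_eqI) (auto simp: basis_map_apply inv_equality[of prod.swap prod.swap] split: prod.splits)

text \<open>The amplification applies \<open>S\<close> to every row of its argument. The squared
  norms of the rows add up to the squared norm of the vector, which gives square summability of the
  result and the bound \<open>norm S\<close> at once.\<close>

lemma amp2_exists:
  fixes S :: "('i, 'k) hom"
  assumes S: "S \<in> clin"
  shows "\<exists>R\<in>clin. \<forall>x y. blinfun_apply R ((x :: 'r ell2) \<otimes>\<^sub>v y) = x \<otimes>\<^sub>v blinfun_apply S y"
proof -
  define row :: "'r \<Rightarrow> ('r \<times> 'i, 'i) hom" where "row r = adj (lvec (basis_vec r))" for r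
  have row: "coord (row r X) i = coord X (r, i)" for r X i
    using cinner_adj_right[of "lvec (basis_vec r)" "basis_vec i" X] by (simp add: row_def)
  have rows: "((\<lambda>r. (norm (row r X))\<^sup>2) has_sum (norm X)\<^sup>2) UNIV" for X
    by (rule has_sum_SigmaD[where B="\<lambda>_. UNIV" and f="\<lambda>p. (cmod (coord X p))\<^sup>2"])
      (use norm_sq_has_sum[of X] norm_sq_has_sum[of "row _ X"] in \<open>auto simp: row\<close>)
  define f where "f X p = coord (S (row (fst p) X)) (snd p)" for X p
  have le: "(norm (S (row r X)))\<^sup>2 \<le> (norm S)\<^sup>2 * (norm (row r X))\<^sup>2" for r X
    unfolding power_mult_distrib[symmetric] by (intro power_mono norm_blinfun) auto
  have sumS: "(\<lambda>r. (norm (S (row r X)))\<^sup>2) summable_on UNIV" for X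
    by (rule summable_on_comparison_test[OF summable_on_cmult_right[OF has_sum_imp_summable[OF rows]]]) (use le in auto)
  have fsum: "(\<lambda>p. (cmod (f X p))\<^sup>2) summable_on Sigma UNIV (\<lambda>_. UNIV)" for X
    by (rule summable_on_SigmaI[OF _ sumS[of X]]) (auto simp: f_def norm_sq_has_sum)
  then have co: "coord (Abs_ell2 (f X)) = f X" for X by (intro Abs_ell2_inverse) simp
  have n: "norm (Abs_ell2 (f X)) \<le> norm X * norm S" for X
  proof -
    have "((\<lambda>p. (cmod (f X p))\<^sup>2) has_sum (norm (Abs_ell2 (f X)))\<^sup>2) (Sigma UNIV (\<lambda>_. UNIV))"
      using norm_sq_has_sum[of "Abs_ell2 (f X)"] by (simp add: co)
    then have "((\<lambda>r. (norm (S (row r X)))\<^sup>2) has_sum (norm (Abs_ell2 (f X)))\<^sup>2) UNIV"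
      by (rule has_sum_SigmaD) (auto simp: f_def norm_sq_has_sum)
    then have "(norm (Abs_ell2 (f X)))\<^sup>2 \<le> (norm S)\<^sup>2 * (norm X)\<^sup>2"
      by (rule has_sum_mono[OF _ has_sum_cmult_right[OF rows]]) (rule le)
    then show ?thesis using power2_le_imp_le[of "norm (Abs_ell2 (f X))" "norm X * norm S"] by (simp add: power_mult_distrib mult.commute)
  qed
  have bl: "bounded_linear (\<lambda>X. Abs_ell2 (f X))"
    by (rule bounded_linear_intro[of _ "norm S", OF _ _ n])
      (auto intro!: coord_eqI simp: co f_def blinfun.add_right blinfun.scaleR_right)
  have cs: "f (cscale c X) p = c * f X p" for c X p by (simp add: f_def row_def clinD[OF adj_clin[OF lvec_clin]] clinD[OF S])
  have row_t: "row r (x \<otimes>\<^sub>v y) = cscale (coord x r) y" for r x y by (rule coord_eqI) (simp add: row)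
  have ft: "f (x \<otimes>\<^sub>v y) p = coord (x \<otimes>\<^sub>v S y) p" for x y p by (cases p) (simp add: f_def row_t clinD[OF S])
  show ?thesis
    by (rule bexI[of _ "Blinfun (\<lambda>X. Abs_ell2 (f X))"])
      (auto simp: clin_def bounded_linear_Blinfun_apply[OF bl] co cs ft intro!: coord_eqI simp del: coord_vec_tensor)
qed

lemma op_tensor_exists:
  fixes S :: "('i, 'k) hom" and T :: "('j, 'l) hom"
  assumes S: "S \<in> clin" and T: "T \<in> clin"
  shows "S \<otimes> T \<in> clin" "(S \<otimes> T) (x \<otimes>\<^sub>v y) = S x \<otimes>\<^sub>v T y"
proof -
  obtain A :: "('i \<times> 'j, 'i \<times> 'l) hom" where A: "A \<in> clin" "\<And>x y. blinfun_apply A (x \<otimes>\<^sub>v y) = x \<otimes>\<^sub>v T y" using amp2_exists[OF T] by blast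
  obtain B :: "('l \<times> 'i, 'l \<times> 'k) hom" where B: "B \<in> clin" "\<And>x y. blinfun_apply B (x \<otimes>\<^sub>v y) = x \<otimes>\<^sub>v S y" using amp2_exists[OF S] by blast
  \<comment> \<open>Only the second leg can be reached directly; the first one is reached by
    flipping, amplifying and flipping back.\<close>
  define R where "R = (basis_map prod.swap \<cdot> B \<cdot> basis_map prod.swap) \<cdot> A"
  have c: "R \<in> clin" using A B by (simp add: R_def basis_map_apply)
  have R: "\<forall>x y. R (x \<otimes>\<^sub>v y) = S x \<otimes>\<^sub>v T y" using A B by (simp add: R_def swap_tensor)
  have "S \<otimes> T = R" unfolding op_tensor_def
  proof (rule the_equality[where P="\<lambda>R. \<forall>x y. blinfun_apply R (x \<otimes>\<^sub>v y) = blinfun_apply S x \<otimes>\<^sub>v blinfun_apply T y", OF R])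
    \<comment> \<open>The description does not ask for complex linearity of \<open>R'\<close>.
      Complex multiples of basis vectors are still covered, since the scalar can be absorbed by the
      first factor of an elementary tensor.\<close>
    fix R' assume R': "\<forall>x y. blinfun_apply R' (x \<otimes>\<^sub>v y) = S x \<otimes>\<^sub>v T y"
    have "R' x = R x" for x
    proof (rule bounded_linear_basis_eqI[OF blinfun.bounded_linear_right blinfun.bounded_linear_right])
      fix d and p :: "'i \<times> 'j"
      have "cscale d (basis_vec p) = cscale d (basis_vec (fst p)) \<otimes>\<^sub>v basis_vec (snd p)" by (simp add: vec_tensor_simps)
      then show "R' (cscale d (basis_vec p)) = R (cscale d (basis_vec p))" by (metis R R')
    qed
    then show "R' = R" by (rule blinfun_eqI)
  qed
  then show "S \<otimes> T \<in> clin" "(S \<otimes> T) (x \<otimes>\<^sub>v y) = S x \<otimes>\<^sub>v T y" using R c by auto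
qed

declare op_tensor_exists [simp]

lemma op_tensor_simps:
  "\<lbrakk>S \<in> clin; S' \<in> clin; T \<in> clin\<rbrakk> \<Longrightarrow> (S + S') \<otimes> T = S \<otimes> T + S' \<otimes> T"
  "\<lbrakk>S \<in> clin; T \<in> clin; T' \<in> clin\<rbrakk> \<Longrightarrow> S \<otimes> (T + T') = S \<otimes> T + S \<otimes> T'"
  "\<lbrakk>S \<in> clin; T \<in> clin\<rbrakk> \<Longrightarrow> (c *\<^sub>C S) \<otimes> T = c *\<^sub>C (S \<otimes> T)"
  "\<lbrakk>S \<in> clin; T \<in> clin\<rbrakk> \<Longrightarrow> S \<otimes> (c *\<^sub>C T) = c *\<^sub>C (S \<otimes> T)"
  "\<lbrakk>S \<in> clin; T \<in> clin\<rbrakk> \<Longrightarrow> adj (S \<otimes> T) = adj S \<otimes> adj T"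
  by (auto intro!: hom_eq_tensorI hom_eq_tensorI2 simp: vec_tensor_simps blinfun.add_left cinner_adj_right simp del: vec_tensor_simps(3,4))

lemma compose_id [simp]: "\<one> \<cdot> T = T" "T \<cdot> \<one> = T"
  by (auto intro: blinfun_eqI)

lemma compose_assoc: "(R \<cdot> S) \<cdot> T = R \<cdot> (S \<cdot> T)"
  by (rule blinfun_eqI) simp

lemma op_tensor_compose:
  "\<lbrakk>S \<in> clin; T \<in> clin; S' \<in> clin; T' \<in> clin\<rbrakk> \<Longrightarrow> (S \<otimes> T) \<cdot> (S' \<otimes> T') = (S \<cdot> S') \<otimes> (T \<cdot> T')"
  by (auto intro!: hom_eq_tensorI)

lemma op_tensor_id [simp]: "\<one> \<otimes> \<one> = \<one>"
  by (auto intro!: hom_eq_tensorI)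

lemma slice_tensor [simp]: "a \<in> clin \<Longrightarrow> b \<in> clin \<Longrightarrow> ls u v (a \<otimes> b) = cinner u (a v) *\<^sub>C b"
  "a \<in> clin \<Longrightarrow> b \<in> clin \<Longrightarrow> rs u' v' (a \<otimes> b) = cinner u' (b v') *\<^sub>C a"
  by (rule blinfun_eqI; simp add: ls_def rs_def)+

lemma slice_linear: "ls u v (S + T) = ls u v S + ls u v T" "rs u' v' (S + T) = rs u' v' S + rs u' v' T"
  "ls u v (S - T) = ls u v S - ls u v T" "rs u' v' (S - T) = rs u' v' S - rs u' v' T"
  "ls u v (c *\<^sub>C T) = c *\<^sub>C ls u v T" "rs u' v' (c *\<^sub>C T) = c *\<^sub>C rs u' v' T"
  by (auto intro!: hom_eqI simp: cinner_ls cinner_rs blinfun.add_left blinfun.diff_left cinner.add_right cinner.diff_right)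

lemma slice_sum: "ls u v (\<Sum>p\<in>F. T p) = (\<Sum>p\<in>F. ls u v (T p))" "rs u' v' (\<Sum>p\<in>F. T p) = (\<Sum>p\<in>F. rs u' v' (T p))"
  by (auto intro!: hom_eqI simp: cinner_ls cinner_rs sum_apply cinner.sum_right)

lemma slice_eqI:
  assumes "S \<in> clin" "T \<in> clin"
  shows "(\<And>u v. ls u v S = ls u v T) \<Longrightarrow> S = T" "(\<And>u v. rs u v S = rs u v T) \<Longrightarrow> S = T"
proof -
  show "S = T" if "\<And>u v. ls u v S = ls u v T"
    by (rule hom_eq_tensorI2[OF assms]) (simp add: cinner_ls[symmetric] that)
  show "S = T" if "\<And>u v. rs u v S = rs u v T"
    by (rule hom_eq_tensorI2[OF assms]) (simp add: cinner_rs[symmetric] that)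
qed

section \<open>The sigma-weak topology\<close>

abbreviation row :: "'r \<Rightarrow> ('r \<times> 'i) ell2 \<Rightarrow> 'i ell2" where "row r X \<equiv> adj (lvec (basis_vec r)) X"

lemma coord_row [simp]: "coord (row r X) i = coord X (r, i)"
  using cinner_adj_right[of "lvec (basis_vec r)" "basis_vec i" X] by simp

lemma row_norms: "((\<lambda>r. (norm (row r X))\<^sup>2) has_sum (norm X)\<^sup>2) UNIV"
  by (rule has_sum_SigmaD[where B="\<lambda>_. UNIV" and f="\<lambda>p. (cmod (coord X p))\<^sup>2"])
    (use norm_sq_has_sum[of X] norm_sq_has_sum[of "row _ X"] in auto)

lemma norm_row: "norm (row r X) \<le> norm X"
proof (rule norm_le_cinnerI)
  show "cmod (cinner z (row r X)) \<le> norm X * norm z" for z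
    using cinner_bound[of "basis_vec r \<otimes>\<^sub>v z" X] by (simp add: cinner_adj_right mult.commute)
qed simp

lemma cinner_rows: "((\<lambda>r. cinner (row r X) (row r Y)) has_sum cinner X Y) UNIV"
proof (rule has_sum_SigmaD[where B="\<lambda>_. UNIV" and f="\<lambda>p. cnj (coord X p) * coord Y p"])
  show "((\<lambda>p. cnj (coord X p) * coord Y p) has_sum cinner X Y) (Sigma UNIV (\<lambda>_. UNIV))"
    unfolding cinner_def by (auto intro: has_sum_infsum coord_summable)
  show "((\<lambda>i. cnj (coord X (r, i)) * coord Y (r, i)) has_sum cinner (row r X) (row r Y)) UNIV" for r
    unfolding cinner_def using has_sum_infsum[OF coord_summable[of "row r X" "row r Y"]] by simp
qed

lemma rows_exist:
  assumes "(\<lambda>r. (norm (x r))\<^sup>2) summable_on UNIV" shows "\<exists>X. \<forall>r. row r X = x r"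
proof -
  have "(\<lambda>p. (cmod (coord (x (fst p)) (snd p)))\<^sup>2) summable_on Sigma UNIV (\<lambda>_. UNIV)"
    by (rule summable_on_SigmaI[OF _ assms]) (auto simp: norm_sq_has_sum)
  then have "coord (Abs_ell2 (\<lambda>p. coord (x (fst p)) (snd p))) = (\<lambda>p. coord (x (fst p)) (snd p))" by (simp add: Abs_ell2_inverse)
  then show ?thesis by (intro exI[of _ "Abs_ell2 (\<lambda>p. coord (x (fst p)) (snd p))"] allI coord_eqI) simp
qed

lemma row_amp [simp]: "T \<in> clin \<Longrightarrow> row r ((\<one> \<otimes> T) X) = T (row r X)"
proof -
  assume T: "T \<in> clin"
  have "adj (lvec (basis_vec r)) \<cdot> (\<one> \<otimes> T) = T \<cdot> adj (lvec (basis_vec r))"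
    using T by (intro hom_eq_tensorI) (auto simp: clinD)
  then show ?thesis by (metis blinfun_apply_blinfun_compose)
qed

text \<open>Sigma-weak functionals are series over \<open>nat\<close>. An unordered sum with
  countable support becomes such a series by an injection of the support into \<open>nat\<close>,
  with zeros elsewhere.\<close>

lemma sums_enumerate:
  assumes "(a has_sum s) UNIV" and g: "inj_on g D" and "\<And>r. r \<notin> D \<Longrightarrow> a r = 0"
  shows "(\<lambda>n :: nat. if n \<in> g ` D then a (inv_into D g n) else 0) sums s"
proof (rule has_sum_imp_sums)
  have "(a has_sum s) D" by (rule has_sum_cong_neutral[THEN iffD1, OF _ _ _ assms(1)]) (use assms in auto)
  then have "((\<lambda>n. a (inv_into D g n)) has_sum s) (g ` D)"
    by (subst has_sum_reindex[OF g]) (auto simp: o_def inv_into_f_f[OF g] cong: has_sum_cong)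
  then show "((\<lambda>n. if n \<in> g ` D then a (inv_into D g n) else 0) has_sum s) UNIV"
    by (rule has_sum_cong_neutral[THEN iffD1, rotated -1]) auto
qed

text \<open>A vector of the amplified space has only countably many nonzero rows, whatever the type
  \<open>'r\<close>, so a vector functional of an amplification is sigma-weak. Together with the
  converse \<open>functional_amp\<close>, whose rows are indexed by \<open>nat\<close>, this
  replaces series by single pairs of vectors.\<close>

lemma amp_functional:
  fixes X Y :: "('r \<times> 'i) ell2"
  shows "\<exists>w\<in>sigma_weak_functionals. \<forall>T\<in>clin. w T = cinner X ((\<one> \<otimes> T) Y)"
proof -
  define D where "D = {r. row r X \<noteq> 0} \<union> {r. row r Y \<noteq> 0}"
  have "countable {r. (norm (row r Z))\<^sup>2 \<noteq> 0}" for Z :: "('r \<times> 'i) ell2"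
    using summable_countable_real[OF has_sum_imp_summable[OF row_norms[of Z]]] by simp
  then have "countable D" by (simp add: D_def)
  then obtain g :: "'r \<Rightarrow> nat" where g: "inj_on g D" using countable_def by blast
  define v where "v Z n = (if n \<in> g ` D then row (inv_into D g n) Z else 0)" for Z :: "('r \<times> 'i) ell2" and n
  have sm: "summable (\<lambda>n. (norm (v Z n))\<^sup>2)" if "Z = X \<or> Z = Y" for Z
  proof -
    have "(\<lambda>n. if n \<in> g ` D then (norm (row (inv_into D g n) Z))\<^sup>2 else 0) sums (norm Z)\<^sup>2"
      by (rule sums_enumerate[OF row_norms g]) (use that in \<open>auto simp: D_def\<close>)
    moreover have "(\<lambda>n. (norm (v Z n))\<^sup>2) = (\<lambda>n. if n \<in> g ` D then (norm (row (inv_into D g n) Z))\<^sup>2 else 0)" by (auto simp: v_def)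
    ultimately show ?thesis by (simp add: sums_iff)
  qed
  have "(\<Sum>n. cinner (v X n) (T (v Y n))) = cinner X ((\<one> \<otimes> T) Y)" if T: "T \<in> clin" for T
  proof -
    have "(\<lambda>n. if n \<in> g ` D then cinner (row (inv_into D g n) X) (row (inv_into D g n) ((\<one> \<otimes> T) Y)) else 0)
        sums cinner X ((\<one> \<otimes> T) Y)"
      by (rule sums_enumerate[OF cinner_rows g]) (auto simp: D_def)
    moreover have "(\<lambda>n. cinner (v X n) (T (v Y n))) = (\<lambda>n. if n \<in> g ` D
        then cinner (row (inv_into D g n) X) (row (inv_into D g n) ((\<one> \<otimes> T) Y)) else 0)"
      using T by (auto simp: v_def)
    ultimately show ?thesis by (simp add: sums_iff)
  qed
  moreover have "(\<lambda>T. \<Sum>n. cinner (v X n) (blinfun_apply T (v Y n))) \<in> sigma_weak_functionals"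
    unfolding sigma_weak_functionals_def using sm[of X] sm[of Y] by blast
  ultimately show ?thesis by (intro bexI[of _ "\<lambda>T. \<Sum>n. cinner (v X n) (blinfun_apply T (v Y n))"]) auto
qed

lemma functional_amp:
  fixes w :: "'i op \<Rightarrow> complex"
  assumes "w \<in> sigma_weak_functionals"
  shows "\<exists>X Y :: (nat \<times> 'i) ell2. \<forall>T\<in>clin. w T = cinner X ((\<one> \<otimes> T) Y)"
proof -
  obtain x y where w: "w = (\<lambda>T. \<Sum>n. cinner (x n) (T (y n)))" and xy: "summable (\<lambda>n. (norm (x n))\<^sup>2)" "summable (\<lambda>n. (norm (y n))\<^sup>2)"
    using assms by (auto simp: sigma_weak_functionals_def)
  obtain X where X: "\<forall>r. row r X = x r" using rows_exist[OF norm_summable_imp_summable_on, of x] xy by auto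
  obtain Y where Y: "\<forall>r. row r Y = y r" using rows_exist[OF norm_summable_imp_summable_on, of y] xy by auto
  have "w T = cinner X ((\<one> \<otimes> T) Y)" if "T \<in> clin" for T
    using has_sum_imp_sums[OF cinner_rows[of X "(\<one> \<otimes> T) Y"]] that by (auto simp: w X Y sums_iff)
  then show ?thesis by blast
qed

lemma vector_functional: "(\<lambda>T. cinner x (blinfun_apply T y)) \<in> sigma_weak_functionals"
proof -
  have "(\<lambda>T. cinner x (blinfun_apply T y)) = (\<lambda>T. \<Sum>n. cinner (if n = 0 then x else 0) (blinfun_apply T (if n = 0 then y else 0)))"
    (is "_ = ?R")
  proof
    fix T
    have "(\<lambda>n. cinner (if n = 0 then x else 0) (blinfun_apply T (if n = 0 then y else 0))) = (\<lambda>n :: nat. if n = 0 then cinner x (T y) else 0)"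
      by auto
    then show "cinner x (blinfun_apply T y) = ?R T" using sums_single[of 0 "\<lambda>_. cinner x (T y)"] by (simp add: sums_iff)
  qed
  moreover have "summable (\<lambda>n :: nat. (norm (if n = 0 then z else 0 :: 'c ell2))\<^sup>2)" for z
    by (rule summable_finite[of "{0}"]) auto
  ultimately show ?thesis unfolding sigma_weak_functionals_def
    by (intro CollectI exI[of _ "\<lambda>n. if n = 0 then x else 0"] exI[of _ "\<lambda>n. if n = 0 then y else 0"]) auto
qed

text \<open>Induction over the generation of open sets: an intersection takes the union of the two
  sets of functionals and the smaller radius.\<close>

lemma sigma_weak_nbhd:
  assumes "openin sigma_weak U" "T \<in> U"
  shows "\<exists>W e. finite W \<and> W \<subseteq> sigma_weak_functionals \<and> 0 < e \<and> (\<forall>S. (\<forall>w\<in>W. cmod (w S - w T) < e) \<longrightarrow> S \<in> U)"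
proof -
  have "generate_topology_on {w -` U | w U. w \<in> sigma_weak_functionals \<and> open U} U"
    using assms(1) unfolding sigma_weak_def by (rule openin_topology_generated_by)
  then show ?thesis using assms(2)
  proof (induction)
    case (Int a b)
    obtain W e W' e' where "finite W" "W \<subseteq> sigma_weak_functionals" "0 < e" "\<forall>S. (\<forall>w\<in>W. cmod (w S - w T) < e) \<longrightarrow> S \<in> a"
      "finite W'" "W' \<subseteq> sigma_weak_functionals" "0 < e'" "\<forall>S. (\<forall>w\<in>W'. cmod (w S - w T) < e') \<longrightarrow> S \<in> b"
      using Int.IH Int.prems by (elim IntE) blast
    then show ?case by (intro exI[of _ "W \<union> W'"] exI[of _ "min e e'"]) auto
  next
    case (Basis s)
    then obtain w V where w: "s = w -` V" "w \<in> sigma_weak_functionals" "open V" by auto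
    then obtain e where e: "e > 0" "\<And>y. dist y (w T) < e \<Longrightarrow> y \<in> V" using Basis(2) unfolding open_dist by blast
    have "\<forall>S. (\<forall>v\<in>{w}. cmod (v S - v T) < e) \<longrightarrow> S \<in> s" using e(2) w(1) by (simp add: dist_norm)
    then show ?case using w(2) e(1) by (intro exI[of _ "{w}"] exI[of _ e]) simp
  next
    case (UN K)
    from UN.prems obtain k where k: "k \<in> K" "T \<in> k" by (auto simp del: Union_iff elim: UnionE)
    then obtain W e where "finite W" "W \<subseteq> sigma_weak_functionals" "0 < e" "\<forall>S. (\<forall>w\<in>W. cmod (w S - w T) < e) \<longrightarrow> S \<in> k"
      using UN.IH[OF k] by blast
    then show ?case using k(1) by (intro exI[of _ W] exI[of _ e]) blast
  qed simp
qed

lemma topspace_sigma_weak [simp]: "topspace (sigma_weak :: 'i op topology) = UNIV"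
proof -
  have "UNIV \<in> {w -` U | w U. w \<in> (sigma_weak_functionals :: ('i op \<Rightarrow> complex) set) \<and> open U}"
    using vector_functional[of 0 0] by (intro CollectI exI[of _ "\<lambda>T. cinner 0 (blinfun_apply T 0)"] exI[of _ UNIV]) auto
  then show ?thesis unfolding sigma_weak_def topology_generated_by_topspace by blast
qed

lemma openin_functional: "w \<in> sigma_weak_functionals \<Longrightarrow> open U \<Longrightarrow> openin sigma_weak (w -` U)"
  unfolding sigma_weak_def by (intro topology_generated_by_Basis) auto

lemma continuous_functional: "w \<in> sigma_weak_functionals \<Longrightarrow> continuous_map sigma_weak euclidean w"
  unfolding continuous_map_def using openin_functional[of w] by (simp add: vimage_def)

lemma limitin_sigma_weakI:
  fixes l :: "'i op"
  assumes "\<And>w. w \<in> sigma_weak_functionals \<Longrightarrow> ((\<lambda>x. w (f x)) \<longlongrightarrow> w l) F"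
  shows "limitin sigma_weak f l F"
  unfolding limitin_def
proof (intro conjI allI impI)
  fix U :: "'i op set" assume U: "openin sigma_weak U \<and> l \<in> U"
  obtain W e where W: "finite W" "W \<subseteq> sigma_weak_functionals" "0 < e" "\<forall>S. (\<forall>w\<in>W. cmod (w S - w l) < e) \<longrightarrow> S \<in> U"
    using sigma_weak_nbhd[OF conjunct1[OF U] conjunct2[OF U]] by (elim exE conjE)
  have "\<forall>\<^sub>F x in F. cmod (w (f x) - w l) < e" if "w \<in> W" for w
    using tendstoD[OF assms[OF subsetD[OF W(2) that]] W(3)] by (simp add: dist_norm)
  then have "\<forall>\<^sub>F x in F. \<forall>w\<in>W. cmod (w (f x) - w l) < e"
    using W(1) by (simp add: eventually_ball_finite_distrib)
  then show "\<forall>\<^sub>F x in F. f x \<in> U" by (rule eventually_mono) (use W(4) in simp)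
qed simp

lemma limitin_functional:
  assumes "limitin sigma_weak f l F" "w \<in> sigma_weak_functionals" shows "((\<lambda>x. w (f x)) \<longlongrightarrow> w l) F"
  using continuous_map_limit[OF continuous_functional[OF assms(2)] assms(1)] by (simp add: o_def)

lemma Hausdorff_sigma_weak: "Hausdorff_space (sigma_weak :: 'i op topology)"
  unfolding Hausdorff_space_def
proof (intro allI impI)
  fix S T :: "'i op" assume "S \<in> topspace sigma_weak \<and> T \<in> topspace sigma_weak \<and> S \<noteq> T"
  then obtain x y where "cinner x (S y) \<noteq> cinner x (T y)" using hom_eqI[of S T] by auto
  from hausdorff[OF this] obtain U V where UV: "open U" "open V" "cinner x (S y) \<in> U" "cinner x (T y) \<in> V" "U \<inter> V = {}" by blast
  note o = openin_functional[OF vector_functional[of x y]]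
  show "\<exists>U V. openin sigma_weak U \<and> openin sigma_weak V \<and> S \<in> U \<and> T \<in> V \<and> disjnt U V"
    by (rule exI, rule exI, intro conjI, rule o[OF UV(1)], rule o[OF UV(2)]) (use UV(3-5) in \<open>auto simp: disjnt_def\<close>)
qed

lemma normal_onI:
  fixes F :: "'i op \<Rightarrow> 'j op"
  assumes "\<And>w. w \<in> sigma_weak_functionals \<Longrightarrow> \<exists>w'\<in>sigma_weak_functionals. \<forall>T\<in>N. w (F T) = w' T"
  shows "normal_on N F"
  unfolding normal_on_def sigma_weak_def[where 'i='j]
proof (rule continuous_on_generated_topo)
  fix U :: "'j op set" assume "U \<in> {w -` U | w U. w \<in> sigma_weak_functionals \<and> open U}"
  then obtain w V where w: "U = w -` V" "w \<in> sigma_weak_functionals" "open V" by auto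
  from assms[OF w(2)] obtain w' where w': "w' \<in> sigma_weak_functionals" "\<forall>T\<in>N. w (F T) = w' T" by (elim bexE)
  have "openin sigma_weak (w' -` V)" by (rule openin_functional[OF w'(1) w(3)])
  moreover have "F -` U \<inter> N = w' -` V \<inter> N" using w(1) w'(2) by auto
  ultimately show "openin (subtopology sigma_weak N) (F -` U \<inter> topspace (subtopology sigma_weak N))"
    unfolding openin_subtopology by (intro exI[of _ "w' -` V"]) simp
next
  show "F ` topspace (subtopology sigma_weak N) \<subseteq> \<Union> {w -` U | w U. w \<in> sigma_weak_functionals \<and> open U}"
    using topspace_sigma_weak[where 'i='j] unfolding sigma_weak_def topology_generated_by_topspace by auto
qed

text \<open>A sigma-weak functional is given by two vectors of an amplification. The operators
  \<open>P\<close> and \<open>Q\<close> are absorbed into these vectors, and regrouping the index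
  \<open>nat \<times> 'r \<times> 'i\<close> as \<open>(nat \<times> 'r) \<times> 'i\<close> shows
  that the pulled back functional is a vector functional of a larger amplification. Normality of the
  maps constructed below rests on this form.\<close>

lemma normal_spatial:
  fixes P :: "('r \<times> 'i, 'j) hom"
  assumes "N \<subseteq> clin" "P \<in> clin" "\<And>T. T \<in> N \<Longrightarrow> F T = P \<cdot> (\<one> \<otimes> T) \<cdot> Q" "Q \<in> clin"
  shows "normal_on N F"
proof (rule normal_onI)
  fix w :: "'j op \<Rightarrow> complex" assume sw: "w \<in> sigma_weak_functionals"
  from functional_amp[OF sw] obtain X Y :: "(nat \<times> 'j) ell2"
    where w: "\<forall>T\<in>clin. w T = cinner X ((\<one> \<otimes> T) Y)" by (elim exE)
  define p where "p = (\<lambda>(n :: nat, r :: 'r, i :: 'i). ((n, r), i))"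
  have ip: "inv p = (\<lambda>((n, r), i). (n, r, i))" and bp: "bij p"
    by (auto simp: p_def intro!: inv_equality o_bij[where g="\<lambda>((n, r), i). (n, r, i)"])
  let ?X = "basis_map p ((\<one> \<otimes> adj P) X)" and ?Y = "basis_map p ((\<one> \<otimes> Q) Y)"
  from amp_functional[of ?X ?Y] obtain w' where w': "w' \<in> sigma_weak_functionals"
    "\<forall>T\<in>clin. w' T = cinner ?X ((\<one> \<otimes> T) ?Y)" by (elim bexE)
  have "w (F T) = w' T" if "T \<in> N" for T
  proof -
    have T: "T \<in> clin" using that assms by auto
    have tri: "basis_map p (x \<otimes>\<^sub>v (y \<otimes>\<^sub>v z)) = (x \<otimes>\<^sub>v y) \<otimes>\<^sub>v z" for x y z
      by (rule coord_eqI) (auto simp: basis_map_apply[OF bp] ip mult.assoc split: prod.splits)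
    have tri': "adj (basis_map p) ((x \<otimes>\<^sub>v y) \<otimes>\<^sub>v z) = x \<otimes>\<^sub>v (y \<otimes>\<^sub>v z)" for x y z
      using basis_map_unitary(1)[OF bp] by (metis blinfun_apply_blinfun_compose id_blinfun.rep_eq tri)
    have "adj (basis_map p) \<cdot> (\<one> \<otimes> T) \<cdot> basis_map p = \<one> \<otimes> (\<one> \<otimes> T)"
    proof (rule clin_eqI)
      fix q show "(adj (basis_map p) \<cdot> (\<one> \<otimes> T) \<cdot> basis_map p) (basis_vec q) = (\<one> \<otimes> (\<one> \<otimes> T)) (basis_vec q)"
        using T by (cases q) (simp flip: basis_tensor add: tri tri')
    qed (use T in \<open>auto simp: basis_map_apply[OF bp]\<close>)
    moreover have "w' T = cinner ((\<one> \<otimes> adj P) X) ((adj (basis_map p) \<cdot> (\<one> \<otimes> T) \<cdot> basis_map p) ((\<one> \<otimes> Q) Y))"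
      using w'(2) T by (simp add: cinner_adj_right[OF basis_map_apply(2)[OF bp]])
    ultimately have "w' T = cinner ((\<one> \<otimes> adj P) X) ((\<one> \<otimes> (\<one> \<otimes> T)) ((\<one> \<otimes> Q) Y))" by simp
    also have "\<dots> = cinner X ((\<one> \<otimes> (P \<cdot> (\<one> \<otimes> T) \<cdot> Q)) Y)"
    proof -
      have e: "\<one> \<otimes> (P \<cdot> (\<one> \<otimes> T) \<cdot> Q) = (\<one> \<otimes> P) \<cdot> (\<one> \<otimes> (\<one> \<otimes> T)) \<cdot> (\<one> \<otimes> Q)"
        using T assms by (simp add: op_tensor_compose)
      have "cinner ((\<one> \<otimes> adj P) X) V = cinner X ((\<one> \<otimes> P) V)" for V :: "(nat \<times> 'r \<times> 'i) ell2"
        using cinner_adj_left[of "\<one> \<otimes> P" X V] assms(2) by (simp add: op_tensor_simps)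
      then show ?thesis unfolding e by simp
    qed
    finally show ?thesis using w assms(3)[OF that] T assms by simp
  qed
  then show "\<exists>w'\<in>sigma_weak_functionals. \<forall>T\<in>N. w (F T) = w' T" using w'(1) by (intro bexI[of _ w']) simp_all
qed

lemma swap_conj: "T \<in> clin \<Longrightarrow> basis_map prod.swap \<cdot> (\<one> \<otimes> T) \<cdot> basis_map prod.swap = T \<otimes> \<one>"
  by (rule hom_eq_tensorI) (auto simp: basis_map_apply swap_tensor)

lemma normal_spatial_left:
  fixes P :: "('i \<times> 'r, 'j) hom"
  assumes "N \<subseteq> clin" "P \<in> clin" "\<And>T. T \<in> N \<Longrightarrow> F T = P \<cdot> (T \<otimes> \<one>) \<cdot> Q" "Q \<in> clin"
  shows "normal_on N F"
proof (rule normal_spatial[where P="P \<cdot> basis_map prod.swap" and Q="basis_map prod.swap \<cdot> Q"])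
  fix T assume "T \<in> N"
  then show "F T = (P \<cdot> basis_map prod.swap) \<cdot> (\<one> \<otimes> T) \<cdot> (basis_map prod.swap \<cdot> Q)"
    using assms(1) by (simp only: assms(3) swap_conj[symmetric] subset_iff) (simp add: compose_assoc)
qed (use assms in \<open>auto simp: basis_map_apply\<close>)

section \<open>Von Neumann algebras\<close>

lemma commutant_clin: "commutant A \<subseteq> clin" by (auto simp: commutant_def)

lemma commutant_bi: "A \<subseteq> clin \<Longrightarrow> A \<subseteq> commutant (commutant A)" by (auto simp: commutant_def)

lemma commutant_anti: "A \<subseteq> B \<Longrightarrow> commutant B \<subseteq> commutant A" by (auto simp: commutant_def)

lemma commutant_triple: "A \<subseteq> clin \<Longrightarrow> commutant (commutant (commutant A)) = commutant A"
  by (meson commutant_anti commutant_bi commutant_clin subset_antisym)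

lemma commutant_closed:
  "\<one> \<in> commutant A" "0 \<in> commutant A"
  "S \<in> commutant A \<Longrightarrow> T \<in> commutant A \<Longrightarrow> S + T \<in> commutant A"
  "S \<in> commutant A \<Longrightarrow> T \<in> commutant A \<Longrightarrow> S \<cdot> T \<in> commutant A"
  "A \<subseteq> clin \<Longrightarrow> T \<in> commutant A \<Longrightarrow> c *\<^sub>C T \<in> commutant A"
proof -
  show "S \<in> commutant A \<Longrightarrow> T \<in> commutant A \<Longrightarrow> S \<cdot> T \<in> commutant A"
    unfolding commutant_def by (auto simp: compose_assoc) (metis compose_assoc)
qed (auto simp: commutant_def blinfun_compose.add_left blinfun_compose.add_right subset_iff)

lemma commutant_adj:
  assumes "A \<subseteq> clin" "\<And>a. a \<in> A \<Longrightarrow> adj a \<in> A" "T \<in> commutant A" shows "adj T \<in> commutant A"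
proof -
  have "adj T \<cdot> a = a \<cdot> adj T" if "a \<in> A" for a
  proof -
    have "T \<cdot> adj a = adj a \<cdot> T" using assms that by (auto simp: commutant_def)
    then have "adj (T \<cdot> adj a) = adj (adj a \<cdot> T)" by (rule arg_cong)
    moreover have "a \<in> clin" "T \<in> clin" using assms that by (auto simp: commutant_def)
    ultimately show ?thesis by simp
  qed
  then show ?thesis using assms by (auto simp: commutant_def)
qed

lemma bicommutant_adj: "A \<subseteq> clin \<Longrightarrow> (\<And>a. a \<in> A \<Longrightarrow> adj a \<in> A) \<Longrightarrow> T \<in> commutant (commutant A) \<Longrightarrow> adj T \<in> commutant (commutant A)"
  by (rule commutant_adj[OF commutant_clin]) (auto intro: commutant_adj)

lemma star_algebraD:
  assumes "unital_star_algebra A"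
  shows "A \<subseteq> clin" "\<one> \<in> A" "a \<in> A \<Longrightarrow> b \<in> A \<Longrightarrow> a + b \<in> A" "a \<in> A \<Longrightarrow> b \<in> A \<Longrightarrow> a \<cdot> b \<in> A"
    "a \<in> A \<Longrightarrow> adj a \<in> A" "a \<in> A \<Longrightarrow> c *\<^sub>C a \<in> A" "0 \<in> A" "a \<in> A \<Longrightarrow> b \<in> A \<Longrightarrow> a - b \<in> A"
proof -
  show z: "0 \<in> A" and "a \<in> A \<Longrightarrow> c *\<^sub>C a \<in> A" for a c using assms unfolding unital_star_algebra_def by (metis scaleC_simps(3), metis)
  show "a - b \<in> A" if "a \<in> A" "b \<in> A"
    using that assms unfolding unital_star_algebra_def by (metis scaleC_simps(7) uminus_add_conv_diff add.commute)
qed (use assms in \<open>auto simp: unital_star_algebra_def\<close>)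

lemma star_algebra_sum: "unital_star_algebra A \<Longrightarrow> (\<And>p. p \<in> F \<Longrightarrow> T p \<in> A) \<Longrightarrow> (\<Sum>p\<in>F. T p) \<in> A"
  by (induction F rule: infinite_finite_induct) (auto intro: star_algebraD)

lemma bicommutant_star_algebra:
  assumes "A \<subseteq> clin" "\<And>a. a \<in> A \<Longrightarrow> adj a \<in> A" shows "unital_star_algebra (commutant (commutant A))"
  using assms commutant_clin[of A] commutant_clin[of "commutant A"]
  by (auto simp: unital_star_algebra_def intro: commutant_closed bicommutant_adj)

lemma slice_amp_compose:
  "S \<in> clin \<Longrightarrow> ls u v ((\<one> \<otimes> S) \<cdot> T) = S \<cdot> ls u v T" "S \<in> clin \<Longrightarrow> ls u v (T \<cdot> (\<one> \<otimes> S)) = ls u v T \<cdot> S"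
  "R \<in> clin \<Longrightarrow> rs u' v' ((R \<otimes> \<one>) \<cdot> T) = R \<cdot> rs u' v' T" "R \<in> clin \<Longrightarrow> rs u' v' (T \<cdot> (R \<otimes> \<one>)) = rs u' v' T \<cdot> R"
  by (auto intro!: hom_eqI simp: cinner_ls cinner_rs op_tensor_simps simp flip: cinner_adj_left)

text \<open>First-leg slices of an operator that commutes with \<open>\<one> \<otimes> A\<close>
  commute with \<open>A\<close>, and hence with \<open>T\<close>.\<close>

lemma amp_bicommutant:
  assumes A: "A \<subseteq> clin" and T: "T \<in> commutant (commutant A)"
  shows "\<one> \<otimes> T \<in> commutant (commutant ((\<lambda>a. \<one> \<otimes> a) ` A))"
proof -
  have Tc: "T \<in> clin" using T commutant_clin by blast
  have "(\<one> \<otimes> T) \<cdot> P = P \<cdot> (\<one> \<otimes> T)"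
    if P: "P \<in> commutant ((\<lambda>a. \<one> \<otimes> a) ` A)" and Pc: "P \<in> clin" for P
  proof (rule slice_eqI(1))
    fix u v
    have "ls u v P \<cdot> a = a \<cdot> ls u v P" if "a \<in> A" for a
      using P that A by (simp add: commutant_def subset_iff flip: slice_amp_compose)
    then have "ls u v P \<in> commutant A" using Pc by (simp add: commutant_def)
    then show "ls u v ((\<one> \<otimes> T) \<cdot> P) = ls u v (P \<cdot> (\<one> \<otimes> T))"
      using T Tc by (simp add: slice_amp_compose) (auto simp: commutant_def)
  qed (use Tc Pc in auto)
  then show ?thesis using Tc commutant_clin by (auto simp: commutant_def)
qed

text \<open>The projection onto the closure of \<open>A z\<close> commutes with \<open>A\<close>,
  hence with \<open>T\<close>. It fixes \<open>z\<close> because \<open>A\<close> is unital, so it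
  fixes \<open>T z\<close> as well.\<close>

lemma bicommutant_vector:
  assumes A: "unital_star_algebra A" and T: "T \<in> commutant (commutant A)"
  shows "T z \<in> closure ((\<lambda>a. blinfun_apply a z) ` A)"
proof -
  note A' = star_algebraD[OF A]
  let ?K = "(\<lambda>a. blinfun_apply a z) ` A"
  have K: "csubspace_on ?K" unfolding csubspace_on_def
  proof (intro conjI ballI allI; (elim imageE)?)
    show "0 \<in> ?K" by (rule image_eqI[OF _ A'(7)]) simp
    show "x + y \<in> ?K" if "x = blinfun_apply a z" "a \<in> A" "y = blinfun_apply b z" "b \<in> A" for x y a b
      using that by (intro image_eqI[OF _ A'(3)[of a b]]) (auto simp: blinfun.add_left)
    show "cscale c x \<in> ?K" if "x = blinfun_apply a z" "a \<in> A" for c x a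
      using that by (intro image_eqI[OF _ A'(6)[of a c]]) auto
  qed
  obtain P where P: "P \<in> clin" "\<And>x. P x \<in> closure ?K" "\<And>x k. k \<in> closure ?K \<Longrightarrow> cinner k (x - P x) = 0"
    using projection_exists[OF csubspace_closure[OF K] closed_closure] by blast
  have inv: "a k \<in> closure ?K" if "a \<in> A" "k \<in> closure ?K" for a k
  proof -
    obtain X where X: "\<forall>n. X n \<in> ?K" "X \<longlonglongrightarrow> k" using \<open>k \<in> closure ?K\<close> unfolding closure_sequential by blast
    have "a (X n) \<in> ?K" for n
    proof -
      obtain b where "b \<in> A" "X n = b z" using X by blast
      then show ?thesis using that A'(4)[of a b] by (intro image_eqI[of _ _ "a \<cdot> b"]) auto
    qed
    moreover have "(\<lambda>n. a (X n)) \<longlonglongrightarrow> a k" by (intro blinfun.tendsto tendsto_const X)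
    ultimately show ?thesis unfolding closure_sequential by (intro exI[of _ "\<lambda>n. a (X n)"]) blast
  qed
  have Pk: "P x = k" if "k \<in> closure ?K" "\<And>z. z \<in> closure ?K \<Longrightarrow> cinner z (x - k) = 0" for x k
  proof -
    have m: "P x - k \<in> closure ?K" using csubspace_diff[OF csubspace_closure[OF K]] P(2) that by blast
    have "cinner (P x - k) (P x - k) = cinner (P x - k) (x - k) - cinner (P x - k) (x - P x)" by (simp add: cinner.diff_right)
    then show ?thesis using P(3)[OF m] that(2)[OF m] by simp
  qed
  have "P \<in> commutant A"
  proof -
    have "P (a x) = a (P x)" if a: "a \<in> A" for a x
    proof (rule Pk[OF inv[OF a P(2)]])
      fix k assume k: "k \<in> closure ?K"
      have "cinner k (a (x - P x)) = cinner (adj a k) (x - P x)" using a A' by (auto simp: cinner_adj_left)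
      also have "\<dots> = 0" by (rule P(3)[OF inv[OF A'(5)[OF a] k]])
      finally show "cinner k (a x - a (P x)) = 0" by (simp add: blinfun.diff_right)
    qed
    then show ?thesis using P(1) by (auto simp: commutant_def intro!: blinfun_eqI)
  qed
  then have "T \<cdot> P = P \<cdot> T" using T by (auto simp: commutant_def)
  moreover have "z \<in> closure ?K" using A'(2) closure_subset[of ?K] by (force intro: image_eqI[of z _ \<one>])
  then have "P z = z" by (intro Pk) (auto)
  ultimately have "T z = P (T z)" by (metis blinfun_apply_blinfun_compose)
  then show ?thesis using P(2) by metis
qed

lemma amp_star_algebra:
  assumes B: "unital_star_algebra B" shows "unital_star_algebra ((\<lambda>a. (\<one> :: 'r op) \<otimes> a) ` B)"
proof -
  note B' = star_algebraD[OF B] subsetD[OF star_algebraD(1)[OF B]]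
  let ?\<iota> = "\<lambda>a. (\<one> :: 'r op) \<otimes> a"
  have "?\<iota> a + ?\<iota> b \<in> ?\<iota> ` B" "?\<iota> a \<cdot> ?\<iota> b \<in> ?\<iota> ` B" if "a \<in> B" "b \<in> B" for a b
    using that B' by (simp_all add: op_tensor_simps(2)[symmetric] op_tensor_compose)
  moreover have "adj (?\<iota> a) \<in> ?\<iota> ` B" "c *\<^sub>C ?\<iota> a \<in> ?\<iota> ` B" "?\<iota> a \<in> clin" if "a \<in> B" for a c
    using that B' by (simp_all add: op_tensor_simps(4)[symmetric]) (simp_all add: op_tensor_simps(5))
  moreover have "\<one> \<in> ?\<iota> ` B" using B'(2) by (intro image_eqI[of _ _ \<one>]) auto
  ultimately show ?thesis unfolding unital_star_algebra_def by (simp add: image_subset_iff)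
qed

text \<open>Von Neumann's density theorem: finitely many sigma-weak functionals are vector functionals of an amplification.\<close>

lemma bicommutant_density:
  assumes A: "unital_star_algebra A" and T: "T \<in> commutant (commutant A)"
  shows "T \<in> sigma_weak closure_of A"
  unfolding in_closure_of
proof (intro conjI allI impI)
  note A' = star_algebraD[OF A]
  have Tc: "T \<in> clin" using T commutant_clin by blast
  let ?\<iota> = "\<lambda>a. \<one> \<otimes> a" and ?\<kappa> = "\<lambda>a. \<one> \<otimes> (\<one> \<otimes> a)"
  fix U assume "T \<in> U \<and> openin sigma_weak U"
  then obtain W e where W: "finite W" "W \<subseteq> sigma_weak_functionals" "0 < e" "\<forall>S. (\<forall>w\<in>W. cmod (w S - w T) < e) \<longrightarrow> S \<in> U"
    using sigma_weak_nbhd[of U T] by (elim conjE exE) auto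
  have "\<forall>w\<in>W. \<exists>X Y :: (nat \<times> 'a) ell2. \<forall>T\<in>clin. w T = cinner X (?\<iota> T Y)"
    by (intro ballI functional_amp) (use W(2) in auto)
  from bchoice[OF this] obtain X :: "('a op \<Rightarrow> complex) \<Rightarrow> (nat \<times> 'a) ell2"
    where "\<forall>w\<in>W. \<exists>Y. \<forall>T\<in>clin. w T = cinner (X w) (?\<iota> T Y)" by (elim exE)
  from bchoice[OF this] obtain Y where XY: "\<forall>w\<in>W. \<forall>T\<in>clin. w T = cinner (X w) (?\<iota> T (Y w))" by (elim exE)
  \<comment> \<open>The outer amplification is indexed by the functionals themselves: row
    \<open>w\<close> of \<open>Z\<close> is \<open>Y w\<close>, so that one approximation of a
    single vector handles all of \<open>W\<close>. The constant \<open>C\<close> exceeds every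
    \<open>norm (X w)\<close>; the summand 1 keeps it positive when \<open>W\<close> is
    empty.\<close>
  define Z where "Z = (\<Sum>w\<in>W. basis_vec w \<otimes>\<^sub>v Y w)"
  define C where "C = 1 + (\<Sum>w\<in>W. norm (X w))"
  have C: "0 < C" "norm (X w) < C" if "w \<in> W" for w
    using member_le_sum[OF that, of "\<lambda>w. norm (X w)"] W(1) by (auto simp: C_def sum_nonneg add_pos_nonneg)
  have C0: "0 < C" by (simp add: C_def sum_nonneg add_pos_nonneg)
  have "?\<kappa> T Z \<in> closure ((\<lambda>b. blinfun_apply b Z) ` ?\<iota> ` ?\<iota> ` A)"
    by (intro bicommutant_vector amp_star_algebra A amp_bicommutant T star_algebraD(1))
  then obtain a where a: "a \<in> A" "dist (?\<kappa> a Z) (?\<kappa> T Z) < e / C"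
    using W(3) C0 unfolding closure_approachable image_image by (auto dest: spec[of _ "e / C"])
  have ac: "a \<in> clin" using a A' by auto
  have "cmod (w a - w T) < e" if w: "w \<in> W" for w
  proof -
    have r: "row w (?\<kappa> S Z) = ?\<iota> S (Y w)" if "S \<in> clin" for S
    proof -
      have "(\<Sum>v\<in>W. cscale (cnj (coord (basis_vec w) v)) (?\<iota> S (Y v))) = (\<Sum>v\<in>W. if v = w then ?\<iota> S (Y v) else 0)"
        by (rule sum.cong) (auto simp: coord_basis)
      then show ?thesis using that w W(1) by (simp add: Z_def blinfun.sum_right)
    qed
    have "w a - w T = cinner (X w) (row w (?\<kappa> a Z - ?\<kappa> T Z))"
      using XY w ac Tc r[of \<one>] by (simp add: blinfun.diff_right cinner.diff_right)
    also have "cmod \<dots> \<le> norm (X w) * norm (?\<kappa> a Z - ?\<kappa> T Z)"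
      by (rule order_trans[OF cinner_bound mult_left_mono[OF norm_row]]) simp
    also have "\<dots> \<le> norm (X w) * (e / C)" using a(2) by (intro mult_left_mono) (auto simp: dist_norm)
    also have "\<dots> < e" using C[OF w] W(3) by (simp add: field_simps)
    finally show ?thesis .
  qed
  then have "a \<in> U" using W(4) by simp
  then show "\<exists>y. y \<in> A \<and> y \<in> U" using a(1) by (intro exI conjI)
qed simp

lemma normal_eq_bicommutant:
  assumes A: "unital_star_algebra A" and F: "normal_on (commutant (commutant A)) F" "normal_on (commutant (commutant A)) G"
    and eq: "\<And>a. a \<in> A \<Longrightarrow> F a = G a" and T: "T \<in> commutant (commutant A)"
  shows "F T = G T"
proof (rule forall_in_closure_of_eq[where f=F and g=G and x=T and S=A, OF _ Hausdorff_sigma_weak])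
  let ?M = "commutant (commutant A)"
  show "continuous_map (subtopology sigma_weak ?M) sigma_weak F" "continuous_map (subtopology sigma_weak ?M) sigma_weak G"
    using F by (auto simp: normal_on_def)
  have "A \<subseteq> ?M" using commutant_bi star_algebraD(1)[OF A] by blast
  then show "T \<in> subtopology sigma_weak ?M closure_of A"
    using bicommutant_density[OF A T] T by (simp add: closure_of_subtopology Int_absorb1)
qed (rule eq)

section \<open>Normal extensions to tensor products\<close>

lemma subspace_clin: "subspace clin" by (auto simp: subspace_def)

lemma adj_scaleR [simp]: "T \<in> clin \<Longrightarrow> adj (r *\<^sub>R T) = r *\<^sub>R adj T"
  using adj_scaleC[of T "of_real r"] by simp

lemma compose_eqD: "A \<cdot> B = C \<cdot> D \<Longrightarrow> A (B z) = C (D z)"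
  by (drule arg_cong[where f="\<lambda>X. blinfun_apply X z"]) simp

lemma slice_zero [simp]: "ls 0 v T = 0"
  by (rule hom_eqI) (simp add: cinner_ls)

lemma elem_tensors_star:
  assumes N: "unital_star_algebra N" and M: "unital_star_algebra M"
  shows "unital_star_algebra (span (elem_tensors N M))"
proof -
  note N' = star_algebraD[OF N] subsetD[OF star_algebraD(1)[OF N]]
  note M' = star_algebraD[OF M] subsetD[OF star_algebraD(1)[OF M]]
  let ?E = "elem_tensors N M"
  have E: "a \<otimes> b \<in> ?E" if "a \<in> N" "b \<in> M" for a b using that by (auto simp: elem_tensors_def)
  have EE: "\<exists>a\<in>N. \<exists>b\<in>M. s = a \<otimes> b" if "s \<in> ?E" for s using that by (auto simp: elem_tensors_def)
  have c: "span ?E \<subseteq> clin"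
    by (rule span_minimal[OF _ subspace_clin]) (use N'(9) M'(9) in \<open>auto simp: elem_tensors_def\<close>)
  have mult: "s \<cdot> t \<in> span ?E" if "s \<in> span ?E" "t \<in> span ?E" for s t
  proof -
    have 1: "s \<in> {s. s \<cdot> t \<in> span ?E}" if t: "t \<in> ?E" and s: "s \<in> span ?E" for t s
    proof (rule subsetD[OF span_minimal s])
      show "?E \<subseteq> {s. s \<cdot> t \<in> span ?E}"
      proof
        fix s' assume "s' \<in> ?E"
        then obtain a b a' b' where "a \<in> N" "b \<in> M" "s' = a \<otimes> b" "a' \<in> N" "b' \<in> M" "t = a' \<otimes> b'" using EE t by metis
        then show "s' \<in> {s. s \<cdot> t \<in> span ?E}"
          using E[OF N'(4)[of a a'] M'(4)[of b b']] N'(9) M'(9) by (simp add: op_tensor_compose span_base)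
      qed
      show "subspace {s. s \<cdot> t \<in> span ?E}"
        by (auto simp: subspace_def blinfun_compose.add_left blinfun_compose.scaleR_left span_add span_scale span_zero)
    qed
    have "t \<in> {t. s \<cdot> t \<in> span ?E}"
    proof (rule subsetD[OF span_minimal \<open>t \<in> span ?E\<close>])
      show "?E \<subseteq> {t. s \<cdot> t \<in> span ?E}" using 1 \<open>s \<in> span ?E\<close> by auto
      show "subspace {t. s \<cdot> t \<in> span ?E}"
        by (auto simp: subspace_def blinfun_compose.add_right blinfun_compose.scaleR_right span_add span_scale span_zero)
    qed
    then show ?thesis by simp
  qed
  have adj: "s \<in> {s \<in> clin. adj s \<in> span ?E}" if s: "s \<in> span ?E" for s
  proof (rule subsetD[OF span_minimal s])
    show "?E \<subseteq> {s \<in> clin. adj s \<in> span ?E}"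
    proof
      fix s' assume "s' \<in> ?E"
      then obtain a b where "a \<in> N" "b \<in> M" "s' = a \<otimes> b" using EE by metis
      then show "s' \<in> {s \<in> clin. adj s \<in> span ?E}"
        using E[OF N'(5)[of a] M'(5)[of b]] N'(9) M'(9) by (simp add: op_tensor_simps(5) span_base)
    qed
    show "subspace {s \<in> clin. adj s \<in> span ?E}"
      by (auto simp: subspace_def span_add span_scale span_zero)
  qed
  \<comment> \<open>The span is a real one. On elementary tensors a complex scalar is absorbed by
    the first factor, as \<open>N\<close> is a complex space.\<close>
  have sc: "s \<in> {s. d *\<^sub>C s \<in> span ?E}" if s: "s \<in> span ?E" for s d
  proof (rule subsetD[OF span_minimal s])
    show "?E \<subseteq> {s. d *\<^sub>C s \<in> span ?E}"
    proof
      fix s' assume "s' \<in> ?E"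
      then obtain a b where "a \<in> N" "b \<in> M" "s' = a \<otimes> b" using EE by metis
      then show "s' \<in> {s. d *\<^sub>C s \<in> span ?E}"
        using E[OF N'(6)[of a d], of b] N'(9) M'(9) by (simp add: op_tensor_simps(3) span_base)
    qed
    have "d *\<^sub>C r *\<^sub>R T = r *\<^sub>R d *\<^sub>C T" for r and T :: "('a \<times> 'b) op"
      using scaleC_simps(1)[of d "of_real r" T] scaleC_simps(1)[of "of_real r" d T] by (simp add: mult.commute del: scaleC_simps(1))
    then show "subspace {s. d *\<^sub>C s \<in> span ?E}" by (auto simp: subspace_def scaleC_add span_add span_scale span_zero)
  qed
  have "\<one> \<in> span ?E" using E[OF N'(2) M'(2)] by (simp add: span_base)
  then show ?thesis using c mult adj sc span_add unfolding unital_star_algebra_def by auto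
qed

lemma commutant_span: "S \<subseteq> clin \<Longrightarrow> commutant (span S) = commutant S"
proof
  show "commutant (span S) \<subseteq> commutant S" by (rule commutant_anti) (rule span_superset)
  show "commutant S \<subseteq> commutant (span S)"
  proof
    fix T assume T: "T \<in> commutant S"
    have "span S \<subseteq> {s. T \<cdot> s = s \<cdot> T}"
      by (rule span_minimal) (use T in \<open>auto simp: commutant_def subspace_def blinfun_compose.add_left blinfun_compose.add_right
        blinfun_compose.scaleR_left blinfun_compose.scaleR_right \<close>)
    then show "T \<in> commutant (span S)" using T by (auto simp: commutant_def)
  qed
qed

lemma elem_tensors_clin: "N \<subseteq> clin \<Longrightarrow> M \<subseteq> clin \<Longrightarrow> elem_tensors N M \<subseteq> clin"
  by (auto simp: elem_tensors_def intro!: op_tensor_exists(1))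

lemma vn_tensor_alt:
  "N \<subseteq> clin \<Longrightarrow> M \<subseteq> clin \<Longrightarrow> N \<otimes>\<^sub>v\<^sub>N M = commutant (commutant (span (elem_tensors N M)))"
  by (simp add: vn_tensor_def vn_generated_def commutant_span elem_tensors_clin)

lemma vn_tensor_clin: "N \<otimes>\<^sub>v\<^sub>N M \<subseteq> clin" by (simp add: vn_tensor_def vn_generated_def commutant_clin)

lemma vn_tensor_elem: "N \<subseteq> clin \<Longrightarrow> M \<subseteq> clin \<Longrightarrow> a \<in> N \<Longrightarrow> b \<in> M \<Longrightarrow> a \<otimes> b \<in> N \<otimes>\<^sub>v\<^sub>N M"
  unfolding vn_tensor_def vn_generated_def by (rule subsetD[OF commutant_bi[OF elem_tensors_clin]]) (auto simp: elem_tensors_def)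

lemma normal_cong: "(\<And>T. T \<in> N \<Longrightarrow> F T = G T) \<Longrightarrow> normal_on N F \<Longrightarrow> normal_on N G"
  unfolding normal_on_def by (erule continuous_map_eq) auto

lemma linear_map_on_span_eq:
  assumes F: "linear_map_on V F" and G: "linear_map_on V G" and S: "S \<subseteq> V"
    and V: "subspace V" "0 \<in> V" and eq: "\<And>s. s \<in> S \<Longrightarrow> F s = G s" and x: "x \<in> span S"
  shows "F x = G x"
proof -
  have sc: "H (r *\<^sub>R y) = r *\<^sub>R H y" if "linear_map_on V H" "y \<in> V" for r y and H :: "'a op \<Rightarrow> 'b op"
    using that scaleC_simps(5)[of r] unfolding linear_map_on_def by metis
  have ad: "H (y + y') = H y + H y'" if "linear_map_on V H" "y \<in> V" "y' \<in> V" for y y' and H :: "'a op \<Rightarrow> 'b op"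
    using that by (simp add: linear_map_on_def)
  have z: "H 0 = 0" if "linear_map_on V H" for H :: "'a op \<Rightarrow> 'b op" using sc[OF that V(2), of 0] by simp
  have "span S \<subseteq> {y \<in> V. F y = G y}"
  proof (rule span_minimal)
    show "subspace {y \<in> V. F y = G y}"
      using V(1) unfolding subspace_def by (simp add: z[OF F] z[OF G] sc[OF F] sc[OF G] ad[OF F] ad[OF G])
  qed (use S eq in auto)
  then show ?thesis using x by auto
qed

text \<open>Evaluates the definite description. Normal linear maps are determined on the dense span
  of the elementary tensors, which gives uniqueness; existence is not automatic and has to be
  supplied as \<open>\<Psi>\<close>. The restriction of \<open>\<Psi>\<close> enters because the
  description asks for an extensional map.\<close>

lemma normal_ext_eq:
  assumes N: "unital_star_algebra N" and M: "unital_star_algebra M"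
    and lin: "linear_map_on (N \<otimes>\<^sub>v\<^sub>N M) \<Psi>" and nor: "normal_on (N \<otimes>\<^sub>v\<^sub>N M) \<Psi>"
    and el: "\<And>a b. a \<in> N \<Longrightarrow> b \<in> M \<Longrightarrow> \<Psi> (a \<otimes> b) = f a b" and T: "T \<in> N \<otimes>\<^sub>v\<^sub>N M"
  shows "normal_ext N M f T = \<Psi> T"
proof -
  let ?V = "N \<otimes>\<^sub>v\<^sub>N M" and ?\<Psi> = "restrict \<Psi> (N \<otimes>\<^sub>v\<^sub>N M)"
  note c = star_algebraD(1)[OF N] star_algebraD(1)[OF M]
  have star: "unital_star_algebra ?V" unfolding vn_tensor_alt[OF c]
    by (rule bicommutant_star_algebra) (use elem_tensors_star[OF N M] star_algebraD in auto)
  note V = star_algebraD[OF star]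
  have sub: "subspace ?V" using V(3,6,7) scaleC_simps(5) unfolding subspace_def by metis
  have mem: "a \<otimes> b \<in> ?V" if "a \<in> N" "b \<in> M" for a b using that c by (rule vn_tensor_elem[rotated 2])
  have lin': "linear_map_on ?V ?\<Psi>" using lin V(3,6) by (auto simp: linear_map_on_def)
  have nor': "normal_on ?V ?\<Psi>" by (rule normal_cong[OF _ nor]) simp
  have "normal_ext N M f = ?\<Psi>" unfolding normal_ext_def
  proof (rule the_equality)
    show "?\<Psi> \<in> extensional ?V \<and> linear_map_on ?V ?\<Psi> \<and> normal_on ?V ?\<Psi> \<and> (\<forall>a\<in>N. \<forall>b\<in>M. ?\<Psi> (a \<otimes> b) = f a b)"
      using lin' nor' el mem by simp
    fix F assume F: "F \<in> extensional ?V \<and> linear_map_on ?V F \<and> normal_on ?V F \<and> (\<forall>a\<in>N. \<forall>b\<in>M. F (a \<otimes> b) = f a b)"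
    have FS: "F s = ?\<Psi> s" if s: "s \<in> elem_tensors N M" for s
    proof -
      obtain a b where ab: "s = a \<otimes> b" "a \<in> N" "b \<in> M" using s by (auto simp: elem_tensors_def)
      have "F (a \<otimes> b) = f a b" using F ab(2,3) by simp
      then show ?thesis using el[OF ab(2,3)] mem[OF ab(2,3)] by (simp add: ab(1))
    qed
    have SV: "elem_tensors N M \<subseteq> ?V" using mem by (auto simp: elem_tensors_def)
    have Fl: "linear_map_on ?V F" and Fn: "normal_on ?V F" using F by simp_all
    have "F T = ?\<Psi> T" if "T \<in> ?V" for T
      by (rule normal_eq_bicommutant[OF elem_tensors_star[OF N M], folded vn_tensor_alt[OF c],
          OF Fn nor' linear_map_on_span_eq[OF Fl lin' SV sub V(7) FS] that])
    then show "F = ?\<Psi>" using F by (intro extensionalityI[where A="?V" and f=F]) simp_all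
  qed
  then show ?thesis using T by simp
qed

lemma linear_spatial:
  assumes "V \<subseteq> clin" "P \<in> clin" "Q \<in> clin" "\<And>T. T \<in> V \<Longrightarrow> F T = P \<cdot> (T \<otimes> \<one>) \<cdot> Q"
    and "\<And>S T c. S \<in> V \<Longrightarrow> T \<in> V \<Longrightarrow> S + T \<in> V \<and> c *\<^sub>C T \<in> V"
  shows "linear_map_on V F"
  using assms by (auto simp: linear_map_on_def op_tensor_simps subset_iff blinfun_compose.add_left blinfun_compose.add_right)

lemma vn_tensor_linear: "N \<subseteq> clin \<Longrightarrow> M \<subseteq> clin \<Longrightarrow> S \<in> N \<otimes>\<^sub>v\<^sub>N M \<Longrightarrow> T \<in> N \<otimes>\<^sub>v\<^sub>N M \<Longrightarrow> S + T \<in> N \<otimes>\<^sub>v\<^sub>N M \<and> c *\<^sub>C T \<in> N \<otimes>\<^sub>v\<^sub>N M"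
  unfolding vn_tensor_def vn_generated_def by (blast intro: commutant_closed(3) commutant_closed(5)[OF commutant_clin])

lemma normal_ext_spatial:
  fixes P :: "(('i \<times> 'j) \<times> 'r, 'k) hom"
  assumes N: "unital_star_algebra N" and M: "unital_star_algebra M" and PQ: "P \<in> clin" "Q \<in> clin"
    and el: "\<And>a b. a \<in> N \<Longrightarrow> b \<in> M \<Longrightarrow> P \<cdot> ((a \<otimes> b) \<otimes> \<one>) \<cdot> Q = f a b" and T: "T \<in> N \<otimes>\<^sub>v\<^sub>N M"
  shows "normal_ext N M f T = P \<cdot> (T \<otimes> \<one>) \<cdot> Q"
  by (rule normal_ext_eq[OF N M, where \<Psi>="\<lambda>T. P \<cdot> (T \<otimes> \<one>) \<cdot> Q"], rule linear_spatial[OF vn_tensor_clin PQ refl],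
      rule vn_tensor_linear, rule star_algebraD[OF N], rule star_algebraD[OF M], assumption, assumption,
      rule normal_spatial_left[OF vn_tensor_clin PQ(1) refl PQ(2)], rule el, assumption, assumption, rule T)

text \<open>Brings the auxiliary leg \<open>'r\<close> of a spatial map next to the first leg, past
  the leg on which the identity acts.\<close>

definition p13 :: "(('i \<times> 'j) \<times> 'r) \<Rightarrow> (('i \<times> 'r) \<times> 'j)" where "p13 = (\<lambda>((i, j), r). ((i, r), j))"
definition passoc :: "(('i \<times> 'j) \<times> 'r) \<Rightarrow> ('i \<times> 'j \<times> 'r)" where "passoc = (\<lambda>((i, j), r). (i, j, r))"

lemma bij_p13 [simp]: "bij p13" and bij_passoc [simp]: "bij passoc"
  by (auto simp: p13_def passoc_def bij_def inj_def surj_def)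

lemma inv_p13: "inv p13 = (\<lambda>((i, r), j). ((i, j), r))" and inv_passoc: "inv passoc = (\<lambda>(i, j, r). ((i, j), r))"
  by (auto simp: p13_def passoc_def intro!: inv_equality)

lemma basis_map_tensor [simp]:
  "basis_map p13 ((x \<otimes>\<^sub>v y) \<otimes>\<^sub>v z) = (x \<otimes>\<^sub>v z) \<otimes>\<^sub>v y" "basis_map passoc ((x \<otimes>\<^sub>v y) \<otimes>\<^sub>v z) = x \<otimes>\<^sub>v (y \<otimes>\<^sub>v z)"
  by (auto intro!: coord_eqI simp: basis_map_apply inv_p13 inv_passoc split: prod.splits)

lemma adj_basis_map_tensor [simp]:
  "adj (basis_map p13) ((x \<otimes>\<^sub>v z) \<otimes>\<^sub>v y) = (x \<otimes>\<^sub>v y) \<otimes>\<^sub>v z" "adj (basis_map passoc) (x' \<otimes>\<^sub>v (y' \<otimes>\<^sub>v z')) = (x' \<otimes>\<^sub>v y') \<otimes>\<^sub>v z'"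
  by (metis basis_map_unitary(1) bij_p13 basis_map_tensor(1) blinfun_apply_blinfun_compose id_blinfun.rep_eq,
      metis basis_map_unitary(1) bij_passoc basis_map_tensor(2) blinfun_apply_blinfun_compose id_blinfun.rep_eq)

lemma basis_map_clin [simp]: "bij p \<Longrightarrow> basis_map p \<in> clin" by (rule basis_map_apply)

lemma assoc_op_passoc: "assoc_op = relabel passoc" by (simp add: assoc_op_def passoc_def)

lemma rs_relabel: "T \<in> clin \<Longrightarrow> rs u v (relabel p13 (T \<otimes> \<one>)) = rs u v T \<otimes> \<one>"
  by (intro hom_eq_tensorI2) (auto simp: cinner_rs relabel_def simp flip: cinner_adj_left[OF basis_map_clin[OF bij_p13]])

lemma ls_relabel: "T \<in> clin \<Longrightarrow> ls u v (relabel passoc (T \<otimes> \<one>)) = ls u v T \<otimes> \<one>"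
  by (intro hom_eq_tensorI2) (auto simp: cinner_ls relabel_def simp flip: cinner_adj_left[OF basis_map_clin[OF bij_passoc]])

lemma rs_compose: "P \<in> clin \<Longrightarrow> Q \<in> clin \<Longrightarrow> rs u v ((P \<otimes> \<one>) \<cdot> A \<cdot> (Q \<otimes> \<one>)) = P \<cdot> rs u v A \<cdot> Q"
  by (rule hom_eqI) (simp add: cinner_rs cinner_adj_left[symmetric] op_tensor_simps(5))

lemma ls_compose: "P \<in> clin \<Longrightarrow> Q \<in> clin \<Longrightarrow> ls u v ((\<one> \<otimes> P) \<cdot> A \<cdot> (\<one> \<otimes> Q)) = P \<cdot> ls u v A \<cdot> Q"
  by (rule hom_eqI) (simp add: cinner_ls cinner_adj_left[symmetric] op_tensor_simps(5))

text \<open>A spatial \<open>F\<close> can be tensored with the identity once its auxiliary leg is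
  moved past the second leg, and slices of the second leg then pass through \<open>F\<close>. Maps
  on tensor products are evaluated below only through such slices.\<close>

lemma tensor_map_left:
  fixes P :: "('i \<times> 'r, 'k) hom" and M :: "'j op set"
  assumes N: "unital_star_algebra N" and M: "unital_star_algebra M" and PQ: "P \<in> clin" "Q \<in> clin"
    and F: "\<And>a. a \<in> N \<Longrightarrow> F a = P \<cdot> (a \<otimes> \<one>) \<cdot> Q" and T: "T \<in> N \<otimes>\<^sub>v\<^sub>N M"
  shows "tensor_map N M F (\<lambda>b. b) T \<in> clin" "rs u v (tensor_map N M F (\<lambda>b. b) T) = P \<cdot> (rs u v T \<otimes> \<one>) \<cdot> Q"
proof -
  let ?P = "(P \<otimes> \<one>) \<cdot> basis_map p13" and ?Q = "adj (basis_map p13) \<cdot> (Q \<otimes> \<one>)"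
  have alt: "?P \<cdot> (T \<otimes> \<one>) \<cdot> ?Q = (P \<otimes> \<one>) \<cdot> relabel p13 (T \<otimes> \<one>) \<cdot> (Q \<otimes> \<one>)" for T :: "('i \<times> 'j) op"
    by (simp add: relabel_def compose_assoc)
  have r: "rs u v (?P \<cdot> (T \<otimes> \<one>) \<cdot> ?Q) = P \<cdot> (rs u v T \<otimes> \<one>) \<cdot> Q" if "T \<in> clin" for T :: "('i \<times> 'j) op" and u v
    unfolding alt by (simp add: rs_compose PQ rs_relabel that)
  have "tensor_map N M F (\<lambda>b. b) T = ?P \<cdot> (T \<otimes> \<one>) \<cdot> ?Q" unfolding tensor_map_def
  proof (rule normal_ext_spatial[OF N M _ _ _ T])
    fix a b assume ab: "a \<in> N" "b \<in> M"
    then have c: "a \<in> clin" "b \<in> clin" using N M star_algebraD(1) by auto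
    show "?P \<cdot> ((a \<otimes> b) \<otimes> \<one>) \<cdot> ?Q = F a \<otimes> b"
      by (rule slice_eqI(2)) (use c PQ F[OF ab(1)] in \<open>auto simp: r op_tensor_simps(3)\<close>)
  qed (use PQ in auto)
  then show "tensor_map N M F (\<lambda>b. b) T \<in> clin" "rs u v (tensor_map N M F (\<lambda>b. b) T) = P \<cdot> (rs u v T \<otimes> \<one>) \<cdot> Q"
    using r[OF subsetD[OF vn_tensor_clin T]] PQ subsetD[OF vn_tensor_clin T] by simp_all
qed

lemma tensor_map_right:
  fixes P :: "('j \<times> 'r, 'k) hom" and N :: "'i op set"
  assumes N: "unital_star_algebra N" and M: "unital_star_algebra M" and PQ: "P \<in> clin" "Q \<in> clin"
    and F: "\<And>b. b \<in> M \<Longrightarrow> F b = P \<cdot> (b \<otimes> \<one>) \<cdot> Q" and T: "T \<in> N \<otimes>\<^sub>v\<^sub>N M"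
  shows "tensor_map N M (\<lambda>a. a) F T \<in> clin" "ls u v (tensor_map N M (\<lambda>a. a) F T) = P \<cdot> (ls u v T \<otimes> \<one>) \<cdot> Q"
proof -
  let ?P = "(\<one> \<otimes> P) \<cdot> basis_map passoc" and ?Q = "adj (basis_map passoc) \<cdot> (\<one> \<otimes> Q)"
  have alt: "?P \<cdot> (T \<otimes> \<one>) \<cdot> ?Q = (\<one> \<otimes> P) \<cdot> relabel passoc (T \<otimes> \<one>) \<cdot> (\<one> \<otimes> Q)" for T :: "('i \<times> 'j) op"
    by (simp add: relabel_def compose_assoc)
  have r: "ls u v (?P \<cdot> (T \<otimes> \<one>) \<cdot> ?Q) = P \<cdot> (ls u v T \<otimes> \<one>) \<cdot> Q" if "T \<in> clin" for T :: "('i \<times> 'j) op" and u v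
    unfolding alt by (simp add: ls_compose PQ ls_relabel that)
  have "tensor_map N M (\<lambda>a. a) F T = ?P \<cdot> (T \<otimes> \<one>) \<cdot> ?Q" unfolding tensor_map_def
  proof (rule normal_ext_spatial[OF N M _ _ _ T])
    fix a b assume ab: "a \<in> N" "b \<in> M"
    then have c: "a \<in> clin" "b \<in> clin" using N M star_algebraD(1) by auto
    show "?P \<cdot> ((a \<otimes> b) \<otimes> \<one>) \<cdot> ?Q = a \<otimes> F b"
      by (rule slice_eqI(1)) (use c PQ F[OF ab(2)] in \<open>auto simp: r op_tensor_simps(3)\<close>)
  qed (use PQ in auto)
  then show "tensor_map N M (\<lambda>a. a) F T \<in> clin" "ls u v (tensor_map N M (\<lambda>a. a) F T) = P \<cdot> (ls u v T \<otimes> \<one>) \<cdot> Q"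
    using r[OF subsetD[OF vn_tensor_clin T]] PQ subsetD[OF vn_tensor_clin T] by simp_all
qed

section \<open>Block diagonal operators\<close>

abbreviation blk :: "'e \<Rightarrow> 'e \<Rightarrow> ('e \<times> 'j) op \<Rightarrow> 'j op" where "blk e f T \<equiv> ls (basis_vec e) (basis_vec f) T"

lemma blk_eqI:
  assumes "S \<in> clin" "T \<in> clin" "\<And>e f. blk e f S = blk e f T" shows "S = T"
proof (rule clin_eqI[OF assms(1,2)], rule coord_eqI)
  fix p q :: "'a \<times> 'b"
  have "cinner (basis_vec (snd q)) (blk (fst q) (fst p) R (basis_vec (snd p))) = coord (R (basis_vec p)) q" for R :: "('a \<times> 'b) op"
    by (simp only: cinner_ls) simp
  then show "coord (S (basis_vec p)) q = coord (T (basis_vec p)) q" using assms(3)[of "fst q" "fst p"] by metis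
qed

abbreviation "ent a e f \<equiv> coord (blinfun_apply a (basis_vec f)) e"

lemma entry_coord [simp]: "entry a e f = ent a e f" by (simp add: entry_def)

lemma entry_rs: "coord (rs u v T (basis_vec f)) e = cinner u (blk e f T v)"
  using cinner_rs[of "basis_vec e" u v T "basis_vec f"] by (simp add: cinner_ls)

definition proj :: "'e set \<Rightarrow> 'e op" where "proj S = Blinfun (\<lambda>x. Abs_ell2 (\<lambda>e. if e \<in> S then coord x e else 0))"

lemma proj: "coord (proj S x) e = (if e \<in> S then coord x e else 0)" "proj S \<in> clin" "norm (proj S x) \<le> norm x"
proof -
  define F where "F x = Abs_ell2 (\<lambda>e. if e \<in> S then coord x e else 0)" for x
  have "(\<lambda>e. (cmod (if e \<in> S then coord x e else 0))\<^sup>2) summable_on UNIV" for x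
    by (rule summable_on_comparison_test[OF has_sum_imp_summable[OF norm_sq_has_sum[of x]]]) auto
  then have co: "coord (F x) e = (if e \<in> S then coord x e else 0)" for x e by (simp add: F_def Abs_ell2_inverse)
  have n: "norm (F x) \<le> norm x" for x
    using has_sum_mono[OF norm_sq_has_sum[of "F x"] norm_sq_has_sum[of x]] by (auto simp: co intro: power2_le_imp_le)
  have bl: "bounded_linear F"
    by (rule bounded_linear_intro[of _ 1]) (auto simp: n co intro!: coord_eqI)
  have ap: "proj S x = F x" for x using bl unfolding proj_def F_def by (simp add: bounded_linear_Blinfun_apply)
  show "coord (proj S x) e = (if e \<in> S then coord x e else 0)" "norm (proj S x) \<le> norm x" by (simp_all add: ap co n)
  show "proj S \<in> clin" by (auto simp: clin_def ap co intro!: coord_eqI)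
qed

text \<open>The matrix unit in position \<open>(e, f)\<close>; unrelated to the probability measure
  \<open>\<mu>\<close>.\<close>

definition mu :: "'e \<Rightarrow> 'e \<Rightarrow> 'e op" where "mu e f = Blinfun (\<lambda>x. cscale (coord x f) (basis_vec e))"

lemma mu [simp]: "mu e f x = cscale (coord x f) (basis_vec e)" "mu e f \<in> clin"
proof -
  have "bounded_linear (\<lambda>x. cscale (cinner (basis_vec f) x) (basis_vec e))"
    by (rule bounded_linear_compose[OF cscale.bounded_linear_left cinner.bounded_linear_right])
  then show "mu e f x = cscale (coord x f) (basis_vec e)" for x by (simp add: mu_def bounded_linear_Blinfun_apply)
  then show "mu e f \<in> clin" by (simp add: clin_def)
qed

lemma mu_compose [simp]: "mu e f \<cdot> mu g h = (if f = g then mu e h else 0)"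
  by (auto intro!: blinfun_eqI simp: coord_basis)

lemma adj_mu [simp]: "adj (mu e f) = mu f e" by (rule adj_eqI) (simp add: mult.commute)

lemma linf_iff: "a \<in> linf G \<longleftrightarrow> a \<in> clin \<and> (\<forall>e f. lab G e \<noteq> lab G f \<longrightarrow> ent a e f = 0)"
  by (simp add: linf_def)

lemma mu_linf: "lab G e = lab G f \<Longrightarrow> mu e f \<in> linf G" by (auto simp: linf_iff coord_basis)

text \<open>Block diagonal means commuting with the projections onto the fibres. As a commutant of
  self-adjoint operators, \<open>linf G\<close> is a von Neumann algebra without further
  work.\<close>

lemma linf_commutant: "linf G = commutant (range (\<lambda>x. proj {e. lab G e = x}))"
proof (intro set_eqI iffI)
  fix a assume a: "a \<in> linf G"
  have "a \<cdot> proj S = proj S \<cdot> a" if S: "S = {e. lab G e = x}" for S x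
  proof (rule clin_eqI)
    fix f show "(a \<cdot> proj S) (basis_vec f) = (proj S \<cdot> a) (basis_vec f)"
    proof (cases "f \<in> S")
      case True
      then have "proj S (basis_vec f) = basis_vec f" by (auto intro!: coord_eqI simp: proj coord_basis)
      then show ?thesis using a True S by (auto intro!: coord_eqI simp: proj linf_iff)
    next
      case False
      then have "proj S (basis_vec f) = 0" by (auto intro!: coord_eqI simp: proj coord_basis)
      then show ?thesis using a False S by (auto intro!: coord_eqI simp: proj linf_iff)
    qed
  qed (use a in \<open>auto simp: proj linf_iff\<close>)
  then show "a \<in> commutant (range (\<lambda>x. proj {e. lab G e = x}))" using a by (auto simp: commutant_def linf_iff)
next
  fix a assume a: "a \<in> commutant (range (\<lambda>x. proj {e. lab G e = x}))"
  have "ent a e f = 0" if "lab G e \<noteq> lab G f" for e f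
  proof -
    let ?S = "{e. lab G e = lab G f}"
    have "proj ?S (basis_vec f) = basis_vec f" by (auto intro!: coord_eqI simp: proj coord_basis)
    then have "a (basis_vec f) = (a \<cdot> proj ?S) (basis_vec f)" by simp
    also have "\<dots> = (proj ?S \<cdot> a) (basis_vec f)" using a by (auto simp: commutant_def)
    finally have "ent a e f = coord (proj ?S (a (basis_vec f))) e" by simp
    then show ?thesis using that by (simp add: proj)
  qed
  then show "a \<in> linf G" using a by (auto simp: linf_iff commutant_def)
qed

lemma adj_proj [simp]: "adj (proj S) = proj S"
proof (rule clin_eqI)
  fix f show "adj (proj S) (basis_vec f) = proj S (basis_vec f)"
    using cinner_adj_right[OF proj(2), of "basis_vec _" S "basis_vec f"] by (intro coord_eqI) (simp add: proj coord_basis)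
qed (simp_all add: proj)

lemma linf_star: "unital_star_algebra (linf G)"
  unfolding unital_star_algebra_def linf_commutant
  by (auto intro: commutant_closed commutant_adj subsetD[OF commutant_clin] simp: proj)

lemma linf_clin: "linf G \<subseteq> clin" by (auto simp: linf_def)

lemma linf_bicommutant: "commutant (commutant (linf G)) = linf G"
  unfolding linf_commutant by (rule commutant_triple) (auto simp: proj)

lemma entry_adj: "a \<in> clin \<Longrightarrow> coord (adj a (basis_vec f)) e = cnj (ent a f e)"
  using cinner_adj_right[of a "basis_vec e" "basis_vec f"] by simp

lemma blk_adj: "T \<in> clin \<Longrightarrow> blk e f (adj T) = adj (blk f e T)"
  by (simp add: ls_def compose_assoc)

text \<open>One direction tests \<open>T\<close> against \<open>\<one> \<otimes> m\<close> with
  \<open>m\<close> in the commutant of \<open>M\<close> and against the fibre projections. For the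
  other, an operator commuting with all \<open>mu e f \<otimes> m\<close> is diagonal with blocks
  that \<open>M\<close> intertwines inside each fibre, so it commutes with every \<open>T\<close> of
  the given shape. Membership in the tensor product thereby becomes a condition on single
  blocks.\<close>

lemma linf_tensor_iff:
  fixes T :: "('e \<times> 'j) op"
  assumes M: "unital_star_algebra M" and MM: "commutant (commutant M) = M"
  shows "T \<in> linf G \<otimes>\<^sub>v\<^sub>N M \<longleftrightarrow> T \<in> clin \<and> (\<forall>e f. if lab G e = lab G f then blk e f T \<in> M else blk e f T = 0)"
proof (intro iffI conjI allI)
  note M' = star_algebraD[OF M] subsetD[OF star_algebraD(1)[OF M]]
  have lc: "a \<in> clin" if "a \<in> linf G" for a using that linf_clin[of G] by auto
  {
    assume T: "T \<in> linf G \<otimes>\<^sub>v\<^sub>N M"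
    then show Tc: "T \<in> clin" using vn_tensor_clin by blast
    fix e f
    show "if lab G e = lab G f then blk e f T \<in> M else blk e f T = 0"
    proof (cases "lab G e = lab G f")
      case True
      have "blk e f T \<cdot> m = m \<cdot> blk e f T" if m: "m \<in> commutant M" for m
      proof -
        have mc: "m \<in> clin" using m commutant_clin by blast
        have "\<one> \<otimes> m \<in> commutant (elem_tensors (linf G) M)"
          using m mc M'(9) lc by (auto simp: commutant_def elem_tensors_def op_tensor_compose)
        then have "T \<cdot> (\<one> \<otimes> m) = (\<one> \<otimes> m) \<cdot> T"
          using T by (auto simp: vn_tensor_def vn_generated_def commutant_def)
        then have "blk e f (T \<cdot> (\<one> \<otimes> m)) = blk e f ((\<one> \<otimes> m) \<cdot> T)" by simp
        then show ?thesis using mc by (simp add: slice_amp_compose)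
      qed
      then have "blk e f T \<in> commutant (commutant M)" using Tc by (auto simp: commutant_def)
      then show ?thesis using True MM by simp
    next
      case False
      let ?p = "proj {g. lab G g = lab G f}"
      have "a \<cdot> ?p = ?p \<cdot> a" if "a \<in> linf G" for a using that unfolding linf_commutant by (auto simp: commutant_def)
      then have "?p \<otimes> \<one> \<in> commutant (elem_tensors (linf G) M)"
        using M'(9) lc by (auto simp: commutant_def elem_tensors_def op_tensor_compose proj)
      then have "T \<cdot> (?p \<otimes> \<one>) = (?p \<otimes> \<one>) \<cdot> T"
        using T by (auto simp: vn_tensor_def vn_generated_def commutant_def)
      then have TT: "T ((?p \<otimes> \<one>) z) = (?p \<otimes> \<one>) (T z)" for z by (rule compose_eqD)
      have p: "?p (basis_vec f) = basis_vec f" "?p (basis_vec e) = 0" using False by (auto intro!: coord_eqI simp: proj coord_basis)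
      have "blk e f T = 0"
      proof (rule hom_eqI)
        fix x y
        have "cinner x (blk e f T y) = cinner (basis_vec e \<otimes>\<^sub>v x) (T ((?p \<otimes> \<one>) (basis_vec f \<otimes>\<^sub>v y)))"
          by (simp add: cinner_ls proj(2) p)
        also have "\<dots> = cinner (adj (?p \<otimes> \<one>) (basis_vec e \<otimes>\<^sub>v x)) (T (basis_vec f \<otimes>\<^sub>v y))"
          unfolding TT by (simp add: cinner_adj_left proj)
        also have "\<dots> = 0" by (simp add: op_tensor_simps(5) proj(2) p)
        finally show "cinner x (blk e f T y) = cinner x (blinfun_apply 0 y)" by simp
      qed
      then show ?thesis using False by simp
    qed
  }
  assume T: "T \<in> clin \<and> (\<forall>e f. if lab G e = lab G f then blk e f T \<in> M else blk e f T = 0)"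
  have "T \<cdot> S = S \<cdot> T" if S: "S \<in> commutant (elem_tensors (linf G) M)" for S
  proof -
    have Sc: "S \<in> clin" using S commutant_clin by blast
    \<comment> \<open>Compares the blocks \<open>(g, f)\<close> of the two products of
      \<open>S\<close> with \<open>mu e f \<otimes> m\<close>. For \<open>e = f\<close> and
      \<open>m = \<one>\<close> this says that \<open>S\<close> has no off-diagonal blocks.\<close>
    have key: "blk g e S \<cdot> m = (if g = e then m \<cdot> blk f f S else 0)" if ef: "lab G e = lab G f" and m: "m \<in> M" for e f g m
    proof -
      have "mu e f \<otimes> m \<in> elem_tensors (linf G) M" using mu_linf[OF ef] m by (auto simp: elem_tensors_def)
      then have "S \<cdot> (mu e f \<otimes> m) = (mu e f \<otimes> m) \<cdot> S" using S by (auto simp: commutant_def)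
      then have *: "S ((mu e f \<otimes> m) z) = (mu e f \<otimes> m) (S z)" for z by (rule compose_eqD)
      show ?thesis
      proof (rule hom_eqI)
        fix x y
        have "cinner x ((blk g e S \<cdot> m) y) = cinner (basis_vec g \<otimes>\<^sub>v x) (S ((mu e f \<otimes> m) (basis_vec f \<otimes>\<^sub>v y)))"
          by (simp add: cinner_ls M'(9)[OF m] coord_basis)
        also have "\<dots> = cinner (adj (mu e f \<otimes> m) (basis_vec g \<otimes>\<^sub>v x)) (S (basis_vec f \<otimes>\<^sub>v y))"
          unfolding * by (simp add: cinner_adj_left M'(9)[OF m])
        also have "\<dots> = cinner x ((if g = e then m \<cdot> blk f f S else 0) y)"
          by (auto simp: op_tensor_simps(5) M'(9)[OF m] coord_basis cinner_ls[symmetric] cinner_adj_left)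
        finally show "cinner x ((blk g e S \<cdot> m) y) = cinner x ((if g = e then m \<cdot> blk f f S else 0) y)" .
      qed
    qed
    have d: "blk g e S = (if g = e then blk e e S else 0)" for g e using key[OF refl M'(2), of g e] by simp
    have ap: "R (basis_vec e \<otimes>\<^sub>v y) = basis_vec e \<otimes>\<^sub>v blk e e R y"
      if "\<And>g. g \<noteq> e \<Longrightarrow> blk g e R = 0" for R :: "('e \<times> 'j) op" and e y
    proof (rule coord_eqI)
      fix p :: "'e \<times> 'j"
      have "coord (R (basis_vec e \<otimes>\<^sub>v y)) (fst p, snd p) = cinner (basis_vec (snd p)) (blk (fst p) e R y)" by (simp add: cinner_ls)
      then show "coord (R (basis_vec e \<otimes>\<^sub>v y)) p = coord (basis_vec e \<otimes>\<^sub>v blk e e R y) p"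
        using that[of "fst p"] by (cases p) (auto simp: coord_basis)
    qed
    have S1: "S (basis_vec e \<otimes>\<^sub>v y) = basis_vec e \<otimes>\<^sub>v blk e e S y" for e y by (rule ap) (subst d, simp)
    have S2: "adj S (basis_vec e \<otimes>\<^sub>v y) = basis_vec e \<otimes>\<^sub>v adj (blk e e S) y" for e y
    proof -
      have "blk g e (adj S) = 0" if "g \<noteq> e" for g using d[of e g] that by (simp add: blk_adj Sc)
      from ap[OF this] show ?thesis by (simp add: blk_adj Sc)
    qed
    show ?thesis
    proof (rule blk_eqI)
      fix e f
      have "blk e f (T \<cdot> S) = blk e f T \<cdot> blk f f S" by (rule hom_eqI) (simp add: cinner_ls S1)
      moreover have "blk e f (S \<cdot> T) = blk e e S \<cdot> blk e f T"
        by (rule hom_eqI) (simp add: cinner_ls cinner_adj_left[OF Sc, symmetric] S2 slice_clin Sc coord_basis flip: cinner_adj_left)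
      moreover have "blk e f T \<cdot> blk f f S = blk e e S \<cdot> blk e f T"
      proof (cases "lab G e = lab G f")
        case True
        then show ?thesis using key[OF True, of "blk e f T" e] T by simp
      next
        case False
        then have "blk e f T = 0" using T by metis
        then show ?thesis by simp
      qed
      ultimately show "blk e f (T \<cdot> S) = blk e f (S \<cdot> T)" by simp
    qed (use T Sc in auto)
  qed
  then show "T \<in> linf G \<otimes>\<^sub>v\<^sub>N M" using T commutant_clin by (auto simp: vn_tensor_def vn_generated_def commutant_def)
qed

lemma rs_linf: "unital_star_algebra M \<Longrightarrow> commutant (commutant M) = M \<Longrightarrow> T \<in> linf G \<otimes>\<^sub>v\<^sub>N M \<Longrightarrow> rs u v T \<in> linf G"
  by (auto simp: linf_tensor_iff linf_iff entry_rs)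

section \<open>Unitaries with finite blocks\<close>

lemma cinner_basis_basis: "cinner (basis_vec i) (basis_vec j) = (if i = j then 1 else 0)"
  by (simp add: coord_basis)

text \<open>The common form of the multiplicative unitary, of the link unitary and of their products
  in legs 13 and 23: a direct sum of finite unitary matrices of operators, with rows and columns
  labelled by classes. Finite fibres keep all matrix products finite sums.\<close>

locale block_unitary =
  fixes la :: "'e \<Rightarrow> 'x" and lb :: "'f \<Rightarrow> 'x" and m :: "'e \<Rightarrow> 'f \<Rightarrow> 'i op"
  assumes fin: "finite {e. la e = x}" "finite {f. lb f = x}"
    and m_clin [simp]: "m e f \<in> clin" and m_zero: "la e \<noteq> lb f \<Longrightarrow> m e f = 0"
    and rows: "la e = la e' \<Longrightarrow> (\<Sum>f | lb f = la e. m e f \<cdot> adj (m e' f)) = (if e = e' then \<one> else 0)"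
    and cols: "lb f = lb f' \<Longrightarrow> (\<Sum>e | la e = lb f. adj (m e f) \<cdot> m e f') = (if f = f' then \<one> else 0)"
begin

text \<open>The relation \<open>cols\<close> says that the prescribed images of the basis vectors
  have the Gram matrix of an orthonormal basis, so \<open>isometry_extension\<close> supplies the
  operator described by \<open>block_op\<close>.\<close>

lemma block_op_spec:
  "block_op m \<in> clin" "block_op m (basis_vec f \<otimes>\<^sub>v y) = (\<Sum>e | la e = lb f. basis_vec e \<otimes>\<^sub>v m e f y)"
  "adj (block_op m) \<cdot> block_op m = \<one>"
proof -
  define t where "t p = (\<Sum>e | la e = lb (fst p). basis_vec e \<otimes>\<^sub>v m e (fst p) (basis_vec (snd p)))" for p
  have gram: "cinner (basis_vec p) (basis_vec q) = cinner (t p) (t q)" for p q :: "'f \<times> 'i"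
  proof (cases "lb (fst p) = lb (fst q)")
    case True
    have "cinner (t p) (t q) = (\<Sum>e' | la e' = lb (fst p). \<Sum>e | la e = lb (fst p). if e = e'
        then cinner (m e (fst p) (basis_vec (snd p))) (m e (fst q) (basis_vec (snd q))) else 0)"
      unfolding t_def True cinner.sum_left cinner.sum_right by (intro sum.cong refl) (auto simp: coord_basis)
    also have "\<dots> = (\<Sum>e | la e = lb (fst p). cinner (m e (fst p) (basis_vec (snd p))) (m e (fst q) (basis_vec (snd q))))"
      using fin(1) by (intro sum.cong refl) simp
    also have "\<dots> = cinner (basis_vec (snd p)) ((if fst p = fst q then \<one> else 0) (basis_vec (snd q)))"
      unfolding cols[OF True, symmetric] by (simp add: sum_apply cinner.sum_right cinner_adj_right del: cinner_basis_left)
    also have "\<dots> = cinner (basis_vec p) (basis_vec q)" by (cases p; cases q) (auto simp: coord_basis)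
    finally show ?thesis by simp
  next
    case False
    have "cinner (t p) (t q) = 0"
      unfolding t_def cinner.sum_left cinner.sum_right using False by (intro sum.neutral ballI) (auto simp: coord_basis)
    then show ?thesis using False by (auto simp: coord_basis)
  qed
  have "\<exists>T\<in>clin. (\<forall>p. blinfun_apply T (basis_vec p) = t p) \<and> adj T \<cdot> T = \<one>"
    by (rule isometry_extension[OF gram], rule coord_eqI) simp
  then obtain T
    where T: "T \<in> clin" "\<forall>p. T (basis_vec p) = t p" "adj T \<cdot> T = \<one>" by (elim bexE conjE)
  have ap: "T (basis_vec f \<otimes>\<^sub>v y) = (\<Sum>e | la e = lb f. basis_vec e \<otimes>\<^sub>v m e f y)" for f y
  proof -
    have "T \<cdot> lvec (basis_vec f) = (\<Sum>e | la e = lb f. lvec (basis_vec e) \<cdot> m e f)"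
      by (rule clin_eqI) (auto simp: T t_def sum_apply)
    from arg_cong[OF this, of "\<lambda>X. blinfun_apply X y"] show ?thesis by (simp add: sum_apply)
  qed
  have spec: "cinner (basis_vec e \<otimes>\<^sub>v y) (T (basis_vec f \<otimes>\<^sub>v x)) = cinner y (m e f x)" for e f x y
    using fin(1) m_zero[of e f] by (auto simp: ap cinner.sum_right cinner_basis_basis if_distrib[of "\<lambda>c. c * _"]
        simp del: basis_tensor cinner_basis_left cinner_basis_right cong: if_cong)
  have "block_op m = T" unfolding block_op_def
  proof (rule the_equality)
    show "T \<in> clin \<and> (\<forall>e f x y. cinner (basis_vec e \<otimes>\<^sub>v y) (T (basis_vec f \<otimes>\<^sub>v x)) = cinner y (m e f x))"
      using T(1) spec by simp
    fix T' assume T': "T' \<in> clin \<and> (\<forall>e f x y. cinner (basis_vec e \<otimes>\<^sub>v y) (blinfun_apply T' (basis_vec f \<otimes>\<^sub>v x)) = cinner y (m e f x))"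
    show "T' = T"
    proof (rule clin_eqI, rule conjunct1[OF T'], rule T(1), rule coord_eqI)
      fix p q
      have "cinner (basis_vec (fst q) \<otimes>\<^sub>v basis_vec (snd q)) (T' (basis_vec (fst p) \<otimes>\<^sub>v basis_vec (snd p)))
          = cinner (basis_vec (fst q) \<otimes>\<^sub>v basis_vec (snd q)) (T (basis_vec (fst p) \<otimes>\<^sub>v basis_vec (snd p)))"
        unfolding spec using T' by blast
      then show "ent T' q p = ent T q p" by simp
    qed
  qed
  then show "block_op m \<in> clin" "block_op m (basis_vec f \<otimes>\<^sub>v y) = (\<Sum>e | la e = lb f. basis_vec e \<otimes>\<^sub>v m e f y)"
    "adj (block_op m) \<cdot> block_op m = \<one>" using T ap by auto
qed

lemma adj_block_op: "adj (block_op m) (basis_vec e \<otimes>\<^sub>v y) = (\<Sum>f | lb f = la e. basis_vec f \<otimes>\<^sub>v adj (m e f) y)"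
proof (rule coord_eqI)
  fix q
  have "cinner (basis_vec (fst q) \<otimes>\<^sub>v basis_vec (snd q)) (adj (block_op m) (basis_vec e \<otimes>\<^sub>v y))
      = cinner (m e (fst q) (basis_vec (snd q))) y"
    using fin(1) m_zero[of e "fst q"] by (auto simp: cinner_adj_right block_op_spec cinner.sum_left cinner_basis_basis if_distrib[of "\<lambda>c. c * _"]
        simp del: basis_tensor cinner_basis_left cinner_basis_right cong: if_cong)
  also have "\<dots> = cinner (basis_vec (fst q) \<otimes>\<^sub>v basis_vec (snd q)) (\<Sum>f | lb f = la e. basis_vec f \<otimes>\<^sub>v adj (m e f) y)"
    using fin(2) m_zero[of e "fst q"] by (auto simp: cinner.sum_right cinner_basis_basis if_distrib[of "\<lambda>c. c * _"] cinner_adj_right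
        simp del: basis_tensor cinner_basis_left cinner_basis_right cong: if_cong)
  finally show "coord (adj (block_op m) (basis_vec e \<otimes>\<^sub>v y)) q = coord (\<Sum>f | lb f = la e. basis_vec f \<otimes>\<^sub>v adj (m e f) y) q" by simp
qed

lemma block_op_unitary: "block_op m \<cdot> adj (block_op m) = \<one>"
proof (rule hom_eqI)
  have b: "(block_op m \<cdot> adj (block_op m)) (basis_vec p) = basis_vec p" for p
  proof -
    obtain e i where p: "basis_vec p = basis_vec e \<otimes>\<^sub>v basis_vec i" by (metis basis_tensor surj_pair)
    have "(block_op m \<cdot> adj (block_op m)) (basis_vec p)
        = (\<Sum>f | lb f = la e. \<Sum>e' | la e' = lb f. basis_vec e' \<otimes>\<^sub>v (m e' f \<cdot> adj (m e f)) (basis_vec i))"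
      by (simp add: p adj_block_op block_op_spec blinfun.sum_right del: basis_tensor)
    also have "\<dots> = (\<Sum>e' | la e' = la e. basis_vec e' \<otimes>\<^sub>v (\<Sum>f | lb f = la e'. m e' f \<cdot> adj (m e f)) (basis_vec i))"
      by (simp add: sum_apply vec_tensor.sum_right) (subst sum.swap, rule refl)
    also have "\<dots> = (\<Sum>e' | la e' = la e. if e' = e then basis_vec p else 0)" (is "sum ?f _ = sum ?g _")
    proof (rule sum.cong[OF refl])
      fix e' assume "e' \<in> {e'. la e' = la e}"
      then show "?f e' = ?g e'"
        using rows[of e' e] by (auto simp: p)
    qed
    finally show ?thesis using fin(1) by simp
  qed
  fix x y show "cinner x ((block_op m \<cdot> adj (block_op m)) y) = cinner x (\<one> y)"
    using clin_eqI[of "block_op m \<cdot> adj (block_op m)" \<one>] b block_op_spec(1) by simp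
qed

lemma blk_conj:
  assumes "b \<in> clin"
  shows "blk e e' (block_op m \<cdot> (b \<otimes> \<one>) \<cdot> adj (block_op m)) =
    (\<Sum>f | lb f = la e. \<Sum>f' | lb f' = la e'. ent b f f' *\<^sub>C (m e f \<cdot> adj (m e' f')))"
  by (rule hom_eqI) (simp add: cinner_ls block_op_spec(1) flip: cinner_adj_left,
      simp add: adj_block_op assms blinfun.sum_right cinner.sum_left cinner.sum_right sum_apply cinner_adj_left mult.commute,
      subst sum.swap, rule refl)

text \<open>Adjoints of entries are entries of the inverse matrix, and commuting with a matrix entry
  by entry passes to its inverse: the row relation is inserted, \<open>c\<close> is moved through,
  and the column relation is used.\<close>

lemma commute_adj:
  assumes c: "\<And>e f. c \<cdot> m e f = m e f \<cdot> c" shows "c \<cdot> adj (m e f) = adj (m e f) \<cdot> c"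
proof (cases "la e = lb f")
  case True
  have "adj (m e f) \<cdot> c = (\<Sum>e' | la e' = lb f. adj (m e' f) \<cdot> c \<cdot> (if e' = e then \<one> else 0))"
    using fin(1) True by (simp add: if_distrib[of "\<lambda>x. _ \<cdot> x"] cong: if_cong)
  also have "\<dots> = (\<Sum>e' | la e' = lb f. adj (m e' f) \<cdot> c \<cdot> (\<Sum>f' | lb f' = la e'. m e' f' \<cdot> adj (m e f')))"
    using True by (intro sum.cong refl) (subst rows, auto)
  also have "\<dots> = (\<Sum>e' | la e' = lb f. \<Sum>f' | lb f' = lb f. (adj (m e' f) \<cdot> m e' f') \<cdot> c \<cdot> adj (m e f'))"
    by (intro sum.cong refl) (simp add: compose_sum_right compose_assoc, metis (no_types, lifting) c compose_assoc)
  also have "\<dots> = (\<Sum>f' | lb f' = lb f. (\<Sum>e' | la e' = lb f. adj (m e' f) \<cdot> m e' f') \<cdot> c \<cdot> adj (m e f'))"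
    by (subst sum.swap) (simp add: compose_sum_left)
  also have "\<dots> = (\<Sum>f' | lb f' = lb f. if f' = f then c \<cdot> adj (m e f) else 0)"
    by (rule sum.cong) (auto simp: cols)
  finally show ?thesis using fin(2) by simp
qed (simp add: m_zero)

end

text \<open>These are the entries of the product of two copies of the unitary in legs 13 and 23,
  labelled by pairs of classes.\<close>

lemma (in block_unitary) product:
  "block_unitary (\<lambda>j. (la (fst j), la (snd j))) (\<lambda>k. (lb (fst k), lb (snd k))) (\<lambda>j k. m (fst j) (fst k) \<cdot> m (snd j) (snd k))"
proof
  have sa: "{j. (la (fst j), la (snd j)) = y} = {e. la e = fst y} \<times> {e. la e = snd y}"
    and sb: "{k. (lb (fst k), lb (snd k)) = y} = {e. lb e = fst y} \<times> {e. lb e = snd y}" for y by auto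
  show "finite {j. (la (fst j), la (snd j)) = y}" "finite {k. (lb (fst k), lb (snd k)) = y}" for y
    unfolding sa sb by (simp_all add: fin)
  show "m (fst j) (fst k) \<cdot> m (snd j) (snd k) \<in> clin" for j k by simp
  show "m (fst j) (fst k) \<cdot> m (snd j) (snd k) = 0" if "(la (fst j), la (snd j)) \<noteq> (lb (fst k), lb (snd k))" for j k
    using that m_zero by (cases "la (fst j) = lb (fst k)") (simp_all)
  show "(\<Sum>k | (lb (fst k), lb (snd k)) = (la (fst i), la (snd i)). (m (fst i) (fst k) \<cdot> m (snd i) (snd k)) \<cdot> adj (m (fst j) (fst k) \<cdot> m (snd j) (snd k)))
      = (if i = j then \<one> else 0)" if ij: "(la (fst i), la (snd i)) = (la (fst j), la (snd j))" for i j
  proof -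
    have "(\<Sum>k | (lb (fst k), lb (snd k)) = (la (fst i), la (snd i)). (m (fst i) (fst k) \<cdot> m (snd i) (snd k)) \<cdot> adj (m (fst j) (fst k) \<cdot> m (snd j) (snd k)))
      = (\<Sum>p | lb p = la (fst i). m (fst i) p \<cdot> (\<Sum>q | lb q = la (snd i). m (snd i) q \<cdot> adj (m (snd j) q)) \<cdot> adj (m (fst j) p))"
      unfolding sb by (simp add: compose_sum compose_assoc sum.cartesian_product split_def)
    then show ?thesis using ij rows[of "fst i" "fst j"] rows[of "snd i" "snd j"]
      by (auto simp: prod_eq_iff)
  qed
  show "(\<Sum>i | (la (fst i), la (snd i)) = (lb (fst j), lb (snd j)). adj (m (fst i) (fst j) \<cdot> m (snd i) (snd j)) \<cdot> (m (fst i) (fst k) \<cdot> m (snd i) (snd k)))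
      = (if j = k then \<one> else 0)" if jk: "(lb (fst j), lb (snd j)) = (lb (fst k), lb (snd k))" for j k
  proof -
    have "(\<Sum>i | (la (fst i), la (snd i)) = (lb (fst j), lb (snd j)). adj (m (fst i) (fst j) \<cdot> m (snd i) (snd j)) \<cdot> (m (fst i) (fst k) \<cdot> m (snd i) (snd k)))
      = (\<Sum>q | la q = lb (snd j). adj (m q (snd j)) \<cdot> (\<Sum>p | la p = lb (fst j). adj (m p (fst j)) \<cdot> m p (fst k)) \<cdot> m q (snd k))"
      unfolding sa by (simp add: compose_sum compose_assoc, subst sum.swap, simp add: sum.cartesian_product split_def)
    then show ?thesis using jk cols[of "fst j" "fst k"] cols[of "snd j" "snd k"]
      by (auto simp: prod_eq_iff)
  qed
qed

section \<open>States\<close>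

lemma closed_clin: "closed (clin :: ('i, 'j) hom set)"
  unfolding closed_sequential_limits
proof (intro allI impI)
  fix X and T :: "('i, 'j) hom" assume X: "(\<forall>n. X n \<in> clin) \<and> X \<longlonglongrightarrow> T"
  have l: "(\<lambda>n. X n x) \<longlonglongrightarrow> T x" for x by (rule blinfun.tendsto) (use X in auto)
  have "T (cscale c x) = cscale c (T x)" for c x
  proof (rule LIMSEQ_unique[OF l])
    have "(\<lambda>n. cscale c (X n x)) \<longlonglongrightarrow> cscale c (T x)" by (intro bounded_linear.tendsto[OF cscale.bounded_linear_right] l)
    then show "(\<lambda>n. X n (cscale c x)) \<longlonglongrightarrow> cscale c (T x)" using X by (simp add: clinD)
  qed
  then show "T \<in> clin" by (simp add: clin_def)
qed

text \<open>Solves \<open>1 - a = (1 - b)\<^sup>2\<close> by the contraction \<open>b \<mapsto> (a + b\<^sup>2) / 2\<close>.\<close>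

lemma one_minus_square:
  assumes A: "unital_star_algebra A" "closed A" and a: "a \<in> A" "adj a = a" "norm a \<le> 1 / 2"
  shows "\<exists>b\<in>A. adj b = b \<and> \<one> - a = (\<one> - b) \<cdot> (\<one> - b)"
proof -
  note A' = star_algebraD[OF A(1)]
  let ?S = "{b \<in> A. norm b \<le> 1 / 2}" and ?f = "\<lambda>b. (1 / 2) *\<^sub>R (a + (b \<cdot> b))"
  have S: "closed ?S" using closed_Int[OF A(2) closed_cball[of 0 "1/2"]] by (simp add: Int_def)
  have "\<exists>!b. b \<in> ?S \<and> ?f b = b"
  proof (rule Banach_fix[where c="1/2"])
    show "complete ?S" using S by (simp add: complete_eq_closed)
    have "0 \<in> ?S" using A'(7) by simp
    then show "?S \<noteq> {}" by blast
    show "?f ` ?S \<subseteq> ?S"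
    proof
      fix c assume "c \<in> ?f ` ?S"
      then obtain b where b: "b \<in> A" "norm b \<le> 1 / 2" "c = ?f b" by auto
      have "c = of_real (1 / 2) *\<^sub>C (a + (b \<cdot> b))" using b(3) by (simp only: scaleC_simps)
      then have cA: "c \<in> A" using a b A' by auto
      have "norm (b \<cdot> b) \<le> 1 / 2 * (1 / 2)"
        by (rule order_trans[OF norm_blinfun_compose]) (use b in \<open>intro mult_mono, auto\<close>)
      then have "norm (a + (b \<cdot> b)) \<le> 1" using norm_triangle_ineq[of a "b \<cdot> b"] a(3) by linarith
      then show "c \<in> ?S" using cA b(3) by simp
    qed
    fix b c assume bc: "b \<in> ?S" "c \<in> ?S"
    have "?f b - ?f c = (1 / 2) *\<^sub>R ((b \<cdot> (b - c)) + ((b - c) \<cdot> c))"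
      by (simp add: blinfun_compose.diff_left blinfun_compose.diff_right algebra_simps)
    then have "dist (?f b) (?f c) = 1 / 2 * norm ((b \<cdot> (b - c)) + ((b - c) \<cdot> c))" by (simp add: dist_norm)
    also have "\<dots> \<le> 1 / 2 * (norm b * norm (b - c) + norm (b - c) * norm c)"
      by (intro mult_left_mono order_trans[OF norm_triangle_ineq] add_mono norm_blinfun_compose) auto
    also have "\<dots> \<le> 1 / 2 * (1 / 2 * norm (b - c) + norm (b - c) * (1 / 2))"
      using bc by (intro mult_left_mono add_mono mult_mono) auto
    finally show "dist (?f b) (?f c) \<le> 1 / 2 * dist b c" by (simp add: dist_norm)
  qed auto
  then obtain b where b: "b \<in> ?S" "?f b = b" and uniq: "\<And>c. c \<in> ?S \<Longrightarrow> ?f c = c \<Longrightarrow> c = b" by (elim ex1E) blast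
  have bc: "b \<in> clin" "a \<in> clin" using b a A' by auto
  \<comment> \<open>The adjoint is a fixed point of the same contraction, so uniqueness makes
    \<open>b\<close> self-adjoint.\<close>
  have "adj (?f b) = adj b" by (simp only: b(2))
  then have "?f (adj b) = adj b" using bc a(2) by simp
  moreover have "adj b \<in> ?S" using b(1) A'(5)[of b] norm_adj_le[OF bc(1)] by auto
  ultimately have sa: "adj b = b" by (rule uniq[rotated])
  have "a + (b \<cdot> b) = 2 *\<^sub>R b" using arg_cong[OF b(2), of "\<lambda>x. 2 *\<^sub>R x"] by simp
  then have "a = b + b - (b \<cdot> b)" by (simp add: scaleR_2 algebra_simps)
  then have "\<one> - a = (\<one> - b) \<cdot> (\<one> - b)"
    by (simp add: blinfun_compose.diff_left blinfun_compose.diff_right)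
  then show ?thesis using sa b(1) by auto
qed

lemma state_diff: "state_on A h \<Longrightarrow> unital_star_algebra A \<Longrightarrow> a \<in> A \<Longrightarrow> b \<in> A \<Longrightarrow> h (a - b) = h a - h b"
  using star_algebraD(6)[of A b "-1"] unfolding state_on_def
  by (metis add_uminus_conv_diff mult_minus1 scaleC_simps(7))

text \<open>Positivity of a state is known only on elements \<open>adj a \<cdot> a\<close>, so
  \<open>\<one> - b\<close> must be exhibited as a square. This works for self-adjoint
  \<open>b\<close> of norm at most 1/2 and costs a factor 2; the decomposition into real and
  imaginary parts costs another 2. The constant itself is immaterial, boundedness is the
  aim.\<close>

lemma state_bounded:
  assumes A: "unital_star_algebra A" "closed A" and h: "state_on A h" and a: "a \<in> A"
  shows "cmod (h a) \<le> 4 * norm a"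
proof -
  note A' = star_algebraD[OF A(1)]
  have sc: "h (c *\<^sub>C b) = c * h b" if "b \<in> A" for b c using h that by (simp add: state_on_def)
  have small: "Im (h b) = 0 \<and> Re (h b) \<le> 1" if b: "b \<in> A" "adj b = b" "norm b \<le> 1 / 2" for b
  proof -
    obtain d where d: "d \<in> A" "adj d = d" "\<one> - b = (\<one> - d) \<cdot> (\<one> - d)"
      using one_minus_square[OF A b] by (elim bexE conjE)
    have "\<one> - d \<in> A" using d A' by auto
    then have "h (adj (\<one> - d) \<cdot> (\<one> - d)) \<in> \<real>\<^sub>\<ge>\<^sub>0" using h by (simp add: state_on_def)
    moreover have "adj (\<one> - d) = \<one> - d" using d A' by auto
    ultimately have "1 - h b \<in> \<real>\<^sub>\<ge>\<^sub>0" using state_diff[OF h A(1) A'(2) b(1)] h by (simp add: d(3)[symmetric] state_on_def)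
    then show ?thesis by (auto simp: nonneg_Reals_def complex_eq_iff)
  qed
  have sa: "cmod (h b) \<le> 2 * norm b" if b: "b \<in> A" "adj b = b" for b
  proof (cases "b = 0")
    case True
    then show ?thesis using sc[OF A'(7), of 0] by simp
  next
    case False
    have c: "b \<in> clin" using b A' by auto
    define r where "r = 1 / (2 * norm b)"
    have r: "r > 0" using False by (simp add: r_def)
    have s: "Im (h (of_real t *\<^sub>C b)) = 0 \<and> Re (h (of_real t *\<^sub>C b)) \<le> 1" if "\<bar>t\<bar> = r" for t
      by (rule small) (use b A' c that False in \<open>auto simp: r_def simp del: scaleC_simps\<close>, simp_all)
    have "Im (h b) = 0" "r * Re (h b) \<le> 1" "- r * Re (h b) \<le> 1"
      using s[of r] s[of "- r"] r by (simp_all add: sc[OF b(1)] del: scaleC_simps)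
    then show ?thesis using r False by (simp add: r_def cmod_eq_Re field_simps abs_le_iff)
  qed
  have ac: "a \<in> clin" using a A' by auto
  define p q where "p = (1 / 2) *\<^sub>C (a + adj a)" and "q = (- \<i> / 2) *\<^sub>C (a - adj a)"
  have p: "p \<in> A" "adj p = p" "norm p \<le> norm a"
  proof -
    show "norm p \<le> norm a" using norm_triangle_ineq[of a "adj a"] norm_adj_le[OF ac] by (simp add: p_def norm_scaleC)
  qed (use a ac A' in \<open>auto simp: p_def add.commute\<close>)
  have q: "q \<in> A" "adj q = q" "norm q \<le> norm a"
  proof -
    show "norm q \<le> norm a" using norm_triangle_ineq4[of a "adj a"] norm_adj_le[OF ac] by (simp add: q_def norm_scaleC norm_divide)
    have "adj q = (\<i> / 2) *\<^sub>C (adj a - a)" using ac by (simp add: q_def)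
    also have "\<dots> = q" by (rule blinfun_eqI) (simp add: q_def blinfun.diff_left cscale.diff_right cscale.minus_left)
    finally show "adj q = q" .
  qed (use a A' in \<open>auto simp: q_def\<close>)
  have "a = p + \<i> *\<^sub>C q"
  proof (rule blinfun_eqI)
    fix x
    have "cscale (1 / 2) (a x) + cscale (1 / 2) (a x) = a x" by (simp flip: cscale.add_left)
    then show "a x = (p + \<i> *\<^sub>C q) x"
      by (simp add: p_def q_def blinfun.add_left blinfun.diff_left cscale.add_right cscale.diff_right)
  qed
  then have "h a = h p + \<i> * h q" using h p q A'(6)[of q] by (simp add: state_on_def)
  then have "cmod (h a) \<le> cmod (h p) + cmod (h q)" using norm_triangle_ineq[of "h p" "\<i> * h q"] by (simp add: norm_mult)
  then show ?thesis using sa[OF p(1,2)] sa[OF q(1,2)] p(3) q(3) by linarith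
qed

lemma slice_scaleR: "ls x y (r *\<^sub>R T) = r *\<^sub>R ls x y T" "ls x y 0 = 0"
  using slice_linear(5)[of x y "of_real r" T] slice_linear(5)[of x y 0 0] by simp_all

lemma norm_slice: "norm (ls x y T) \<le> norm x * norm y * norm T"
proof (rule norm_blinfun_bound)
  fix v show "norm (ls x y T v) \<le> norm x * norm y * norm T * norm v"
  proof (rule norm_le_cinnerI)
    fix z
    have "cmod (cinner z (ls x y T v)) \<le> norm (x \<otimes>\<^sub>v z) * (norm T * norm (y \<otimes>\<^sub>v v))"
      unfolding cinner_ls by (rule order_trans[OF cinner_bound mult_left_mono[OF norm_blinfun]]) simp
    then show "cmod (cinner z (ls x y T v)) \<le> norm x * norm y * norm T * norm v * norm z" by (simp add: mult_ac)
  qed simp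
qed simp

lemma min_tensor_linear:
  assumes A: "unital_star_algebra A"
  shows "subspace (min_tensor A A)" "T \<in> min_tensor A A \<Longrightarrow> c *\<^sub>C T \<in> min_tensor A A"
proof -
  let ?E = "span (elem_tensors A A)"
  have c: "closure (f ` ?E) \<subseteq> min_tensor A A" if "f ` ?E \<subseteq> ?E" for f unfolding min_tensor_def using that by (rule closure_mono)
  have seq: "\<exists>X. (\<forall>n. X n \<in> ?E) \<and> X \<longlonglongrightarrow> S" if "S \<in> min_tensor A A" for S
    using that unfolding min_tensor_def closure_sequential .
  have lin: "f S \<in> min_tensor A A" if S: "S \<in> min_tensor A A" and "bounded_linear f" "f ` ?E \<subseteq> ?E" for f S
    using c[OF that(3)] closure_bounded_linear_image_subset[OF that(2), of ?E] S unfolding min_tensor_def by blast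
  have "S + T \<in> min_tensor A A" if ST: "S \<in> min_tensor A A" "T \<in> min_tensor A A" for S T
  proof -
    obtain X where X: "\<forall>n. X n \<in> ?E" "X \<longlonglongrightarrow> S" using seq[OF ST(1)] by (elim exE conjE)
    obtain Y where Y: "\<forall>n. Y n \<in> ?E" "Y \<longlonglongrightarrow> T" using seq[OF ST(2)] by (elim exE conjE)
    have "(\<lambda>n. X n + Y n) \<longlonglongrightarrow> S + T" by (intro tendsto_add X Y)
    moreover have "\<forall>n. X n + Y n \<in> ?E" using X(1) Y(1) by (simp add: span_add)
    ultimately show ?thesis unfolding min_tensor_def closure_sequential by (intro exI conjI)
  qed
  moreover have "0 \<in> min_tensor A A" unfolding min_tensor_def using span_zero closure_subset by blast
  moreover have "r *\<^sub>R S \<in> min_tensor A A" if "S \<in> min_tensor A A" for r S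
    by (rule lin[OF that]) (auto intro: bounded_linear_scaleR_right span_scale)
  ultimately show "subspace (min_tensor A A)" by (simp add: subspace_def)
  have "bounded_linear (\<lambda>T :: ('a \<times> 'a) op. c *\<^sub>C T)"
    by (rule bounded_linear_intro[of _ "cmod c"]) (auto simp: scaleC_add norm_scaleC intro!: blinfun_eqI simp: blinfun.scaleR_left cscale.scaleR_right)
  then show "T \<in> min_tensor A A \<Longrightarrow> c *\<^sub>C T \<in> min_tensor A A"
    by (rule lin[rotated]) (use star_algebraD(6)[OF elem_tensors_star[OF A A]] in auto)
qed

text \<open>The slice of \<open>T\<close> by \<open>h\<close> is defined through its matrix elements
  \<open>h (ls x y T)\<close>. Slices by vector functionals of the first leg stay in
  \<open>A\<close> because \<open>A\<close> is norm closed, and boundedness of \<open>h\<close>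
  makes the matrix elements a bounded sesquilinear form.\<close>

lemma min_tensor_slice_ext:
  assumes A: "unital_star_algebra A" "closed A" and h: "state_on A h"
  shows "\<exists>F. linear_map_on (min_tensor A A) F \<and> continuous_on (min_tensor A A) F \<and> (\<forall>a\<in>A. \<forall>b\<in>A. F (a \<otimes> b) = h b *\<^sub>C a)"
proof -
  note A' = star_algebraD[OF A(1)] subsetD[OF star_algebraD(1)[OF A(1)]]
  have sc: "h (c *\<^sub>C b) = c * h b" if "b \<in> A" for b c using h that by (simp add: state_on_def)
  have scR: "h (r *\<^sub>R b) = r *\<^sub>R h b" if "b \<in> A" for b r
    using sc[OF that, of "of_real r"] by (simp add: scaleR_conv_of_real)
  have ad: "h (b + b') = h b + h b'" if "b \<in> A" "b' \<in> A" for b b' using h that by (simp add: state_on_def)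
  have subA: "subspace A" using A'(3,6,7) scaleC_simps(5) unfolding subspace_def by metis
  have bl: "bounded_linear (ls x y :: ('a \<times> 'a) op \<Rightarrow> 'a op)" for x y
  proof (rule bounded_linear_intro)
    show "ls x y (r *\<^sub>R T) = r *\<^sub>R ls x y T" for r and T :: "('a \<times> 'a) op" using slice_linear(5)[of x y "of_real r" T] by simp
    show "norm (ls x y T) \<le> norm T * (norm x * norm y)" for T :: "('a \<times> 'a) op" using norm_slice[of x y T] by (simp add: mult_ac)
  qed (simp add: slice_linear)
  have mem: "T \<in> clin \<and> (\<forall>x y. ls x y T \<in> A)" if T: "T \<in> min_tensor A A" for T
  proof -
    let ?Q = "{T :: ('a \<times> 'a) op. T \<in> clin \<and> (\<forall>x y. ls x y T \<in> A)}"
    have "span (elem_tensors A A) \<subseteq> ?Q"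
    proof (rule span_minimal)
      show "elem_tensors A A \<subseteq> ?Q" using A'(9,6) by (auto simp: elem_tensors_def)
      show "subspace ?Q"
        using subA by (simp add: subspace_def slice_linear slice_scaleR)
    qed
    moreover have "closed ?Q"
    proof -
      have *: "?Q = clin \<inter> (\<Inter>x. \<Inter>y. ls x y -` A)" by auto
      have "closed (ls x y -` A :: ('a \<times> 'a) op set)" for x y
        using A(2) bounded_linear.continuous_on[OF bl continuous_on_id] by (intro closed_vimage) auto
      then show ?thesis unfolding * by (intro closed_Int closed_INT closed_clin ballI)
    qed
    ultimately have "closure (span (elem_tensors A A)) \<subseteq> ?Q" by (rule closure_minimal)
    then show ?thesis using T by (auto simp: min_tensor_def)
  qed
  have "\<exists>R\<in>clin. \<forall>x y. cinner x (blinfun_apply R y) = h (ls x y T)" if T: "T \<in> min_tensor A A" for T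
  proof (rule form_op)
    note m = mem[OF T]
    have T': "T (cscale c z) = cscale c (T z)" for c z using m clinD by blast
    have l: "ls (x + x') y T = ls x y T + ls x' y T" "ls x (y + y') T = ls x y T + ls x y' T"
      "ls (cscale c x) y T = cnj c *\<^sub>C ls x y T" "ls x (cscale c y) T = c *\<^sub>C ls x y T" for x x' y y' c
      by (auto intro!: hom_eqI simp: cinner_ls vec_tensor.add_left cinner.add_left cinner.add_right blinfun.add_right blinfun.add_left vec_tensor_simps T')
    show c: "h (ls (cscale c x) y T) = cnj c * h (ls x y T)" "h (ls x (cscale c y) T) = c * h (ls x y T)" for c x y
      using m by (simp_all add: l sc)
    show "bounded_bilinear (\<lambda>x y. h (ls x y T))"
    proof
      show "\<exists>K. \<forall>x y. norm (h (ls x y T)) \<le> norm x * norm y * K"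
      proof (intro exI[of _ "4 * norm T"] allI)
        fix x y show "norm (h (ls x y T)) \<le> norm x * norm y * (4 * norm T)"
          using state_bounded[OF A h, of "ls x y T"] m norm_slice[of x y T] by simp
      qed
      show "h (ls (r *\<^sub>R x) y T) = r *\<^sub>R h (ls x y T)" "h (ls x (r *\<^sub>R y) T) = r *\<^sub>R h (ls x y T)" for r x y
        using c(1)[of "of_real r"] c(2)[of _ "of_real r"] by (simp_all add: scaleR_conv_of_real)
    qed (use m in \<open>simp_all add: l ad\<close>)
  qed
  then have "\<forall>T\<in>min_tensor A A. \<exists>R\<in>clin. \<forall>x y. cinner x (blinfun_apply R y) = h (ls x y T)" by blast
  from bchoice[OF this[unfolded Bex_def]] obtain F where
    F: "\<forall>T\<in>min_tensor A A. F T \<in> clin \<and> (\<forall>x y. cinner x (blinfun_apply (F T) y) = h (ls x y T))" by (elim exE)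
  have Fc: "cinner x (F T y) = h (ls x y T)" if "T \<in> min_tensor A A" for T x y using F that by blast
  have mt: "subspace (min_tensor A A)" by (rule min_tensor_linear[OF A(1)])
  have nF: "norm (F S - F T) \<le> 4 * dist S T" if S: "S \<in> min_tensor A A" and T: "T \<in> min_tensor A A" for S T
  proof (rule norm_blinfun_bound)
    fix y show "norm ((F S - F T) y) \<le> 4 * dist S T * norm y"
    proof (rule norm_le_cinnerI)
      fix x
      have "cinner x ((F S - F T) y) = h (ls x y (S - T))"
        using mem[OF S] mem[OF T] by (simp add: blinfun.diff_left cinner.diff_right Fc S T slice_linear(3) state_diff[OF h A(1)])
      also have "cmod \<dots> \<le> 4 * (norm x * norm y * norm (S - T))"
        using state_bounded[OF A h, of "ls x y (S - T)"] mem[OF subspace_diff[OF mt S T]] norm_slice[of x y "S - T"] by simp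
      finally show "cmod (cinner x ((F S - F T) y)) \<le> 4 * dist S T * norm y * norm x" by (simp add: dist_norm mult_ac)
    qed simp
  qed simp
  have "continuous_on (min_tensor A A) F"
    unfolding continuous_on_iff
  proof (intro ballI allI impI)
    fix S e assume "S \<in> min_tensor A A" "(0 :: real) < e"
    then show "\<exists>d>0. \<forall>T\<in>min_tensor A A. dist T S < d \<longrightarrow> dist (F T) (F S) < e"
      unfolding dist_norm[of "F _"] by (intro exI[of _ "e / 4"] conjI ballI impI le_less_trans[OF nF]) simp_all
  qed
  moreover note scT = min_tensor_linear(2)[OF A(1)]
  have "linear_map_on (min_tensor A A) F"
    unfolding linear_map_on_def
  proof (intro conjI ballI allI)
    fix S T c assume S: "S \<in> min_tensor A A" and T: "T \<in> min_tensor A A"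
    show "F (S + T) = F S + F T"
      by (rule hom_eqI) (use mem[OF S] mem[OF T] in \<open>simp add: Fc S T subspace_add[OF mt S T] blinfun.add_left cinner.add_right slice_linear ad\<close>)
    show "F (c *\<^sub>C T) = c *\<^sub>C F T"
      by (rule hom_eqI) (use mem[OF T] in \<open>simp add: Fc T scT slice_linear sc\<close>)
  qed
  moreover have "F (a \<otimes> b) = h b *\<^sub>C a" if "a \<in> A" "b \<in> A" for a b
  proof (rule hom_eqI)
    have "a \<otimes> b \<in> min_tensor A A"
      unfolding min_tensor_def using that by (intro subsetD[OF closure_subset] span_base) (auto simp: elem_tensors_def)
    then show "cinner x (F (a \<otimes> b) y) = cinner x ((h b *\<^sub>C a) y)" for x y
      using that A'(9) by (simp add: Fc sc mult.commute)
  qed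
  ultimately show ?thesis by (intro exI conjI ballI) auto
qed

text \<open>Invariance of the Haar state is stated through \<open>norm_ext\<close>. Here that
  description is evaluated on finite sums: existence is \<open>min_tensor_slice_ext\<close>,
  uniqueness is continuity on the closure of the span.\<close>

lemma norm_ext_slice:
  assumes A: "unital_star_algebra A" "closed A" and h: "state_on A h"
    and K: "finite K" "\<And>k. k \<in> K \<Longrightarrow> a k \<in> A" "\<And>k. k \<in> K \<Longrightarrow> b k \<in> A"
  shows "norm_ext A A (\<lambda>b c. h c *\<^sub>C b) (\<Sum>k\<in>K. a k \<otimes> b k) = (\<Sum>k\<in>K. h (b k) *\<^sub>C a k)"
proof -
  let ?V = "min_tensor A A"
  obtain F where F: "linear_map_on ?V F" "continuous_on ?V F" "\<forall>a\<in>A. \<forall>b\<in>A. F (a \<otimes> b) = h b *\<^sub>C a"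
    using min_tensor_slice_ext[OF A h] by (elim exE conjE)
  have mt: "subspace ?V" by (rule min_tensor_linear[OF A(1)])
  have el: "s \<in> ?V" if "s \<in> elem_tensors A A" for s
    unfolding min_tensor_def using that by (intro subsetD[OF closure_subset] span_base)
  let ?F = "restrict F ?V"
  note star = star_algebraD[OF elem_tensors_star[OF A(1) A(1)]]
  have uniq: "F' = ?F" if F': "F' \<in> extensional ?V" "linear_map_on ?V F'" "continuous_on ?V F'" "\<forall>a\<in>A. \<forall>b\<in>A. F' (a \<otimes> b) = h b *\<^sub>C a" for F'
  proof (rule extensionalityI[OF F'(1) restrict_extensional])
    fix T assume T: "T \<in> ?V"
    have "F' s = F s" if "s \<in> elem_tensors A A" for s using that F(3) F'(4) by (auto simp: elem_tensors_def)
    then have sp: "F' s = F s" if "s \<in> span (elem_tensors A A)" for s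
      using linear_map_on_span_eq[OF F'(2) F(1) _ mt subspace_0[OF mt] _ that] el by blast
    obtain X where X: "\<forall>n. X n \<in> span (elem_tensors A A)" "X \<longlonglongrightarrow> T" using T unfolding min_tensor_def closure_sequential by blast
    have Xn: "X n \<in> ?V" for n using X(1) closure_subset unfolding min_tensor_def by blast
    have "(\<lambda>n. F (X n)) \<longlonglongrightarrow> F T" by (rule continuous_on_tendsto_compose[OF F(2) X(2) T]) (simp add: Xn)
    moreover have "(\<lambda>n. F' (X n)) \<longlonglongrightarrow> F' T" by (rule continuous_on_tendsto_compose[OF F'(3) X(2) T]) (simp add: Xn)
    ultimately have "F' T = F T" using sp X(1) by (simp add: LIMSEQ_unique)
    then show "F' T = ?F T" using T by simp
  qed
  have lin: "linear_map_on ?V ?F"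
    using F(1) subspace_add[OF mt] unfolding linear_map_on_def
    by (simp add: min_tensor_linear(2)[OF A(1)])
  have con: "continuous_on ?V ?F" using F(2) by (rule continuous_on_eq) simp
  have val: "\<forall>a\<in>A. \<forall>b\<in>A. ?F (a \<otimes> b) = h b *\<^sub>C a"
  proof (intro ballI)
    fix a b assume "a \<in> A" "b \<in> A"
    then show "?F (a \<otimes> b) = h b *\<^sub>C a" using F(3) el[of "a \<otimes> b"] by (auto simp: elem_tensors_def)
  qed
  have "norm_ext A A (\<lambda>b c. h c *\<^sub>C b) = ?F" unfolding norm_ext_def
    by (rule the_equality) (use lin con val uniq in simp_all)
  moreover have "?F (\<Sum>k\<in>K. a k \<otimes> b k) = (\<Sum>k\<in>K. h (b k) *\<^sub>C a k) \<and> (\<Sum>k\<in>K. a k \<otimes> b k) \<in> ?V"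
    using K
  proof (induction K rule: finite_induct)
    case empty
    have "?F (0 *\<^sub>C 0) = 0 *\<^sub>C ?F 0" using lin subspace_0[OF mt] unfolding linear_map_on_def by blast
    then show ?case using subspace_0[OF mt] by simp
  next
    case (insert k K)
    then have "a k \<otimes> b k \<in> ?V" by (intro el) (auto simp: elem_tensors_def)
    moreover from this have "?F (a k \<otimes> b k + (\<Sum>k\<in>K. a k \<otimes> b k)) = ?F (a k \<otimes> b k) + ?F (\<Sum>k\<in>K. a k \<otimes> b k)"
      using lin insert by (simp add: linear_map_on_def)
    moreover have "?F (a k \<otimes> b k) = h (b k) *\<^sub>C a k" using val insert by simp
    moreover have IH: "(\<Sum>k\<in>K. a k \<otimes> b k) \<in> ?V" "?F (\<Sum>k\<in>K. a k \<otimes> b k) = (\<Sum>k\<in>K. h (b k) *\<^sub>C a k)"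
      using insert.IH insert.prems by auto
    ultimately show ?case unfolding sum.insert[OF insert.hyps] using subspace_add[OF mt _ IH(1), of "a k \<otimes> b k"] by (simp only: IH)
  qed
  ultimately show ?thesis by (simp only:)
qed

section \<open>Normal homomorphisms of the algebra of block diagonal operators\<close>

text \<open>After a flip of the amplification, a sigma-weak functional evaluated at
  \<open>proj S\<close> is the partial sum over \<open>S\<close> of the inner products of the rows
  of its two vectors.\<close>

lemma proj_limit: "limitin sigma_weak proj \<one> (finite_subsets_at_top UNIV)"
proof (rule limitin_sigma_weakI)
  fix w :: "'i op \<Rightarrow> complex" assume "w \<in> sigma_weak_functionals"
  from functional_amp[OF this] obtain X Y :: "(nat \<times> 'i) ell2"
    where w: "\<forall>T\<in>clin. w T = cinner X ((\<one> \<otimes> T) Y)" by (elim exE)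
  define X' Y' where "X' = basis_map prod.swap X" and "Y' = basis_map prod.swap Y"
  have ia: "adj (basis_map prod.swap) = (basis_map prod.swap :: ('i \<times> nat, nat \<times> 'i) hom)"
    using adj_basis_map[of "prod.swap :: nat \<times> 'i \<Rightarrow> _"] inv_equality[of prod.swap "prod.swap :: nat \<times> 'i \<Rightarrow> _"] by simp
  have Y: "Y = adj (basis_map prod.swap) Y'"
    unfolding Y'_def using basis_map_unitary(1)[of "prod.swap :: nat \<times> 'i \<Rightarrow> _"] by (metis bij_swap blinfun_apply_blinfun_compose id_blinfun.rep_eq)
  have wT: "w T = cinner X' ((T \<otimes> \<one>) Y')" if "T \<in> clin" for T
  proof -
    have "cinner X ((\<one> \<otimes> T) Y) = cinner X (adj (basis_map prod.swap) ((T \<otimes> \<one>) Y'))"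
    proof -
      have "(\<one> \<otimes> T) \<cdot> basis_map prod.swap = basis_map prod.swap \<cdot> (T \<otimes> \<one>)"
        using that by (intro hom_eq_tensorI) (auto simp: swap_tensor)
      from compose_eqD[OF this, of Y'] show ?thesis unfolding Y ia by simp
    qed
    then show ?thesis using w that by (simp add: cinner_adj_right X'_def)
  qed
  have r: "row i ((proj S \<otimes> \<one>) Y') = (if i \<in> S then row i Y' else 0)" for S i
  proof -
    have p: "proj S (basis_vec i) = (if i \<in> S then basis_vec i else 0)" for i by (auto intro!: coord_eqI simp: proj coord_basis)
    have "adj (lvec (basis_vec i)) \<cdot> (proj S \<otimes> \<one>) = (if i \<in> S then adj (lvec (basis_vec i)) else 0)"
      by (rule hom_eq_tensorI) (auto simp: proj)
    from arg_cong[OF this, of "\<lambda>X. blinfun_apply X Y'"] show ?thesis by (simp split: if_splits)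
  qed
  have "cinner X' ((proj S \<otimes> \<one>) Y') = (\<Sum>i\<in>S. cinner (row i X') (row i Y'))" if S: "finite S" for S
  proof (rule has_sum_unique[OF cinner_rows])
    show "((\<lambda>i. cinner (row i X') (row i ((proj S \<otimes> \<one>) Y'))) has_sum (\<Sum>i\<in>S. cinner (row i X') (row i Y'))) UNIV"
      unfolding r by (rule has_sum_finite_neutralI[OF S]) (auto)
  qed
  then have e: "w (proj S) = (\<Sum>i\<in>S. cinner (row i X') (row i Y'))" if "finite S" for S using that by (simp add: wT proj)
  have "((\<lambda>S. \<Sum>i\<in>S. cinner (row i X') (row i Y')) \<longlongrightarrow> cinner X' Y') (finite_subsets_at_top UNIV)"
    using cinner_rows[of X' Y'] by (simp add: has_sum_def)
  then show "((\<lambda>S. w (proj S)) \<longlongrightarrow> w \<one>) (finite_subsets_at_top UNIV)"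
    by (subst tendsto_cong[where g="\<lambda>S. \<Sum>i\<in>S. cinner (row i X') (row i Y')"])
      (auto simp: e wT intro!: eventually_finite_subsets_at_top_weakI)
qed

lemma proj_sum: "finite S \<Longrightarrow> proj S = (\<Sum>e\<in>S. mu e e)"
  by (rule clin_eqI) (auto intro!: coord_eqI simp: proj sum_apply coord_sum coord_basis if_distrib[of "\<lambda>c. _ * c"] cong: if_cong)

lemma linear_map_on_sum:
  assumes "linear_map_on A F" "unital_star_algebra A" "\<And>p. p \<in> S \<Longrightarrow> T p \<in> A"
  shows "F (\<Sum>p\<in>S. T p) = (\<Sum>p\<in>S. F (T p))"
proof -
  have z: "F 0 = 0"
    using assms(1) star_algebraD(7)[OF assms(2)] unfolding linear_map_on_def by (metis scaleC_simps(3))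
  show ?thesis using assms(3)
  proof (induction S rule: infinite_finite_induct)
    case (insert x S)
    have "T x \<in> A" "(\<Sum>p\<in>S. T p) \<in> A" using insert.prems by (auto intro: star_algebra_sum[OF assms(2)])
    then show ?case using assms(1) insert by (simp add: linear_map_on_def)
  qed (simp_all add: z)
qed

lemma homD:
  assumes "unital_star_hom A B F"
  shows "a \<in> A \<Longrightarrow> b \<in> A \<Longrightarrow> F (a + b) = F a + F b" "a \<in> A \<Longrightarrow> F (c *\<^sub>C a) = c *\<^sub>C F a" "F \<one> = \<one>"
    "a \<in> A \<Longrightarrow> b \<in> A \<Longrightarrow> F (a \<cdot> b) = F a \<cdot> F b" "a \<in> A \<Longrightarrow> F (adj a) = adj (F a)" "a \<in> A \<Longrightarrow> F a \<in> B" "linear_map_on A F"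
  using assms by (auto simp: unital_star_hom_def linear_map_on_def)

lemma mu_linf': "a \<in> linf G \<Longrightarrow> finite (fib G (lab G e)) \<Longrightarrow> a \<cdot> mu e f = (\<Sum>g\<in>fib G (lab G e). ent a g e *\<^sub>C mu g f)"
proof (rule clin_eqI)
  fix i assume a: "a \<in> linf G" and fin: "finite (fib G (lab G e))"
  have "a (basis_vec e) = (\<Sum>g\<in>fib G (lab G e). cscale (ent a g e) (basis_vec g))"
    using a fin by (intro coord_eqI) (auto simp: coord_sum coord_basis linf_iff fib_def if_distrib[of "\<lambda>c. _ * c"] cong: if_cong)
  then have "cscale d (a (basis_vec e)) = (\<Sum>g\<in>fib G (lab G e). cscale d (cscale (ent a g e) (basis_vec g)))" for d
    by (metis cscale.sum_right)
  then show "(a \<cdot> mu e f) (basis_vec i) = (\<Sum>g\<in>fib G (lab G e). ent a g e *\<^sub>C mu g f) (basis_vec i)"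
    using a by (simp add: sum_apply clinD linf_iff mult.commute)
qed (auto simp: linf_iff)

text \<open>The uniqueness part of \<open>dual_comult\<close> has to deal with arbitrary normal
  homomorphisms. The aim of this locale is to show that each of them is spatial, so that tensoring
  it with an identity makes sense.\<close>

locale normal_hom =
  fixes G :: "('k, 'x, 'e, 'i) cqg_reps" and B :: "'m op set" and D :: "'e op \<Rightarrow> 'm op"
  assumes hom: "unital_star_hom (linf G) B D" and normal: "normal_on (linf G) D" and B: "B \<subseteq> clin" and fin: "finite (fib G x)"
begin

lemma D_clin: "a \<in> linf G \<Longrightarrow> D a \<in> clin" using homD(6)[OF hom] B by auto

text \<open>Normality enters here: finite sums of the \<open>mu e e\<close> converge sigma-weakly to
  the unit, hence so do their images, and a vector annihilated by all images is annihilated by the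
  unit.\<close>

lemma total: assumes "\<And>e. D (mu e e) x = 0" shows "x = 0"
proof -
  have pl: "proj S \<in> linf G" if "finite S" for S
    unfolding proj_sum[OF that] by (rule star_algebra_sum[OF linf_star]) (simp add: mu_linf)
  have "limitin (subtopology sigma_weak (linf G)) proj \<one> (finite_subsets_at_top UNIV)"
    unfolding limitin_subtopology using proj_limit star_algebraD(2)[OF linf_star] pl
    by (auto intro!: eventually_finite_subsets_at_top_weakI)
  from continuous_map_limit[OF normal[unfolded normal_on_def] this]
  have "limitin sigma_weak (\<lambda>S. D (proj S)) \<one> (finite_subsets_at_top UNIV)" by (simp add: o_def homD(3)[OF hom])
  from limitin_functional[OF this vector_functional[of x x]]
  have "((\<lambda>S. cinner x (D (proj S) x)) \<longlongrightarrow> cinner x x) (finite_subsets_at_top UNIV)" by simp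
  moreover have "((\<lambda>S. cinner x (D (proj S) x)) \<longlongrightarrow> 0) (finite_subsets_at_top UNIV)"
    by (rule tendsto_eventually, rule eventually_finite_subsets_at_top_weakI)
      (simp add: proj_sum linear_map_on_sum[OF homD(7)[OF hom] linf_star] mu_linf sum_apply assms)
  ultimately have "cinner x x = 0" by (rule tendsto_unique[OF finite_subsets_at_top_neq_bot])
  then show ?thesis by simp
qed

lemma D_mu: "a \<in> linf G \<Longrightarrow> lab G e = lab G f \<Longrightarrow> D a \<cdot> D (mu e f) = (\<Sum>g\<in>fib G (lab G e). ent a g e *\<^sub>C D (mu g f))"
proof -
  assume a: "a \<in> linf G" and ef: "lab G e = lab G f"
  have m: "mu g f \<in> linf G" if "g \<in> fib G (lab G e)" for g using that ef by (intro mu_linf) (simp add: fib_def)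
  have "D a \<cdot> D (mu e f) = D (a \<cdot> mu e f)" using homD(4)[OF hom a mu_linf[OF ef]] by simp
  also have "\<dots> = (\<Sum>g\<in>fib G (lab G e). D (ent a g e *\<^sub>C mu g f))"
    unfolding mu_linf'[OF a fin] using m by (intro linear_map_on_sum[OF homD(7)[OF hom] linf_star] star_algebraD(6)[OF linf_star])
  also have "\<dots> = (\<Sum>g\<in>fib G (lab G e). ent a g e *\<^sub>C D (mu g f))"
    using m by (intro sum.cong refl homD(2)[OF hom])
  finally show ?thesis .
qed

lemma D_mu_mu: "lab G e = lab G f \<Longrightarrow> lab G g = lab G h \<Longrightarrow> D (mu e f) \<cdot> D (mu g h) = (if f = g then D (mu e h) else 0)"
proof -
  assume l: "lab G e = lab G f" "lab G g = lab G h"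
  have "D 0 = 0" using homD(2)[OF hom star_algebraD(7)[OF linf_star], of 0] by simp
  then show ?thesis using homD(4)[OF hom mu_linf[OF l(1)] mu_linf[OF l(2)]] by (simp split: if_splits)
qed

lemma adj_D_mu: "lab G e = lab G f \<Longrightarrow> adj (D (mu e f)) = D (mu f e)"
  using homD(5)[OF hom mu_linf, of e f] by simp

lemma mu_total: assumes "\<And>e k. cinner (D (mu e (b (lab G e))) k) x = 0" "\<And>e. lab G (b (lab G e)) = lab G e" shows "x = 0"
proof (rule total, rule cinner_eqI)
  fix e z
  have ee: "D (mu e e) = D (mu e (b (lab G e))) \<cdot> D (mu (b (lab G e)) e)" using D_mu_mu[of e "b (lab G e)" "b (lab G e)" e] assms(2) by simp
  have "cinner z (D (mu e e) x) = cinner (D (mu e e) z) x"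
    using cinner_adj_right[of "D (mu e e)" z x] adj_D_mu[of e e] D_clin[OF mu_linf] by simp
  then show "cinner z (D (mu e e) x) = cinner z 0" unfolding ee using assms(1) by simp
qed

text \<open>The isometry \<open>Y\<close> maps \<open>D(e\<^bsub>e b\<^esub>) k\<close> to \<open>e \<otimes> D(e\<^bsub>b b\<^esub>) k\<close>, with \<open>b\<close> a base point in the fibre of \<open>e\<close>.\<close>

lemma spatial: "\<exists>Y\<in>(clin :: ('m, 'e \<times> 'm) hom set). \<forall>a\<in>linf G. D a = adj Y \<cdot> (a \<otimes> \<one>) \<cdot> Y"
proof -
  define b where "b x = (SOME e. lab G e = x)" for x
  have b: "lab G (b (lab G e)) = lab G e" for e unfolding b_def by (rule someI[of _ e]) simp
  define s where "s p = D (mu (fst p) (b (lab G (fst p)))) (snd p)" for p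
  define t where "t p = basis_vec (fst p) \<otimes>\<^sub>v D (mu (b (lab G (fst p))) (b (lab G (fst p)))) (snd p)" for p
  have gram: "cinner (s p) (s q) = cinner (t p) (t q)" for p q
  proof -
    have pp: "D (mu (b x) (b x)) (D (mu (b x) (b x)) y) = D (mu (b x) (b x)) y" for x y
      using arg_cong[OF D_mu_mu[of "b x" "b x" "b x" "b x"], of "\<lambda>X. blinfun_apply X y"] by simp
    have "cinner (s p) (s q) = cinner (snd p) ((D (mu (b (lab G (fst p))) (fst p)) \<cdot> D (mu (fst q) (b (lab G (fst q))))) (snd q))"
      unfolding s_def using cinner_adj_left[of "D (mu (b (lab G (fst p))) (fst p))"] adj_D_mu[of "b (lab G (fst p))" "fst p"] D_clin[OF mu_linf] b by simp
    also have "\<dots> = (if fst p = fst q then cinner (snd p) ((D (mu (b (lab G (fst p))) (b (lab G (fst p)))) \<cdot> D (mu (b (lab G (fst p))) (b (lab G (fst p))))) (snd q)) else 0)"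
      using D_mu_mu[of "b (lab G (fst p))" "fst p" "fst q" "b (lab G (fst q))"]
        b by (simp add: pp)
    also have "\<dots> = cinner (t p) (t q)"
      unfolding t_def using cinner_adj_left[of "D (mu (b (lab G (fst p))) (b (lab G (fst p))))"]
        adj_D_mu[of "b (lab G (fst p))" "b (lab G (fst p))"] D_clin[OF mu_linf] b by (auto simp: coord_basis)
    finally show ?thesis .
  qed
  have "\<exists>Y\<in>clin. (\<forall>p. blinfun_apply Y (s p) = t p) \<and> adj Y \<cdot> Y = \<one>"
  proof (rule isometry_extension[OF gram], rule mu_total[OF _ b])
    fix x e k assume "\<And>p. cinner (s p) x = 0"
    from this[of "(e, k)"] show "cinner (D (mu e (b (lab G e))) k) x = 0" by (simp add: s_def)
  qed
  then obtain Y where Y: "Y \<in> clin" "\<forall>p. Y (s p) = t p" "adj Y \<cdot> Y = \<one>" by (elim bexE conjE)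
  have main: "D a = adj Y \<cdot> (a \<otimes> \<one>) \<cdot> Y" if a: "a \<in> linf G" for a
  proof -
    have ac: "a \<in> clin" using a by (simp add: linf_iff)
    \<comment> \<open>The defect of the intertwining relation. It vanishes on the total vectors
      \<open>s (e, k)\<close>, because \<open>D a\<close> applied to them involves column
      \<open>e\<close> of \<open>a\<close> only, exactly as \<open>a \<otimes> \<one>\<close> does
      on the vectors \<open>t\<close>.\<close>
    define R where "R = ((a \<otimes> \<one>) \<cdot> Y) - (Y \<cdot> D a)"
    have Rc: "R \<in> clin" using ac Y D_clin[OF a] by (simp add: R_def)
    have Rs: "R (s (e, k)) = 0" for e k
    proof -
      have "Y (D a (s (e, k))) = Y (\<Sum>g\<in>fib G (lab G e). cscale (ent a g e) (s (g, k)))"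
      proof -
        have "D a (s (e, k)) = (D a \<cdot> D (mu e (b (lab G e)))) k" by (simp add: s_def)
        also have "\<dots> = (\<Sum>g\<in>fib G (lab G e). cscale (ent a g e) (s (g, k)))"
          unfolding D_mu[OF a b[symmetric]] by (auto simp: sum_apply s_def fib_def intro!: sum.cong)
        finally show ?thesis by simp
      qed
      also have "\<dots> = (\<Sum>g\<in>fib G (lab G e). cscale (ent a g e) (t (g, k)))"
        using Y by (simp add: blinfun.sum_right clinD)
      also have "\<dots> = (\<Sum>g\<in>fib G (lab G e). cscale (ent a g e) (basis_vec g)) \<otimes>\<^sub>v D (mu (b (lab G e)) (b (lab G e))) k"
        by (auto simp: vec_tensor.sum_left vec_tensor_simps t_def fib_def intro!: sum.cong)
      also have "(\<Sum>g\<in>fib G (lab G e). cscale (ent a g e) (basis_vec g)) = a (basis_vec e)"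
        using arg_cong[OF mu_linf'[OF a fin, of e e], of "\<lambda>X. blinfun_apply X (basis_vec e)"] by (simp add: sum_apply coord_basis)
      finally show ?thesis using Y by (simp add: R_def blinfun.diff_left t_def ac)
    qed
    have "adj R z = 0" for z
    proof (rule mu_total[OF _ b])
      fix e k show "cinner (D (mu e (b (lab G e))) k) (adj R z) = 0"
        using Rs[of e k] Rc by (simp add: cinner_adj_right s_def)
    qed
    then have "adj R = 0" by (intro blinfun_eqI) simp
    then have "R = 0" using Rc by (metis adj_adj adj_simps(1))
    then have "(a \<otimes> \<one>) \<cdot> Y = Y \<cdot> D a" by (simp add: R_def)
    then have "adj Y \<cdot> (a \<otimes> \<one>) \<cdot> Y = (adj Y \<cdot> Y) \<cdot> D a" by (simp add: compose_assoc)
    then show ?thesis by (simp add: Y(3))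
  qed
  show ?thesis by (rule bexI[of _ Y], rule ballI, rule main, assumption, rule Y(1))
qed

end

text \<open>The products \<open>D a \<cdot> D (mu e e)\<close> depend only on the entries of
  \<open>a\<close> and on the images of matrix units, and the ranges of the
  \<open>D (mu e e)\<close> are total.\<close>

lemma normal_hom_unique:
  assumes D: "normal_hom G B D" and D': "normal_hom G B' D'"
    and eq: "\<And>e f. lab G e = lab G f \<Longrightarrow> D (mu e f) = D' (mu e f)" and a: "a \<in> linf G"
  shows "D a = D' a"
proof -
  have "D a \<cdot> D (mu e e) = D' a \<cdot> D (mu e e)" for e
    unfolding normal_hom.D_mu[OF D a refl] unfolding eq[OF refl, of e] normal_hom.D_mu[OF D' a refl]
    by (auto simp: fib_def eq intro!: sum.cong)
  then have *: "(D a - D' a) \<cdot> D (mu e e) = 0" for e by (simp add: blinfun_compose.diff_left)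
  have c: "D a - D' a \<in> clin" using normal_hom.D_clin[OF D a] normal_hom.D_clin[OF D' a] by simp
  have "adj (D a - D' a) z = 0" for z
  proof (rule normal_hom.total[OF D])
    fix e
    have m: "D (mu e e) \<in> clin" by (rule normal_hom.D_clin[OF D mu_linf]) simp
    have "adj ((D a - D' a) \<cdot> D (mu e e)) = 0" unfolding * by simp
    then have "D (mu e e) \<cdot> adj (D a - D' a) = 0"
      unfolding adj_compose[OF c m] normal_hom.adj_D_mu[OF D refl] .
    from arg_cong[OF this, of "\<lambda>X. blinfun_apply X z"] show "D (mu e e) (adj (D a - D' a) z) = 0" by simp
  qed
  then have "adj (D a - D' a) = 0" by (intro blinfun_eqI) simp
  then have "D a - D' a = 0" using c by (metis adj_adj adj_simps(1))
  then show ?thesis by simp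
qed

section \<open>Compact quantum groups\<close>

locale cqg =
  fixes G :: "('k, 'x, 'e, 'i) cqg_reps"
  assumes cqg: "cqg_with_reps G"
begin

abbreviation "A \<equiv> calg G"
abbreviation "h \<equiv> haar G"
abbreviation "\<pi> \<equiv> gns G"
abbreviation "l \<equiv> lab G"
abbreviation "cls e \<equiv> fib G (l e)"

lemma star: "unital_star_algebra A" and closed: "closed A" and state: "state_on A h" and \<pi>_hom: "unital_star_hom A clin \<pi>"
  using cqg by (auto simp: cqg_with_reps_def compact_quantum_group_def haar_state_def gns_rep_def Let_def)

definition "\<xi> = (SOME \<xi>. (\<forall>a\<in>A. h a = cinner \<xi> (blinfun_apply (\<pi> a) \<xi>)) \<and> closure ((\<lambda>a. blinfun_apply (\<pi> a) \<xi>) ` A) = UNIV)"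

lemma \<xi>: "a \<in> A \<Longrightarrow> h a = cinner \<xi> (\<pi> a \<xi>)"
proof -
  have "\<exists>\<xi>. (\<forall>a\<in>A. h a = cinner \<xi> (blinfun_apply (\<pi> a) \<xi>)) \<and> closure ((\<lambda>a. blinfun_apply (\<pi> a) \<xi>) ` A) = UNIV"
    using cqg by (simp add: cqg_with_reps_def gns_rep_def)
  note * = conjunct1[OF someI_ex[OF this, folded \<xi>_def]]
  show "a \<in> A \<Longrightarrow> h a = cinner \<xi> (\<pi> a \<xi>)" by (rule bspec[OF *])
qed

lemma irr: "irred_representatives G" using cqg by (simp add: cqg_with_reps_def)

lemma rep: "unitary_rep G (fib G x) (coef G)" and irreducible: "irreducible_rep (fib G x) (coef G)"
  using irr by (auto simp: irred_representatives_def)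

lemma fin [simp]: "finite (fib G x)" using rep[of x] by (simp add: unitary_rep_def)

lemma fib_ne: "fib G x \<noteq> {}" using irreducible[of x] by (simp add: irreducible_rep_def)

lemma mem_fib [simp]: "e \<in> fib G x \<longleftrightarrow> l e = x" by (simp add: fib_def)

lemma coef_A: "l e = l f \<Longrightarrow> coef G e f \<in> A" using rep[of "l e"] by (simp add: unitary_rep_def)

lemma coef_unitary:
  "l e = l e' \<Longrightarrow> (\<Sum>f\<in>cls e. coef G e f \<cdot> adj (coef G e' f)) = (if e = e' then \<one> else 0)"
  "l e = l e' \<Longrightarrow> (\<Sum>f\<in>cls e. adj (coef G f e) \<cdot> coef G f e') = (if e = e' then \<one> else 0)"
  using rep[of "l e"] by (simp_all add: unitary_rep_def unitary_matrix_def)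

definition gU :: "'e \<Rightarrow> 'e \<Rightarrow> 'i op" where "gU e f = (if l e = l f then \<pi> (coef G e f) else 0)"

lemma \<pi>_sum: "(\<And>p. p \<in> S \<Longrightarrow> T p \<in> A) \<Longrightarrow> \<pi> (\<Sum>p\<in>S. T p) = (\<Sum>p\<in>S. \<pi> (T p))"
  by (rule linear_map_on_sum[OF homD(7)[OF \<pi>_hom] star])

lemma \<pi>_zero: "\<pi> 0 = 0" using homD(2)[OF \<pi>_hom star_algebraD(7)[OF star], of 0] by simp

sublocale V: block_unitary l l gU
proof
  show "finite {e. l e = x}" for x using fin[of x] by (simp add: fib_def)
  show "gU e f \<in> clin" for e f using homD(6)[OF \<pi>_hom coef_A, of e f] by (simp add: gU_def)
  show "gU e f = 0" if "l e \<noteq> l f" for e f using that by (simp add: gU_def)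
  fix e e' assume ee: "l e = l e'"
  have "(\<Sum>f | l f = l e. gU e f \<cdot> adj (gU e' f)) = \<pi> (\<Sum>f\<in>cls e. coef G e f \<cdot> adj (coef G e' f))"
    using ee coef_A by (subst \<pi>_sum) (auto simp: fib_def gU_def homD[OF \<pi>_hom] star_algebraD[OF star] intro!: sum.cong)
  then show "(\<Sum>f | l f = l e. gU e f \<cdot> adj (gU e' f)) = (if e = e' then \<one> else 0)"
    using coef_unitary(1)[OF ee] by (simp add: homD(3)[OF \<pi>_hom] \<pi>_zero)
  have "(\<Sum>f | l f = l e. adj (gU f e) \<cdot> gU f e') = \<pi> (\<Sum>f\<in>cls e. adj (coef G f e) \<cdot> coef G f e')"
    using ee coef_A by (subst \<pi>_sum) (auto simp: fib_def gU_def homD[OF \<pi>_hom] star_algebraD[OF star] intro!: sum.cong)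
  then show "(\<Sum>f | l f = l e. adj (gU f e) \<cdot> gU f e') = (if e = e' then \<one> else 0)"
    using coef_unitary(2)[OF ee] by (simp add: homD(3)[OF \<pi>_hom] \<pi>_zero)
qed

abbreviation "V \<equiv> mult_unitary G"

lemma V_def: "V = block_op gU" by (simp add: mult_unitary_def gU_def[abs_def])

lemma haar_invariant:
  assumes "l i = l j" shows "(\<Sum>k\<in>cls i. h (coef G k j) *\<^sub>C coef G i k) = h (coef G i j) *\<^sub>C \<one>"
proof -
  have "norm_ext A A (\<lambda>b c. h c *\<^sub>C b) (comult G (coef G i j)) = h (coef G i j) *\<^sub>C \<one>"
    using cqg coef_A[OF assms] by (simp add: cqg_with_reps_def haar_state_def Let_def)
  moreover have "comult G (coef G i j) = (\<Sum>k\<in>cls i. coef G i k \<otimes> coef G k j)"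
    using rep[of "l i"] assms by (simp add: unitary_rep_def)
  ultimately show ?thesis using norm_ext_slice[OF star closed state fin, of "l i" "\<lambda>k. coef G i k" "\<lambda>k. coef G k j"] assms coef_A by simp
qed

text \<open>A fixed vector \<open>w\<close> makes the rank one matrix with entries
  \<open>w i * cnj (w k)\<close> a self-intertwiner, hence a scalar by irreducibility. A nonzero
  scalar matrix of rank one lives on a single index, where fixedness makes the coefficient equal to
  the unit; the representation is then equivalent to the trivial one.\<close>

lemma fixed_vector_trivial:
  assumes j: "l j = x" and w: "\<And>i. l i = x \<Longrightarrow> (\<Sum>k\<in>fib G x. w k *\<^sub>C coef G i k) = w i *\<^sub>C \<one>" and nz: "w j \<noteq> 0"
  shows "x = triv G"
proof -
  have cl: "coef G e f \<in> clin" if "l e = l f" for e f using coef_A[OF that] star_algebraD(1)[OF star] by auto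
  \<comment> \<open>Unitarity turns the fixed column \<open>w\<close> into a fixed row of
    conjugates; both are needed for the intertwining relation of the rank one matrix.\<close>
  have w': "(\<Sum>k\<in>fib G x. cnj (w k) *\<^sub>C coef G k i) = cnj (w i) *\<^sub>C \<one>" if i: "l i = x" for i
  proof -
    have "(\<Sum>k\<in>fib G x. w k *\<^sub>C adj (coef G k i)) = (\<Sum>k\<in>fib G x. adj (coef G k i) \<cdot> (\<Sum>k'\<in>fib G x. w k' *\<^sub>C coef G k k'))"
      using w i cl by (intro sum.cong) auto
    also have "\<dots> = (\<Sum>k'\<in>fib G x. w k' *\<^sub>C (\<Sum>k\<in>fib G x. adj (coef G k i) \<cdot> coef G k k'))"
      unfolding compose_sum_right scaleC_sum using cl i by (subst sum.swap) (auto intro!: sum.cong)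
    also have "\<dots> = (\<Sum>k'\<in>fib G x. if i = k' then w i *\<^sub>C \<one> else 0)" (is "sum ?f _ = sum ?g _")
    proof (rule sum.cong[OF refl])
      fix k' assume "k' \<in> fib G x"
      then show "?f k' = ?g k'"
        using coef_unitary(2)[of i k'] i by simp
    qed
    finally have "adj (\<Sum>k\<in>fib G x. w k *\<^sub>C adj (coef G k i)) = adj (w i *\<^sub>C \<one>)" using i by simp
    then show ?thesis using cl i by (subst (asm) adj_sum) (auto intro!: sum.cong)
  qed
  let ?M = "\<lambda>i k. if l i = x \<and> l k = x then w i * cnj (w k) else 0"
  have "?M \<in> Mor (fib G x) (coef G) (fib G x) (coef G)"
    unfolding Mor_def supported_def
  proof (intro CollectI conjI allI ballI impI)
    fix i k assume ik: "i \<in> fib G x" "k \<in> fib G x"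
    have "(\<Sum>m\<in>fib G x. ?M m k *\<^sub>C coef G i m) = cnj (w k) *\<^sub>C (\<Sum>m\<in>fib G x. w m *\<^sub>C coef G i m)"
      unfolding scaleC_sum using ik by (intro sum.cong) (auto simp: mult.commute)
    also have "\<dots> = w i *\<^sub>C (\<Sum>m\<in>fib G x. cnj (w m) *\<^sub>C coef G m k)"
      using w[of i] w'[of k] ik by (simp add: mult.commute)
    also have "\<dots> = (\<Sum>m\<in>fib G x. ?M i m *\<^sub>C coef G m k)"
      unfolding scaleC_sum using ik by (intro sum.cong) auto
    finally show "(\<Sum>m\<in>fib G x. ?M m k *\<^sub>C coef G i m) = (\<Sum>m\<in>fib G x. ?M i m *\<^sub>C coef G m k)" .
  qed (auto split: if_splits)
  then obtain c where "?M = (\<lambda>i k. c * id_mat (fib G x) i k)" using irreducible[of x] by (auto simp: irreducible_rep_def)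
  then have c: "?M i k = c * id_mat (fib G x) i k" for i k by (rule fun_cong[THEN fun_cong])
  have one: "i = j" if i: "l i = x" for i
  proof (rule ccontr)
    assume "i \<noteq> j"
    then have "w j * cnj (w i) = 0" using c[of j i] i j by (simp add: id_mat_def)
    then have "c = 0" using c[of i i] i nz by (simp add: id_mat_def)
    then show False using c[of j j] j nz by (simp add: id_mat_def)
  qed
  have fx: "fib G x = {j}"
  proof (intro set_eqI iffI)
    show "i \<in> {j}" if "i \<in> fib G x" for i using that one[of i] by simp
    show "i \<in> fib G x" if "i \<in> {j}" for i using that j by simp
  qed
  have "w j *\<^sub>C coef G j j = w j *\<^sub>C \<one>" using w[OF j] by (simp add: fx)
  then have "inverse (w j) *\<^sub>C w j *\<^sub>C coef G j j = inverse (w j) *\<^sub>C w j *\<^sub>C \<one>" by simp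
  then have uj: "coef G j j = \<one>" using nz by simp
  obtain e where e: "fib G (triv G) = {e}" "coef G e e = \<one>" using irr by (auto simp: irred_representatives_def)
  let ?T = "\<lambda>i k. if i = j \<and> k = e then 1 else 0 :: complex"
  have "equivalent_reps (fib G x) (coef G) (fib G (triv G)) (coef G)"
    unfolding equivalent_reps_def
  proof (rule bexI[of _ ?T])
    show "?T \<in> Mor (fib G x) (coef G) (fib G (triv G)) (coef G)"
      using uj e by (auto simp: Mor_def supported_def fx)
    show "mult_mat (fib G (triv G)) ?T (adj_mat ?T) = id_mat (fib G x) \<and> mult_mat (fib G x) (adj_mat ?T) ?T = id_mat (fib G (triv G))"
      unfolding e(1) fx by (auto simp: mult_mat_def adj_mat_def id_mat_def fun_eq_iff)
  qed
  then show ?thesis using irr by (simp add: irred_representatives_def)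
qed

text \<open>By invariance of the Haar state, the values on a column of coefficients form a fixed
  vector.\<close>

lemma haar_coef: "l e = l f \<Longrightarrow> l e \<noteq> triv G \<Longrightarrow> h (coef G e f) = 0"
  using fixed_vector_trivial[of e "l e" "\<lambda>k. h (coef G k f)"] haar_invariant[of _ f] by force

lemma triv: "\<exists>e. fib G (triv G) = {e} \<and> coef G e e = \<one>" using irr by (auto simp: irred_representatives_def)

lemma h_gU: "cinner \<xi> (gU e f \<xi>) = (if l e = triv G \<and> l f = triv G then 1 else 0)"
proof (cases "l e = l f \<and> l e = triv G")
  case True
  then obtain g where g: "fib G (triv G) = {g}" "coef G g g = \<one>" using triv by blast
  then have "e = g" "f = g" using True mem_fib[of _ "triv G"] by (metis singletonD)+
  then show ?thesis using True \<xi>[OF coef_A[OF refl], of g] g state by (simp add: gU_def state_on_def)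
next
  case False
  then show ?thesis using haar_coef[of e f] \<xi>[OF coef_A, of e f] by (auto simp: gU_def)
qed

lemma haar_mult_adj: "l e = l f \<Longrightarrow> l e' = l f' \<Longrightarrow> h (coef G e f \<cdot> adj (coef G e' f')) = cinner \<xi> (gU e f (adj (gU e' f') \<xi>))"
  using coef_A \<xi>[of "coef G e f \<cdot> adj (coef G e' f')"] by (simp add: gU_def homD[OF \<pi>_hom] star_algebraD[OF star])

text \<open>Commutants do not see linear spans, and the zeros in \<open>gU\<close> outside of the
  fibres are harmless; thus the coefficients alone generate.\<close>

lemma Linf_alt: "Linf G = commutant (commutant (range (\<lambda>(e, f). gU e f)))"
proof -
  have "commutant (\<pi> ` coef_algebra G) = commutant (range (\<lambda>(e, f). gU e f))"
  proof (intro subset_antisym subsetI)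
    fix T assume T: "T \<in> commutant (\<pi> ` coef_algebra G)"
    have "T \<cdot> gU e f = gU e f \<cdot> T" for e f
    proof (cases "l e = l f")
      case True
      have "1 *\<^sub>C coef G e f \<in> coef_algebra G" unfolding coef_algebra_def
        by (rule span_base, rule CollectI, rule exI[of _ 1], rule exI[of _ e], rule exI[of _ f]) (simp add: True)
      then have "coef G e f \<in> coef_algebra G" by simp
      then show ?thesis using T True by (simp add: commutant_def gU_def)
    qed (simp add: gU_def)
    then show "T \<in> commutant (range (\<lambda>(e, f). gU e f))" using T by (auto simp: commutant_def)
  next
    fix T assume T: "T \<in> commutant (range (\<lambda>(e, f). gU e f))"
    then have Tc: "T \<in> clin" by (simp add: commutant_def)
    have g: "T \<cdot> gU e f = gU e f \<cdot> T" for e f using T by (auto simp: commutant_def)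
    have "coef_algebra G \<subseteq> {a \<in> A. T \<cdot> \<pi> a = \<pi> a \<cdot> T}" unfolding coef_algebra_def
    proof (rule span_minimal)
      show "{c *\<^sub>C coef G e f |c e f. l e = l f} \<subseteq> {a \<in> A. T \<cdot> \<pi> a = \<pi> a \<cdot> T}"
      proof clarify
        fix c e f assume ef: "l e = l f"
        have "T \<cdot> \<pi> (coef G e f) = \<pi> (coef G e f) \<cdot> T" using g[of e f] ef by (simp add: gU_def)
        then show "c *\<^sub>C coef G e f \<in> A \<and> T \<cdot> \<pi> (c *\<^sub>C coef G e f) = \<pi> (c *\<^sub>C coef G e f) \<cdot> T"
          using coef_A[OF ef] Tc by (simp add: homD[OF \<pi>_hom] star_algebraD[OF star])
      qed
      have r: "r *\<^sub>R a \<in> A" "\<pi> (r *\<^sub>R a) = r *\<^sub>R \<pi> a" if "a \<in> A" for r a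
        using that star_algebraD(6)[OF star that, of "of_real r"] homD(2)[OF \<pi>_hom that, of "of_real r"] by simp_all
      show "subspace {a \<in> A. T \<cdot> \<pi> a = \<pi> a \<cdot> T}"
        using \<pi>_zero by (auto simp: subspace_def r homD[OF \<pi>_hom] star_algebraD[OF star] blinfun_compose.add_left blinfun_compose.add_right
            blinfun_compose.scaleR_left blinfun_compose.scaleR_right)
    qed
    then show "T \<in> commutant (\<pi> ` coef_algebra G)" using Tc by (auto simp: commutant_def)
  qed
  then show ?thesis by (simp add: Linf_def vn_generated_def)
qed

text \<open>The only issue is closure under adjoints. It is obtained from
  \<open>V.commute_adj\<close> at the level of the commutant, so contragredient representations do
  not have to be constructed.\<close>

lemma Linf_star: "unital_star_algebra (Linf G)"
proof -
  have "adj T \<in> commutant (range (\<lambda>(e, f). gU e f))" if T: "T \<in> commutant (range (\<lambda>(e, f). gU e f))" for T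
  proof -
    have Tc: "T \<in> clin" using T by (simp add: commutant_def)
    have "T \<cdot> gU e f = gU e f \<cdot> T" for e f using T by (auto simp: commutant_def)
    from V.commute_adj[OF this] have "adj (T \<cdot> adj (gU e f)) = adj (adj (gU e f) \<cdot> T)" for e f by simp
    then show ?thesis using Tc by (auto simp: commutant_def)
  qed
  then show ?thesis unfolding Linf_alt using commutant_clin
    by (auto simp: unital_star_algebra_def intro: commutant_closed commutant_closed(5)[OF commutant_clin] commutant_adj[OF commutant_clin])
qed

lemma Linf_bicommutant: "commutant (commutant (Linf G)) = Linf G"
  unfolding Linf_alt by (rule commutant_triple[OF commutant_clin])

lemma gU_Linf: "gU e f \<in> Linf G"
  unfolding Linf_alt by (rule subsetD[OF commutant_bi]) auto

lemma blk_V: "blk e f V = gU e f"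
proof (rule hom_eqI)
  fix x y show "cinner x (blk e f V y) = cinner x (gU e f y)"
    using V.fin(1) V.m_zero[of e f] by (auto simp: V_def cinner_ls V.block_op_spec cinner.sum_right cinner_basis_basis if_distrib[of "\<lambda>c. c * _"]
        simp del: cinner_basis_left cinner_basis_right cong: if_cong)
qed

lemma V_clin [simp]: "V \<in> clin" by (simp add: V_def V.block_op_spec)

lemma V_mem: "V \<in> linf G \<otimes>\<^sub>v\<^sub>N Linf G"
  unfolding linf_tensor_iff[OF Linf_star Linf_bicommutant] by (simp add: blk_V gU_Linf V.m_zero)

lemma adjoint_action_blk:
  "b \<in> clin \<Longrightarrow> blk e e' (adjoint_action G b) =
    (\<Sum>f\<in>cls e. \<Sum>f'\<in>cls e'. ent b f f' *\<^sub>C (gU e f \<cdot> adj (gU e' f')))"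
  unfolding adjoint_action_def V_def by (subst V.blk_conj) (simp_all add: fib_def)

lemma adjoint_action_mem:
  assumes b: "b \<in> linf G" shows "adjoint_action G b \<in> linf G \<otimes>\<^sub>v\<^sub>N Linf G"
  unfolding linf_tensor_iff[OF Linf_star Linf_bicommutant]
proof (intro conjI allI)
  have bc: "b \<in> clin" using b by (simp add: linf_iff)
  then show "adjoint_action G b \<in> clin" by (simp add: adjoint_action_def)
  fix e e'
  have "blk e e' (adjoint_action G b) \<in> Linf G"
    unfolding adjoint_action_blk[OF bc] by (intro star_algebra_sum[OF Linf_star] star_algebraD[OF Linf_star] gU_Linf)
  moreover have "blk e e' (adjoint_action G b) = 0" if "l e \<noteq> l e'"
    unfolding adjoint_action_blk[OF bc] using b that by (intro sum.neutral ballI) (auto simp: linf_iff)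
  ultimately show "if l e = l e' then blk e e' (adjoint_action G b) \<in> Linf G else blk e e' (adjoint_action G b) = 0" by simp
qed

end

section \<open>The comultiplication of the discrete dual\<close>

lemma bij_leg: "bij (\<lambda>(i :: 'a, j :: 'b, k :: 'c). ((i, j), k))" "bij (\<lambda>(j :: 'b, i :: 'a, k :: 'c). ((i, j), k))"
  by (auto simp: bij_def inj_def surj_def)

context cqg
begin

definition l2 :: "'e \<times> 'e \<Rightarrow> 'x \<times> 'x" where "l2 j = (l (fst j), l (snd j))"

text \<open>The entries of the tensor square of the representations, that is of
  \<open>V_13 V_23\<close>, in the GNS representation.\<close>

definition UU :: "'e \<times> 'e \<Rightarrow> 'e \<times> 'e \<Rightarrow> 'i op" where "UU j k = gU (fst j) (fst k) \<cdot> gU (snd j) (snd k)"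

abbreviation "JJ y \<equiv> {j. l2 j = y}"

lemma JJ_Times: "JJ y = fib G (fst y) \<times> fib G (snd y)" by (auto simp: l2_def)

lemma fin_JJ [simp]: "finite (JJ y)" unfolding JJ_Times by simp

lemma UU_clin [simp]: "UU j k \<in> clin" by (simp add: UU_def)

lemma UU_zero: "l2 j \<noteq> l2 k \<Longrightarrow> UU j k = 0"
  by (auto simp: UU_def l2_def gU_def)

lemma UU_cols: "l2 j = l2 k \<Longrightarrow> (\<Sum>i\<in>JJ (l2 j). adj (UU i j) \<cdot> UU i k) = (if j = k then \<one> else 0)"
  unfolding UU_def l2_def by (rule block_unitary.cols[OF V.product])

end

text \<open>What is needed of a fusion theory. The pairs \<open>du\<close>, \<open>dv\<close> give
  vector functionals dual to the coefficients; \<open>K e f j k\<close> is the coefficient of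
  \<open>gU e f\<close> in \<open>UU j k\<close>, equivalently the entry \<open>(j, k)\<close> of
  the dual comultiplication at the matrix unit \<open>mu e f\<close>; \<open>N y\<close> is a finite
  set of classes outside of which \<open>K\<close> vanishes. \<open>K_mult\<close> and
  \<open>K_unit\<close> say that the matrices \<open>K e f\<close> behave like matrix units, and
  \<open>Q\<close> contains the orthogonality relations. One of \<open>du\<close>, \<open>dv\<close>
  is constant for each of the two groups, on opposite sides.\<close>

locale dual = cqg G for G :: "('k, 'x, 'e, 'i) cqg_reps" +
  fixes du dv :: "'e \<Rightarrow> 'e \<Rightarrow> 'i ell2" and N :: "'x \<times> 'x \<Rightarrow> 'x set"
    and K :: "'e \<Rightarrow> 'e \<Rightarrow> 'e \<times> 'e \<Rightarrow> 'e \<times> 'e \<Rightarrow> complex" and Q :: "'e \<Rightarrow> 'e \<Rightarrow> complex"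
  assumes dual_vec: "l e = l f \<Longrightarrow> l e' = l f' \<Longrightarrow> cinner (du e f) (gU e' f' (dv e f)) = (if e' = e \<and> f' = f then 1 else 0)"
    and K_eq: "K e f j k = cinner (du e f) (UU j k (dv e f))"
    and N_fin: "finite (N y)"
    and K_zero: "l e = l f \<Longrightarrow> l e \<notin> N (l2 j) \<Longrightarrow> K e f j k = 0"
    and K_prod: "l2 j = l2 k \<Longrightarrow> UU j k = (\<Sum>e | l e \<in> N (l2 j). \<Sum>f\<in>cls e. K e f j k *\<^sub>C gU e f)"
    and K_mult: "l e = l f \<Longrightarrow> l g = l d \<Longrightarrow> l2 i = l2 k \<Longrightarrow>
      (\<Sum>j\<in>JJ (l2 i). K e f i j * K g d j k) = (if f = g then K e d i k else 0)"
    and K_unit: "l2 i = l2 k \<Longrightarrow> (\<Sum>e | l e \<in> N (l2 i). K e e i k) = (if i = k then 1 else 0)"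
    and Q_eq: "l e = l f \<Longrightarrow> l e' = l f' \<Longrightarrow> l e = l e' \<Longrightarrow> cinner \<xi> (gU e f (adj (gU e' f') \<xi>)) = (if e = e' then Q f f' else 0)"
begin

abbreviation "EL L \<equiv> {e. l e \<in> L}"
abbreviation "EN y \<equiv> EL (N y)"

lemma fin_EL: "finite L \<Longrightarrow> finite (EL L)"
proof -
  assume "finite L"
  moreover have "EL L = (\<Union>x\<in>L. fib G x)" by auto
  ultimately show ?thesis by simp
qed

lemmas fin_EN [simp] = fin_EL[OF N_fin]

lemma K_supp: "l2 j \<noteq> l2 k \<Longrightarrow> K e f j k = 0"
  by (simp add: K_eq UU_zero)

text \<open>By \<open>K_mult\<close> and \<open>K_unit\<close>, the combinations of
  \<open>adj (gU f e)\<close> with coefficients \<open>K\<close> form a right inverse of the matrix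
  \<open>UU\<close>. As \<open>UU\<close> is unitary they are its adjoint, and the dual functionals
  compare the coefficients.\<close>

lemma K_star: assumes ef: "l e = l f" and jk: "l2 j = l2 k" shows "cnj (K e f k j) = K f e j k"
proof -
  let ?E = "EN (l2 j)" and ?J = "JJ (l2 j)"
  define R where "R i = (\<Sum>e\<in>?E. \<Sum>f\<in>cls e. K e f i k *\<^sub>C adj (gU f e))" for i
  have UR: "(\<Sum>m\<in>?J. UU i m \<cdot> R m) = (if i = k then \<one> else 0)" if i: "l2 i = l2 k" for i
  proof -
    have "(\<Sum>m\<in>?J. UU i m \<cdot> R m) = (\<Sum>m\<in>?J. \<Sum>e\<in>?E. \<Sum>f\<in>cls e. \<Sum>g\<in>?E. \<Sum>d\<in>cls g.
        (K e f i m * K g d m k) *\<^sub>C (gU e f \<cdot> adj (gU d g)))"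
      using i jk by (intro sum.cong refl) (simp add: K_prod R_def compose_sum_left, simp add: compose_sum_right scaleC_sum mult.commute)
    also have "\<dots> = (\<Sum>e\<in>?E. \<Sum>f\<in>cls e. \<Sum>g\<in>?E. \<Sum>d\<in>cls g.
        (\<Sum>m\<in>?J. K e f i m * K g d m k) *\<^sub>C (gU e f \<cdot> adj (gU d g)))"
      unfolding scaleC_sum by (subst sum.swap, intro sum.cong refl, subst sum.swap, intro sum.cong refl,
          subst sum.swap, intro sum.cong refl, subst sum.swap, rule refl)
    also have "\<dots> = (\<Sum>e\<in>?E. \<Sum>f\<in>cls e. \<Sum>g\<in>?E. if g = f then (\<Sum>d\<in>cls e. K e d i k *\<^sub>C (gU e f \<cdot> adj (gU d f))) else 0)" (is "(\<Sum>e\<in>_. \<Sum>f\<in>_. \<Sum>g\<in>_. ?f e f g) = (\<Sum>e\<in>_. \<Sum>f\<in>_. \<Sum>g\<in>_. ?g e f g)")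
    proof (intro sum.cong refl)
      fix e f g assume f: "f \<in> cls e"
      have "(\<Sum>d\<in>cls g. (\<Sum>m\<in>?J. K e f i m * K g d m k) *\<^sub>C (gU e f \<cdot> adj (gU d g)))
          = (\<Sum>d\<in>cls g. (if f = g then K e d i k else 0) *\<^sub>C (gU e f \<cdot> adj (gU d g)))"
        using K_mult[OF _ _ i, of e f g] f i jk by (intro sum.cong refl) auto
      then show "?f e f g = ?g e f g" using f by auto
    qed
    also have "\<dots> = (\<Sum>e\<in>?E. \<Sum>f\<in>cls e. \<Sum>d\<in>cls e. K e d i k *\<^sub>C (gU e f \<cdot> adj (gU d f)))"
      by (intro sum.cong[OF refl]) simp
    also have "\<dots> = (\<Sum>e\<in>?E. \<Sum>d\<in>cls e. K e d i k *\<^sub>C (\<Sum>f\<in>cls e. gU e f \<cdot> adj (gU d f)))"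
      unfolding scaleC_sum by (rule sum.cong[OF refl], subst sum.swap, rule refl)
    also have "\<dots> = (\<Sum>e\<in>?E. \<Sum>d\<in>cls e. if d = e then K e e i k *\<^sub>C \<one> else 0)"
    proof (intro sum.cong refl)
      fix e d assume "d \<in> cls e"
      then show "K e d i k *\<^sub>C (\<Sum>f\<in>cls e. gU e f \<cdot> adj (gU d f)) = (if d = e then K e e i k *\<^sub>C \<one> else 0)"
        using V.rows[of e d] by (auto simp: fib_def)
    qed
    also have "\<dots> = (\<Sum>e\<in>?E. K e e i k) *\<^sub>C \<one>" unfolding scaleC_sum by (intro sum.cong refl) simp
    also have "\<dots> = (if i = k then \<one> else 0)" using K_unit[OF i] i jk by simp
    finally show ?thesis .
  qed
  have "R j = (\<Sum>i\<in>?J. (if j = i then \<one> else 0) \<cdot> R i)"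
    by (simp add: if_distrib[of "\<lambda>x. x \<cdot> _"] cong: if_cong)
  also have "\<dots> = (\<Sum>i\<in>?J. (\<Sum>m\<in>?J. adj (UU m j) \<cdot> UU m i) \<cdot> R i)"
    by (intro sum.cong refl, subst UU_cols) auto
  also have "\<dots> = (\<Sum>m\<in>?J. adj (UU m j) \<cdot> (\<Sum>i\<in>?J. UU m i \<cdot> R i))"
    unfolding compose_sum by (subst sum.swap) (simp add: compose_assoc)
  also have "\<dots> = (\<Sum>m\<in>?J. if m = k then adj (UU k j) else 0)"
  proof (rule sum.cong[OF refl])
    fix m assume "m \<in> ?J"
    then have "l2 m = l2 k" using jk by simp
    from UR[OF this] show "adj (UU m j) \<cdot> (\<Sum>i\<in>?J. UU m i \<cdot> R i) = (if m = k then adj (UU k j) else 0)"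
      by simp
  qed
  also have "\<dots> = adj (UU k j)" using jk by simp
  finally have R: "R j = adj (UU k j)" .
  have c: "cinner (dv e f) (R j (du e f)) = (\<Sum>e'\<in>?E. \<Sum>f'\<in>cls e'. K e' f' j k * cnj (cinner (du e f) (gU f' e' (dv e f))))"
    by (simp add: R_def sum_apply cinner.sum_right cinner_adj_right cinner_cnj)
  also have "\<dots> = (\<Sum>e'\<in>?E. \<Sum>f'\<in>cls e'. if e' = f \<and> f' = e then K f e j k else 0)"
    by (intro sum.cong refl) (auto simp: dual_vec[OF ef])
  also have "\<dots> = (\<Sum>e'\<in>?E. if e' = f then K f e j k else 0)"
    using ef by (intro sum.cong refl) (auto simp: if_distrib cong: if_cong intro: sum.neutral)
  also have "\<dots> = K f e j k" using K_zero[OF ef[symmetric], of j k] by simp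
  finally show ?thesis unfolding R by (simp add: K_eq cinner_adj_right cinner_cnj)
qed

definition bp :: "'x \<Rightarrow> 'e" where "bp x = (SOME e. l e = x)"

lemma bp [simp]: "l (bp (l e)) = l e" unfolding bp_def by (rule someI[of _ e]) simp

text \<open>The vectors \<open>Y (e\<^sub>k) = \<Sum>\<^sub>e e \<otimes> D(e\<^bsub>b e\<^esub>) e\<^sub>k\<close>, with \<open>b\<close> the base point in the fibre of \<open>e\<close> and \<open>D(e\<^bsub>e f\<^esub>)\<close> the matrix \<open>K e f\<close>.\<close>

definition tt :: "'e \<times> 'e \<Rightarrow> ('e \<times> 'e \<times> 'e) ell2" where
  "tt k = (\<Sum>e\<in>EN (l2 k). \<Sum>j\<in>JJ (l2 k). cscale (K (bp (l e)) e j k) (basis_vec e \<otimes>\<^sub>v basis_vec j))"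

lemma coord_tensor_tt:
  assumes a: "a \<in> clin"
  shows "coord ((a \<otimes> \<one>) (tt k)) (e, j) = (if l2 j = l2 k then \<Sum>f\<in>EN (l2 k). K (bp (l f)) f j k * ent a e f else 0)"
proof -
  have "coord ((a \<otimes> \<one>) (tt k)) (e, j)
      = (\<Sum>f\<in>EN (l2 k). \<Sum>i\<in>JJ (l2 k). K (bp (l f)) f i k * (ent a e f * coord (basis_vec i) j))"
    using a by (simp add: tt_def blinfun.sum_right coord_sum clinD del: basis_tensor)
  also have "\<dots> = (\<Sum>f\<in>EN (l2 k). \<Sum>i\<in>JJ (l2 k). if i = j then K (bp (l f)) f j k * ent a e f else 0)"
    by (intro sum.cong refl) (auto simp: coord_basis)
  finally show ?thesis by simp
qed

lemma cinner_tt: "cinner (tt k) z = (\<Sum>e\<in>EN (l2 k). \<Sum>j\<in>JJ (l2 k). K e (bp (l e)) k j * coord z (e, j))"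
  by (simp add: tt_def cinner.sum_left K_star)

lemma tt_entry:
  assumes a: "a \<in> linf G"
  shows "cinner (tt k) ((a \<otimes> \<one>) (tt k')) =
    (if l2 k = l2 k' then \<Sum>e\<in>EN (l2 k). \<Sum>f\<in>EN (l2 k). ent a e f * K e f k k' else 0)"
proof (cases "l2 k = l2 k'")
  case True
  have ac: "a \<in> clin" using a by (simp add: linf_iff)
  have "cinner (tt k) ((a \<otimes> \<one>) (tt k')) = (\<Sum>e\<in>EN (l2 k). \<Sum>j\<in>JJ (l2 k). \<Sum>f\<in>EN (l2 k).
      ent a e f * (K e (bp (l e)) k j * K (bp (l f)) f j k'))"
    unfolding cinner_tt coord_tensor_tt[OF ac] using True by (intro sum.cong refl) (simp add: sum_distrib_left mult_ac)
  also have "\<dots> = (\<Sum>e\<in>EN (l2 k). \<Sum>f\<in>EN (l2 k). ent a e f * (\<Sum>j\<in>JJ (l2 k). K e (bp (l e)) k j * K (bp (l f)) f j k'))"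
    by (intro sum.cong refl, subst sum.swap) (simp add: sum_distrib_left)
  also have "\<dots> = (\<Sum>e\<in>EN (l2 k). \<Sum>f\<in>EN (l2 k). ent a e f * K e f k k')"
  proof (intro sum.cong refl)
    fix e f
    show "ent a e f * (\<Sum>j\<in>JJ (l2 k). K e (bp (l e)) k j * K (bp (l f)) f j k') = ent a e f * K e f k k'"
    proof (cases "l e = l f")
      case l: True
      then show ?thesis using K_mult[of e "bp (l e)" "bp (l f)" f k k'] True by simp
    next
      case False
      then show ?thesis using a by (simp add: linf_iff)
    qed
  qed
  finally show ?thesis using True by simp
next
  case False
  have "a \<in> clin" using a by (simp add: linf_iff)
  then show ?thesis using False unfolding cinner_tt by (auto intro!: sum.neutral simp: coord_tensor_tt)
qed

lemma Y_exists: "\<exists>Y\<in>(clin :: ('e \<times> 'e, 'e \<times> 'e \<times> 'e) hom set). (\<forall>k. blinfun_apply Y (basis_vec k) = tt k) \<and> adj Y \<cdot> Y = \<one>"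
proof (rule isometry_extension)
  fix k k' :: "'e \<times> 'e"
  have "(\<Sum>e\<in>EN (l2 k). \<Sum>f\<in>EN (l2 k). coord (\<one> (basis_vec f)) e * K e f k k') = (\<Sum>e\<in>EN (l2 k). \<Sum>f\<in>EN (l2 k). if f = e then K e e k k' else 0)"
    by (intro sum.cong refl) (auto simp: coord_basis)
  then show "cinner (basis_vec k) (basis_vec k') = cinner (tt k) (tt k')"
    using tt_entry[OF star_algebraD(2)[OF linf_star], of k k'] K_unit[of k k'] by (auto simp: coord_basis)
qed (rule coord_eqI, simp)

definition Y :: "('e \<times> 'e, 'e \<times> 'e \<times> 'e) hom" where
  "Y = (SOME Y. Y \<in> clin \<and> (\<forall>k. blinfun_apply Y (basis_vec k) = tt k) \<and> adj Y \<cdot> Y = \<one>)"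

lemma Y: "Y \<in> clin" "Y (basis_vec k) = tt k" "adj Y \<cdot> Y = \<one>"
proof -
  note * = someI_ex[OF Y_exists[unfolded Bex_def], folded Y_def]
  show "Y \<in> clin" "Y (basis_vec k) = tt k" "adj Y \<cdot> Y = \<one>"
    using conjunct1[OF *] spec[OF conjunct1[OF conjunct2[OF *]]] conjunct2[OF conjunct2[OF *]] by blast+
qed

text \<open>The candidate for the comultiplication, sending \<open>mu e f\<close> to the matrix
  \<open>K e f\<close>. Written as a compression by the isometry \<open>Y\<close>, its boundedness,
  normality and compatibility with adjoints are automatic.\<close>

definition DD :: "'e op \<Rightarrow> ('e \<times> 'e) op" where "DD a = adj Y \<cdot> (a \<otimes> \<one>) \<cdot> Y"

lemma DD_clin [simp]: "a \<in> clin \<Longrightarrow> DD a \<in> clin" by (simp add: DD_def Y)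

lemma DD_entry:
  "a \<in> linf G \<Longrightarrow> ent (DD a) k k' =
    (if l2 k = l2 k' then \<Sum>e\<in>EN (l2 k). \<Sum>f\<in>EN (l2 k). ent a e f * K e f k k' else 0)"
  using tt_entry[of a k k'] cinner_adj_right[OF Y(1), of "basis_vec k" "(a \<otimes> \<one>) (tt k')"] by (simp add: DD_def Y)

text \<open>The summation may run over any larger finite set of classes. This freedom is used when
  entries for the two groups are summed over index sets matched by \<open>\<phi>\<close>.\<close>

lemma DD_entry':
  assumes a: "a \<in> linf G" and k: "l2 k = l2 k'" and L: "finite L" "N (l2 k) \<subseteq> L"
  shows "ent (DD a) k k' = (\<Sum>e\<in>EL L. \<Sum>f\<in>EL L. ent a e f * K e f k k')"
proof -
  have z: "ent a e f * K e f k k' = 0" if "e \<notin> EN (l2 k) \<or> f \<notin> EN (l2 k)" for e f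
    using that a K_zero[of e f k k'] by (cases "l e = l f") (auto simp: linf_iff)
  have "(\<Sum>e\<in>EN (l2 k). \<Sum>f\<in>EN (l2 k). ent a e f * K e f k k')
      = (\<Sum>e\<in>EN (l2 k). \<Sum>f\<in>EL L. ent a e f * K e f k k')"
    by (intro sum.cong refl sum.mono_neutral_left fin_EL[OF L(1)] ballI z) (use L(2) in auto)
  also have "\<dots> = (\<Sum>e\<in>EL L. \<Sum>f\<in>EL L. ent a e f * K e f k k')"
    by (intro sum.mono_neutral_left fin_EL[OF L(1)] ballI sum.neutral z) (use L(2) in auto)
  finally show ?thesis using DD_entry[OF a, of k' k] k by simp
qed

text \<open>Compression by an isometry is not multiplicative in general; here it is, because the
  matrices \<open>K e f\<close> multiply like matrix units. The verification is on entries, where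
  all sums are finite.\<close>

lemma DD_mult: assumes a: "a \<in> linf G" and b: "b \<in> linf G" shows "DD (a \<cdot> b) = DD a \<cdot> DD b"
proof (rule clin_eqI)
  have c: "a \<in> clin" "b \<in> clin" using a b by (auto simp: linf_iff)
  then show "DD (a \<cdot> b) \<in> clin" "DD a \<cdot> DD b \<in> clin" by simp_all
  have ab: "a \<cdot> b \<in> linf G" using a b star_algebraD(4)[OF linf_star] by blast
  fix k'
  show "DD (a \<cdot> b) (basis_vec k') = (DD a \<cdot> DD b) (basis_vec k')"
  proof (rule coord_eqI)
    fix k
    let ?E = "EN (l2 k)" and ?J = "JJ (l2 k)"
    have "DD b (basis_vec k') = (\<Sum>j\<in>JJ (l2 k'). cscale (ent (DD b) j k') (basis_vec j))"
      by (rule coord_eqI) (auto simp: coord_sum coord_basis DD_entry[OF b] if_distrib[of "\<lambda>c. _ * c"] cong: if_cong)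
    then have "coord ((DD a \<cdot> DD b) (basis_vec k')) k = coord (DD a (\<Sum>j\<in>JJ (l2 k'). cscale (ent (DD b) j k') (basis_vec j))) k"
      by simp
    also have "\<dots> = (\<Sum>j\<in>JJ (l2 k'). ent (DD b) j k' * ent (DD a) k j)"
      using c by (simp add: blinfun.sum_right coord_sum clinD[of "DD a"])
    also have "\<dots> = coord (DD (a \<cdot> b) (basis_vec k')) k"
    proof (cases "l2 k = l2 k'")
      case True
      have co: "coord ((a \<cdot> b) (basis_vec d)) e = (\<Sum>f\<in>?E. ent a e f * ent b f d)" if d: "d \<in> ?E" for e d
      proof -
        have bh: "ent b f d = 0" if "l f \<notin> N (l2 k)" for f
        proof -
          have "l f \<noteq> l d" using that d by auto
          then show ?thesis using b by (simp add: linf_iff)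
        qed
        have "b (basis_vec d) = (\<Sum>f\<in>?E. cscale (ent b f d) (basis_vec f))"
          by (rule coord_eqI) (auto simp: coord_sum coord_basis if_distrib[of "\<lambda>c. _ * c"] bh cong: if_cong)
        then have "coord (a (b (basis_vec d))) e = coord (a (\<Sum>f\<in>?E. cscale (ent b f d) (basis_vec f))) e" by simp
        then show ?thesis using c by (simp add: blinfun.sum_right coord_sum clinD mult.commute)
      qed
      have "(\<Sum>j\<in>JJ (l2 k'). ent (DD b) j k' * ent (DD a) k j)
        = (\<Sum>j\<in>?J. \<Sum>e\<in>?E. \<Sum>f\<in>?E. \<Sum>g\<in>?E. \<Sum>d\<in>?E. ent a e f * ent b g d * (K e f k j * K g d j k'))"
      proof (rule sum.cong)
        have prod: "(\<Sum>g\<in>?E. \<Sum>d\<in>?E. Z g d) * (\<Sum>e\<in>?E. \<Sum>f\<in>?E. X e f) = (\<Sum>e\<in>?E. \<Sum>f\<in>?E. \<Sum>g\<in>?E. \<Sum>d\<in>?E. X e f * Z g d)"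
          for X Z :: "'e \<Rightarrow> 'e \<Rightarrow> complex"
          by (subst mult.commute, unfold sum_distrib_right, unfold sum_distrib_left, rule refl)
        fix j assume "j \<in> ?J"
        then have j: "l2 j = l2 k'" "l2 k = l2 j" using True by auto
        show "ent (DD b) j k' * ent (DD a) k j = (\<Sum>e\<in>?E. \<Sum>f\<in>?E. \<Sum>g\<in>?E. \<Sum>d\<in>?E.
            ent a e f * ent b g d * (K e f k j * K g d j k'))"
          unfolding DD_entry[OF a] DD_entry[OF b] if_P[OF j(1)] if_P[OF j(2)] unfolding j(2)[symmetric] prod
          by (intro sum.cong refl) (simp add: mult_ac)
      qed (simp add: True)
      also have "\<dots> = (\<Sum>e\<in>?E. \<Sum>f\<in>?E. \<Sum>g\<in>?E. \<Sum>d\<in>?E. ent a e f * ent b g d * (\<Sum>j\<in>?J. K e f k j * K g d j k'))"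
        unfolding sum_distrib_left by (subst sum.swap, intro sum.cong refl, subst sum.swap, intro sum.cong refl,
            subst sum.swap, intro sum.cong refl, subst sum.swap, rule refl)
      also have "\<dots> = (\<Sum>e\<in>?E. \<Sum>f\<in>?E. \<Sum>g\<in>?E. if g = f then (\<Sum>d\<in>?E. ent a e f * ent b f d * K e d k k') else 0)" (is "(\<Sum>e\<in>_. \<Sum>f\<in>_. \<Sum>g\<in>_. ?f e f g) = (\<Sum>e\<in>_. \<Sum>f\<in>_. \<Sum>g\<in>_. ?g e f g)")
      proof (intro sum.cong refl)
        fix e f g
        have "(\<Sum>d\<in>?E. ent a e f * ent b g d * (\<Sum>j\<in>?J. K e f k j * K g d j k'))
            = (\<Sum>d\<in>?E. ent a e f * ent b g d * (if f = g then K e d k k' else 0))"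
        proof (intro sum.cong refl)
          fix d show "ent a e f * ent b g d * (\<Sum>j\<in>?J. K e f k j * K g d j k')
              = ent a e f * ent b g d * (if f = g then K e d k k' else 0)"
            using a b K_mult[of e f g d k k'] True by (cases "l e = l f \<and> l g = l d") (auto simp: linf_iff)
        qed
        then show "?f e f g = ?g e f g" by simp
      qed
      also have "\<dots> = (\<Sum>e\<in>?E. \<Sum>f\<in>?E. \<Sum>d\<in>?E. ent a e f * ent b f d * K e d k k')"
        by (rule sum.cong[OF refl], rule sum.cong[OF refl]) simp
      also have "\<dots> = (\<Sum>e\<in>?E. \<Sum>d\<in>?E. (\<Sum>f\<in>?E. ent a e f * ent b f d) * K e d k k')"
        by (rule sum.cong[OF refl], subst sum.swap) (simp add: sum_distrib_right)
      also have "\<dots> = coord (DD (a \<cdot> b) (basis_vec k')) k"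
        unfolding DD_entry[OF ab] using True co by (auto intro!: sum.cong)
      finally show ?thesis .
    next
      case False
      then show ?thesis by (auto simp: DD_entry[OF a] DD_entry[OF ab] intro!: sum.neutral)
    qed
    finally show "coord (DD (a \<cdot> b) (basis_vec k')) k = coord ((DD a \<cdot> DD b) (basis_vec k')) k" by simp
  qed
qed

lemma coord_blk: "coord (blk e f T (basis_vec d)) g = ent T (e, g) (f, d)"
  using cinner_ls[of "basis_vec g" "basis_vec e" "basis_vec f" T "basis_vec d"] by simp

lemma DD_mem: assumes a: "a \<in> linf G" shows "DD a \<in> linf G \<otimes>\<^sub>v\<^sub>N linf G"
  unfolding linf_tensor_iff[OF linf_star linf_bicommutant]
proof (intro conjI allI)
  show c: "DD a \<in> clin" using a by (simp add: linf_iff)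
  fix e f
  have "blk e f (DD a) \<in> linf G" using c by (auto simp: linf_iff coord_blk DD_entry[OF a] l2_def)
  moreover have "blk e f (DD a) = 0" if "l e \<noteq> l f"
    using c that by (intro clin_eqI coord_eqI) (auto simp: coord_blk DD_entry[OF a] l2_def)
  ultimately show "if l e = l f then blk e f (DD a) \<in> linf G else blk e f (DD a) = 0" by simp
qed

lemma DD_hom: "unital_star_hom (linf G) (linf G \<otimes>\<^sub>v\<^sub>N linf G) DD"
  unfolding unital_star_hom_def linear_map_on_def
proof (intro conjI ballI allI subsetI)
  fix a b assume ab: "a \<in> linf G" "b \<in> linf G"
  then have c: "a \<in> clin" "b \<in> clin" by (auto simp: linf_iff)
  show "DD (a \<cdot> b) = DD a \<cdot> DD b" by (rule DD_mult[OF ab])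
  show "DD (a + b) = DD a + DD b" using c by (simp add: DD_def op_tensor_simps(1) blinfun_compose.add_left blinfun_compose.add_right)
next
  fix a assume "a \<in> linf G"
  then have c: "a \<in> clin" by (auto simp: linf_iff)
  show "DD (d *\<^sub>C a) = d *\<^sub>C DD a" for d using c by (simp add: DD_def op_tensor_simps(3) Y)
  show "DD (adj a) = adj (DD a)" using c by (simp add: DD_def op_tensor_simps(5) Y compose_assoc)
qed (auto simp: DD_mem, simp add: DD_def Y)

lemma DD_normal: "normal_on (linf G) DD"
  by (rule normal_spatial_left[OF linf_clin, where P="adj Y" and Q=Y]) (simp_all add: DD_def Y)

lemma leg_product_slice: "coord (rs u v (leg13 V \<cdot> leg23 V) (basis_vec k)) j = cinner u (UU j k v)"
proof -
  let ?p = "\<lambda>(i :: 'e, j :: 'e, k :: 'i). ((i, j), k)" and ?q = "\<lambda>(j :: 'e, i :: 'e, k :: 'i). ((i, j), k)"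
  note b = bij_leg[where ?'a='e and ?'b='e and ?'c='i]
  have i: "inv ?p = (\<lambda>((i, j), k). (i, j, k))" "inv ?q = (\<lambda>((i, j), k). (j, i, k))" by (auto intro!: inv_equality)
  have bm: "basis_map ?p (x \<otimes>\<^sub>v (y \<otimes>\<^sub>v z)) = (x \<otimes>\<^sub>v y) \<otimes>\<^sub>v z" "basis_map ?q (x \<otimes>\<^sub>v (y \<otimes>\<^sub>v z)) = (y \<otimes>\<^sub>v x) \<otimes>\<^sub>v z" for x y z
    by (auto intro!: coord_eqI simp: basis_map_apply[OF b(1)] basis_map_apply[OF b(2)] i split: prod.splits)
  have ab: "adj (basis_map ?p) ((x \<otimes>\<^sub>v y) \<otimes>\<^sub>v z) = x \<otimes>\<^sub>v (y \<otimes>\<^sub>v z)" "adj (basis_map ?q) ((y \<otimes>\<^sub>v x) \<otimes>\<^sub>v z) = x \<otimes>\<^sub>v (y \<otimes>\<^sub>v z)" for x y z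
    using arg_cong[OF basis_map_unitary(1)[OF b(1)], of "\<lambda>X. blinfun_apply X (x \<otimes>\<^sub>v (y \<otimes>\<^sub>v z))"]
      arg_cong[OF basis_map_unitary(1)[OF b(2)], of "\<lambda>X. blinfun_apply X (x \<otimes>\<^sub>v (y \<otimes>\<^sub>v z))"] by (simp_all add: bm)
  obtain r s where k: "k = (r, s)" by (cases k)
  obtain p q where j: "j = (p, q)" by (cases j)
  have L23: "leg23 V ((basis_vec r \<otimes>\<^sub>v basis_vec s) \<otimes>\<^sub>v v) = (\<Sum>q'\<in>cls s. (basis_vec r \<otimes>\<^sub>v basis_vec q') \<otimes>\<^sub>v gU q' s v)"
    unfolding leg23_def relabel_def
    by (simp add: ab V_def V.block_op_spec vec_tensor.sum_right blinfun.sum_right bm fib_def del: basis_tensor)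
  have L13: "adj (leg13 V) ((basis_vec p \<otimes>\<^sub>v basis_vec q) \<otimes>\<^sub>v u) = (\<Sum>r'\<in>cls p. (basis_vec r' \<otimes>\<^sub>v basis_vec q) \<otimes>\<^sub>v adj (gU p r') u)"
    unfolding leg13_def relabel_def using b(2)
    by (simp add: ab op_tensor_simps(5) V_def V.adj_block_op V.block_op_spec vec_tensor.sum_right blinfun.sum_right bm fib_def compose_assoc del: basis_tensor)
  have c13: "(leg13 V :: (('e \<times> 'e) \<times> 'i) op) \<in> clin" unfolding leg13_def by (rule relabel_clin[OF b(2)]) simp
  have "coord (rs u v (leg13 V \<cdot> leg23 V) (basis_vec k)) j
      = cinner ((basis_vec p \<otimes>\<^sub>v basis_vec q) \<otimes>\<^sub>v u) (leg13 V (leg23 V ((basis_vec r \<otimes>\<^sub>v basis_vec s) \<otimes>\<^sub>v v)))"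
    using cinner_rs[of "basis_vec j" u v "leg13 V \<cdot> leg23 V" "basis_vec k"] by (simp add: j k)
  also have "\<dots> = (\<Sum>q'\<in>cls s. \<Sum>r'\<in>cls p. if r' = r \<and> q' = q then cinner u (gU p r (gU q s v)) else 0)"
    unfolding cinner_adj_left[OF c13, symmetric] L13 L23 cinner.sum_right cinner.sum_left
    by (intro sum.cong refl) (auto simp: cinner_basis_basis cinner_adj_left simp del: cinner_basis_left cinner_basis_right basis_tensor)
  also have "\<dots> = (if l r = l p \<and> l q = l s then cinner u (gU p r (gU q s v)) else 0)"
    by (cases "l r = l p"; cases "l q = l s") (auto simp: if_distrib cong: if_cong intro!: sum.neutral,
      simp add: sum.cartesian_product, subst sum.mono_neutral_right[of _ "{(q, r)}"], auto split: if_splits)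
  also have "\<dots> = cinner u (UU j k v)" by (auto simp: UU_def j k gU_def)
  finally show ?thesis .
qed

lemma normal_homI: "unital_star_hom (linf G) (linf G \<otimes>\<^sub>v\<^sub>N linf G) D \<Longrightarrow> normal_on (linf G) D \<Longrightarrow> normal_hom G (linf G \<otimes>\<^sub>v\<^sub>N linf G) D"
  by (simp add: normal_hom_def vn_tensor_clin)

text \<open>Stated for every normal homomorphism and not just for \<open>DD\<close>, since the
  competitor in the uniqueness proof is arbitrary; its spatial form makes \<open>tensor_map\<close>
  meaningful for it.\<close>

lemma tensor_map_slice:
  assumes D: "normal_hom G (linf G \<otimes>\<^sub>v\<^sub>N linf G) D"
  shows "tensor_map (linf G) (Linf G) D (\<lambda>b. b) V \<in> clin" "rs u v (tensor_map (linf G) (Linf G) D (\<lambda>b. b) V) = D (rs u v V)"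
proof -
  obtain Z :: "('e \<times> 'e, 'e \<times> 'e \<times> 'e) hom" where Z: "Z \<in> clin" "\<forall>a\<in>linf G. D a = adj Z \<cdot> (a \<otimes> \<one>) \<cdot> Z" using normal_hom.spatial[OF D] by (elim bexE)
  note t = tensor_map_left[OF linf_star Linf_star adj_clin[OF Z(1)] Z(1) _ V_mem, of D]
  show "tensor_map (linf G) (Linf G) D (\<lambda>b. b) V \<in> clin" using Z(2) by (intro t) simp
  have "rs u v V \<in> linf G" by (rule rs_linf[OF Linf_star Linf_bicommutant V_mem])
  then show "rs u v (tensor_map (linf G) (Linf G) D (\<lambda>b. b) V) = D (rs u v V)" using Z(2) t(2)[of u v] by simp
qed

text \<open>The dual functionals cut the multiplicative unitary down to single matrix units, so the
  equation imposed on the comultiplication prescribes its values on all of them.\<close>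

lemma rs_V: "l e = l f \<Longrightarrow> rs (du e f) (dv e f) V = mu e f"
proof (rule clin_eqI, simp, simp, rule coord_eqI)
  fix f' e' assume ef: "l e = l f"
  show "coord (rs (du e f) (dv e f) V (basis_vec f')) e' = coord (mu e f (basis_vec f')) e'"
    using dual_vec[OF ef, of e' f'] V.m_zero[of e' f'] ef
    by (cases "l e' = l f'") (auto simp: entry_rs blk_V coord_basis split: if_splits)
qed

lemma DD_equation: "tensor_map (linf G) (Linf G) DD (\<lambda>b. b) V = leg13 V \<cdot> leg23 V"
proof (rule slice_eqI(2))
  note D = normal_homI[OF DD_hom DD_normal]
  show "tensor_map (linf G) (Linf G) DD (\<lambda>b. b) V \<in> clin" by (rule tensor_map_slice[OF D])
  show c: "leg13 V \<cdot> leg23 V \<in> clin" unfolding leg13_def leg23_def by (simp add: bij_leg)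
  fix u v
  have r: "rs u v V \<in> linf G" by (rule rs_linf[OF Linf_star Linf_bicommutant V_mem])
  show "rs u v (tensor_map (linf G) (Linf G) DD (\<lambda>b. b) V) = rs u v (leg13 V \<cdot> leg23 V)"
    unfolding tensor_map_slice[OF D]
  proof (rule clin_eqI)
    show "DD (rs u v V) \<in> clin" "rs u v (leg13 V \<cdot> leg23 V) \<in> clin" using c by simp_all
    fix k' show "DD (rs u v V) (basis_vec k') = rs u v (leg13 V \<cdot> leg23 V) (basis_vec k')"
    proof (rule coord_eqI)
      fix k show "coord (DD (rs u v V) (basis_vec k')) k = coord (rs u v (leg13 V \<cdot> leg23 V) (basis_vec k')) k"
      proof (cases "l2 k = l2 k'")
        case True
        have "coord (DD (rs u v V) (basis_vec k')) k = (\<Sum>e\<in>EN (l2 k). \<Sum>f\<in>EN (l2 k). cinner u (gU e f v) * K e f k k')"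
          using True by (simp add: DD_entry[OF r] entry_rs blk_V)
        also have "\<dots> = (\<Sum>e\<in>EN (l2 k). \<Sum>f\<in>cls e. cinner u (gU e f v) * K e f k k')"
          by (intro sum.cong refl sum.mono_neutral_right) (auto simp: gU_def)
        also have "\<dots> = cinner u (UU k k' v)"
          unfolding K_prod[OF True] by (simp add: sum_apply cinner.sum_right mult.commute)
        finally show ?thesis by (simp add: leg_product_slice)
      next
        case False
        then show ?thesis by (simp add: DD_entry[OF r] leg_product_slice UU_zero)
      qed
    qed
  qed
qed

text \<open>Existence is \<open>DD_equation\<close>. For uniqueness, slicing the defining equation
  by the dual functionals shows that a competitor agrees with \<open>DD\<close> on matrix units, and
  \<open>normal_hom_unique\<close> does the rest.\<close>

lemma dual_comult_eq: assumes a: "a \<in> linf G" shows "dual_comult G a = DD a"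
proof -
  let ?D = "restrict DD (linf G)"
  note st = star_algebraD[OF linf_star]
  have tm: "tensor_map (linf G) (Linf G) ?D (\<lambda>b. b) V = tensor_map (linf G) (Linf G) DD (\<lambda>b. b) V"
    unfolding tensor_map_def normal_ext_def by (rule arg_cong[where f="\<lambda>F. The F V"]) (auto simp: fun_eq_iff)
  have hom: "unital_star_hom (linf G) (linf G \<otimes>\<^sub>v\<^sub>N linf G) ?D"
    using DD_hom st(2) unfolding unital_star_hom_def linear_map_on_def by (auto simp: st(3-6)[of "_ :: 'e op"] intro: st)
  have "dual_comult G = ?D" unfolding dual_comult_def
  proof (rule the_equality, intro conjI)
    show "?D \<in> extensional (linf G)" by simp
    show "unital_star_hom (linf G) (linf G \<otimes>\<^sub>v\<^sub>N linf G) ?D" by (rule hom)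
    show "normal_on (linf G) ?D" by (rule normal_cong[OF _ DD_normal]) simp
    show "tensor_map (linf G) (Linf G) ?D (\<lambda>b. b) V = leg13 V \<cdot> leg23 V" unfolding tm by (rule DD_equation)
    fix D assume D: "D \<in> extensional (linf G) \<and> unital_star_hom (linf G) (linf G \<otimes>\<^sub>v\<^sub>N linf G) D \<and> normal_on (linf G) D \<and>
        tensor_map (linf G) (Linf G) D (\<lambda>b. b) V = leg13 V \<cdot> leg23 V"
    then have nD: "normal_hom G (linf G \<otimes>\<^sub>v\<^sub>N linf G) D" and eq: "tensor_map (linf G) (Linf G) D (\<lambda>b. b) V = leg13 V \<cdot> leg23 V"
      by (simp_all add: normal_homI)
    note nDD = normal_homI[OF DD_hom DD_normal]
    have mus: "D (mu e f) = DD (mu e f)" if "l e = l f" for e f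
      using tensor_map_slice(2)[OF nD, of "du e f" "dv e f"] tensor_map_slice(2)[OF nDD, of "du e f" "dv e f"] eq DD_equation rs_V[OF that] by simp
    have "D a = ?D a" if "a \<in> linf G" for a using normal_hom_unique[OF nD nDD mus that] that by simp
    then show "D = ?D" using D by (intro extensionalityI[where A="linf G" and f=D]) simp_all
  qed
  then show ?thesis using a by simp
qed

end

section \<open>The Markov operator\<close>

lemma relabel_passoc_tensor:
  fixes a :: "'i op" and b :: "'j op" and c :: "'k op"
  shows "a \<in> clin \<Longrightarrow> b \<in> clin \<Longrightarrow> c \<in> clin \<Longrightarrow> basis_map passoc \<cdot> ((a \<otimes> b) \<otimes> c) \<cdot> adj (basis_map passoc) = a \<otimes> (b \<otimes> c)"
proof (rule clin_eqI)
  fix p :: "'i \<times> 'j \<times> 'k" assume c: "a \<in> clin" "b \<in> clin" "c \<in> clin"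
  obtain i j k where p: "basis_vec p = basis_vec (i :: 'i) \<otimes>\<^sub>v (basis_vec (j :: 'j) \<otimes>\<^sub>v basis_vec (k :: 'k))" by (metis basis_tensor surj_pair)
  show "blinfun_apply (basis_map passoc \<cdot> ((a \<otimes> b) \<otimes> c) \<cdot> adj (basis_map passoc)) (basis_vec p) = blinfun_apply (a \<otimes> (b \<otimes> c)) (basis_vec p)"
    using c by (simp add: p del: basis_tensor)
qed auto

lemma basis_map_cancel [simp]: "bij p \<Longrightarrow> adj (basis_map p) (basis_map p x) = x" "bij p \<Longrightarrow> basis_map p (adj (basis_map p) y) = y"
  using arg_cong[OF basis_map_unitary(1)[of p], of "\<lambda>X. X x"] arg_cong[OF basis_map_unitary(2)[of p], of "\<lambda>X. X y"] by simp_all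

lemma norm_isometry: "T \<in> clin \<Longrightarrow> adj T \<cdot> T = \<one> \<Longrightarrow> norm (T x) = norm x"
  using cinner_adj_right[of T x "T x"] blinfun_apply_blinfun_compose[of "adj T" T x]
  by (simp add: norm_sq_le_iff_cinner del: blinfun_apply_blinfun_compose)

lemma pmf_vector: "\<exists>v. (\<forall>x. coord v x = of_real (sqrt (pmf \<mu> x))) \<and> norm v \<le> 1"
proof -
  have b: "sum (pmf \<mu>) F \<le> 1" if "finite F" for F
    using measure_pmf.prob_le_1[of \<mu> F] measure_measure_pmf_finite[OF that, of \<mu>] by simp
  then have sm: "pmf \<mu> summable_on UNIV" by (intro nonneg_bdd_above_summable_on bdd_aboveI2[of _ _ 1]) auto
  have e: "(\<lambda>x. (cmod (of_real (sqrt (pmf \<mu> x))))\<^sup>2) = pmf \<mu>" by (auto simp: fun_eq_iff)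
  let ?v = "Abs_ell2 (\<lambda>x. of_real (sqrt (pmf \<mu> x)))"
  have co: "coord ?v = (\<lambda>x. of_real (sqrt (pmf \<mu> x)))" using sm by (intro Abs_ell2_inverse) (simp only: mem_Collect_eq e)
  have "(pmf \<mu> has_sum (norm ?v)\<^sup>2) UNIV" using norm_sq_has_sum[of ?v] by (simp only: co e)
  then have "(norm ?v)\<^sup>2 \<le> 1" by (rule has_sum_le_finite_sums) (rule b)
  then have "norm ?v \<le> 1" by (intro power2_le_imp_le[of "norm ?v" 1]) simp_all
  then show ?thesis by (intro exI[of _ ?v] conjI allI) (simp_all add: co)
qed

context dual
begin

lemma bp' [simp]: "l (bp x) = x" using bp fib_ne[of x] by (metis equals0I mem_fib)

lemma psi_eq: "psi G x a = (\<Sum>f\<in>fib G x. \<Sum>f'\<in>fib G x. ent a f f' * Q f f')"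
  unfolding psi_def
proof (rule the_equality)
  let ?c = "\<Sum>f\<in>fib G x. \<Sum>f'\<in>fib G x. ent a f f' * Q f f'"
  have s: "(\<Sum>f\<in>fib G x. \<Sum>f'\<in>fib G x. entry a f f' * h (coef G e f \<cdot> adj (coef G e' f'))) = (if e = e' then ?c else 0)"
    if "e \<in> fib G x" "e' \<in> fib G x" for e e'
    using that by (auto simp: haar_mult_adj Q_eq intro!: sum.cong sum.neutral)
  show "\<forall>e\<in>fib G x. \<forall>e'\<in>fib G x. (\<Sum>f\<in>fib G x. \<Sum>f'\<in>fib G x. entry a f f' * h (coef G e f \<cdot> adj (coef G e' f'))) = (if e = e' then ?c else 0)"
    using s by (intro ballI)
  fix c assume c: "\<forall>e\<in>fib G x. \<forall>e'\<in>fib G x. (\<Sum>f\<in>fib G x. \<Sum>f'\<in>fib G x. entry a f f' * h (coef G e f \<cdot> adj (coef G e' f'))) = (if e = e' then c else 0)"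
  have m: "bp x \<in> fib G x" by simp
  show "c = ?c" using bspec[OF bspec[OF c m] m] s[OF m m] by simp
qed

text \<open>The adjoint of \<open>V\<close> applied to
  \<open>basis_vec (bp x) \<otimes> \<xi>\<close>; it turns \<open>psi G x\<close> into a vector
  state of \<open>a \<otimes> \<one>\<close>.\<close>

definition zx :: "'x \<Rightarrow> ('e \<times> 'i) ell2" where "zx x = (\<Sum>f\<in>fib G x. basis_vec f \<otimes>\<^sub>v adj (gU (bp x) f) \<xi>)"

lemma cinner_zx:
  assumes a: "a \<in> linf G" shows "cinner (zx x) ((a \<otimes> \<one>) (zx y)) = (if x = y then psi G x a else 0)"
proof -
  have ac: "a \<in> clin" using a by (simp add: linf_iff)
  have "cinner (zx x) ((a \<otimes> \<one>) (zx y)) =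
      (\<Sum>f'\<in>fib G y. \<Sum>f\<in>fib G x. ent a f f' * cinner (adj (gU (bp x) f) \<xi>) (adj (gU (bp y) f') \<xi>))"
    using ac by (simp add: zx_def blinfun.sum_right cinner.sum_left cinner.sum_right)
  also have "\<dots> = (if x = y then psi G x a else 0)"
  proof (cases "x = y")
    case True
    have "(\<Sum>f'\<in>fib G y. \<Sum>f\<in>fib G x. ent a f f' * cinner (adj (gU (bp x) f) \<xi>) (adj (gU (bp y) f') \<xi>))
      = (\<Sum>f'\<in>fib G x. \<Sum>f\<in>fib G x. ent a f f' * Q f f')"
      using True by (intro sum.cong refl) (auto simp: cinner_adj_left Q_eq)
    then show ?thesis using True unfolding psi_eq by (subst (2) sum.swap) simp
  next
    case False
    then show ?thesis using a by (auto simp: linf_iff intro!: sum.neutral)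
  qed
  finally show ?thesis .
qed

lemma psi_one: "psi G x \<one> = 1"
proof -
  have "psi G x \<one> = (\<Sum>f\<in>fib G x. Q f f)" unfolding psi_eq
    by (auto simp: coord_basis if_distrib[of "\<lambda>c. c * _"] intro!: sum.cong cong: if_cong)
  also have "\<dots> = (\<Sum>f\<in>fib G x. cinner \<xi> (gU (bp x) f (adj (gU (bp x) f) \<xi>)))" by (intro sum.cong refl) (simp add: Q_eq)
  also have "\<dots> = cinner \<xi> ((\<Sum>f\<in>fib G x. gU (bp x) f \<cdot> adj (gU (bp x) f)) \<xi>)" by (simp add: sum_apply cinner.sum_right)
  also have "\<dots> = cinner \<xi> \<xi>" using V.rows[of "bp x" "bp x"] by (simp add: fib_def)
  also have "\<dots> = 1" using \<xi>[OF star_algebraD(2)[OF star]] state homD(3)[OF \<pi>_hom] by (simp add: state_on_def)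
  finally show ?thesis .
qed

text \<open>The vectors \<open>zx x\<close> are orthonormal, and block diagonal operators have no
  matrix elements between different classes. Hence their superposition with amplitudes
  \<open>sqrt (pmf \<mu> x)\<close> implements the mixture of the states
  \<open>psi G x\<close>.\<close>

lemma zeta_exists: "\<exists>z. norm z \<le> 1 \<and> (\<forall>a\<in>linf G. ((\<lambda>x. of_real (pmf \<mu> x) * psi G x a) has_sum cinner z ((a \<otimes> (\<one> :: 'i op)) z)) UNIV)"
proof -
  have "\<exists>T\<in>(clin :: ('x, 'e \<times> 'i) hom set). (\<forall>x. blinfun_apply T (basis_vec x) = zx x) \<and> adj T \<cdot> T = \<one>"
  proof (rule isometry_extension)
    show "cinner (basis_vec x) (basis_vec y) = cinner (zx x) (zx y)" for x y
      using cinner_zx[OF star_algebraD(2)[OF linf_star], of x y] by (simp add: psi_one coord_basis)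
  qed (rule coord_eqI, simp)
  then obtain T :: "('x, 'e \<times> 'i) hom" where T: "T \<in> clin" "\<forall>x. T (basis_vec x) = zx x" "adj T \<cdot> T = \<one>" by (elim bexE conjE)
  obtain v where v: "\<forall>x. coord v x = of_real (sqrt (pmf \<mu> x))" "norm v \<le> 1" using pmf_vector[of \<mu>] by (elim exE conjE)
  have "((\<lambda>x. of_real (pmf \<mu> x) * psi G x a) has_sum cinner (T v) ((a \<otimes> \<one>) (T v))) UNIV" if a: "a \<in> linf G" for a
  proof -
    have ac: "a \<in> clin" using a by (simp add: linf_iff)
    define D where "D = adj T \<cdot> (a \<otimes> \<one>) \<cdot> T"
    have Dc: "D \<in> clin" using T ac by (simp add: D_def)
    have Db: "ent D x y = (if x = y then psi G x a else 0)" for x y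
      using cinner_zx[OF a, of x y] T(2) cinner_adj_right[OF T(1), of "basis_vec x" "(a \<otimes> \<one>) (T (basis_vec y))"] by (simp add: D_def)
    have "adj D (basis_vec x) = cscale (cnj (psi G x a)) (basis_vec x)" for x
      by (rule coord_eqI) (simp add: entry_adj[OF Dc] Db coord_basis)
    then have "coord (D v) x = psi G x a * coord v x" for x
      using cinner_adj_left[OF Dc, of "basis_vec x" v] by simp
    then have "cnj (coord v x) * coord (D v) x = of_real (pmf \<mu> x) * psi G x a" for x
      using v(1) of_real_mult[of "sqrt (pmf \<mu> x)" "sqrt (pmf \<mu> x)", where 'a=complex] by (simp add: mult_ac)
    moreover have "((\<lambda>x. cnj (coord v x) * coord (D v) x) has_sum cinner v (D v)) UNIV"
      unfolding cinner_def by (rule has_sum_infsum[OF coord_summable])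
    ultimately show ?thesis using T(1) by (simp add: D_def cinner_adj_right)
  qed
  then show ?thesis using v(2) norm_isometry[OF T(1,3), of v] by (intro exI[of _ "T v"] conjI ballI) simp_all
qed

definition zeta :: "'x pmf \<Rightarrow> ('e \<times> 'i) ell2" where
  "zeta \<mu> = (SOME z. norm z \<le> 1 \<and> (\<forall>a\<in>linf G. ((\<lambda>x. of_real (pmf \<mu> x) * psi G x a) has_sum cinner z ((a \<otimes> \<one>) z)) UNIV))"

lemma zeta: "norm (zeta \<mu>) \<le> 1"
  "a \<in> linf G \<Longrightarrow> ((\<lambda>x. of_real (pmf \<mu> x) * psi G x a) has_sum cinner (zeta \<mu>) ((a \<otimes> \<one>) (zeta \<mu>))) UNIV"
proof -
  note * = someI_ex[OF zeta_exists[of \<mu>]]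
  show "norm (zeta \<mu>) \<le> 1" unfolding zeta_def by (rule conjunct1[OF *])
  show "a \<in> linf G \<Longrightarrow> ((\<lambda>x. of_real (pmf \<mu> x) * psi G x a) has_sum cinner (zeta \<mu>) ((a \<otimes> \<one>) (zeta \<mu>))) UNIV" unfolding zeta_def by (rule bspec[OF conjunct2[OF *]])
qed

lemma psi_measure_eq: "a \<in> linf G \<Longrightarrow> psi_measure G \<mu> a = cinner (zeta \<mu>) ((a \<otimes> \<one>) (zeta \<mu>))"
  unfolding psi_measure_def using infsumI[OF zeta(2)] .

definition Z1 :: "'x pmf \<Rightarrow> ('e, ('e \<times> 'e) \<times> 'i) hom" where "Z1 \<mu> = adj (basis_map passoc) \<cdot> rvec (zeta \<mu>)"

lemma Z1_clin [simp]: "Z1 \<mu> \<in> clin" by (simp add: Z1_def)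

lemma markov_Z1: assumes a: "a \<in> linf G" shows "markov G \<mu> a = adj (Z1 \<mu>) \<cdot> (DD a \<otimes> \<one>) \<cdot> Z1 \<mu>"
  unfolding markov_def dual_comult_eq[OF a]
proof (rule normal_ext_spatial[OF linf_star linf_star _ _ _ DD_mem[OF a]])
  fix b c assume b: "b \<in> linf G" and c: "c \<in> linf G"
  then have bc: "b \<in> clin" "c \<in> clin" by (auto simp: linf_iff)
  have "adj (Z1 \<mu>) \<cdot> ((b \<otimes> c) \<otimes> \<one>) \<cdot> Z1 \<mu> = rs (zeta \<mu>) (zeta \<mu>) (b \<otimes> (c \<otimes> \<one>))"
    unfolding relabel_passoc_tensor[OF bc clin_intros(2), symmetric] rs_def Z1_def by (simp add: compose_assoc)
  also have "\<dots> = psi_measure G \<mu> c *\<^sub>C b" using bc by (simp add: psi_measure_eq[OF c])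
  finally show "adj (Z1 \<mu>) \<cdot> ((b \<otimes> c) \<otimes> \<one>) \<cdot> Z1 \<mu> = psi_measure G \<mu> c *\<^sub>C b" .
qed simp_all

text \<open>Combines the dilation \<open>Y\<close> of the comultiplication with the vector
  \<open>zeta \<mu>\<close> of the state. The Markov operator becomes a compression by a single
  contraction, which yields its normality, positivity and norm bound.\<close>

definition Z :: "'x pmf \<Rightarrow> ('e, 'e \<times> ('e \<times> 'e) \<times> 'i) hom" where "Z \<mu> = basis_map passoc \<cdot> (Y \<otimes> \<one>) \<cdot> Z1 \<mu>"

lemma Z_clin [simp]: "Z \<mu> \<in> clin" by (simp add: Z_def Y)

lemma markov_spatial: assumes a: "a \<in> linf G" shows "markov G \<mu> a = adj (Z \<mu>) \<cdot> (a \<otimes> \<one>) \<cdot> Z \<mu>"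
proof -
  have ac: "a \<in> clin" using a by (simp add: linf_iff)
  have "DD a \<otimes> (\<one> :: 'i op) = adj (Y \<otimes> \<one>) \<cdot> (adj (basis_map passoc) \<cdot> (a \<otimes> (\<one> :: (('e \<times> 'e) \<times> 'i) op)) \<cdot> basis_map passoc) \<cdot> (Y \<otimes> \<one>)"
  proof -
    have "adj (basis_map passoc) \<cdot> (a \<otimes> (\<one> :: (('e \<times> 'e) \<times> 'i) op)) \<cdot> basis_map passoc = (a \<otimes> \<one>) \<otimes> \<one>"
      using relabel_passoc_tensor[OF ac, of "\<one> :: ('e \<times> 'e) op" "\<one> :: 'i op", symmetric] by (intro blinfun_eqI) simp
    then show ?thesis using ac by (simp add: Y DD_def op_tensor_simps(5) op_tensor_compose)
  qed
  then show ?thesis unfolding markov_Z1[OF a] Z_def by (simp add: Y op_tensor_simps(5) compose_assoc)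
qed

lemma norm_Z: "norm (Z \<mu> x) \<le> norm x"
proof -
  have "norm ((Y \<otimes> (\<one> :: 'i op)) u) = norm u" for u
    by (rule norm_isometry) (simp_all add: Y op_tensor_simps(5) op_tensor_compose)
  then have "norm (Z \<mu> x) = norm x * norm (zeta \<mu>)" by (simp add: Z_def Z1_def basis_map_apply adj_basis_map bij_imp_bij_inv)
  then show ?thesis using zeta(1)[of \<mu>] by (simp add: mult_left_le)
qed

text \<open>The scalar form in which the Markov operators of the two groups are compared: slicing
  the first leg leaves one block of \<open>DD a\<close>, on which the mixture of states is an
  absolutely explicit series over the classes.\<close>

lemma markov_entry: assumes a: "a \<in> linf G"
  shows "((\<lambda>x. of_real (pmf \<mu> x) * (\<Sum>f\<in>fib G x. \<Sum>f'\<in>fib G x. ent (DD a) (p, f) (p', f') * Q f f'))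
    has_sum ent (markov G \<mu> a) p p') UNIV"
proof -
  have b: "blk p p' (DD a) \<in> linf G"
    using DD_mem[OF a, unfolded linf_tensor_iff[OF linf_star linf_bicommutant], THEN conjunct2, rule_format, of p p']
      star_algebraD(1,4)[OF linf_star] by (cases "l p = l p'") (auto simp: linf_iff)
  have c: "DD a \<in> clin" using a by (simp add: linf_iff)
  have "ent (markov G \<mu> a) p p' = cinner (zeta \<mu>) ((blk p p' (DD a) \<otimes> \<one>) (zeta \<mu>))"
  proof -
    have "cinner (basis_vec p) (markov G \<mu> a (basis_vec p')) = cinner (Z1 \<mu> (basis_vec p)) ((DD a \<otimes> \<one>) (Z1 \<mu> (basis_vec p')))"
      unfolding markov_Z1[OF a] by (simp add: cinner_adj_right del: cinner_basis_left)
    also have "\<dots> = cinner (basis_vec p \<otimes>\<^sub>v zeta \<mu>) (relabel passoc (DD a \<otimes> \<one>) (basis_vec p' \<otimes>\<^sub>v zeta \<mu>))"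
      by (simp add: Z1_def relabel_def cinner_adj_left)
    also have "\<dots> = cinner (zeta \<mu>) ((blk p p' (DD a) \<otimes> \<one>) (zeta \<mu>))"
      unfolding cinner_ls[symmetric] ls_relabel[OF c] ..
    finally show ?thesis by simp
  qed
  then show ?thesis using zeta(2)[OF b, of \<mu>] by (simp add: psi_eq coord_blk)
qed

lemma markov_linf: assumes a: "a \<in> linf G" shows "markov G \<mu> a \<in> linf G"
  unfolding linf_iff
proof (intro conjI allI impI)
  show "markov G \<mu> a \<in> clin" using a by (simp add: markov_spatial linf_iff)
  fix e f assume ef: "l e \<noteq> l f"
  have "(\<lambda>x. of_real (pmf \<mu> x) * (\<Sum>f'\<in>fib G x. \<Sum>f''\<in>fib G x. ent (DD a) (e, f') (f, f'') * Q f' f'')) = (\<lambda>x. 0)"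
    using ef by (auto simp: fun_eq_iff DD_entry[OF a] l2_def intro!: sum.neutral)
  then show "ent (markov G \<mu> a) e f = 0"
    using markov_entry[OF a, of \<mu> f e] has_sum_unique[OF _ has_sum_0[OF refl]] by (simp only:)
qed

lemma markov_amp:
  assumes B: "unital_star_algebra B" and T: "T \<in> linf G \<otimes>\<^sub>v\<^sub>N B" "commutant (commutant B) = B"
  shows "markov_amp G \<mu> B T \<in> clin" "rs u v (markov_amp G \<mu> B T) = markov G \<mu> (rs u v T)"
  unfolding markov_amp_def markov_spatial[OF rs_linf[OF B T(2,1)]]
  by (rule tensor_map_left[OF linf_star B adj_clin[OF Z_clin] Z_clin markov_spatial T(1)], assumption)+

end

section \<open>The link algebra\<close>

text \<open>For fixed \<open>f\<close>, \<open>f'\<close> the Haar state of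
  \<open>coef G r f \<cdot> adj (coef G s f')\<close> is a matrix in \<open>r\<close>,
  \<open>s\<close>. Invariance of the state says that conjugation by the representation fixes this
  matrix, so it is a self-intertwiner and therefore scalar.\<close>

lemma (in cqg) schur:
  "\<exists>Q. \<forall>e f e' f'. l e = l f \<longrightarrow> l e' = l f' \<longrightarrow> l e = l e' \<longrightarrow>
    cinner \<xi> (gU e f (adj (gU e' f') \<xi>)) = (if e = e' then Q f f' else 0)"
proof -
  have "\<exists>q. \<forall>e e'. l e = l f \<longrightarrow> l e' = l f \<longrightarrow> cinner \<xi> (gU e f (adj (gU e' f') \<xi>)) = (if e = e' then q else 0)"
    if ff: "l f = l f'" for f f'
  proof -
    let ?I = "cls f"
    define M where "M r s = (if l r = l f \<and> l s = l f then h (coef G r f \<cdot> adj (coef G s f')) else 0)" for r s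
    note A' = star_algebraD[OF star]
    have D: "unital_star_hom A (min_tensor A A) (comult G)"
      using cqg by (simp add: cqg_with_reps_def compact_quantum_group_def Let_def)
    have co: "comult G (coef G i j) = (\<Sum>k\<in>?I. coef G i k \<otimes> coef G k j)" if "l i = l f" "l j = l f" for i j
      using rep[of "l f"] that by (simp add: unitary_rep_def)
    have cl: "coef G i j \<in> clin" if "l i = l j" for i j using coef_A[OF that] A'(1) by auto
    have inv: "(\<Sum>p\<in>?I \<times> ?I. M (fst p) (snd p) *\<^sub>C (coef G r (fst p) \<cdot> adj (coef G s (snd p)))) = M r s *\<^sub>C \<one>"
      if rs: "l r = l f" "l s = l f" for r s
    proof -
      have m: "coef G r f \<cdot> adj (coef G s f') \<in> A" using rs ff by (intro A' coef_A) auto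
      have "comult G (coef G r f \<cdot> adj (coef G s f')) = comult G (coef G r f) \<cdot> adj (comult G (coef G s f'))"
        using rs ff by (simp add: homD[OF D] coef_A A')
      also have "\<dots> = (\<Sum>k\<in>?I. coef G r k \<otimes> coef G k f) \<cdot> (\<Sum>m\<in>?I. adj (coef G s m) \<otimes> adj (coef G m f'))"
      proof -
        have "adj (\<Sum>m\<in>?I. coef G s m \<otimes> coef G m f') = (\<Sum>m\<in>?I. adj (coef G s m) \<otimes> adj (coef G m f'))"
        proof (subst adj_sum)
          have c: "coef G s m \<in> clin" "coef G m f' \<in> clin" if "m \<in> ?I" for m using cl[of s m] cl[of m f'] rs ff that by simp_all
          show "coef G s m \<otimes> coef G m f' \<in> clin" if "m \<in> ?I" for m using c[OF that] by simp
          show "(\<Sum>m\<in>?I. adj (coef G s m \<otimes> coef G m f')) = (\<Sum>m\<in>?I. adj (coef G s m) \<otimes> adj (coef G m f'))"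
            using c by (intro sum.cong refl op_tensor_simps(5))
        qed
        then show ?thesis by (simp only: co[OF rs(2) ff[symmetric]] co[OF rs(1) refl])
      qed
      also have "\<dots> = (\<Sum>p\<in>?I \<times> ?I. (coef G r (fst p) \<cdot> adj (coef G s (snd p))) \<otimes> (coef G (fst p) f \<cdot> adj (coef G (snd p) f')))"
        unfolding compose_sum
        by (subst sum.swap, unfold sum.cartesian_product, rule sum.cong) (use rs ff cl in \<open>auto simp: op_tensor_compose\<close>)
      finally have c: "comult G (coef G r f \<cdot> adj (coef G s f')) = \<dots>" .
      have "norm_ext A A (\<lambda>b c. h c *\<^sub>C b) (comult G (coef G r f \<cdot> adj (coef G s f'))) = M r s *\<^sub>C \<one>"
        using cqg m rs by (simp add: cqg_with_reps_def haar_state_def Let_def M_def)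
      moreover have "norm_ext A A (\<lambda>b c. h c *\<^sub>C b) (comult G (coef G r f \<cdot> adj (coef G s f')))
        = (\<Sum>p\<in>?I \<times> ?I. h (coef G (fst p) f \<cdot> adj (coef G (snd p) f')) *\<^sub>C (coef G r (fst p) \<cdot> adj (coef G s (snd p))))"
        unfolding c by (rule norm_ext_slice[OF star closed state]) (use rs ff coef_A A' in auto)
      moreover have "\<dots> = (\<Sum>p\<in>?I \<times> ?I. M (fst p) (snd p) *\<^sub>C (coef G r (fst p) \<cdot> adj (coef G s (snd p))))"
        by (intro sum.cong refl) (auto simp: M_def)
      ultimately show ?thesis by (simp only:)
    qed
    have "M \<in> Mor ?I (coef G) ?I (coef G)" unfolding Mor_def supported_def
    proof (intro CollectI conjI allI ballI impI)
      fix i j assume ij: "i \<in> ?I" "j \<in> ?I"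
      have "(\<Sum>s\<in>?I. M i s *\<^sub>C coef G s j) = (\<Sum>s\<in>?I. (\<Sum>p\<in>?I \<times> ?I. M (fst p) (snd p) *\<^sub>C (coef G i (fst p) \<cdot> adj (coef G s (snd p)))) \<cdot> coef G s j)"
        using ij by (intro sum.cong refl, subst inv) auto
      also have "\<dots> = (\<Sum>p\<in>?I \<times> ?I. M (fst p) (snd p) *\<^sub>C (coef G i (fst p) \<cdot> (\<Sum>s\<in>?I. adj (coef G s (snd p)) \<cdot> coef G s j)))"
        unfolding compose_sum scaleC_sum by (subst sum.swap) (simp add: compose_assoc)
      also have "\<dots> = (\<Sum>p\<in>?I \<times> ?I. if snd p = j then M (fst p) j *\<^sub>C coef G i (fst p) else 0)"
        using ij coef_unitary(2)[of _ j] by (intro sum.cong refl) (auto)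
      also have "\<dots> = (\<Sum>k\<in>?I. M k j *\<^sub>C coef G i k)"
      proof -
        have "(\<Sum>p\<in>?I \<times> ?I. if snd p = j then M (fst p) j *\<^sub>C coef G i (fst p) else 0)
          = (\<Sum>k\<in>?I. \<Sum>m\<in>?I. if m = j then M k j *\<^sub>C coef G i k else 0)"
          unfolding sum.cartesian_product split_def ..
        then show ?thesis using ij by simp
      qed
      finally show "(\<Sum>k\<in>?I. M k j *\<^sub>C coef G i k) = (\<Sum>k\<in>?I. M i k *\<^sub>C coef G k j)" by simp
    qed (auto simp: M_def split: if_splits)
    then obtain q where q: "M = (\<lambda>i j. q * id_mat ?I i j)" using irreducible[of "l f"] by (auto simp: irreducible_rep_def)
    have "cinner \<xi> (gU e f (adj (gU e' f') \<xi>)) = (if e = e' then q else 0)" if e: "l e = l f" "l e' = l f" for e e'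
      using fun_cong[OF fun_cong[OF q, of e], of e'] haar_mult_adj[of e f e' f'] e ff by (simp add: M_def id_mat_def split: if_splits)
    then show ?thesis by (intro exI[of _ q] allI impI)
  qed
  then have "\<forall>p. \<exists>q. l (fst p) = l (snd p) \<longrightarrow> (\<forall>e e'. l e = l (fst p) \<longrightarrow> l e' = l (fst p) \<longrightarrow>
      cinner \<xi> (gU e (fst p) (adj (gU e' (snd p)) \<xi>)) = (if e = e' then q else 0))"
    by (intro allI) blast
  from choice[OF this] obtain Q where Q: "\<forall>p. l (fst p) = l (snd p) \<longrightarrow> (\<forall>e e'. l e = l (fst p) \<longrightarrow> l e' = l (fst p) \<longrightarrow>
      cinner \<xi> (gU e (fst p) (adj (gU e' (snd p)) \<xi>)) = (if e = e' then Q p else 0))" by (elim exE)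
  show ?thesis
  proof (rule exI[of _ "\<lambda>f f'. Q (f, f')"], intro allI impI)
    fix e f e' f' assume "l e = l f" "l e' = l f'" "l e = l e'"
    then show "cinner \<xi> (gU e f (adj (gU e' f') \<xi>)) = (if e = e' then Q (f, f') else 0)"
      using spec[OF Q, of "(f, f')"] by simp
  qed
qed

text \<open>Here \<open>u\<close> and \<open>uu\<close> are the coefficients of the irreducible representations and of a tensor product, and \<open>t\<close>
  contains enough intertwiners between them.\<close>

lemma fusion_coefficients:
  fixes u :: "'e \<Rightarrow> 'e \<Rightarrow> 'i op" and uu :: "'j \<Rightarrow> 'j \<Rightarrow> 'i op" and t :: "'j \<Rightarrow> 'e \<Rightarrow> 'n \<Rightarrow> complex" and lb :: "'e \<Rightarrow> 'x"
  assumes fb: "\<And>y. finite {e. lb e = y}" and J: "finite J" and N: "finite N"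
    and dual: "\<And>e f e' f'. lb e = lb f \<Longrightarrow> lb e' = lb f' \<Longrightarrow> cinner (du e f) (u e' f' (dv e f)) = (if e' = e \<and> f' = f then 1 else 0)"
    and T: "\<And>i d n. i \<in> J \<Longrightarrow> (\<Sum>j\<in>J. t j d n *\<^sub>C uu i j) = (\<Sum>d' | lb d' = lb d. t i d' n *\<^sub>C u d' d)"
    and tN: "\<And>i d n. i \<in> J \<Longrightarrow> lb d \<notin> N \<Longrightarrow> t i d n = 0"
    and inj': "\<forall>s. (\<forall>d n. (\<Sum>j\<in>J. s j * t j d n) = 0) \<longrightarrow> (\<forall>j\<in>J. s j = 0)"
    and K: "\<And>e f i j. K e f i j = cinner (du e f) (uu i j (dv e f))"
  shows "\<And>e f i j d n. lb e = lb f \<Longrightarrow> i \<in> J \<Longrightarrow> (\<Sum>j\<in>J. K e f i j * t j d n) = (if d = f then t i e n else 0)"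
    "\<And>e f i j. lb e = lb f \<Longrightarrow> lb e \<notin> N \<Longrightarrow> i \<in> J \<Longrightarrow> j \<in> J \<Longrightarrow> K e f i j = 0"
    "\<And>i j. i \<in> J \<Longrightarrow> j \<in> J \<Longrightarrow> uu i j = (\<Sum>e | lb e \<in> N. \<Sum>f | lb f = lb e. K e f i j *\<^sub>C u e f)"
    "\<And>e f g d i k. lb e = lb f \<Longrightarrow> lb g = lb d \<Longrightarrow> i \<in> J \<Longrightarrow> k \<in> J \<Longrightarrow>
      (\<Sum>j\<in>J. K e f i j * K g d j k) = (if f = g then K e d i k else 0)"
    "\<And>i k. i \<in> J \<Longrightarrow> k \<in> J \<Longrightarrow> (\<Sum>e | lb e \<in> N. K e e i k) = (if i = k then 1 else 0)"
proof -
  have inj: "s j = 0" if "\<And>d n. (\<Sum>j\<in>J. s j * t j d n) = 0" "j \<in> J" for s j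
    by (rule bspec[OF spec[OF inj', THEN mp] that(2)]) (simp add: that(1))
  have "{e. lb e \<in> N} = (\<Union>y\<in>N. {e. lb e = y})" by auto
  then have fN: "finite {e. lb e \<in> N}" using N fb by simp
  \<comment> \<open>The functional dual to \<open>(e, f)\<close> is applied to the intertwining
    relation: it produces \<open>K\<close> on the left and selects at most one term on the
    right.\<close>
  show Kt: "(\<Sum>j\<in>J. K e f i j * t j d n) = (if d = f then t i e n else 0)" if ef: "lb e = lb f" and i: "i \<in> J" for e f i d n
  proof -
    have "(\<Sum>j\<in>J. K e f i j * t j d n) = cinner (du e f) ((\<Sum>j\<in>J. t j d n *\<^sub>C uu i j) (dv e f))"
      by (simp add: K sum_apply cinner.sum_right mult.commute)
    also have "\<dots> = (\<Sum>d' | lb d' = lb d. if d' = e \<and> d = f then t i d' n else 0)"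
      unfolding T[OF i] sum_apply cinner.sum_right by (intro sum.cong refl) (simp add: dual[OF ef])
    also have "\<dots> = (if d = f then t i e n else 0)" using fb[of "lb d"] ef by (cases "d = f") auto
    finally show ?thesis .
  qed
  \<comment> \<open>The intertwiners \<open>t\<close> separate vectors indexed by \<open>J\<close>,
    so each remaining identity may be contracted with them first and then evaluated by
    \<open>Kt\<close>.\<close>
  have eqI: "r j = r' j" if "\<And>d n. (\<Sum>j\<in>J. r j * t j d n) = (\<Sum>j\<in>J. r' j * t j d n)" "j \<in> J" for r r' j
  proof -
    have "r j - r' j = 0" by (rule inj[OF _ that(2)]) (simp add: left_diff_distrib sum_subtractf that(1))
    then show ?thesis by simp
  qed
  show "K e f i j = 0" if "lb e = lb f" "lb e \<notin> N" "i \<in> J" "j \<in> J" for e f i j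
    by (rule inj[OF _ that(4)]) (simp add: Kt[OF that(1,3)] tN[OF that(3,2)])
  show "(\<Sum>j\<in>J. K e f i j * K g d j k) = (if f = g then K e d i k else 0)"
    if "lb e = lb f" "lb g = lb d" "i \<in> J" "k \<in> J" for e f g d i k
  proof (rule eqI[OF _ that(4), where r="\<lambda>k. \<Sum>j\<in>J. K e f i j * K g d j k" and r'="\<lambda>k. if f = g then K e d i k else 0"])
    fix d' n
    have "(\<Sum>k\<in>J. (\<Sum>j\<in>J. K e f i j * K g d j k) * t k d' n) = (\<Sum>j\<in>J. K e f i j * (\<Sum>k\<in>J. K g d j k * t k d' n))"
      unfolding sum_distrib_left sum_distrib_right by (subst sum.swap) (simp add: mult.assoc)
    also have "\<dots> = (if d' = d then (\<Sum>j\<in>J. K e f i j * t j g n) else 0)" using that(2) by (simp add: Kt)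
    also have "\<dots> = (\<Sum>k\<in>J. (if f = g then K e d i k else 0) * t k d' n)"
      using that Kt[OF that(1,3), of g n] Kt[of e d i d' n] by auto
    finally show "(\<Sum>k\<in>J. (\<Sum>j\<in>J. K e f i j * K g d j k) * t k d' n) = (\<Sum>k\<in>J. (if f = g then K e d i k else 0) * t k d' n)" .
  qed
  show "(\<Sum>e | lb e \<in> N. K e e i k) = (if i = k then 1 else 0)" if ik: "i \<in> J" "k \<in> J" for i k
  proof (rule eqI[OF _ ik(2), where r="\<lambda>k. \<Sum>e | lb e \<in> N. K e e i k" and r'="\<lambda>k. if i = k then 1 else 0"])
    fix d n
    have "(\<Sum>k\<in>J. (\<Sum>e | lb e \<in> N. K e e i k) * t k d n) = (\<Sum>e | lb e \<in> N. \<Sum>k\<in>J. K e e i k * t k d n)"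
      unfolding sum_distrib_right by (rule sum.swap)
    also have "\<dots> = t i d n" using ik(1) fN tN[OF ik(1), of d n] by (simp add: Kt)
    also have "\<dots> = (\<Sum>k\<in>J. (if i = k then 1 else 0) * t k d n)" using J ik(1) by (simp add: if_distrib[of "\<lambda>c. c * _"] cong: if_cong)
    finally show "(\<Sum>k\<in>J. (\<Sum>e | lb e \<in> N. K e e i k) * t k d n) = (\<Sum>k\<in>J. (if i = k then 1 else 0) * t k d n)" .
  qed
  show "uu i j = (\<Sum>e | lb e \<in> N. \<Sum>f | lb f = lb e. K e f i j *\<^sub>C u e f)" if ij: "i \<in> J" "j \<in> J" for i j
  proof (rule hom_eqI)
    fix y z
    let ?U = "\<lambda>j. \<Sum>e | lb e \<in> N. \<Sum>f | lb f = lb e. K e f i j *\<^sub>C u e f"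
    show "cinner y (uu i j z) = cinner y (?U j z)"
    proof (rule eqI[OF _ ij(2), where r="\<lambda>j. cinner y (uu i j z)" and r'="\<lambda>j. cinner y (?U j z)"])
      fix d n
      have "(\<Sum>j\<in>J. cinner y (uu i j z) * t j d n) = cinner y ((\<Sum>j\<in>J. t j d n *\<^sub>C uu i j) z)"
        by (simp add: sum_apply cinner.sum_right mult.commute)
      also have "\<dots> = (\<Sum>d' | lb d' = lb d. t i d' n * cinner y (u d' d z))"
        unfolding T[OF ij(1)] by (simp add: sum_apply cinner.sum_right)
      also have "\<dots> = (\<Sum>e | lb e \<in> N. \<Sum>f | lb f = lb e. if d = f then t i e n * cinner y (u e f z) else 0)"
      proof -
        have "(\<Sum>e | lb e \<in> N. \<Sum>f | lb f = lb e. if d = f then t i e n * cinner y (u e f z) else 0)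
          = (\<Sum>e | lb e \<in> N. if lb e = lb d then t i e n * cinner y (u e d z) else 0)"
          using fb by (intro sum.cong refl) auto
        also have "\<dots> = (\<Sum>e | lb e = lb d. t i e n * cinner y (u e d z))"
          using fN tN[OF ij(1)] fb[of "lb d"] by (intro sum.mono_neutral_cong) auto
        finally show ?thesis by simp
      qed
      also have "\<dots> = (\<Sum>e | lb e \<in> N. \<Sum>f | lb f = lb e. (\<Sum>j\<in>J. K e f i j * t j d n) * cinner y (u e f z))"
        using ij by (intro sum.cong refl) (auto simp: Kt)
      also have "\<dots> = (\<Sum>j\<in>J. cinner y (?U j z) * t j d n)"
      proof -
        have "(\<Sum>j\<in>J. cinner y (?U j z) * t j d n) = (\<Sum>j\<in>J. \<Sum>e | lb e \<in> N. \<Sum>f | lb f = lb e. K e f i j * t j d n * cinner y (u e f z))"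
          by (simp add: sum_apply cinner.sum_right sum_distrib_left mult_ac)
        also have "\<dots> = (\<Sum>e | lb e \<in> N. \<Sum>f | lb f = lb e. (\<Sum>j\<in>J. K e f i j * t j d n) * cinner y (u e f z))"
          unfolding sum_distrib_right by (subst sum.swap, rule sum.cong[OF refl], rule sum.swap)
        finally show ?thesis by (rule sym)
      qed
      finally show "(\<Sum>j\<in>J. cinner y (uu i j z) * t j d n) = (\<Sum>j\<in>J. cinner y (?U j z) * t j d n)" .
    qed
  qed
qed

section \<open>Families dual to independent vectors\<close>

lemma linear_projection:
  fixes w :: "'p \<Rightarrow> 'i ell2"
  assumes "finite I" shows "\<exists>c. \<forall>j\<in>I. cinner (w j) (v - (\<Sum>i\<in>I. cscale (c i) (w i))) = 0"
  using assms
proof (induction I arbitrary: v)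
  case (insert i I)
  obtain c where c: "\<forall>j\<in>I. cinner (w j) (v - (\<Sum>i\<in>I. cscale (c i) (w i))) = 0" using insert.IH[of v] by (elim exE)
  obtain d where d: "\<forall>j\<in>I. cinner (w j) (w i - (\<Sum>k\<in>I. cscale (d k) (w k))) = 0" using insert.IH[of "w i"] by (elim exE)
  define r where "r = w i - (\<Sum>k\<in>I. cscale (d k) (w k))"
  define s where "s = v - (\<Sum>i\<in>I. cscale (c i) (w i))"
  \<comment> \<open>If \<open>w i\<close> depends on the other vectors then \<open>r = 0\<close>,
    and division by zero gives \<open>a = 0\<close>, which is a correct coefficient.\<close>
  define a where "a = cinner r s / cinner r r"
  have wi: "w i = r + (\<Sum>k\<in>I. cscale (d k) (w k))" by (simp add: r_def)
  have rs: "cinner r (s - cscale a r) = 0" by (cases "r = 0") (simp_all add: a_def cinner.diff_right)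
  have o: "cinner (w j) (s - cscale a r) = 0" if "j \<in> insert i I" for j
  proof (cases "j = i")
    case True
    have "cinner (\<Sum>k\<in>I. cscale (d k) (w k)) (s - cscale a r) = 0"
      unfolding cinner.sum_left using c d by (intro sum.neutral ballI) (simp add: cinner.diff_right r_def s_def)
    then show ?thesis using rs True wi by (simp add: cinner.add_left)
  next
    case False
    then show ?thesis using that c d by (simp add: cinner.diff_right r_def s_def)
  qed
  have "v - (\<Sum>k\<in>insert i I. cscale (if k = i then a else c k - a * d k) (w k)) = s - cscale a r"
  proof -
    have "(\<Sum>k\<in>I. cscale (if k = i then a else c k - a * d k) (w k)) = (\<Sum>k\<in>I. cscale (c k) (w k) - cscale a (cscale (d k) (w k)))"
      using insert.hyps(2) by (intro sum.cong refl) (auto simp: cscale.diff_left)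
    then show ?thesis using insert.hyps
      by (simp add: s_def r_def cscale.diff_right sum_subtractf cscale_sum_right algebra_simps)
  qed
  then show ?case using o by (intro exI[of _ "\<lambda>k. if k = i then a else c k - a * d k"] ballI) (simp only:)
qed simp

text \<open>The residue of \<open>w i\<close> modulo the other vectors is orthogonal to these and,
  by independence, nonzero; after rescaling it is the dual vector.\<close>

lemma dual_family:
  fixes w :: "'p \<Rightarrow> 'i ell2"
  assumes I: "finite I" and ind: "\<And>c. (\<Sum>i\<in>I. cscale (c i) (w i)) = 0 \<Longrightarrow> \<forall>i\<in>I. c i = 0" and i: "i \<in> I"
  shows "\<exists>c. \<forall>j\<in>I. cinner (\<Sum>k\<in>I. cscale (c k) (w k)) (w j) = (if j = i then 1 else 0)"
proof -
  have fin: "finite (I - {i})" using I by simp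
  obtain c where c: "\<forall>j\<in>I - {i}. cinner (w j) (w i - (\<Sum>k\<in>I - {i}. cscale (c k) (w k))) = 0"
    using linear_projection[OF fin, of w "w i"] by (elim exE)
  define r where "r = w i - (\<Sum>k\<in>I - {i}. cscale (c k) (w k))"
  define d where "d k = (if k = i then 1 else - c k)" for k
  have r: "r = (\<Sum>k\<in>I. cscale (d k) (w k))"
    using I i by (simp add: r_def sum.remove[of I i] d_def cscale.minus_left sum_negf)
  have "r \<noteq> 0" using bspec[OF ind[of d] i] r by (auto simp: d_def)
  have o: "cinner r (w j) = 0" if "j \<in> I - {i}" for j
    using bspec[OF c that] cinner_cnj[of "w j" r] by (simp add: r_def)
  have "cinner r (w i) = cinner r r"
  proof -
    have "cinner r (\<Sum>k\<in>I - {i}. cscale (c k) (w k)) = 0" using o by (simp add: cinner.sum_right)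
    then have "cinner r (w i - (\<Sum>k\<in>I - {i}. cscale (c k) (w k))) = cinner r (w i)" by (simp add: cinner.diff_right)
    then show ?thesis by (simp add: r_def)
  qed
  then have "cinner (cscale (1 / cnj (cinner r r)) r) (w j) = (if j = i then 1 else 0)" if "j \<in> I" for j
    using o[of j] that \<open>r \<noteq> 0\<close> by auto
  moreover have "cscale (1 / cnj (cinner r r)) r = (\<Sum>k\<in>I. cscale (1 / cnj (cinner r r) * d k) (w k))"
    unfolding r cscale_sum_right by simp
  ultimately show ?thesis by (intro exI[of _ "\<lambda>k. 1 / cnj (cinner r r) * d k"] ballI) (simp only:)
qed

lemma image_star_algebra:
  assumes A: "unital_star_algebra A" and F: "unital_star_hom A clin F" shows "unital_star_algebra (F ` A)"
  unfolding unital_star_algebra_def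
proof (intro conjI ballI allI; (elim imageE)?)
  note A' = star_algebraD[OF A]
  note F' = homD[OF F]
  show "F ` A \<subseteq> clin" using F'(6) by auto
  show "\<one> \<in> F ` A" using A'(2) F'(3) by (intro image_eqI[of _ _ \<one>]) auto
  fix s a assume s: "s = F a" and a: "a \<in> A"
  show "adj s \<in> F ` A" using A'(5)[OF a] F'(5)[OF a] s by (intro image_eqI[of _ _ "adj a"]) auto
  show "c *\<^sub>C s \<in> F ` A" for c using A'(6)[OF a] F'(2)[OF a] s by (intro image_eqI[of _ _ "c *\<^sub>C a"]) auto
  fix s' b assume s': "s' = F b" and b: "b \<in> A"
  show "s + s' \<in> F ` A" using A'(3)[OF a b] F'(1)[OF a b] s s' by (intro image_eqI[of _ _ "a + b"]) auto
  show "s \<cdot> s' \<in> F ` A" using A'(4)[OF a b] F'(4)[OF a b] s s' by (intro image_eqI[of _ _ "a \<cdot> b"]) auto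
qed

lemma op_tensor_zero [simp]: "a \<in> clin \<Longrightarrow> a \<otimes> 0 = 0" "b \<in> clin \<Longrightarrow> 0 \<otimes> b = 0"
  using op_tensor_simps(3)[of 0 b 0] op_tensor_simps(4)[of a 0 0] by simp_all

section \<open>Coordinates in the link algebra with respect to the entries of X\<close>

locale linking = G1: cqg G1 + G2: cqg G2
  for G1 :: "('k1, 'x1, 'e1, 'i1) cqg_reps" and G2 :: "('k2, 'x2, 'e2, 'i2) cqg_reps" +
  fixes \<phi> :: "'x2 \<Rightarrow> 'x1" and \<Phi> and L :: "('b, 'j, 'e1, 'e2) link"
    and \<delta>1 :: "'j op \<Rightarrow> ('i1 \<times> 'j) op" and \<delta>2 :: "'j op \<Rightarrow> ('j \<times> 'i2) op"
  assumes bij: "bij \<phi>" and triv: "\<phi> (triv G2) = triv G1" and link: "link_algebra G1 G2 \<phi> \<Phi> L"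
    and act1: "link_action1 G1 G2 \<phi> L \<delta>1" and act2: "link_action2 G1 G2 \<phi> L \<delta>2"
begin

abbreviation "A \<equiv> lalg L"
abbreviation "\<pi> \<equiv> lgns L"
abbreviation "M \<equiv> link_vn L"
abbreviation "\<phi>l c \<equiv> \<phi> (G2.l c)"
abbreviation "IX \<equiv> link_index G1 G2 \<phi>"

lemma A: "unital_star_algebra A" and \<pi>: "unital_star_hom A clin \<pi>" and \<omega>: "state_on A (lstate L)" and \<omega>_faithful: "faithful_on A (lstate L)"
  using link by (simp_all add: link_algebra_def Let_def gns_rep_def)

lemma IX: "(a, c) \<in> IX \<longleftrightarrow> G1.l a = \<phi>l c" by (simp add: link_index_def)

lemma \<phi>_eq [simp]: "\<phi> x = \<phi> y \<longleftrightarrow> x = y" using bij by (auto simp: bij_def inj_eq)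

lemma lcoef_A: "p \<in> IX \<Longrightarrow> lcoef L (fst p) (snd p) \<in> A"
  using link by (auto simp: link_algebra_def Let_def)

lemma lcoef_unitary: "unitary_matrix (fib G1 (\<phi> x)) (fib G2 x) (lcoef L)"
  using link by (simp add: link_algebra_def Let_def)

lemma expand: "b \<in> A \<Longrightarrow> \<exists>!t. finite {p. t p \<noteq> 0} \<and> {p. t p \<noteq> 0} \<subseteq> IX \<and> b = (\<Sum>(a, c)\<in>{p. t p \<noteq> 0}. t (a, c) *\<^sub>C lcoef L a c)"
  using link by (simp add: link_algebra_def Let_def)

definition "\<xi> = (SOME \<xi>. (\<forall>a\<in>A. lstate L a = cinner \<xi> (blinfun_apply (\<pi> a) \<xi>)) \<and> closure ((\<lambda>a. blinfun_apply (\<pi> a) \<xi>) ` A) = UNIV)"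

lemma \<xi>: "a \<in> A \<Longrightarrow> lstate L a = cinner \<xi> (\<pi> a \<xi>)" "closure ((\<lambda>a. blinfun_apply (\<pi> a) \<xi>) ` A) = UNIV"
proof -
  have "\<exists>\<xi>. (\<forall>a\<in>A. lstate L a = cinner \<xi> (blinfun_apply (\<pi> a) \<xi>)) \<and> closure ((\<lambda>a. blinfun_apply (\<pi> a) \<xi>) ` A) = UNIV"
    using link by (simp add: link_algebra_def Let_def gns_rep_def)
  note * = someI_ex[OF this, folded \<xi>_def]
  show "a \<in> A \<Longrightarrow> lstate L a = cinner \<xi> (\<pi> a \<xi>)" by (rule bspec[OF conjunct1[OF *]])
  show "closure ((\<lambda>a. blinfun_apply (\<pi> a) \<xi>) ` A) = UNIV" by (rule conjunct2[OF *])
qed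

definition B where "B = \<pi> ` A"
text \<open>Entries of \<open>X\<close> in the GNS representation of the state, extended by zero so
  that sums over arbitrary index pairs need no side conditions.\<close>

definition x where "x a c = (if (a, c) \<in> IX then \<pi> (lcoef L a c) else 0)"

lemma B: "unital_star_algebra B" unfolding B_def by (rule image_star_algebra[OF A \<pi>])

lemma \<pi>_sum: "(\<And>p. p \<in> S \<Longrightarrow> T p \<in> A) \<Longrightarrow> \<pi> (\<Sum>p\<in>S. T p) = (\<Sum>p\<in>S. \<pi> (T p))"
  by (rule linear_map_on_sum[OF homD(7)[OF \<pi>] A])

lemma \<pi>_zero: "\<pi> 0 = 0" using homD(2)[OF \<pi> star_algebraD(7)[OF A], of 0] by simp

lemma faithful: assumes b: "b \<in> B" and z: "b \<xi> = 0" shows "b = 0"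
proof -
  obtain a where a: "a \<in> A" "b = \<pi> a" using b by (auto simp: B_def)
  have "lstate L (adj a \<cdot> a) = 0" using a z \<xi>(1)[of "adj a \<cdot> a"]
    by (simp add: star_algebraD[OF A] homD[OF \<pi>])
  then have "a = 0" using \<omega>_faithful a(1) by (simp add: faithful_on_def)
  then show ?thesis using a(2) \<pi>_zero by simp
qed

lemma \<xi>_norm: "cinner \<xi> \<xi> = 1"
  using \<xi>(1)[OF star_algebraD(2)[OF A]] \<omega> homD(3)[OF \<pi>] by (simp add: state_on_def)

lemma x_B [simp]: "x a c \<in> B" using lcoef_A[of "(a, c)"] star_algebraD(7)[OF B] by (auto simp: x_def B_def)

lemma B_clin: "b \<in> B \<Longrightarrow> b \<in> clin" using star_algebraD(1)[OF B] by auto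

lemma state_x: "\<phi>l c \<noteq> triv G1 \<Longrightarrow> cinner \<xi> (x a c \<xi>) = 0"
proof -
  assume c: "\<phi>l c \<noteq> triv G1"
  have "\<forall>(a, c)\<in>IX. G2.l c \<noteq> triv G2 \<longrightarrow> lstate L (lcoef L a c) = 0" using link by (simp add: link_algebra_def Let_def)
  then have "lstate L (lcoef L a c) = 0" if "(a, c) \<in> IX" using that c triv by auto
  then show ?thesis using \<xi>(1)[OF lcoef_A[of "(a, c)"]] by (auto simp: x_def)
qed

sublocale X: block_unitary G1.l "\<lambda>c. \<phi>l c" x
proof
  have f1: "{e. G1.l e = y} = fib G1 y" for y by auto
  have f2: "{c. \<phi>l c = \<phi> y} = fib G2 y" for y by auto
  have surj: "\<exists>y. z = \<phi> y" for z using bij by (metis bij_is_surj surj_def)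
  have m: "lcoef L a c \<in> A" "adj (lcoef L a c) \<in> A" if "G1.l a = \<phi>l c" for a c
    using lcoef_A[of "(a, c)"] that star_algebraD(5)[OF A] by (auto simp: IX)
  show "finite {e. G1.l e = y}" for y unfolding f1 by simp
  show "finite {c. \<phi>l c = z}" for z
  proof -
    obtain y where "z = \<phi> y" using surj[of z] by (elim exE)
    then show ?thesis using f2[of y] by simp
  qed
  show "x a c \<in> clin" for a c by (rule B_clin) simp
  show "G1.l a \<noteq> \<phi>l c \<Longrightarrow> x a c = 0" for a c by (simp add: x_def IX)
  show "(\<Sum>f | \<phi>l f = G1.l e. x e f \<cdot> adj (x e' f)) = (if e = e' then \<one> else 0)"
    if e: "G1.l e = G1.l e'" for e e'
  proof -
    obtain y where y: "G1.l e = \<phi> y" using surj[of "G1.l e"] by (elim exE)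
    have "(\<Sum>f\<in>fib G2 y. x e f \<cdot> adj (x e' f)) = (\<Sum>f\<in>fib G2 y. \<pi> (lcoef L e f \<cdot> adj (lcoef L e' f)))"
      using e m y by (intro sum.cong refl) (auto simp: x_def IX homD[OF \<pi>])
    also have "\<dots> = \<pi> (\<Sum>f\<in>fib G2 y. lcoef L e f \<cdot> adj (lcoef L e' f))"
      using e m y by (intro \<pi>_sum[symmetric] star_algebraD(4)[OF A]) auto
    also have "\<dots> = (if e = e' then \<one> else 0)"
      using lcoef_unitary[of y] y e by (simp add: unitary_matrix_def homD(3)[OF \<pi>] \<pi>_zero)
    finally show ?thesis using f2[of y] y by simp
  qed
  show "(\<Sum>e | G1.l e = \<phi>l f. adj (x e f) \<cdot> x e f') = (if f = f' then \<one> else 0)"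
    if f: "\<phi>l f = \<phi>l f'" for f f'
  proof -
    let ?y = "G2.l f"
    have "(\<Sum>e\<in>fib G1 (\<phi> ?y). adj (x e f) \<cdot> x e f') = (\<Sum>e\<in>fib G1 (\<phi> ?y). \<pi> (adj (lcoef L e f) \<cdot> lcoef L e f'))"
      using f m by (intro sum.cong refl) (auto simp: x_def IX homD[OF \<pi>])
    also have "\<dots> = \<pi> (\<Sum>e\<in>fib G1 (\<phi> ?y). adj (lcoef L e f) \<cdot> lcoef L e f')"
      using f m by (intro \<pi>_sum[symmetric] star_algebraD(4)[OF A]) auto
    also have "\<dots> = (if f = f' then \<one> else 0)"
      using lcoef_unitary[of ?y] f by (simp add: unitary_matrix_def homD(3)[OF \<pi>] \<pi>_zero)
    finally show ?thesis unfolding f1 .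
  qed
qed

lemma x_zero: "G1.l a \<noteq> \<phi>l c \<Longrightarrow> x a c = 0" by (rule X.m_zero)

definition expansion :: "('e1 \<times> 'e2 \<Rightarrow> complex) \<Rightarrow> 'j op \<Rightarrow> bool" where
  "expansion t b \<longleftrightarrow> (\<exists>F. finite F \<and> F \<subseteq> IX \<and> (\<forall>p. p \<notin> F \<longrightarrow> t p = 0) \<and> b = (\<Sum>p\<in>F. t p *\<^sub>C x (fst p) (snd p)))"

lemma expansion_supp: "expansion t b \<Longrightarrow> finite {p. t p \<noteq> 0} \<and> {p. t p \<noteq> 0} \<subseteq> IX \<and> b = (\<Sum>p | t p \<noteq> 0. t p *\<^sub>C x (fst p) (snd p))"
  unfolding expansion_def
proof (elim exE conjE, intro conjI)
  fix F assume F: "finite F" "F \<subseteq> IX" "\<forall>p. p \<notin> F \<longrightarrow> t p = 0" "b = (\<Sum>p\<in>F. t p *\<^sub>C x (fst p) (snd p))"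
  then have s: "{p. t p \<noteq> 0} \<subseteq> F" by blast
  then show "finite {p. t p \<noteq> 0}" "{p. t p \<noteq> 0} \<subseteq> IX" using F(1,2) by (auto intro: finite_subset)
  show "b = (\<Sum>p | t p \<noteq> 0. t p *\<^sub>C x (fst p) (snd p))" unfolding F(4) using F(1) s by (intro sum.mono_neutral_right) auto
qed

lemma \<pi>_expansion:
  assumes t: "{p. t p \<noteq> 0} \<subseteq> IX"
  shows "\<pi> (\<Sum>(a, c)\<in>{p. t p \<noteq> 0}. t (a, c) *\<^sub>C lcoef L a c) = (\<Sum>p | t p \<noteq> 0. t p *\<^sub>C x (fst p) (snd p))"
    "(\<Sum>(a, c)\<in>{p. t p \<noteq> 0}. t (a, c) *\<^sub>C lcoef L a c) \<in> A"
proof -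
  have A': "t p *\<^sub>C lcoef L (fst p) (snd p) \<in> A" if "p \<in> {p. t p \<noteq> 0}" for p
    using subsetD[OF t that] by (intro star_algebraD(6)[OF A] lcoef_A)
  show "(\<Sum>(a, c)\<in>{p. t p \<noteq> 0}. t (a, c) *\<^sub>C lcoef L a c) \<in> A"
    unfolding split_def prod.collapse by (rule star_algebra_sum[OF A A'])
  show "\<pi> (\<Sum>(a, c)\<in>{p. t p \<noteq> 0}. t (a, c) *\<^sub>C lcoef L a c) = (\<Sum>p | t p \<noteq> 0. t p *\<^sub>C x (fst p) (snd p))"
    unfolding split_def prod.collapse
  proof (rule trans[OF \<pi>_sum[OF A']], assumption, intro sum.cong refl)
    fix p assume "p \<in> {p. t p \<noteq> 0}"
    then have "p \<in> IX" using t by blast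
    then show "\<pi> (t p *\<^sub>C lcoef L (fst p) (snd p)) = t p *\<^sub>C x (fst p) (snd p)"
      using lcoef_A by (simp add: homD(2)[OF \<pi>] x_def)
  qed
qed

lemma expansion_exists: assumes "b \<in> B" shows "\<exists>t. expansion t b"
proof -
  obtain a where a: "a \<in> A" "b = \<pi> a" using assms by (auto simp: B_def)
  obtain t where t: "finite {p. t p \<noteq> 0} \<and> {p. t p \<noteq> 0} \<subseteq> IX \<and> a = (\<Sum>(a, c)\<in>{p. t p \<noteq> 0}. t (a, c) *\<^sub>C lcoef L a c)"
    using expand[OF a(1)] by (elim ex1E)
  then have t1: "finite {p. t p \<noteq> 0}" and t2: "{p. t p \<noteq> 0} \<subseteq> IX" and t3: "a = (\<Sum>(a, c)\<in>{p. t p \<noteq> 0}. t (a, c) *\<^sub>C lcoef L a c)" by simp_all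
  have "b = (\<Sum>p | t p \<noteq> 0. t p *\<^sub>C x (fst p) (snd p))" unfolding a(2) t3 by (rule \<pi>_expansion[OF t2])
  then show ?thesis unfolding expansion_def using t1 t2 by (intro exI[of _ t] exI[of _ "{p. t p \<noteq> 0}"]) simp
qed

text \<open>The basis property is assumed in the abstract algebra. Faithfulness of the state makes
  the GNS representation injective and carries uniqueness of the expansion over to
  \<open>B\<close>.\<close>

lemma expansion_unique: assumes "expansion t b" "expansion t' b" shows "t = t'"
proof -
  have t: "finite {p. t p \<noteq> 0}" "{p. t p \<noteq> 0} \<subseteq> IX" "b = (\<Sum>p | t p \<noteq> 0. t p *\<^sub>C x (fst p) (snd p))"
    and t': "finite {p. t' p \<noteq> 0}" "{p. t' p \<noteq> 0} \<subseteq> IX" "b = (\<Sum>p | t' p \<noteq> 0. t' p *\<^sub>C x (fst p) (snd p))"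
    using expansion_supp[OF assms(1)] expansion_supp[OF assms(2)] by simp_all
  define a where "a = (\<Sum>(a, c)\<in>{p. t p \<noteq> 0}. t (a, c) *\<^sub>C lcoef L a c)"
  define a' where "a' = (\<Sum>(a, c)\<in>{p. t' p \<noteq> 0}. t' (a, c) *\<^sub>C lcoef L a c)"
  have aA: "a \<in> A" "a' \<in> A" and p: "\<pi> a = b" "\<pi> a' = b"
    unfolding a_def a'_def using \<pi>_expansion[OF t(2)] \<pi>_expansion[OF t'(2)] t(3) t'(3) by simp_all
  have "a - a' = 0"
  proof -
    have d: "a - a' = a + (- 1) *\<^sub>C a'" by simp
    have m: "a - a' \<in> A" by (rule star_algebraD(8)[OF A aA])
    have "\<pi> (a - a') = 0" unfolding d using aA p by (simp add: homD(1,2)[OF \<pi>] star_algebraD(6)[OF A] del: scaleC_simps(7)) simp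
    then have "lstate L (adj (a - a') \<cdot> (a - a')) = 0"
      using m \<xi>(1)[of "adj (a - a') \<cdot> (a - a')"] by (simp add: star_algebraD[OF A] homD[OF \<pi>])
    then show ?thesis by (rule bspec[OF \<omega>_faithful[unfolded faithful_on_def] m, THEN mp])
  qed
  then have "a = a'" by simp
  then show ?thesis using ex1E[OF expand[OF aA(1)]] t(1,2) t'(1,2) unfolding a_def a'_def
    by (metis (no_types, lifting))
qed

text \<open>The coordinate functionals of the basis formed by the entries of
  \<open>X\<close>.\<close>

definition cf :: "'j op \<Rightarrow> 'e1 \<times> 'e2 \<Rightarrow> complex" where "cf b = (SOME t. expansion t b)"

lemma cf: "b \<in> B \<Longrightarrow> expansion (cf b) b"
  unfolding cf_def by (rule someI_ex[OF expansion_exists])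

lemma cf_eqI: "b \<in> B \<Longrightarrow> expansion t b \<Longrightarrow> cf b = t"
  by (rule expansion_unique[OF cf])

lemma cf_lin: assumes b: "b \<in> B" "b' \<in> B" shows "cf (c *\<^sub>C b + b') p = c * cf b p + cf b' p"
proof -
  let ?F = "{p. cf b p \<noteq> 0} \<union> {p. cf b' p \<noteq> 0}"
  note e = expansion_supp[OF cf[OF b(1)]] expansion_supp[OF cf[OF b(2)]]
  have s: "s = (\<Sum>p\<in>?F. cf s p *\<^sub>C x (fst p) (snd p))" if "s = b \<or> s = b'" for s
  proof -
    have "s = (\<Sum>p | cf s p \<noteq> 0. cf s p *\<^sub>C x (fst p) (snd p))" using that e by blast
    also have "\<dots> = (\<Sum>p\<in>?F. cf s p *\<^sub>C x (fst p) (snd p))" using that e by (intro sum.mono_neutral_left) auto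
    finally show ?thesis .
  qed
  have "c *\<^sub>C b + b' = c *\<^sub>C (\<Sum>p\<in>?F. cf b p *\<^sub>C x (fst p) (snd p)) + (\<Sum>p\<in>?F. cf b' p *\<^sub>C x (fst p) (snd p))"
    using s[of b] s[of b'] by simp
  also have "\<dots> = (\<Sum>p\<in>?F. (c * cf b p + cf b' p) *\<^sub>C x (fst p) (snd p))"
    by (simp add: scaleC_sum scaleC_add sum.distrib)
  finally have eq: "c *\<^sub>C b + b' = (\<Sum>p\<in>?F. (c * cf b p + cf b' p) *\<^sub>C x (fst p) (snd p))" .
  have "expansion (\<lambda>p. c * cf b p + cf b' p) (c *\<^sub>C b + b')"
    unfolding expansion_def using e eq by (intro exI[of _ ?F] conjI) auto
  then have "cf (c *\<^sub>C b + b') = (\<lambda>p. c * cf b p + cf b' p)"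
    using b by (intro cf_eqI star_algebraD[OF B])
  then show ?thesis by simp
qed

lemma cf_zero: "cf 0 p = 0"
proof -
  have "expansion (\<lambda>_. 0) 0" unfolding expansion_def by (intro exI[of _ "{}"]) auto
  then show ?thesis using cf_eqI[OF star_algebraD(7)[OF B]] by simp
qed

lemma cf_scale: "b \<in> B \<Longrightarrow> cf (c *\<^sub>C b) p = c * cf b p"
  using cf_lin[OF _ star_algebraD(7)[OF B], of b c p] by (simp add: cf_zero)

lemma cf_sum: "(\<And>i. i \<in> I \<Longrightarrow> b i \<in> B) \<Longrightarrow> cf (\<Sum>i\<in>I. c i *\<^sub>C b i) p = (\<Sum>i\<in>I. c i * cf (b i) p)"
proof (induction I rule: infinite_finite_induct)
  case (insert i I)
  then have "(\<Sum>i\<in>I. c i *\<^sub>C b i) \<in> B" by (intro star_algebra_sum[OF B] star_algebraD(6)[OF B]) auto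
  then show ?case using insert by (simp add: cf_lin)
qed (auto simp: cf_zero)

lemma cf_x: "cf (x a c) p = (if (a, c) \<in> IX \<and> p = (a, c) then 1 else 0)"
proof (cases "(a, c) \<in> IX")
  case True
  then have "expansion (\<lambda>p. if p = (a, c) then 1 else 0) (x a c)"
    unfolding expansion_def by (intro exI[of _ "{(a, c)}"]) auto
  then show ?thesis using cf_eqI[OF x_B, of _ a c] True by simp
qed (simp add: x_def cf_zero)

lemma B_star: "a \<in> B \<Longrightarrow> b \<in> B \<Longrightarrow> a \<cdot> b \<in> B" "b \<in> B \<Longrightarrow> adj b \<in> B" "b \<in> B \<Longrightarrow> c *\<^sub>C b \<in> B" "\<one> \<in> B" "0 \<in> B"
  using star_algebraD[OF B] by auto

lemma M_alt: "M = commutant (commutant B)" by (simp add: link_vn_def vn_generated_def B_def)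

lemma B_M: "b \<in> B \<Longrightarrow> b \<in> M"
  unfolding M_alt using commutant_bi[of B] star_algebraD(1)[OF B] by auto

lemma \<delta>1_hom: "unital_star_hom M (Linf G1 \<otimes>\<^sub>v\<^sub>N M) \<delta>1" and \<delta>1_normal: "normal_on M \<delta>1"
  using act1 by (simp_all add: link_action1_def)

lemma \<delta>2_hom: "unital_star_hom M (M \<otimes>\<^sub>v\<^sub>N Linf G2) \<delta>2" and \<delta>2_normal: "normal_on M \<delta>2"
  using act2 by (simp_all add: link_action2_def)

lemma M_star: "unital_star_algebra M"
  unfolding M_alt using star_algebraD[OF B] by (intro bicommutant_star_algebra) auto

lemma \<delta>_sum: "(\<And>p. p \<in> S \<Longrightarrow> T p \<in> B) \<Longrightarrow> \<delta>1 (\<Sum>p\<in>S. T p) = (\<Sum>p\<in>S. \<delta>1 (T p))"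
  "(\<And>p. p \<in> S \<Longrightarrow> T p \<in> B) \<Longrightarrow> \<delta>2 (\<Sum>p\<in>S. T p) = (\<Sum>p\<in>S. \<delta>2 (T p))"
  by (auto intro!: linear_map_on_sum[OF homD(7)[OF \<delta>1_hom] M_star] linear_map_on_sum[OF homD(7)[OF \<delta>2_hom] M_star] B_M)

lemma \<delta>_zero: "\<delta>1 0 = 0" "\<delta>2 0 = 0"
  using \<delta>_sum[of "{}"] by simp_all

lemma \<delta>1_x: "\<delta>1 (x a c) = (\<Sum>d\<in>G1.cls a. G1.gU a d \<otimes> x d c)"
proof (cases "(a, c) \<in> IX")
  case True
  then have "\<delta>1 (x a c) = (\<Sum>d\<in>G1.cls a. gns G1 (coef G1 a d) \<otimes> \<pi> (lcoef L d c))"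
    using act1 by (auto simp: link_action1_def x_def)
  also have "\<dots> = (\<Sum>d\<in>G1.cls a. G1.gU a d \<otimes> x d c)"
    using True by (intro sum.cong refl) (simp add: G1.gU_def x_def IX)
  finally show ?thesis .
next
  case False
  then have "x d c = 0" if "d \<in> G1.cls a" for d using that x_zero[of d c] by (simp add: IX)
  then show ?thesis using False by (simp add: x_def[of a c] \<delta>_zero)
qed

lemma \<delta>2_x: "\<delta>2 (x a c) = (\<Sum>d\<in>G2.cls c. x a d \<otimes> G2.gU d c)"
proof (cases "(a, c) \<in> IX")
  case True
  then have "\<delta>2 (x a c) = (\<Sum>d\<in>G2.cls c. \<pi> (lcoef L a d) \<otimes> gns G2 (coef G2 d c))"
    using act2 by (auto simp: link_action2_def x_def)
  also have "\<dots> = (\<Sum>d\<in>G2.cls c. x a d \<otimes> G2.gU d c)"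
    using True by (intro sum.cong refl) (simp add: G2.gU_def x_def IX)
  finally show ?thesis .
next
  case False
  then have "x a d = 0" if "d \<in> G2.cls c" for d using that x_zero[of a d] by (simp add: IX)
  then show ?thesis using False by (simp add: x_def[of a c] \<delta>_zero)
qed

end

lemma (in cqg) \<xi>_norm: "cinner \<xi> \<xi> = 1"
  using \<xi>[OF star_algebraD(2)[OF star]] state homD(3)[OF \<pi>_hom] by (simp add: state_on_def)

lemma (in cqg) fib_triv: assumes a: "l a = triv G" shows "fib G (triv G) = {a}"
proof -
  obtain e where e: "fib G (triv G) = {e}" using triv by (elim exE conjE)
  have "a \<in> fib G (triv G)" using a by (simp only: mem_fib)
  then show ?thesis unfolding e by simp
qed

section \<open>The two actions in coordinates and the invariance of the state\<close>

context linking
begin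

lemma linked1: "\<exists>c. G1.l a = \<phi>l c"
proof -
  obtain y where y: "G1.l a = \<phi> y" using bij by (metis bij_is_surj surj_def)
  obtain c where "c \<in> fib G2 y" using G2.fib_ne[of y] by blast
  then show ?thesis using y by (intro exI[of _ c]) simp
qed

lemma linked2: "\<exists>a. G1.l a = \<phi>l c"
proof -
  obtain a where "a \<in> fib G1 (\<phi>l c)" using G1.fib_ne[of "\<phi>l c"] by blast
  then show ?thesis by (intro exI[of _ a]) simp
qed

lemma B_expand: "b \<in> B \<Longrightarrow> b = (\<Sum>p | cf b p \<noteq> 0. cf b p *\<^sub>C x (fst p) (snd p))"
  by (rule conjunct2[OF conjunct2[OF expansion_supp[OF cf]]])

lemma B_functional_eq:
  assumes "\<And>c a b. a \<in> B \<Longrightarrow> b \<in> B \<Longrightarrow> f (c *\<^sub>C a + b) = c * f a + f b" "\<And>c a b. a \<in> B \<Longrightarrow> b \<in> B \<Longrightarrow> g (c *\<^sub>C a + b) = c * g a + g b"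
    and eq: "\<And>a c. f (x a c) = g (x a c)" and b: "b \<in> B"
  shows "f b = (g b :: complex)"
proof -
  have m: "(\<Sum>p\<in>F. t p *\<^sub>C x (fst p) (snd p)) \<in> B" for F t by (intro star_algebra_sum[OF B] B_star(3) x_B)
  have z: "f 0 = 0" "g 0 = 0" using assms(1,2)[OF B_star(5) B_star(5), of 1] by simp_all
  have "f (\<Sum>p\<in>F. t p *\<^sub>C x (fst p) (snd p)) = g (\<Sum>p\<in>F. t p *\<^sub>C x (fst p) (snd p))" for F t
  proof (induction F rule: infinite_finite_induct)
    case (insert p F)
    then show ?case using assms(1,2)[OF x_B[of "fst p" "snd p"] m[of t F], of "t p"] by (simp add: eq)
  qed (simp_all add: z)
  from this[of "cf b" "{p. cf b p \<noteq> 0}"] show ?thesis unfolding B_expand[OF b, symmetric] .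
qed

lemma cf_inject: assumes "a \<in> B" "b \<in> B" "\<And>p. cf a p = cf b p" shows "a = b"
proof -
  have "cf a = cf b" using assms(3) by (rule ext)
  then show ?thesis using trans[OF B_expand[OF assms(1)] trans[OF _ B_expand[OF assms(2), symmetric]]] by simp
qed

lemma cf_off: "b \<in> B \<Longrightarrow> G1.l d \<noteq> \<phi>l c \<Longrightarrow> cf b (d, c) = 0"
  using expansion_supp[OF cf, of b] by (auto simp: link_index_def)

lemma cf_fin: "b \<in> B \<Longrightarrow> finite {p. cf b p \<noteq> 0}"
  using expansion_supp[OF cf, of b] by simp

lemma \<delta>_lin: "a \<in> B \<Longrightarrow> b \<in> B \<Longrightarrow> \<delta>1 (c *\<^sub>C a + b) = c *\<^sub>C \<delta>1 a + \<delta>1 b" "a \<in> B \<Longrightarrow> b \<in> B \<Longrightarrow> \<delta>2 (c *\<^sub>C a + b) = c *\<^sub>C \<delta>2 a + \<delta>2 b"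
  using homD(1,2)[OF \<delta>1_hom] homD(1,2)[OF \<delta>2_hom] by (simp_all add: B_M B_star)

lemma ls_\<delta>1_x: "ls u v (\<delta>1 (x a c)) = (\<Sum>d\<in>G1.cls a. cinner u (G1.gU a d v) *\<^sub>C x d c)"
  by (simp add: \<delta>1_x slice_sum)

lemma rs_\<delta>2_x: "rs u v (\<delta>2 (x a c)) = (\<Sum>d\<in>G2.cls c. cinner u (G2.gU d c v) *\<^sub>C x a d)"
  by (simp add: \<delta>2_x slice_sum)

lemma slice_\<delta>_B: assumes b: "b \<in> B" shows "ls u v (\<delta>1 b) \<in> B" "rs u' v' (\<delta>2 b) \<in> B"
proof -
  obtain t F where b': "b = (\<Sum>p\<in>F. t p *\<^sub>C x (fst p) (snd p))" by (rule that[OF B_expand[OF b]])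
  have m: "t p *\<^sub>C x (fst p) (snd p) \<in> B" for p by (simp add: B_star)
  show "ls u v (\<delta>1 b) \<in> B" "rs u' v' (\<delta>2 b) \<in> B"
    unfolding b' \<delta>_sum[OF m] slice_sum homD(2)[OF \<delta>1_hom B_M[OF x_B]] homD(2)[OF \<delta>2_hom B_M[OF x_B]] slice_linear ls_\<delta>1_x rs_\<delta>2_x
    by (intro star_algebra_sum[OF B] B_star x_B)+
qed

text \<open>Coordinates transform contragrediently to the basis: \<open>\<delta>1\<close> acts on
  the entries \<open>x\<close> by rows of \<open>gU\<close> and on their coordinates by
  columns.\<close>

lemma cf_\<delta>1:
  assumes b: "b \<in> B" shows "cf (ls u v (\<delta>1 b)) (d, c) = (\<Sum>d'\<in>G1.cls d. cf b (d', c) * cinner u (G1.gU d' d v))"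
proof (rule B_functional_eq[OF _ _ _ b, where f="\<lambda>b. cf (ls u v (\<delta>1 b)) (d, c)"])
  show "cf (ls u v (\<delta>1 (k *\<^sub>C a + b))) (d, c) = k * cf (ls u v (\<delta>1 a)) (d, c) + cf (ls u v (\<delta>1 b)) (d, c)"
    if "a \<in> B" "b \<in> B" for k a b using that by (simp add: \<delta>_lin slice_linear cf_lin slice_\<delta>_B)
  show "(\<Sum>d'\<in>G1.cls d. cf (k *\<^sub>C a + b) (d', c) * cinner u (G1.gU d' d v)) =
      k * (\<Sum>d'\<in>G1.cls d. cf a (d', c) * cinner u (G1.gU d' d v)) + (\<Sum>d'\<in>G1.cls d. cf b (d', c) * cinner u (G1.gU d' d v))"
    if "a \<in> B" "b \<in> B" for k a b using that by (simp add: cf_lin distrib_right sum.distrib sum_distrib_left mult.assoc)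
  show "cf (ls u v (\<delta>1 (x a c'))) (d, c) = (\<Sum>d'\<in>G1.cls d. cf (x a c') (d', c) * cinner u (G1.gU d' d v))" for a c'
  proof -
    have "cf (ls u v (\<delta>1 (x a c'))) (d, c) = (\<Sum>d'\<in>G1.cls a. if d' = d then (if (d, c') \<in> IX \<and> c = c' then cinner u (G1.gU a d v) else 0) else 0)"
      unfolding ls_\<delta>1_x cf_sum[OF x_B] by (intro sum.cong refl) (auto simp: cf_x)
    also have "\<dots> = (\<Sum>d'\<in>G1.cls d. if d' = a then (if (a, c') \<in> IX \<and> c = c' then cinner u (G1.gU a d v) else 0) else 0)"
      by (auto simp: IX)
    also have "\<dots> = (\<Sum>d'\<in>G1.cls d. cf (x a c') (d', c) * cinner u (G1.gU d' d v))"
      by (intro sum.cong refl) (auto simp: cf_x)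
    finally show ?thesis .
  qed
qed

lemma cf_\<delta>2:
  assumes b: "b \<in> B" shows "cf (rs u v (\<delta>2 b)) (d, c) = (\<Sum>c'\<in>G2.cls c. cf b (d, c') * cinner u (G2.gU c c' v))"
proof (rule B_functional_eq[OF _ _ _ b, where f="\<lambda>b. cf (rs u v (\<delta>2 b)) (d, c)"])
  show "cf (rs u v (\<delta>2 (k *\<^sub>C a + b))) (d, c) = k * cf (rs u v (\<delta>2 a)) (d, c) + cf (rs u v (\<delta>2 b)) (d, c)"
    if "a \<in> B" "b \<in> B" for k a b using that by (simp add: \<delta>_lin slice_linear cf_lin slice_\<delta>_B)
  show "(\<Sum>c'\<in>G2.cls c. cf (k *\<^sub>C a + b) (d, c') * cinner u (G2.gU c c' v)) =
      k * (\<Sum>c'\<in>G2.cls c. cf a (d, c') * cinner u (G2.gU c c' v)) + (\<Sum>c'\<in>G2.cls c. cf b (d, c') * cinner u (G2.gU c c' v))"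
    if "a \<in> B" "b \<in> B" for k a b using that by (simp add: cf_lin distrib_right sum.distrib sum_distrib_left mult.assoc)
  show "cf (rs u v (\<delta>2 (x a k))) (d, c) = (\<Sum>c'\<in>G2.cls c. cf (x a k) (d, c') * cinner u (G2.gU c c' v))" for a k
  proof -
    have "cf (rs u v (\<delta>2 (x a k))) (d, c) = (\<Sum>d'\<in>G2.cls k. if d' = c then (if (a, c) \<in> IX \<and> d = a then cinner u (G2.gU c k v) else 0) else 0)"
      unfolding rs_\<delta>2_x cf_sum[OF x_B] by (intro sum.cong refl) (auto simp: cf_x)
    also have "\<dots> = (\<Sum>d'\<in>G2.cls c. if d' = k then (if (a, k) \<in> IX \<and> d = a then cinner u (G2.gU c k v) else 0) else 0)"
      by (auto simp: IX)
    also have "\<dots> = (\<Sum>c'\<in>G2.cls c. cf (x a k) (d, c') * cinner u (G2.gU c c' v))"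
      by (intro sum.cong refl) (auto simp: cf_x)
    finally show ?thesis .
  qed
qed

text \<open>The unit is fixed by averaging over the first group, and averaging kills all coordinates
  outside of the trivial class. Both trivial fibres have one element, so the unit is a multiple of
  this one entry; evaluation in the vector state of \<open>\<xi>\<close> identifies the
  factor.\<close>

lemma x_trivial: assumes a: "G1.l a = triv G1" shows "x a c = cinner \<xi> (x a c \<xi>) *\<^sub>C \<one>"
proof (cases "(a, c) \<in> IX")
  case True
  obtain e1 where e1: "fib G1 (triv G1) = {e1}" using G1.triv by blast
  obtain e2 where e2: "fib G2 (triv G2) = {e2}" using G2.triv by blast
  have one: "G1.l d = triv G1 \<longleftrightarrow> d = a" for d using e1 a G1.mem_fib[of d "triv G1"] G1.mem_fib[of a "triv G1"] by auto
  have lc: "G2.l c = triv G2" using True a triv by (auto simp: IX)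
  have two: "G2.l d = triv G2 \<longleftrightarrow> d = c" for d using e2 lc G2.mem_fib[of d "triv G2"] G2.mem_fib[of c "triv G2"] by auto
  define s where "s = cf \<one> (a, c)"
  have "\<one> = s *\<^sub>C x a c"
  proof (rule cf_inject)
    fix p
    obtain d :: 'e1 and k :: 'e2 where p: "p = (d, k)" by (cases p)
    have d1: "ls G1.\<xi> G1.\<xi> (\<delta>1 \<one>) = (\<one> :: 'j op)"
      using slice_tensor(1)[of \<one> \<one> G1.\<xi> G1.\<xi>] by (simp add: homD(3)[OF \<delta>1_hom] G1.\<xi>_norm)
    have "cf \<one> (d, k) = (\<Sum>d'\<in>G1.cls d. cf \<one> (d', k) * cinner G1.\<xi> (G1.gU d' d G1.\<xi>))"
      using cf_\<delta>1[OF B_star(4), of G1.\<xi> G1.\<xi> d k] unfolding d1 .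
    also have "\<dots> = (\<Sum>d'\<in>G1.cls d. if d = a \<and> d' = a then cf \<one> (a, k) else 0)"
    proof (rule sum.cong[OF refl])
      fix d' show "cf \<one> (d', k) * cinner G1.\<xi> (G1.gU d' d G1.\<xi>) = (if d = a \<and> d' = a then cf \<one> (a, k) else 0)"
        using one[of d] one[of d'] by (simp add: G1.h_gU)
    qed
    also have "\<dots> = (if d = a then cf \<one> (a, k) else 0)" by auto
    also have "\<dots> = (if p = (a, c) then s else 0)"
    proof (cases "G1.l a = \<phi>l k")
      case True
      then have "k = c" using a triv two by (metis \<phi>_eq)
      then show ?thesis by (auto simp: p s_def)
    next
      case False
      then show ?thesis using cf_off[OF B_star(4) False] \<open>(a, c) \<in> IX\<close> by (auto simp: p IX)
    qed
    finally show "cf \<one> p = cf (s *\<^sub>C x a c) p" using True by (simp add: p cf_scale cf_x)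
  qed (simp_all add: B_star)
  then have s: "\<one> = s *\<^sub>C x a c" .
  have "s * cinner \<xi> (x a c \<xi>) = cinner \<xi> ((s *\<^sub>C x a c) \<xi>)" by simp
  then have one': "s * cinner \<xi> (x a c \<xi>) = 1" unfolding s[symmetric] by (simp add: \<xi>_norm)
  have "x a c = (cinner \<xi> (x a c \<xi>) * s) *\<^sub>C x a c" using one' by (simp add: mult.commute)
  also have "\<dots> = cinner \<xi> (x a c \<xi>) *\<^sub>C \<one>" unfolding s by simp
  finally show ?thesis .
next
  case False
  then have z: "x a c = 0" unfolding x_def by (rule if_not_P)
  show ?thesis unfolding z by (simp add: cinner.zero_right)
qed

lemma B_op_eq:
  fixes F :: "'j op \<Rightarrow> ('q, 'q) hom"
  assumes F: "\<And>c a b. a \<in> B \<Longrightarrow> b \<in> B \<Longrightarrow> F (c *\<^sub>C a + b) = c *\<^sub>C F a + F b"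
    and eq: "\<And>a c. F (x a c) = cinner \<xi> (x a c \<xi>) *\<^sub>C \<one>" and b: "b \<in> B"
  shows "F b = cinner \<xi> (b \<xi>) *\<^sub>C \<one>"
proof (rule hom_eqI)
  fix y z show "cinner y (F b z) = cinner y ((cinner \<xi> (b \<xi>) *\<^sub>C \<one>) z)"
    by (intro B_functional_eq[OF _ _ _ b, where f="\<lambda>b. cinner y (F b z)" and g="\<lambda>b. cinner y ((cinner \<xi> (b \<xi>) *\<^sub>C \<one>) z)"])
      (simp_all add: F eq blinfun.add_left cinner.add_right distrib_right mult.assoc)
qed

text \<open>Averaging over the first group is the state. On entries of a nontrivial class both sides
  vanish, and on the trivial class the claim is \<open>x_trivial\<close>. This identity is the
  source of all relations between the Haar states and the link algebra.\<close>

lemma h1: "b \<in> B \<Longrightarrow> ls G1.\<xi> G1.\<xi> (\<delta>1 b) = cinner \<xi> (b \<xi>) *\<^sub>C \<one>"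
proof (rule B_op_eq)
  show "ls G1.\<xi> G1.\<xi> (\<delta>1 (x a c)) = cinner \<xi> (x a c \<xi>) *\<^sub>C \<one>" for a c
  proof (cases "G1.l a = triv G1")
    case True
    note f = G1.fib_triv[OF True]
    have "ls G1.\<xi> G1.\<xi> (\<delta>1 (x a c)) = x a c" unfolding ls_\<delta>1_x True f by (simp add: G1.h_gU True)
    then show ?thesis using x_trivial[OF True, of c] by (rule trans)
  next
    case False
    then have "cinner \<xi> (x a c \<xi>) = 0" using state_x[of c a] x_zero[of a c] by (cases "G1.l a = \<phi>l c") auto
    then show ?thesis unfolding ls_\<delta>1_x using False by (auto simp: G1.h_gU intro!: sum.neutral)
  qed
qed (simp_all add: \<delta>_lin slice_linear)

lemma h2: "b \<in> B \<Longrightarrow> rs G2.\<xi> G2.\<xi> (\<delta>2 b) = cinner \<xi> (b \<xi>) *\<^sub>C \<one>"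
proof (rule B_op_eq)
  show "rs G2.\<xi> G2.\<xi> (\<delta>2 (x a c)) = cinner \<xi> (x a c \<xi>) *\<^sub>C \<one>" for a c
  proof (cases "G2.l c = triv G2")
    case True
    note f = G2.fib_triv[OF True]
    have r: "rs G2.\<xi> G2.\<xi> (\<delta>2 (x a c)) = x a c" unfolding rs_\<delta>2_x True f by (simp add: G2.h_gU True)
    show ?thesis
    proof (cases "G1.l a = triv G1")
      case True
      show ?thesis by (rule trans[OF r x_trivial[OF True]])
    next
      case False
      then have z: "x a c = 0" using \<open>G2.l c = triv G2\<close> triv by (intro x_zero) simp
      show ?thesis unfolding r unfolding z by (simp add: cinner.zero_right)
    qed
  next
    case False
    then have "cinner \<xi> (x a c \<xi>) = 0" using triv by (intro state_x) (simp flip: triv)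
    then show ?thesis unfolding rs_\<delta>2_x using False by (auto simp: G2.h_gU intro!: sum.neutral)
  qed
qed (simp_all add: \<delta>_lin slice_linear)

end

section \<open>Products of entries of X, intertwiners and orthogonality\<close>

context linking
begin

sublocale XX: block_unitary "\<lambda>j. (G1.l (fst j), G1.l (snd j))" "\<lambda>k. (\<phi> (G2.l (fst k)), \<phi> (G2.l (snd k)))"
    "\<lambda>j k. x (fst j) (fst k) \<cdot> x (snd j) (snd k)"
  by (rule X.product)

text \<open>Entries of \<open>X_13 X_23\<close>. Under \<open>\<delta>1\<close> they transform with
  \<open>G1.UU\<close> in the first index, under \<open>\<delta>2\<close> with \<open>G2.UU\<close>
  in the second.\<close>

definition "XX j k = x (fst j) (fst k) \<cdot> x (snd j) (snd k)"
definition "lb k = (\<phi> (G2.l (fst k)), \<phi> (G2.l (snd k)))"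

lemma XX_B [simp]: "XX j k \<in> B" by (simp add: XX_def B_star)

lemma XX_zero: "G1.l2 j \<noteq> lb k \<Longrightarrow> XX j k = 0"
  using XX.m_zero[of j k] by (simp add: XX_def lb_def G1.l2_def)

lemma XX_rows: "G1.l2 i = G1.l2 j \<Longrightarrow> (\<Sum>k | lb k = G1.l2 i. XX i k \<cdot> adj (XX j k)) = (if i = j then \<one> else 0)"
  using XX.rows[of i j] by (simp add: XX_def lb_def G1.l2_def)

lemma XX_cols: "lb j = lb k \<Longrightarrow> (\<Sum>i | G1.l2 i = lb j. adj (XX i j) \<cdot> XX i k) = (if j = k then \<one> else 0)"
  using XX.cols[of j k] by (simp add: XX_def lb_def G1.l2_def)

lemma fin_lb [simp]: "finite {k. lb k = y}" using XX.fin(2)[of y] by (simp add: lb_def)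

lemma lb_eq: "{k. lb k = lb k'} = G2.JJ (G2.l2 k')" by (auto simp: lb_def G2.l2_def)

lemma \<delta>1_XX: "\<delta>1 (XX j k) = (\<Sum>i\<in>G1.JJ (G1.l2 j). G1.UU j i \<otimes> XX i k)"
proof -
  have "\<delta>1 (XX j k) = (\<Sum>p\<in>fib G1 (G1.l (fst j)). \<Sum>q\<in>fib G1 (G1.l (snd j)). (G1.gU (fst j) p \<cdot> G1.gU (snd j) q) \<otimes> (x p (fst k) \<cdot> x q (snd k)))"
    unfolding XX_def homD(4)[OF \<delta>1_hom B_M[OF x_B] B_M[OF x_B]] \<delta>1_x compose_sum
    by (subst sum.swap) (simp add: op_tensor_compose)
  then show ?thesis unfolding G1.JJ_Times by (simp add: sum.cartesian_product G1.UU_def XX_def G1.l2_def split_def)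
qed

lemma \<delta>2_XX: "\<delta>2 (XX j k) = (\<Sum>i\<in>G2.JJ (G2.l2 k). XX j i \<otimes> G2.UU i k)"
proof -
  have "\<delta>2 (XX j k) = (\<Sum>p\<in>fib G2 (G2.l (fst k)). \<Sum>q\<in>fib G2 (G2.l (snd k)). (x (fst j) p \<cdot> x (snd j) q) \<otimes> (G2.gU p (fst k) \<cdot> G2.gU q (snd k)))"
    unfolding XX_def homD(4)[OF \<delta>2_hom B_M[OF x_B] B_M[OF x_B]] \<delta>2_x compose_sum
    by (subst sum.swap) (simp add: op_tensor_compose)
  then show ?thesis unfolding G2.JJ_Times by (simp add: sum.cartesian_product G2.UU_def XX_def G2.l2_def split_def)
qed

text \<open>Comparing coordinates of \<open>\<delta>1 (XX j k)\<close> computed in two ways shows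
  that the coordinates of \<open>XX\<close> in the basis \<open>x\<close> intertwine the tensor
  square with the irreducible representations of the first group. They stand in for a decomposition
  into irreducibles.\<close>

lemma T1: "(\<Sum>i\<in>G1.JJ (G1.l2 j). cf (XX i k) (d, c) *\<^sub>C G1.UU j i) = (\<Sum>d' | G1.l d' = G1.l d. cf (XX j k) (d', c) *\<^sub>C G1.gU d' d)"
proof (rule hom_eqI)
  fix u v
  have "cf (ls u v (\<delta>1 (XX j k))) (d, c) = (\<Sum>i\<in>G1.JJ (G1.l2 j). cinner u (G1.UU j i v) * cf (XX i k) (d, c))"
    unfolding \<delta>1_XX slice_sum by (simp add: B_clin cf_sum)
  then show "cinner u ((\<Sum>i\<in>G1.JJ (G1.l2 j). cf (XX i k) (d, c) *\<^sub>C G1.UU j i) v) = cinner u ((\<Sum>d' | G1.l d' = G1.l d. cf (XX j k) (d', c) *\<^sub>C G1.gU d' d) v)"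
    unfolding cf_\<delta>1[OF XX_B] by (simp add: sum_apply cinner.sum_right mult.commute fib_def)
qed

lemma T2: "(\<Sum>i\<in>G2.JJ (G2.l2 k). cf (XX j i) (d, c) *\<^sub>C G2.UU i k) = (\<Sum>c' | G2.l c' = G2.l c. cf (XX j k) (d, c') *\<^sub>C G2.gU c c')"
proof (rule hom_eqI)
  fix u v
  have "cf (rs u v (\<delta>2 (XX j k))) (d, c) = (\<Sum>i\<in>G2.JJ (G2.l2 k). cinner u (G2.UU i k v) * cf (XX j i) (d, c))"
    unfolding \<delta>2_XX slice_sum by (simp add: B_clin cf_sum)
  then show "cinner u ((\<Sum>i\<in>G2.JJ (G2.l2 k). cf (XX j i) (d, c) *\<^sub>C G2.UU i k) v) = cinner u ((\<Sum>c' | G2.l c' = G2.l c. cf (XX j k) (d, c') *\<^sub>C G2.gU c c') v)"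
    unfolding cf_\<delta>2[OF XX_B] by (simp add: sum_apply cinner.sum_right mult.commute fib_def)
qed

text \<open>Both Gram matrices come from the invariance of the Haar states under the two actions.\<close>

lemma gram1:
  assumes l: "G1.l a = G1.l f" "G1.l e' = G1.l f'" "G1.l f = \<phi>l c"
  shows "cinner (G1.gU a f G1.\<xi>) (G1.gU e' f' G1.\<xi>) = (if f = f' then cinner (x a c \<xi>) (x e' c \<xi>) else 0)"
proof -
  define s where "s d = cinner \<xi> ((adj (x a c) \<cdot> x e' d) \<xi>)" for d
  let ?H = "\<lambda>p q. cinner (G1.gU a p G1.\<xi>) (G1.gU e' q G1.\<xi>)" and ?I = "G1.cls a" and ?J = "G1.cls e'"
    and ?D = "{d. \<phi>l d = G1.l e'}"
  have m: "adj (x a c) \<cdot> x e' d \<in> B" for d by (intro B_star x_B)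
  have e: "(\<Sum>p\<in>?I. \<Sum>q\<in>?J. ?H p q *\<^sub>C (adj (x p c) \<cdot> x q d)) = s d *\<^sub>C \<one>" for d
  proof -
    have "\<delta>1 (adj (x a c) \<cdot> x e' d) = (\<Sum>p\<in>?I. \<Sum>q\<in>?J. (adj (G1.gU a p) \<cdot> G1.gU e' q) \<otimes> (adj (x p c) \<cdot> x q d))"
      unfolding homD(4)[OF \<delta>1_hom B_M[OF B_star(2)[OF x_B]] B_M[OF x_B]] homD(5)[OF \<delta>1_hom B_M[OF x_B]] \<delta>1_x
      by (subst adj_sum, simp, simp add: op_tensor_simps(5) compose_sum op_tensor_compose, rule sum.swap)
    then show ?thesis unfolding s_def h1[OF m, symmetric] by (simp add: slice_sum cinner_adj_right)
  qed
  \<comment> \<open>Multiplication by \<open>adj (x f' d)\<close> and summation over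
    \<open>d\<close> isolates the terms with \<open>q = f'\<close> by the row relation.\<close>
  have "(\<Sum>p\<in>?I. ?H p f' *\<^sub>C adj (x p c)) = (\<Sum>d\<in>?D. (\<Sum>p\<in>?I. \<Sum>q\<in>?J. ?H p q *\<^sub>C (adj (x p c) \<cdot> x q d)) \<cdot> adj (x f' d))"
  proof -
    have "(\<Sum>d\<in>?D. (\<Sum>p\<in>?I. \<Sum>q\<in>?J. ?H p q *\<^sub>C (adj (x p c) \<cdot> x q d)) \<cdot> adj (x f' d))
      = (\<Sum>p\<in>?I. \<Sum>q\<in>?J. ?H p q *\<^sub>C (adj (x p c) \<cdot> (\<Sum>d\<in>?D. x q d \<cdot> adj (x f' d))))"
      unfolding compose_sum scaleC_sum
      by (subst sum.swap, rule sum.cong[OF refl], subst sum.swap) (simp add: compose_assoc)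
    also have "\<dots> = (\<Sum>p\<in>?I. \<Sum>q\<in>?J. if q = f' then ?H p f' *\<^sub>C adj (x p c) else 0)"
    proof (rule sum.cong[OF refl], rule sum.cong[OF refl])
      fix p q assume "q \<in> ?J"
      then show "?H p q *\<^sub>C (adj (x p c) \<cdot> (\<Sum>d\<in>?D. x q d \<cdot> adj (x f' d))) = (if q = f' then ?H p f' *\<^sub>C adj (x p c) else 0)"
        using X.rows[of q f'] l(2) by simp
    qed
    also have "\<dots> = (\<Sum>p\<in>?I. ?H p f' *\<^sub>C adj (x p c))" using l(2) by simp
    finally show ?thesis by simp
  qed
  then have "adj (\<Sum>p\<in>?I. ?H p f' *\<^sub>C adj (x p c)) = adj (\<Sum>d\<in>?D. s d *\<^sub>C adj (x f' d))" unfolding e by simp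
  then have eq: "(\<Sum>p\<in>?I. cnj (?H p f') *\<^sub>C x p c) = (\<Sum>d\<in>?D. cnj (s d) *\<^sub>C x f' d)" by (simp add: adj_sum)
  \<comment> \<open>Coordinates are compared at \<open>(f, c)\<close>. The right-hand side of
    \<open>eq\<close> contains only entries in row \<open>f'\<close>, which forces the Gram entry to
    vanish for \<open>f \<noteq> f'\<close>.\<close>
  have "cnj (?H f f') = (\<Sum>p\<in>?I. if p = f then cnj (?H f f') else 0)" using l(1) by simp
  also have "\<dots> = cf (\<Sum>p\<in>?I. cnj (?H p f') *\<^sub>C x p c) (f, c)"
    unfolding cf_sum[OF x_B] by (intro sum.cong refl) (use l in \<open>auto simp: cf_x IX\<close>)
  also have "\<dots> = (\<Sum>d\<in>?D. if d = c then (if f = f' then cnj (s c) else 0) else 0)"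
    unfolding eq cf_sum[OF x_B] by (intro sum.cong refl) (use l in \<open>auto simp: cf_x IX\<close>)
  also have "\<dots> = (if f = f' then cnj (s c) else 0)" using l X.fin(2)[of "G1.l e'"] by auto
  finally have "cnj (?H f f') = cnj (if f = f' then s c else 0)" by simp
  then show ?thesis unfolding complex_cnj_cancel_iff by (simp add: s_def cinner_adj_right)
qed

lemma gram2:
  assumes l: "G2.l r = G2.l p" "G2.l q' = G2.l q" "G1.l b = \<phi>l q"
  shows "cinner G2.\<xi> (G2.gU r p (adj (G2.gU q' q) G2.\<xi>)) = (if r = q' then cinner \<xi> (x b p (adj (x b q) \<xi>)) else 0)"
proof -
  define s where "s a = cinner \<xi> ((x a p \<cdot> adj (x b q)) \<xi>)" for a
  let ?H = "\<lambda>p1 q1. cinner G2.\<xi> (G2.gU p1 p (adj (G2.gU q1 q) G2.\<xi>))" and ?I = "G2.cls p" and ?J = "G2.cls q"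
    and ?D = "{a. G1.l a = \<phi>l r}"
  have m: "x a p \<cdot> adj (x b q) \<in> B" for a by (intro B_star x_B)
  have e: "(\<Sum>p1\<in>?I. \<Sum>q1\<in>?J. ?H p1 q1 *\<^sub>C (x a p1 \<cdot> adj (x b q1))) = s a *\<^sub>C \<one>" for a
  proof -
    have "\<delta>2 (x a p \<cdot> adj (x b q)) = (\<Sum>p1\<in>?I. \<Sum>q1\<in>?J. (x a p1 \<cdot> adj (x b q1)) \<otimes> (G2.gU p1 p \<cdot> adj (G2.gU q1 q)))"
      unfolding homD(4)[OF \<delta>2_hom B_M[OF x_B] B_M[OF B_star(2)[OF x_B]]] homD(5)[OF \<delta>2_hom B_M[OF x_B]] \<delta>2_x
      by (subst adj_sum, simp, simp add: op_tensor_simps(5) compose_sum op_tensor_compose, rule sum.swap)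
    then show ?thesis unfolding s_def h2[OF m, symmetric] by (simp add: slice_sum)
  qed
  have "(\<Sum>q1\<in>?J. ?H r q1 *\<^sub>C adj (x b q1)) = (\<Sum>a\<in>?D. adj (x a r) \<cdot> (\<Sum>p1\<in>?I. \<Sum>q1\<in>?J. ?H p1 q1 *\<^sub>C (x a p1 \<cdot> adj (x b q1))))"
  proof -
    have "(\<Sum>a\<in>?D. adj (x a r) \<cdot> (\<Sum>p1\<in>?I. \<Sum>q1\<in>?J. ?H p1 q1 *\<^sub>C (x a p1 \<cdot> adj (x b q1))))
      = (\<Sum>p1\<in>?I. \<Sum>q1\<in>?J. ?H p1 q1 *\<^sub>C ((\<Sum>a\<in>?D. adj (x a r) \<cdot> x a p1) \<cdot> adj (x b q1)))"
      unfolding compose_sum scaleC_sum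
      by (subst sum.swap, rule sum.cong[OF refl], subst sum.swap) (simp add: compose_assoc)
    also have "\<dots> = (\<Sum>p1\<in>?I. if p1 = r then (\<Sum>q1\<in>?J. ?H r q1 *\<^sub>C adj (x b q1)) else 0)" (is "sum ?f _ = sum ?g _")
    proof (rule sum.cong[OF refl])
      fix p1 assume "p1 \<in> ?I"
      then show "?f p1 = ?g p1"
        using X.cols[of r p1] l(1) by simp
    qed
    also have "\<dots> = (\<Sum>q1\<in>?J. ?H r q1 *\<^sub>C adj (x b q1))" using l(1) by simp
    finally show ?thesis by simp
  qed
  then have "adj (\<Sum>q1\<in>?J. ?H r q1 *\<^sub>C adj (x b q1)) = adj (\<Sum>a\<in>?D. s a *\<^sub>C adj (x a r))" unfolding e by simp
  then have eq: "(\<Sum>q1\<in>?J. cnj (?H r q1) *\<^sub>C x b q1) = (\<Sum>a\<in>?D. cnj (s a) *\<^sub>C x a r)" by (simp add: adj_sum)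
  have "cnj (?H r q') = (\<Sum>q1\<in>?J. if q1 = q' then cnj (?H r q') else 0)" using l(2) by simp
  also have "\<dots> = cf (\<Sum>q1\<in>?J. cnj (?H r q1) *\<^sub>C x b q1) (b, q')"
    unfolding cf_sum[OF x_B] by (intro sum.cong refl) (use l in \<open>auto simp: cf_x IX\<close>)
  also have "\<dots> = (\<Sum>a\<in>?D. if a = b then (if r = q' then cnj (s b) else 0) else 0)"
    unfolding eq cf_sum[OF x_B] by (intro sum.cong refl) (use l in \<open>auto simp: cf_x IX\<close>)
  also have "\<dots> = (if r = q' then cnj (s b) else 0)" using l X.fin(1)[of "\<phi>l r"] by auto
  finally have "cnj (?H r q') = cnj (if r = q' then s b else 0)" by simp
  then show ?thesis unfolding complex_cnj_cancel_iff by (simp add: s_def)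
qed

text \<open>Within a column \<open>f\<close>, the vectors \<open>G1.gU a f G1.\<xi>\<close> have the
  Gram matrix of the vectors \<open>x a c \<xi>\<close>. The latter are independent because
  \<open>\<xi>\<close> is separating for \<open>B\<close> and the entries form a basis. Different
  columns are orthogonal by \<open>gram1\<close>, so the dual vector found inside one column works
  for all coefficients.\<close>

lemma dual1:
  assumes ef: "G1.l e = G1.l f"
  shows "\<exists>u. \<forall>e' f'. G1.l e' = G1.l f' \<longrightarrow> cinner u (G1.gU e' f' G1.\<xi>) = (if e' = e \<and> f' = f then 1 else 0)"
proof -
  obtain c where c: "G1.l f = \<phi>l c" using linked1[of f] by (elim exE)
  let ?I = "G1.cls f" and ?w = "\<lambda>a. G1.gU a f G1.\<xi>"
  have ind: "\<forall>i\<in>?I. k i = 0" if k: "(\<Sum>i\<in>?I. cscale (k i) (?w i)) = 0" for k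
  proof -
    define v where "v = (\<Sum>i\<in>?I. k i *\<^sub>C x i c)"
    have v: "v \<in> B" unfolding v_def by (intro star_algebra_sum[OF B] B_star x_B)
    have "cinner (v \<xi>) (v \<xi>) = (\<Sum>j\<in>?I. \<Sum>i\<in>?I. cnj (k i) * k j * cinner (x i c \<xi>) (x j c \<xi>))"
      by (simp add: v_def sum_apply cinner.sum_left cinner.sum_right sum_distrib_left mult.assoc mult.left_commute)
    also have "\<dots> = (\<Sum>j\<in>?I. \<Sum>i\<in>?I. cnj (k i) * k j * cinner (?w i) (?w j))"
      using c by (intro sum.cong refl) (simp add: gram1[where c=c])
    also have "\<dots> = cinner (\<Sum>i\<in>?I. cscale (k i) (?w i)) (\<Sum>i\<in>?I. cscale (k i) (?w i))"
      by (simp add: cinner.sum_left cinner.sum_right sum_distrib_left mult.assoc mult.left_commute)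
    finally have "cinner (v \<xi>) (v \<xi>) = 0" by (simp only: k cinner.zero_left)
    then have "v = 0" using faithful[OF v] by simp
    then have z: "cf v (i, c) = 0" for i by (simp add: cf_zero)
    have "k i = 0" if i: "i \<in> ?I" for i
    proof -
      have "cf v (i, c) = (\<Sum>i'\<in>?I. if i' = i then k i else 0)"
        unfolding v_def cf_sum[OF x_B] by (intro sum.cong refl) (use c in \<open>auto simp: cf_x IX\<close>)
      then show ?thesis using z[of i] i by simp
    qed
    then show ?thesis ..
  qed
  obtain k where k: "\<forall>j\<in>?I. cinner (\<Sum>i\<in>?I. cscale (k i) (?w i)) (?w j) = (if j = e then 1 else 0)"
  proof -
    have m: "e \<in> ?I" using ef by simp
    show ?thesis by (rule exE[OF dual_family[where w="?w" and i=e, OF G1.fin ind m]], assumption, rule that)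
  qed
  show ?thesis
  proof (rule exI[of _ "\<Sum>i\<in>?I. cscale (k i) (?w i)"], intro allI impI)
    fix e' f' assume l: "G1.l e' = G1.l f'"
    show "cinner (\<Sum>i\<in>?I. cscale (k i) (?w i)) (G1.gU e' f' G1.\<xi>) = (if e' = e \<and> f' = f then 1 else 0)"
    proof (cases "f' = f")
      case True
      then show ?thesis using k l by simp
    next
      case False
      then show ?thesis using gram1[OF _ l c] by (auto simp: cinner.sum_left intro!: sum.neutral)
    qed
  qed
qed

text \<open>For the second group the orthogonality concerns adjoint coefficients applied to
  \<open>G2.\<xi>\<close>, grouped by rows. The dual vectors therefore stand on the right and the
  constant vector on the left.\<close>

lemma dual2:
  assumes ef: "G2.l e = G2.l f"
  shows "\<exists>v. \<forall>e' f'. G2.l e' = G2.l f' \<longrightarrow> cinner G2.\<xi> (G2.gU e' f' v) = (if e' = e \<and> f' = f then 1 else 0)"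
proof -
  obtain b where b: "G1.l b = \<phi>l e" using linked2[of e] by (elim exE)
  let ?I = "G2.cls e" and ?w = "\<lambda>p. adj (G2.gU e p) G2.\<xi>"
  have ind: "\<forall>i\<in>?I. k i = 0" if k: "(\<Sum>i\<in>?I. cscale (k i) (?w i)) = 0" for k
  proof -
    define v where "v = (\<Sum>i\<in>?I. k i *\<^sub>C adj (x b i))"
    have v: "v \<in> B" unfolding v_def by (intro star_algebra_sum[OF B] B_star x_B)
    have "cinner (v \<xi>) (v \<xi>) = (\<Sum>j\<in>?I. \<Sum>i\<in>?I. cnj (k i) * k j * cinner \<xi> (x b i (adj (x b j) \<xi>)))"
      by (simp add: v_def sum_apply cinner.sum_left cinner.sum_right sum_distrib_left mult.assoc mult.left_commute cinner_adj_left)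
    also have "\<dots> = (\<Sum>j\<in>?I. \<Sum>i\<in>?I. cnj (k i) * k j * cinner (?w i) (?w j))"
      using b by (intro sum.cong refl) (simp add: gram2[where b=b] cinner_adj_left)
    also have "\<dots> = cinner (\<Sum>i\<in>?I. cscale (k i) (?w i)) (\<Sum>i\<in>?I. cscale (k i) (?w i))"
      by (simp add: cinner.sum_left cinner.sum_right sum_distrib_left mult.assoc mult.left_commute)
    finally have "cinner (v \<xi>) (v \<xi>) = 0" by (simp only: k cinner.zero_left)
    then have "v = 0" using faithful[OF v] by simp
    then have "adj v = 0" by simp
    then have z: "(\<Sum>i\<in>?I. cnj (k i) *\<^sub>C x b i) = 0" by (simp add: v_def adj_sum)
    have "k i = 0" if i: "i \<in> ?I" for i
    proof -
      have "cf (\<Sum>i\<in>?I. cnj (k i) *\<^sub>C x b i) (b, i) = (\<Sum>i'\<in>?I. if i' = i then cnj (k i) else 0)"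
        unfolding cf_sum[OF x_B] by (intro sum.cong refl) (use b in \<open>auto simp: cf_x IX\<close>)
      then show ?thesis using z i by (simp add: cf_zero)
    qed
    then show ?thesis ..
  qed
  obtain k where k: "\<forall>j\<in>?I. cinner (\<Sum>i\<in>?I. cscale (k i) (?w i)) (?w j) = (if j = f then 1 else 0)"
  proof -
    have m: "f \<in> ?I" using ef by simp
    show ?thesis by (rule exE[OF dual_family[where w="?w" and i=f, OF G2.fin ind m]], assumption, rule that)
  qed
  have k': "cinner G2.\<xi> (G2.gU e j (\<Sum>i\<in>?I. cscale (k i) (?w i))) = (if j = f then 1 else 0)" if "j \<in> ?I" for j
  proof -
    have "cinner G2.\<xi> (G2.gU e j (\<Sum>i\<in>?I. cscale (k i) (?w i))) = cnj (cinner (\<Sum>i\<in>?I. cscale (k i) (?w i)) (?w j))"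
      by (simp add: cinner_cnj cinner_adj_left)
    then show ?thesis using k that by simp
  qed
  show ?thesis
  proof (rule exI[of _ "\<Sum>i\<in>?I. cscale (k i) (?w i)"], intro allI impI)
    fix e' f' assume l: "G2.l e' = G2.l f'"
    show "cinner G2.\<xi> (G2.gU e' f' (\<Sum>i\<in>?I. cscale (k i) (?w i))) = (if e' = e \<and> f' = f then 1 else 0)"
    proof (cases "e' = e")
      case True
      then show ?thesis using k' l by simp
    next
      case False
      then show ?thesis using gram2[OF l, of e _ b] b by (auto simp: cinner.sum_right blinfun.sum_right clinD intro!: sum.neutral)
    qed
  qed
qed

section \<open>Fusion coefficients of the two quantum groups\<close>

definition du1 where "du1 e f = (SOME u. \<forall>e' f'. G1.l e' = G1.l f' \<longrightarrow> cinner u (G1.gU e' f' G1.\<xi>) = (if e' = e \<and> f' = f then 1 else 0))"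
definition dv2 where "dv2 e f = (SOME v. \<forall>e' f'. G2.l e' = G2.l f' \<longrightarrow> cinner G2.\<xi> (G2.gU e' f' v) = (if e' = e \<and> f' = f then 1 else 0))"

lemma du1: "G1.l e = G1.l f \<Longrightarrow> G1.l e' = G1.l f' \<Longrightarrow> cinner (du1 e f) (G1.gU e' f' G1.\<xi>) = (if e' = e \<and> f' = f then 1 else 0)"
  using someI_ex[OF dual1[of e f]] unfolding du1_def by simp

lemma dv2: "G2.l e = G2.l f \<Longrightarrow> G2.l e' = G2.l f' \<Longrightarrow> cinner G2.\<xi> (G2.gU e' f' (dv2 e f)) = (if e' = e \<and> f' = f then 1 else 0)"
  using someI_ex[OF dual2[of e f]] unfolding dv2_def by simp

definition "K1 e f j k = cinner (du1 e f) (G1.UU j k G1.\<xi>)"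
definition "K2 e f j k = cinner G2.\<xi> (G2.UU j k (dv2 e f))"

text \<open>The classes met by the finitely many coordinates of the products \<open>XX\<close> over
  the pair \<open>y\<close>; finiteness comes from the finiteness of linear expansions.\<close>

definition "N1 y = (\<lambda>q. G1.l (fst q)) ` (\<Union>j\<in>G1.JJ y. \<Union>k\<in>{k. lb k = y}. {q. cf (XX j k) q \<noteq> 0})"
definition "N2 y = (\<lambda>q. G2.l (snd q)) ` (\<Union>k\<in>G2.JJ y. \<Union>j\<in>{j. G1.l2 j = (\<phi> (fst y), \<phi> (snd y))}. {q. cf (XX j k) q \<noteq> 0})"

lemma N_fin: "finite (N1 y)" "finite (N2 y')" unfolding N1_def N2_def by (intro finite_imageI finite_UN_I; simp add: cf_fin)+

lemma id_ne: "k *\<^sub>C (\<one> :: 'j op) = 0 \<Longrightarrow> k = 0"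
proof -
  assume "k *\<^sub>C (\<one> :: 'j op) = 0"
  then have "(k *\<^sub>C (\<one> :: 'j op)) \<xi> = 0" by simp
  then have "cinner \<xi> (cscale k \<xi>) = 0" by simp
  then show "k = 0" using \<xi>_norm by simp
qed

text \<open>If all contractions with coordinates vanish, then the combination of the
  \<open>XX j k\<close> with coefficients \<open>s j\<close> vanishes for every \<open>k\<close>;
  unitarity of the matrix \<open>XX\<close> recovers \<open>s i\<close> from it.\<close>

lemma inj1: assumes s: "\<And>d n. (\<Sum>j\<in>G1.JJ y. s j * cf (XX j (snd n)) (d, fst n)) = 0" and i: "i \<in> G1.JJ y" shows "s i = 0"
proof -
  have z: "(\<Sum>j\<in>G1.JJ y. s j *\<^sub>C XX j k) = 0" for k
  proof (rule cf_inject)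
    show "(\<Sum>j\<in>G1.JJ y. s j *\<^sub>C XX j k) \<in> B" by (intro star_algebra_sum[OF B] B_star XX_B)
    show "cf (\<Sum>j\<in>G1.JJ y. s j *\<^sub>C XX j k) p = cf 0 p" for p
      using s[of "(snd p, k)" "fst p"] by (simp add: cf_sum cf_zero)
  qed (rule B_star)
  have "0 = (\<Sum>k | lb k = y. (\<Sum>j\<in>G1.JJ y. s j *\<^sub>C XX j k) \<cdot> adj (XX i k))" by (simp add: z)
  also have "\<dots> = (\<Sum>j\<in>G1.JJ y. s j *\<^sub>C (\<Sum>k | lb k = y. XX j k \<cdot> adj (XX i k)))"
    unfolding compose_sum_left scaleC_sum by (subst sum.swap) simp
  also have "\<dots> = (\<Sum>j\<in>G1.JJ y. if j = i then s i *\<^sub>C \<one> else 0)" (is "sum ?f _ = sum ?g _")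
  proof (rule sum.cong[OF refl])
    fix j assume "j \<in> G1.JJ y"
    then show "?f j = ?g j"
      using XX_rows[of j i] i by auto
  qed
  also have "\<dots> = s i *\<^sub>C \<one>" using i by simp
  finally show ?thesis by (intro id_ne) simp
qed

lemma inj2: assumes s: "\<And>d n. (\<Sum>k\<in>G2.JJ y. s k * cf (XX (snd n) k) (fst n, d)) = 0" and i: "i \<in> G2.JJ y" shows "s i = 0"
proof -
  have z: "(\<Sum>k\<in>G2.JJ y. s k *\<^sub>C XX j k) = 0" for j
  proof (rule cf_inject)
    show "(\<Sum>k\<in>G2.JJ y. s k *\<^sub>C XX j k) \<in> B" by (intro star_algebra_sum[OF B] B_star XX_B)
    show "cf (\<Sum>k\<in>G2.JJ y. s k *\<^sub>C XX j k) p = cf 0 p" for p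
      using s[of "(fst p, j)" "snd p"] by (simp add: cf_sum cf_zero)
  qed (rule B_star)
  have "0 = (\<Sum>j | G1.l2 j = lb i. adj (XX j i) \<cdot> (\<Sum>k\<in>G2.JJ y. s k *\<^sub>C XX j k))" by (simp add: z)
  also have "\<dots> = (\<Sum>k\<in>G2.JJ y. s k *\<^sub>C (\<Sum>j | G1.l2 j = lb i. adj (XX j i) \<cdot> XX j k))"
    unfolding compose_sum_right scaleC_sum by (subst sum.swap) (simp add: B_clin)
  also have "\<dots> = (\<Sum>k\<in>G2.JJ y. if k = i then s i *\<^sub>C \<one> else 0)" (is "sum ?f _ = sum ?g _")
  proof (rule sum.cong[OF refl])
    fix k assume "k \<in> G2.JJ y"
    then have "lb i = lb k" using i by (simp add: lb_def G2.l2_def prod_eq_iff)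
    then show "?f k = ?g k"
      using XX_cols[of i k] by auto
  qed
  also have "\<dots> = s i *\<^sub>C \<one>" using i by simp
  finally show ?thesis by (intro id_ne) simp
qed

lemma N1_zero: assumes "i \<in> G1.JJ y" "G1.l d \<notin> N1 y" shows "cf (XX i k) (d, c) = 0"
proof (cases "lb k = y")
  case True
  show ?thesis
  proof (rule ccontr)
    assume "cf (XX i k) (d, c) \<noteq> 0"
    then have "G1.l d \<in> N1 y" unfolding N1_def using assms(1) True by (intro image_eqI[of _ _ "(d, c)"] UN_I[of i] UN_I[of k]) auto
    then show False using assms(2) by contradiction
  qed
next
  case False
  then have "XX i k = 0" using assms(1) by (intro XX_zero) auto
  then show ?thesis by (simp add: cf_zero)
qed

lemma N2_zero: assumes "i \<in> G2.JJ y" "G2.l d \<notin> N2 y" shows "cf (XX j i) (c, d) = 0"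
proof (cases "G1.l2 j = (\<phi> (fst y), \<phi> (snd y))")
  case True
  show ?thesis
  proof (rule ccontr)
    assume "cf (XX j i) (c, d) \<noteq> 0"
    then have "G2.l d \<in> N2 y" unfolding N2_def using assms(1) True by (intro image_eqI[of _ _ "(c, d)"] UN_I[of i] UN_I[of j]) auto
    then show False using assms(2) by contradiction
  qed
next
  case False
  then have "XX j i = 0" using assms(1) by (intro XX_zero) (auto simp: lb_def G2.l2_def)
  then show ?thesis by (simp add: cf_zero)
qed

lemmas fusion1' = fusion_coefficients[where lb=G1.l and u=G1.gU and uu=G1.UU and du=du1 and dv="\<lambda>_ _. G1.\<xi>"
    and t="\<lambda>j d n. cf (XX j (snd n)) (d, fst n)" and K=K1]

text \<open>The second group acts from the right, so its matrices enter the general statement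
  transposed; hence the exchanged index pairs in \<open>u\<close>, \<open>uu\<close>,
  \<open>dv\<close> and \<open>K\<close>.\<close>

lemmas fusion2' = fusion_coefficients[where lb=G2.l and u="\<lambda>e f. G2.gU f e" and uu="\<lambda>i j. G2.UU j i" and du="\<lambda>_ _. G2.\<xi>" and dv="\<lambda>e f. dv2 f e"
    and t="\<lambda>j d n. cf (XX (snd n) j) (fst n, d)" and K="\<lambda>e f i j. K2 f e j i"]

lemma T1': "i \<in> G1.JJ y \<Longrightarrow> (\<Sum>j\<in>G1.JJ y. cf (XX j (snd n)) (d, fst n) *\<^sub>C G1.UU i j) = (\<Sum>d' | G1.l d' = G1.l d. cf (XX i (snd n)) (d', fst n) *\<^sub>C G1.gU d' d)"
  using T1[where j=i and k="snd n" and d=d and c="fst n"] by simp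

lemma inj1': "\<forall>s. (\<forall>d n. (\<Sum>j\<in>G1.JJ y. s j * cf (XX j (snd n)) (d, fst n)) = 0) \<longrightarrow> (\<forall>j\<in>G1.JJ y. s j = 0)"
  by (intro allI impI ballI, rule inj1[where y=y]) (elim allE, assumption+)

lemma T2': "i \<in> G2.JJ y \<Longrightarrow> (\<Sum>j\<in>G2.JJ y. cf (XX (snd n) j) (fst n, d) *\<^sub>C G2.UU j i) = (\<Sum>d' | G2.l d' = G2.l d. cf (XX (snd n) i) (fst n, d') *\<^sub>C G2.gU d d')"
  using T2[where k=i and j="snd n" and c=d and d="fst n"] by simp

lemma inj2': "\<forall>s. (\<forall>d n. (\<Sum>j\<in>G2.JJ y. s j * cf (XX (snd n) j) (fst n, d)) = 0) \<longrightarrow> (\<forall>j\<in>G2.JJ y. s j = 0)"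
  by (intro allI impI ballI, rule inj2[where y=y]) (elim allE, assumption+)

lemma dv2': "G2.l e = G2.l f \<Longrightarrow> G2.l e' = G2.l f' \<Longrightarrow> cinner G2.\<xi> (G2.gU f' e' (dv2 f e)) = (if e' = e \<and> f' = f then 1 else 0)"
  using dv2[of f e f' e'] by auto

lemma fin_G2: "finite {e. G2.l e = z}" using G2.fin[of z] by (simp add: fib_def)

lemma fusion1:
  "G1.l e = G1.l f \<Longrightarrow> i \<in> G1.JJ y \<Longrightarrow> (\<Sum>j\<in>G1.JJ y. K1 e f i j * cf (XX j k) (d, c)) = (if d = f then cf (XX i k) (e, c) else 0)"
  "G1.l e = G1.l f \<Longrightarrow> G1.l e \<notin> N1 y \<Longrightarrow> i \<in> G1.JJ y \<Longrightarrow> j \<in> G1.JJ y \<Longrightarrow> K1 e f i j = 0"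
  "i \<in> G1.JJ y \<Longrightarrow> j \<in> G1.JJ y \<Longrightarrow> G1.UU i j = (\<Sum>e | G1.l e \<in> N1 y. \<Sum>f | G1.l f = G1.l e. K1 e f i j *\<^sub>C G1.gU e f)"
  "G1.l e = G1.l f \<Longrightarrow> G1.l g = G1.l d \<Longrightarrow> i \<in> G1.JJ y \<Longrightarrow> j \<in> G1.JJ y \<Longrightarrow>
    (\<Sum>m\<in>G1.JJ y. K1 e f i m * K1 g d m j) = (if f = g then K1 e d i j else 0)"
  "i \<in> G1.JJ y \<Longrightarrow> j \<in> G1.JJ y \<Longrightarrow> (\<Sum>e | G1.l e \<in> N1 y. K1 e e i j) = (if i = j then 1 else 0)"
proof -
  show "G1.l e = G1.l f \<Longrightarrow> i \<in> G1.JJ y \<Longrightarrow> (\<Sum>j\<in>G1.JJ y. K1 e f i j * cf (XX j k) (d, c)) = (if d = f then cf (XX i k) (e, c) else 0)"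
    by (rule fusion1'(1)[where J="G1.JJ y" and n="(c, k)", unfolded fst_conv snd_conv], rule X.fin, rule G1.fin_JJ, rule N_fin(1), rule du1, assumption+,
        rule T1', assumption, rule N1_zero, assumption+, rule inj1', rule K1_def, assumption+)
qed (rule fusion1'(2-)[where J="G1.JJ y"], rule X.fin, rule G1.fin_JJ, rule N_fin(1), rule du1, assumption+,
        rule T1', assumption, rule N1_zero, assumption+, rule inj1', rule K1_def, assumption+)+

lemma fusion2:
  "G2.l e = G2.l f \<Longrightarrow> i \<in> G2.JJ y \<Longrightarrow> (\<Sum>j\<in>G2.JJ y. K2 e f j i * cf (XX k j) (c, d)) = (if d = e then cf (XX k i) (c, f) else 0)"
  "G2.l e = G2.l f \<Longrightarrow> G2.l e \<notin> N2 y \<Longrightarrow> i \<in> G2.JJ y \<Longrightarrow> j \<in> G2.JJ y \<Longrightarrow> K2 f e j i = 0"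
  "i \<in> G2.JJ y \<Longrightarrow> j \<in> G2.JJ y \<Longrightarrow> G2.UU j i = (\<Sum>e | G2.l e \<in> N2 y. \<Sum>f | G2.l f = G2.l e. K2 f e j i *\<^sub>C G2.gU f e)"
  "G2.l e = G2.l f \<Longrightarrow> G2.l g = G2.l d \<Longrightarrow> i \<in> G2.JJ y \<Longrightarrow> j \<in> G2.JJ y \<Longrightarrow>
    (\<Sum>m\<in>G2.JJ y. K2 f e m i * K2 d g j m) = (if f = g then K2 d e j i else 0)"
  "i \<in> G2.JJ y \<Longrightarrow> j \<in> G2.JJ y \<Longrightarrow> (\<Sum>e | G2.l e \<in> N2 y. K2 e e j i) = (if i = j then 1 else 0)"
proof -
  show "(\<Sum>j\<in>G2.JJ y. K2 e f j i * cf (XX k j) (c, d)) = (if d = e then cf (XX k i) (c, f) else 0)"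
    if l: "G2.l e = G2.l f" and i: "i \<in> G2.JJ y"
    by (rule fusion2'(1)[where J="G2.JJ y" and n="(c, k)" and e=f and f=e, unfolded fst_conv snd_conv], rule fin_G2, rule G2.fin_JJ, rule N_fin(2), rule dv2', assumption+,
        rule T2', assumption, rule N2_zero, assumption+, rule inj2', rule K2_def, rule l[symmetric], rule i)
qed (rule fusion2'(2-)[where J="G2.JJ y"], rule fin_G2, rule G2.fin_JJ, rule N_fin(2), rule dv2', assumption+,
        rule T2', assumption, rule N2_zero, assumption+, rule inj2', rule K2_def, assumption+)+

end

section \<open>Both duals and the relations between their structure constants\<close>

definition (in cqg) QQ where "QQ = (SOME Q. \<forall>e f e' f'. l e = l f \<longrightarrow> l e' = l f' \<longrightarrow> l e = l e' \<longrightarrow>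
    cinner \<xi> (gU e f (adj (gU e' f') \<xi>)) = (if e = e' then Q f f' else 0))"

lemma (in cqg) QQ:
  "l e = l f \<Longrightarrow> l e' = l f' \<Longrightarrow> l e = l e' \<Longrightarrow> cinner \<xi> (gU e f (adj (gU e' f') \<xi>)) = (if e = e' then QQ f f' else 0)"
  using someI_ex[OF schur] unfolding QQ_def by simp

context linking
begin

sublocale D1: dual G1 du1 "\<lambda>_ _. G1.\<xi>" N1 K1 G1.QQ
proof (unfold_locales, goal_cases)
  case (4 e f j k)
  show ?case
  proof (cases "G1.l2 k = G1.l2 j")
    case True then show ?thesis using 4 by (intro fusion1(2)[where y="G1.l2 j"]) simp_all
  qed (simp add: K1_def G1.UU_zero)
next
  case 5
  then show ?case unfolding fib_def by (intro fusion1(3)) simp_all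
next
  case 6
  then show ?case by (intro fusion1(4)) simp_all
next
  case 7
  then show ?case by (intro fusion1(5)) simp_all
qed (simp_all add: du1 K1_def N_fin G1.QQ)

sublocale D2: dual G2 "\<lambda>_ _. G2.\<xi>" dv2 N2 K2 G2.QQ
proof (unfold_locales, goal_cases)
  case (4 e f j k)
  show ?case
  proof (cases "G2.l2 k = G2.l2 j")
    case True then show ?thesis using 4 by (intro fusion2(2)[where y="G2.l2 j"]) simp_all
  qed (simp add: K2_def G2.UU_zero)
next
  \<comment> \<open>The transposed fusion relation exchanges the outer and the inner index. Both run
    through the same fibre, so the double sum can be reordered.\<close>
  case (5 j k)
    let ?E = "{e. G2.l e \<in> N2 (G2.l2 j)}"
    have fE: "finite ?E"
    proof -
      have "?E = (\<Union>z\<in>N2 (G2.l2 j). fib G2 z)" by auto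
      then show ?thesis using N_fin by simp
    qed
    have ss: "(\<Sum>e\<in>?E. \<Sum>f\<in>G2.cls e. F e f) = (\<Sum>e\<in>?E. \<Sum>f\<in>?E. if G2.l e = G2.l f then F e f else 0)" for F :: "'e2 \<Rightarrow> 'e2 \<Rightarrow> 'i2 op"
      using fE by (intro sum.cong refl sum.mono_neutral_cong_left) auto
    have "G2.UU j k = (\<Sum>e\<in>?E. \<Sum>f\<in>G2.cls e. K2 f e j k *\<^sub>C G2.gU f e)"
      unfolding fib_def using 5 by (intro fusion2(3)) simp_all
    also have "\<dots> = (\<Sum>f\<in>?E. \<Sum>e\<in>G2.cls f. K2 f e j k *\<^sub>C G2.gU f e)"
      unfolding ss by (subst sum.swap, intro sum.cong refl) auto
    finally show ?case .
next
  case (6 e f g d i k)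
  then show ?case using fusion2(4)[where e=d and f=g and g=f and d=e and i=k and j=i and y="G2.l2 i"] by (simp add: mult.commute eq_commute)
next
  case (7 i k)
  then show ?case using fusion2(5)[where j=i and i=k and y="G2.l2 i"] by auto
qed (simp_all add: dv2 K2_def N_fin G2.QQ)

text \<open>Averaging \<open>x e v \<cdot> adj (x e s)\<close> over the first group produces the
  matrix \<open>G1.QQ\<close> on one side; by \<open>h1\<close> it is also the scalar value of the
  state, which \<open>gram2\<close> identifies as an entry of \<open>G2.QQ\<close>. In terms of
  states, conjugation by \<open>X\<close> carries \<open>psi\<close> of a class to
  \<open>psi\<close> of the class matched by \<open>\<phi>\<close>.\<close>

lemma star_relation:
  assumes v: "G2.l v = y" and s: "G2.l s = y"
  shows "(\<Sum>f\<in>fib G1 (\<phi> y). \<Sum>f'\<in>fib G1 (\<phi> y). G1.QQ f f' *\<^sub>C (x f v \<cdot> adj (x f' s))) = G2.QQ v s *\<^sub>C \<one>"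
proof -
  obtain e where e: "G1.l e = \<phi>l v" using linked2[of v] by (elim exE)
  let ?I = "fib G1 (\<phi> y)"
  have m: "x e v \<cdot> adj (x e s) \<in> B" by (intro B_star x_B)
  have "\<delta>1 (x e v \<cdot> adj (x e s)) = (\<Sum>p\<in>?I. \<Sum>q\<in>?I. (G1.gU e p \<cdot> adj (G1.gU e q)) \<otimes> (x p v \<cdot> adj (x q s)))"
    unfolding homD(4)[OF \<delta>1_hom B_M[OF x_B] B_M[OF B_star(2)[OF x_B]]] homD(5)[OF \<delta>1_hom B_M[OF x_B]] \<delta>1_x e v
    by (subst adj_sum, simp, simp add: op_tensor_simps(5) compose_sum op_tensor_compose, rule sum.swap)
  then have "(\<Sum>p\<in>?I. \<Sum>q\<in>?I. cinner G1.\<xi> (G1.gU e p (adj (G1.gU e q) G1.\<xi>)) *\<^sub>C (x p v \<cdot> adj (x q s))) = cinner \<xi> ((x e v \<cdot> adj (x e s)) \<xi>) *\<^sub>C \<one>"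
    unfolding h1[OF m, symmetric] by (simp add: slice_sum)
  moreover have "cinner \<xi> ((x e v \<cdot> adj (x e s)) \<xi>) = G2.QQ v s"
    using gram2[of v v s s e] gram2[of v v v s e] G2.QQ[of v v v s] e v s by simp
  moreover have "(\<Sum>p\<in>?I. \<Sum>q\<in>?I. cinner G1.\<xi> (G1.gU e p (adj (G1.gU e q) G1.\<xi>)) *\<^sub>C (x p v \<cdot> adj (x q s)))
      = (\<Sum>p\<in>?I. \<Sum>q\<in>?I. G1.QQ p q *\<^sub>C (x p v \<cdot> adj (x q s)))"
    using e v by (intro sum.cong refl) (simp add: G1.QQ)
  ultimately show ?thesis by (simp only:)
qed

text \<open>Multiplication by the entries of \<open>X X\<close> turns both sides into the same combination of entries of \<open>X\<close>.\<close>

lemma transfer_relation: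
  assumes c: "G2.l c = G2.l c'" and ij: "G1.l2 i = G1.l2 j"
  shows "(\<Sum>d\<in>fib G1 (\<phi>l c). \<Sum>d'\<in>fib G1 (\<phi>l c). K1 d d' i j *\<^sub>C (x d c \<cdot> adj (x d' c')))
    = (\<Sum>k | lb k = G1.l2 i. \<Sum>m | lb m = G1.l2 i. K2 c c' k m *\<^sub>C (XX i k \<cdot> adj (XX j m)))"
proof -
  let ?J = "G1.JJ (G1.l2 i)" and ?K = "{k. lb k = G1.l2 i}" and ?D = "fib G1 (\<phi>l c)" and ?F = "{f. \<phi>l f = \<phi>l c}"
  define M1 where "M1 j = (\<Sum>d\<in>?D. \<Sum>d'\<in>?D. K1 d d' i j *\<^sub>C (x d c \<cdot> adj (x d' c')))" for j
  define M2 where "M2 j = (\<Sum>k\<in>?K. \<Sum>m\<in>?K. K2 c c' k m *\<^sub>C (XX i k \<cdot> adj (XX j m)))" for j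
  have e1: "(\<Sum>j\<in>?J. M1 j \<cdot> XX j r) = (\<Sum>d\<in>?D. cf (XX i r) (d, c') *\<^sub>C x d c)" for r
  proof -
    have in1: "(\<Sum>j\<in>?J. K1 d d' i j *\<^sub>C XX j r) = (\<Sum>f\<in>?F. cf (XX i r) (d, f) *\<^sub>C x d' f)"
      if d: "d \<in> ?D" "d' \<in> ?D" for d d'
    proof (rule cf_inject)
      fix p obtain g f where p: "p = (g :: 'e1, f :: 'e2)" by (cases p)
      have "cf (\<Sum>j\<in>?J. K1 d d' i j *\<^sub>C XX j r) p = (if g = d' then cf (XX i r) (d, f) else 0)"
        using d unfolding p by (simp add: cf_sum fusion1(1))
      also have "\<dots> = (\<Sum>f'\<in>?F. if f' = f then (if g = d' then cf (XX i r) (d, f) else 0) else 0)"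
        using d X.fin(2)[of "\<phi>l c"] cf_off[OF XX_B, of d f i r] by auto
      also have "\<dots> = cf (\<Sum>f\<in>?F. cf (XX i r) (d, f) *\<^sub>C x d' f) p"
        using d unfolding p cf_sum[OF x_B] by (intro sum.cong refl) (auto simp: cf_x IX)
      finally show "cf (\<Sum>j\<in>?J. K1 d d' i j *\<^sub>C XX j r) p = cf (\<Sum>f\<in>?F. cf (XX i r) (d, f) *\<^sub>C x d' f) p" .
    qed (intro star_algebra_sum[OF B] B_star x_B XX_B)+
    have "(\<Sum>j\<in>?J. M1 j \<cdot> XX j r) = (\<Sum>d\<in>?D. \<Sum>d'\<in>?D. x d c \<cdot> adj (x d' c') \<cdot> (\<Sum>j\<in>?J. K1 d d' i j *\<^sub>C XX j r))"
      unfolding M1_def compose_sum by (subst sum.swap, rule sum.cong[OF refl], subst sum.swap) (simp add: compose_assoc)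
    also have "\<dots> = (\<Sum>d\<in>?D. \<Sum>f\<in>?F. cf (XX i r) (d, f) *\<^sub>C (x d c \<cdot> (\<Sum>d'\<in>?D. adj (x d' c') \<cdot> x d' f)))" (is "sum ?f _ = sum ?g _")
    proof (rule sum.cong[OF refl])
      fix d assume d: "d \<in> ?D"
      have "(\<Sum>d'\<in>?D. x d c \<cdot> adj (x d' c') \<cdot> (\<Sum>j\<in>?J. K1 d d' i j *\<^sub>C XX j r))
        = (\<Sum>d'\<in>?D. x d c \<cdot> adj (x d' c') \<cdot> (\<Sum>f\<in>?F. cf (XX i r) (d, f) *\<^sub>C x d' f))"
        by (rule sum.cong[OF refl]) (simp only: in1[OF d])
      also have "\<dots> = (\<Sum>f\<in>?F. cf (XX i r) (d, f) *\<^sub>C (x d c \<cdot> (\<Sum>d'\<in>?D. adj (x d' c') \<cdot> x d' f)))"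
        unfolding compose_sum_right scaleC_sum by (subst sum.swap) (simp add: compose_assoc)
      finally show "?f d = ?g d" .
    qed
    also have "\<dots> = (\<Sum>d\<in>?D. \<Sum>f\<in>?F. if f = c' then cf (XX i r) (d, c') *\<^sub>C x d c else 0)" (is "(\<Sum>d\<in>_. \<Sum>f\<in>_. ?f d f) = (\<Sum>d\<in>_. \<Sum>f\<in>_. ?g d f)")
    proof (intro sum.cong refl)
      fix d f assume "f \<in> ?F"
      then show "?f d f = ?g d f"
        using c X.cols[of c' f] by (simp add: fib_def eq_commute[of f])
    qed
    also have "\<dots> = (\<Sum>d\<in>?D. cf (XX i r) (d, c') *\<^sub>C x d c)" using c X.fin(2)[of "\<phi>l c"] by simp
    finally show ?thesis .
  qed
  have e2: "(\<Sum>j\<in>?J. M2 j \<cdot> XX j r) = (\<Sum>k\<in>?K. K2 c c' k r *\<^sub>C XX i k)" if r: "r \<in> ?K" for r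
  proof -
    have "(\<Sum>j\<in>?J. M2 j \<cdot> XX j r) = (\<Sum>k\<in>?K. \<Sum>m\<in>?K. K2 c c' k m *\<^sub>C (XX i k \<cdot> (\<Sum>j\<in>?J. adj (XX j m) \<cdot> XX j r)))"
      unfolding M2_def compose_sum scaleC_sum by (subst sum.swap, rule sum.cong[OF refl], subst sum.swap) (simp add: compose_assoc)
    also have "\<dots> = (\<Sum>k\<in>?K. \<Sum>m\<in>?K. if m = r then K2 c c' k r *\<^sub>C XX i k else 0)" (is "(\<Sum>k\<in>_. \<Sum>m\<in>_. ?f k m) = (\<Sum>k\<in>_. \<Sum>m\<in>_. ?g k m)")
    proof (intro sum.cong refl)
      fix k m assume "m \<in> ?K"
      then show "?f k m = ?g k m"
        using XX_cols[of m r] r by simp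
    qed
    also have "\<dots> = (\<Sum>k\<in>?K. K2 c c' k r *\<^sub>C XX i k)" using r by simp
    finally show ?thesis .
  qed
  have e: "(\<Sum>j\<in>?J. M1 j \<cdot> XX j r) = (\<Sum>j\<in>?J. M2 j \<cdot> XX j r)" if r: "r \<in> ?K" for r
    unfolding e1 e2[OF r]
  proof (rule cf_inject)
    fix p obtain b d where p: "p = (b :: 'e1, d :: 'e2)" by (cases p)
    have K: "?K = G2.JJ (G2.l2 r)" using r lb_eq[of r] by simp
    have "cf (\<Sum>d\<in>?D. cf (XX i r) (d, c') *\<^sub>C x d c) p = (\<Sum>d'\<in>?D. if d' = b then (if d = c then cf (XX i r) (b, c') else 0) else 0)"
      unfolding p cf_sum[OF x_B] by (intro sum.cong refl) (auto simp: cf_x IX)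
    also have "\<dots> = (if d = c then cf (XX i r) (b, c') else 0)" using c cf_off[OF XX_B, of b c' i r] by auto
    also have "\<dots> = cf (\<Sum>k\<in>?K. K2 c c' k r *\<^sub>C XX i k) p"
      unfolding p K using c by (simp add: cf_sum fusion2(1))
    finally show "cf (\<Sum>d\<in>?D. cf (XX i r) (d, c') *\<^sub>C x d c) p = cf (\<Sum>k\<in>?K. K2 c c' k r *\<^sub>C XX i k) p" .
  qed (intro star_algebra_sum[OF B] B_star x_B XX_B)+
  \<comment> \<open>The matrix \<open>XX\<close> is unitary, so \<open>M1\<close> and
    \<open>M2\<close> can be recovered from their products with its columns.\<close>
  have rec: "M j = (\<Sum>r\<in>?K. (\<Sum>i\<in>?J. M i \<cdot> XX i r) \<cdot> adj (XX j r))" for M :: "'e1 \<times> 'e1 \<Rightarrow> 'j op"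
  proof -
    have "(\<Sum>r\<in>?K. (\<Sum>i\<in>?J. M i \<cdot> XX i r) \<cdot> adj (XX j r)) = (\<Sum>i\<in>?J. M i \<cdot> (\<Sum>r\<in>?K. XX i r \<cdot> adj (XX j r)))"
      unfolding compose_sum by (subst sum.swap) (simp add: compose_assoc)
    also have "\<dots> = (\<Sum>i\<in>?J. if i = j then M j else 0)" (is "sum ?f _ = sum ?g _")
    proof (rule sum.cong[OF refl])
      fix i' assume "i' \<in> ?J"
      then show "?f i' = ?g i'"
        using XX_rows[of i' j] ij by simp
    qed
    also have "\<dots> = M j" using ij by simp
    finally show ?thesis by simp
  qed
  have "M1 j = M2 j" unfolding rec[of M1] rec[of M2] by (intro sum.cong refl arg_cong2[where f="(\<cdot>)"] e) simp
  then show ?thesis by (simp add: M1_def M2_def)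
qed

end

section \<open>Transport of the Markov operator\<close>

lemma has_sum_finite_sum:
  fixes f :: "'p \<Rightarrow> 'q \<Rightarrow> complex"
  shows "(\<And>p. p \<in> F \<Longrightarrow> (f p has_sum s p) A) \<Longrightarrow> ((\<lambda>q. \<Sum>p\<in>F. f p q) has_sum (\<Sum>p\<in>F. s p)) A"
  by (induction F rule: infinite_finite_induct) (auto intro: has_sum_add)

lemma sum_swap2: "(\<Sum>a\<in>A. \<Sum>c\<in>C. \<Sum>e\<in>E. F a c e) = (\<Sum>c\<in>C. \<Sum>e\<in>E. \<Sum>a\<in>A. F a c e)"
  by (subst sum.swap, rule sum.cong[OF refl], rule sum.swap)

context linking
begin

abbreviation "W \<equiv> link_unitary G1 G2 \<phi> L"
definition "\<rho> b = W \<cdot> (b \<otimes> \<one>) \<cdot> adj W"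

lemma W: "W = block_op x" unfolding link_unitary_def x_def[abs_def] ..

lemma W_unitary: "W \<in> clin" "adj W \<cdot> W = \<one>" "W \<cdot> adj W = \<one>"
  unfolding W by (rule X.block_op_spec X.block_op_unitary)+

lemma \<rho>_clin [simp]: "b \<in> clin \<Longrightarrow> \<rho> b \<in> clin" by (simp add: \<rho>_def W_unitary)

lemma blk_\<rho>: "b \<in> clin \<Longrightarrow> blk e e' (\<rho> b) =
    (\<Sum>f | \<phi>l f = G1.l e. \<Sum>f' | \<phi>l f' = G1.l e'. ent b f f' *\<^sub>C (x e f \<cdot> adj (x e' f')))"
  unfolding \<rho>_def W by (rule X.blk_conj)

lemma M_bicommutant: "commutant (commutant M) = M"
  unfolding M_alt by (rule commutant_triple[OF commutant_clin])

lemma \<rho>_mem: assumes b: "b \<in> linf G2" shows "\<rho> b \<in> linf G1 \<otimes>\<^sub>v\<^sub>N M"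
  unfolding linf_tensor_iff[OF M_star M_bicommutant]
proof (intro conjI allI)
  have bc: "b \<in> clin" using b by (simp add: linf_iff)
  then show "\<rho> b \<in> clin" by simp
  fix e e'
  have "blk e e' (\<rho> b) \<in> M"
    unfolding blk_\<rho>[OF bc] by (intro star_algebra_sum[OF M_star] star_algebraD(6)[OF M_star] B_M B_star x_B)
  moreover have "blk e e' (\<rho> b) = 0" if "G1.l e \<noteq> G1.l e'"
  proof -
    have "ent b f f' = 0" if "\<phi>l f = G1.l e" "\<phi>l f' = G1.l e'" for f f'
    proof -
      have "G2.l f \<noteq> G2.l f'" using that \<open>G1.l e \<noteq> G1.l e'\<close> by auto
      then show ?thesis using b by (simp add: linf_iff)
    qed
    then show ?thesis unfolding blk_\<rho>[OF bc] by (intro sum.neutral ballI) simp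
  qed
  ultimately show "if G1.l e = G1.l e' then blk e e' (\<rho> b) \<in> M else blk e e' (\<rho> b) = 0" by simp
qed

lemma \<rho>_linear: "linear_map_on (linf G2) \<rho>"
  by (rule linear_spatial[OF linf_clin W_unitary(1) adj_clin[OF W_unitary(1)]]) (simp_all add: \<rho>_def star_algebraD[OF linf_star])

lemma \<rho>_adj: "b \<in> clin \<Longrightarrow> \<rho> (adj b) = adj (\<rho> b)"
  by (simp add: \<rho>_def W_unitary op_tensor_simps(5) compose_assoc)

lemma \<rho>_mult: "a \<in> clin \<Longrightarrow> b \<in> clin \<Longrightarrow> \<rho> (a \<cdot> b) = \<rho> a \<cdot> \<rho> b"
proof -
  assume ab: "a \<in> clin" "b \<in> clin"
  have "\<rho> a \<cdot> \<rho> b = W \<cdot> (a \<otimes> \<one>) \<cdot> (adj W \<cdot> W) \<cdot> (b \<otimes> \<one>) \<cdot> adj W" by (simp add: \<rho>_def compose_assoc)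
  also have "\<dots> = W \<cdot> ((a \<otimes> \<one>) \<cdot> (b \<otimes> \<one>)) \<cdot> adj W" by (simp add: W_unitary compose_assoc)
  finally show ?thesis using ab by (simp add: op_tensor_compose \<rho>_def)
qed

lemma \<rho>_inject: assumes ab: "a \<in> clin" "b \<in> clin" and eq: "\<rho> a = \<rho> b" shows "a = b"
proof -
  have u: "adj W \<cdot> \<rho> c \<cdot> W = c \<otimes> \<one>" for c
  proof -
    have "adj W \<cdot> \<rho> c \<cdot> W = (adj W \<cdot> W) \<cdot> (c \<otimes> \<one>) \<cdot> (adj W \<cdot> W)" by (simp add: \<rho>_def compose_assoc)
    then show ?thesis by (simp add: W_unitary)
  qed
  have "a \<otimes> (\<one> :: 'j op) = b \<otimes> \<one>" using u[of a] u[of b] eq by simp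
  then have "rs \<xi> \<xi> (a \<otimes> (\<one> :: 'j op)) = rs \<xi> \<xi> (b \<otimes> (\<one> :: 'j op))" by simp
  then show ?thesis using ab by (simp add: \<xi>_norm)
qed

text \<open>In leg notation: applying the first dual comultiplication to the first leg of
  \<open>\<rho> b\<close> gives the conjugate of the second dual comultiplication of
  \<open>b\<close> by \<open>X_13 X_23\<close>. The lemma reads this at the entry
  \<open>(i, j)\<close> and in the slice by \<open>u\<close>, \<open>v\<close>; expansion in matrix
  units reduces it to \<open>transfer_relation\<close>.\<close>

lemma K1_\<rho>:
  assumes b: "b \<in> linf G2" and ij: "G1.l2 i = G1.l2 j"
  shows "coord (D1.DD (rs u v (\<rho> b)) (basis_vec j)) i
    = cinner u ((\<Sum>k | lb k = G1.l2 i. \<Sum>m | lb m = G1.l2 i. ent (D2.DD b) k m *\<^sub>C (XX i k \<cdot> adj (XX j m))) v)"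
proof -
  have bc: "b \<in> clin" using b by (simp add: linf_iff)
  obtain y where y: "G1.l2 i = (\<phi> (fst y), \<phi> (snd y))" using bij by (metis bij_is_surj surjE prod.collapse fst_conv snd_conv)
  \<comment> \<open>One finite set of classes that contains the supports of the fusion coefficients
    on both sides, so that both double sums run over index sets matched by
    \<open>\<phi>\<close>.\<close>
  define L2 where "L2 = inv \<phi> ` N1 (G1.l2 i) \<union> N2 y"
  let ?L1 = "\<phi> ` L2" and ?E1 = "{d. G1.l d \<in> \<phi> ` L2}" and ?E2 = "{c. G2.l c \<in> L2}" and ?K = "{k. lb k = G1.l2 i}"
  have L2: "finite L2" by (simp add: L2_def N_fin)
  have L1: "finite ?L1" "N1 (G1.l2 i) \<subseteq> ?L1"
  proof -
    show "N1 (G1.l2 i) \<subseteq> ?L1"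
    proof
      show "z \<in> ?L1" if "z \<in> N1 (G1.l2 i)" for z using that bij by (intro image_eqI[of _ _ "inv \<phi> z"]) (auto simp: L2_def bij_is_surj surj_f_inv_f)
    qed
  qed (use L2 in simp)
  have fE1: "finite ?E1" by (rule D1.fin_EL[OF L1(1)])
  have fE2: "finite ?E2" by (rule D2.fin_EL[OF L2])
  have K: "?K = G2.JJ y" unfolding y lb_def G2.l2_def by (auto simp: prod_eq_iff)
  have r: "rs u v (\<rho> b) \<in> linf G1" by (rule rs_linf[OF M_star M_bicommutant \<rho>_mem[OF b]])
  have "(\<Sum>d\<in>?E1. \<Sum>d'\<in>?E1. K1 d d' i j *\<^sub>C blk d d' (\<rho> b))
      = (\<Sum>d\<in>?E1. \<Sum>d'\<in>?E1. \<Sum>c\<in>?E2. \<Sum>c'\<in>?E2. (ent b c c' * K1 d d' i j) *\<^sub>C (x d c \<cdot> adj (x d' c')))" (is "(\<Sum>d\<in>_. \<Sum>d'\<in>_. ?f d d') = (\<Sum>d\<in>_. \<Sum>d'\<in>_. ?g d d')")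
  proof (intro sum.cong refl)
    fix d d' assume d: "d \<in> ?E1" "d' \<in> ?E1"
    have "blk d d' (\<rho> b) = (\<Sum>c\<in>?E2. \<Sum>c'\<in>?E2. ent b c c' *\<^sub>C (x d c \<cdot> adj (x d' c')))"
      unfolding blk_\<rho>[OF bc]
    proof (rule sum.mono_neutral_cong_left[OF fE2])
      show "{f. \<phi>l f = G1.l d} \<subseteq> ?E2" using d by auto
      show "\<forall>c\<in>?E2 - {f. \<phi>l f = G1.l d}. (\<Sum>c'\<in>?E2. ent b c c' *\<^sub>C (x d c \<cdot> adj (x d' c'))) = 0"
        by (auto simp: x_zero[OF not_sym] x_zero intro!: sum.neutral)
      show "(\<Sum>f' | \<phi>l f' = G1.l d'. ent b c f' *\<^sub>C (x d c \<cdot> adj (x d' f'))) =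
          (\<Sum>c'\<in>?E2. ent b c c' *\<^sub>C (x d c \<cdot> adj (x d' c')))" for c
        using d by (intro sum.mono_neutral_left[OF fE2]) (auto simp: x_zero[OF not_sym] x_zero)
    qed
    then show "?f d d' = ?g d d'"
      by (simp add: scaleC_sum mult.commute)
  qed
  also have "\<dots> = (\<Sum>c\<in>?E2. \<Sum>c'\<in>?E2. \<Sum>d\<in>?E1. \<Sum>d'\<in>?E1. (ent b c c' * K1 d d' i j) *\<^sub>C (x d c \<cdot> adj (x d' c')))"
    by (rule trans, rule sum.cong[OF refl], rule sum_swap2, rule sum_swap2)
  also have "\<dots> = (\<Sum>c\<in>?E2. \<Sum>c'\<in>?E2. ent b c c' *\<^sub>C (\<Sum>k\<in>?K. \<Sum>m\<in>?K. K2 c c' k m *\<^sub>C (XX i k \<cdot> adj (XX j m))))" (is "(\<Sum>c\<in>_. \<Sum>c'\<in>_. ?f c c') = (\<Sum>c\<in>_. \<Sum>c'\<in>_. ?g c c')")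
  proof (intro sum.cong refl)
    fix c c' assume c: "c \<in> ?E2" "c' \<in> ?E2"
    show "?f c c' = ?g c c'"
    proof (cases "G2.l c = G2.l c'")
      case True
      have s: "(\<Sum>d\<in>fib G1 (\<phi>l c). \<Sum>d'\<in>fib G1 (\<phi>l c). K1 d d' i j *\<^sub>C (x d c \<cdot> adj (x d' c')))
          = (\<Sum>d\<in>?E1. \<Sum>d'\<in>?E1. K1 d d' i j *\<^sub>C (x d c \<cdot> adj (x d' c')))"
      proof (rule sum.mono_neutral_cong_left[OF fE1])
        show "fib G1 (\<phi>l c) \<subseteq> ?E1" using c by auto
        show "\<forall>d\<in>?E1 - fib G1 (\<phi>l c). (\<Sum>d'\<in>?E1. K1 d d' i j *\<^sub>C (x d c \<cdot> adj (x d' c'))) = 0"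
          by (auto simp: x_zero[OF not_sym] x_zero intro!: sum.neutral)
        show "(\<Sum>d'\<in>fib G1 (\<phi>l c). K1 d d' i j *\<^sub>C (x d c \<cdot> adj (x d' c'))) = (\<Sum>d'\<in>?E1. K1 d d' i j *\<^sub>C (x d c \<cdot> adj (x d' c')))" for d
          using c True by (intro sum.mono_neutral_left[OF fE1]) (auto simp: x_zero[OF not_sym] x_zero)
      qed
      show ?thesis unfolding transfer_relation[OF True ij, symmetric] s by (simp add: scaleC_sum)
    next
      case False
      then have "ent b c c' = 0" using b by (simp add: linf_iff)
      then show ?thesis by simp
    qed
  qed
  also have "\<dots> = (\<Sum>k\<in>?K. \<Sum>m\<in>?K. (\<Sum>c\<in>?E2. \<Sum>c'\<in>?E2. ent b c c' * K2 c c' k m) *\<^sub>C (XX i k \<cdot> adj (XX j m)))"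
    unfolding scaleC_sum scaleC_simps(1) by (rule trans, rule sum.cong[OF refl], rule sum_swap2, rule sum_swap2)
  also have "\<dots> = (\<Sum>k\<in>?K. \<Sum>m\<in>?K. ent (D2.DD b) k m *\<^sub>C (XX i k \<cdot> adj (XX j m)))" (is "(\<Sum>k\<in>_. \<Sum>m\<in>_. ?f k m) = (\<Sum>k\<in>_. \<Sum>m\<in>_. ?g k m)")
  proof (intro sum.cong refl)
    fix k m assume km: "k \<in> ?K" "m \<in> ?K"
    have e: "G2.l2 k = G2.l2 m" "N2 (G2.l2 k) \<subseteq> L2" using km unfolding K by (auto simp: L2_def)
    show "?f k m = ?g k m"
      unfolding D2.DD_entry'[OF b e(1) L2 e(2)] ..
  qed
  finally have main: "(\<Sum>d\<in>?E1. \<Sum>d'\<in>?E1. K1 d d' i j *\<^sub>C blk d d' (\<rho> b)) = \<dots>" .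
  have "coord (D1.DD (rs u v (\<rho> b)) (basis_vec j)) i = cinner u ((\<Sum>d\<in>?E1. \<Sum>d'\<in>?E1. K1 d d' i j *\<^sub>C blk d d' (\<rho> b)) v)"
    unfolding D1.DD_entry'[OF r ij L1] entry_rs by (simp add: sum_apply cinner.sum_right mult.commute)
  then show ?thesis unfolding main .
qed

text \<open>Applies \<open>psi\<close> to the second leg in \<open>K1_\<rho>\<close>. The sum
  against \<open>G1.QQ\<close> meets exactly the two inner factors of each product of four entries,
  and \<open>star_relation\<close> replaces them by the scalars \<open>G2.QQ\<close>; the outer
  factors are those of a block of \<open>\<rho>\<close>.\<close>

lemma Q1_\<rho>:
  assumes b: "b \<in> linf G2" and p: "G1.l p = G1.l p'"
  shows "(\<Sum>f\<in>fib G1 (\<phi> y). \<Sum>f'\<in>fib G1 (\<phi> y). coord (D1.DD (rs u v (\<rho> b)) (basis_vec (p', f'))) (p, f) * G1.QQ f f')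
    = (\<Sum>r | \<phi>l r = G1.l p. \<Sum>r' | \<phi>l r' = G1.l p.
        (\<Sum>w\<in>fib G2 y. \<Sum>s\<in>fib G2 y. ent (D2.DD b) (r, w) (r', s) * G2.QQ w s) * cinner u ((x p r \<cdot> adj (x p' r')) v))"
proof -
  let ?F = "fib G1 (\<phi> y)" and ?R = "{r. \<phi>l r = G1.l p}" and ?Y = "fib G2 y"
  let ?D = "\<lambda>r w r' s. ent (D2.DD b) (r, w) (r', s)"
  have K: "{k. lb k = G1.l2 (p, f)} = ?R \<times> ?Y" if "f \<in> ?F" for f using that by (auto simp: lb_def G1.l2_def)
  have 1: "coord (D1.DD (rs u v (\<rho> b)) (basis_vec (p', f'))) (p, f)
      = (\<Sum>r\<in>?R. \<Sum>w\<in>?Y. \<Sum>r'\<in>?R. \<Sum>s\<in>?Y. ?D r w r' s * cinner u ((x p r \<cdot> (x f w \<cdot> adj (x f' s)) \<cdot> adj (x p' r')) v))"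
    if f: "f \<in> ?F" "f' \<in> ?F" for f f'
  proof -
    have l: "G1.l2 (p, f) = G1.l2 (p', f')" using f p by (simp add: G1.l2_def)
    show ?thesis unfolding K1_\<rho>[OF b l] K[OF f(1)]
      by (simp add: sum.cartesian_product[symmetric] sum.cartesian_product' sum_apply cinner.sum_right XX_def)
  qed
  have "(\<Sum>f\<in>?F. \<Sum>f'\<in>?F. coord (D1.DD (rs u v (\<rho> b)) (basis_vec (p', f'))) (p, f) * G1.QQ f f')
    = (\<Sum>f\<in>?F. \<Sum>f'\<in>?F. \<Sum>r\<in>?R. \<Sum>w\<in>?Y. \<Sum>r'\<in>?R. \<Sum>s\<in>?Y. ?D r w r' s * (G1.QQ f f' * cinner u ((x p r \<cdot> (x f w \<cdot> adj (x f' s)) \<cdot> adj (x p' r')) v)))"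
    by (rule sum.cong[OF refl], rule sum.cong[OF refl], subst 1, assumption, assumption, unfold sum_distrib_right, simp only: mult_ac)
  also have "\<dots> = (\<Sum>r\<in>?R. \<Sum>w\<in>?Y. \<Sum>r'\<in>?R. \<Sum>s\<in>?Y. \<Sum>f\<in>?F. \<Sum>f'\<in>?F. ?D r w r' s * (G1.QQ f f' * cinner u ((x p r \<cdot> (x f w \<cdot> adj (x f' s)) \<cdot> adj (x p' r')) v)))"
  proof -
    have swap: "(\<Sum>a\<in>A. \<Sum>r\<in>R. \<Sum>w\<in>Y. \<Sum>r'\<in>R. \<Sum>s\<in>Y. H a r w r' s) = (\<Sum>r\<in>R. \<Sum>w\<in>Y. \<Sum>r'\<in>R. \<Sum>s\<in>Y. \<Sum>a\<in>A. H a r w r' s)"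
      for H :: "'e1 \<Rightarrow> 'e2 \<Rightarrow> 'e2 \<Rightarrow> 'e2 \<Rightarrow> 'e2 \<Rightarrow> complex" and A R Y
      by (subst sum_swap2, intro sum.cong refl, rule sum_swap2)
    show ?thesis by (rule trans, rule sum.cong[OF refl], rule swap, rule swap)
  qed
  also have "\<dots> = (\<Sum>r\<in>?R. \<Sum>w\<in>?Y. \<Sum>r'\<in>?R. \<Sum>s\<in>?Y. ?D r w r' s * (G2.QQ w s * cinner u ((x p r \<cdot> adj (x p' r')) v)))" (is "(\<Sum>r\<in>_. \<Sum>w\<in>_. \<Sum>r'\<in>_. \<Sum>s\<in>_. ?f r w r' s) = (\<Sum>r\<in>_. \<Sum>w\<in>_. \<Sum>r'\<in>_. \<Sum>s\<in>_. ?g r w r' s)")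
  proof (intro sum.cong refl)
    fix r w r' s assume ws: "w \<in> ?Y" "s \<in> ?Y"
    have "x p r \<cdot> (\<Sum>f\<in>?F. \<Sum>f'\<in>?F. G1.QQ f f' *\<^sub>C (x f w \<cdot> adj (x f' s))) \<cdot> adj (x p' r')
        = (\<Sum>f\<in>?F. \<Sum>f'\<in>?F. G1.QQ f f' *\<^sub>C (x p r \<cdot> (x f w \<cdot> adj (x f' s)) \<cdot> adj (x p' r')))"
      by (simp add: compose_sum)
    moreover have "(\<Sum>f\<in>?F. \<Sum>f'\<in>?F. G1.QQ f f' *\<^sub>C (x f w \<cdot> adj (x f' s))) = G2.QQ w s *\<^sub>C \<one>"
      using ws by (intro star_relation) auto
    ultimately have "(\<Sum>f\<in>?F. \<Sum>f'\<in>?F. G1.QQ f f' *\<^sub>C (x p r \<cdot> (x f w \<cdot> adj (x f' s)) \<cdot> adj (x p' r'))) = G2.QQ w s *\<^sub>C (x p r \<cdot> adj (x p' r'))"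
      by simp
    then have "cinner u ((\<Sum>f\<in>?F. \<Sum>f'\<in>?F. G1.QQ f f' *\<^sub>C (x p r \<cdot> (x f w \<cdot> adj (x f' s)) \<cdot> adj (x p' r'))) v) = cinner u ((G2.QQ w s *\<^sub>C (x p r \<cdot> adj (x p' r'))) v)" by simp
    then have "(\<Sum>f\<in>?F. \<Sum>f'\<in>?F. G1.QQ f f' * cinner u ((x p r \<cdot> (x f w \<cdot> adj (x f' s)) \<cdot> adj (x p' r')) v)) = G2.QQ w s * cinner u ((x p r \<cdot> adj (x p' r')) v)"
      by (simp add: sum_apply cinner.sum_right)
    then show "?f r w r' s = ?g r w r' s"
      by (simp only: sum_distrib_left[symmetric])
  qed
  also have "\<dots> = (\<Sum>r\<in>?R. \<Sum>r'\<in>?R. (\<Sum>w\<in>?Y. \<Sum>s\<in>?Y. ?D r w r' s * G2.QQ w s) * cinner u ((x p r \<cdot> adj (x p' r')) v))"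
    unfolding sum_distrib_right by (rule sum.cong[OF refl], subst sum.swap) (simp only: mult.assoc)
  finally show ?thesis .
qed

text \<open>The comparison is made on scalar entries, where the Markov operators are convergent
  series over the classes. \<open>\<phi>\<close> reindexes one series into the other, and the finite
  sums over a fibre commute with them.\<close>

lemma markov_\<rho>:
  assumes b: "b \<in> linf G2"
  shows "markov_amp G1 \<mu> M (\<rho> b) = \<rho> (markov G2 (map_pmf (inv \<phi>) \<mu>) b)"
proof -
  let ?\<mu> = "map_pmf (inv \<phi>) \<mu>"
  note am = D1.markov_amp[OF M_star \<rho>_mem[OF b] M_bicommutant]
  have m2: "markov G2 ?\<mu> b \<in> linf G2" by (rule D2.markov_linf[OF b])
  then have m2c: "markov G2 ?\<mu> b \<in> clin" by (simp add: linf_iff)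
  have pm: "pmf ?\<mu> y = pmf \<mu> (\<phi> y)" for y
    using pmf_map_inj'[of "inv \<phi>" \<mu> "\<phi> y"] bij by (simp add: bij_imp_bij_inv bij_is_inj inv_f_f)
  show ?thesis
  proof (rule blk_eqI)
    show "markov_amp G1 \<mu> M (\<rho> b) \<in> clin" by (rule am)
    show "\<rho> (markov G2 ?\<mu> b) \<in> clin" using m2c by simp
    fix p p'
    show "blk p p' (markov_amp G1 \<mu> M (\<rho> b)) = blk p p' (\<rho> (markov G2 ?\<mu> b))"
    proof (rule hom_eqI)
      fix u v
      have r: "rs u v (\<rho> b) \<in> linf G1" by (rule rs_linf[OF M_star M_bicommutant \<rho>_mem[OF b]])
      have lhs: "cinner u (blk p p' (markov_amp G1 \<mu> M (\<rho> b)) v) = coord (markov G1 \<mu> (rs u v (\<rho> b)) (basis_vec p')) p"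
        unfolding entry_rs[symmetric] am(2) ..
      show "cinner u (blk p p' (markov_amp G1 \<mu> M (\<rho> b)) v) = cinner u (blk p p' (\<rho> (markov G2 ?\<mu> b)) v)"
      proof (cases "G1.l p = G1.l p'")
        case True
        let ?R = "{r. \<phi>l r = G1.l p}"
        define q where "q r r' y = (\<Sum>w\<in>fib G2 y. \<Sum>s\<in>fib G2 y. ent (D2.DD b) (r, w) (r', s) * G2.QQ w s)" for r r' y
        have "((\<lambda>z. of_real (pmf \<mu> z) * (\<Sum>f\<in>fib G1 z. \<Sum>f'\<in>fib G1 z. coord (D1.DD (rs u v (\<rho> b)) (basis_vec (p', f'))) (p, f) * G1.QQ f f'))
            has_sum coord (markov G1 \<mu> (rs u v (\<rho> b)) (basis_vec p')) p) UNIV"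
          by (rule D1.markov_entry[OF r])
        then have h1: "((\<lambda>y. of_real (pmf \<mu> (\<phi> y)) * (\<Sum>f\<in>fib G1 (\<phi> y). \<Sum>f'\<in>fib G1 (\<phi> y). coord (D1.DD (rs u v (\<rho> b)) (basis_vec (p', f'))) (p, f) * G1.QQ f f'))
            has_sum coord (markov G1 \<mu> (rs u v (\<rho> b)) (basis_vec p')) p) UNIV"
          by (subst has_sum_reindex_bij_betw[OF bij])
        have h2: "((\<lambda>y. of_real (pmf \<mu> (\<phi> y)) * q r r' y) has_sum ent (markov G2 ?\<mu> b) r r') UNIV" for r r'
          using D2.markov_entry[OF b, of ?\<mu> r' r] unfolding pm q_def .
        have h2': "((\<lambda>y. \<Sum>r\<in>?R. \<Sum>r'\<in>?R. of_real (pmf \<mu> (\<phi> y)) * q r r' y * cinner u ((x p r \<cdot> adj (x p' r')) v)) has_sum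
            (\<Sum>r\<in>?R. \<Sum>r'\<in>?R. ent (markov G2 ?\<mu> b) r r' * cinner u ((x p r \<cdot> adj (x p' r')) v))) UNIV"
          by (intro has_sum_finite_sum has_sum_cmult_left h2)
        have eq: "of_real (pmf \<mu> (\<phi> y)) * (\<Sum>f\<in>fib G1 (\<phi> y). \<Sum>f'\<in>fib G1 (\<phi> y). coord (D1.DD (rs u v (\<rho> b)) (basis_vec (p', f'))) (p, f) * G1.QQ f f')
            = (\<Sum>r\<in>?R. \<Sum>r'\<in>?R. of_real (pmf \<mu> (\<phi> y)) * q r r' y * cinner u ((x p r \<cdot> adj (x p' r')) v))" for y
          unfolding Q1_\<rho>[OF b True] q_def[symmetric] sum_distrib_left mult.assoc ..
        have "coord (markov G1 \<mu> (rs u v (\<rho> b)) (basis_vec p')) p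
            = (\<Sum>r\<in>?R. \<Sum>r'\<in>?R. ent (markov G2 ?\<mu> b) r r' * cinner u ((x p r \<cdot> adj (x p' r')) v))"
          by (rule has_sum_unique[OF h1 h2'[folded eq]])
        also have "\<dots> = cinner u (blk p p' (\<rho> (markov G2 ?\<mu> b)) v)"
          unfolding blk_\<rho>[OF m2c] True[symmetric] by (simp add: sum_apply cinner.sum_right)
        finally show ?thesis unfolding lhs .
      next
        case False
        have "blk p p' (\<rho> (markov G2 ?\<mu> b)) = 0"
          using \<rho>_mem[OF m2, unfolded linf_tensor_iff[OF M_star M_bicommutant], THEN conjunct2, rule_format, of p p'] False by simp
        moreover have "coord (markov G1 \<mu> (rs u v (\<rho> b)) (basis_vec p')) p = 0"
          using D1.markov_linf[OF r, of \<mu>] False by (simp add: linf_iff)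
        ultimately show ?thesis unfolding lhs by (simp add: cinner.zero_right)
      qed
    qed
  qed
qed

end

section \<open>Equivariance\<close>

lemma total_eqI:
  assumes X: "X \<in> clin" "X' \<in> clin" and s: "\<And>z. (\<And>p. cinner (s p) z = 0) \<Longrightarrow> z = 0" and eq: "\<And>p. X (s p) = X' (s p)"
  shows "X = X'"
proof -
  have "adj (X - X') z = 0" for z
    by (rule s) (use X eq in \<open>simp add: cinner_adj_right blinfun.diff_left del: adj_diff\<close>)
  then have "adj (X - X') = 0" by (intro blinfun_eqI) simp
  then have "adj (adj (X - X')) = 0" by simp
  then show ?thesis using X by (simp del: adj_diff)
qed

lemma rs_blk_passoc: "rs u v (blk p q (relabel passoc T)) = blk p q (rs u v T)"
proof (rule hom_eqI)
  fix x y
  have "cinner x (rs u v (blk p q (relabel passoc T)) y)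
      = cinner (basis_map passoc ((basis_vec p \<otimes>\<^sub>v x) \<otimes>\<^sub>v u)) (relabel passoc T (basis_map passoc ((basis_vec q \<otimes>\<^sub>v y) \<otimes>\<^sub>v v)))"
    by (simp add: cinner_rs cinner_ls del: basis_tensor)
  then show "cinner x (rs u v (blk p q (relabel passoc T)) y) = cinner x (blk p q (rs u v T) y)"
    unfolding cinner_relabel[OF bij_passoc] by (simp add: cinner_rs cinner_ls)
qed

context linking
begin

lemma cyclic: assumes z: "\<And>b. b \<in> B \<Longrightarrow> cinner (b \<xi>) z = 0" shows "z = 0"
proof -
  have "closed {y. cinner y z = 0}"
    by (intro closed_Collect_eq continuous_intros cinner.continuous_on)
  moreover have "(\<lambda>a. blinfun_apply (\<pi> a) \<xi>) ` A \<subseteq> {y. cinner y z = 0}" using z by (auto simp: B_def)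
  ultimately have "closure ((\<lambda>a. blinfun_apply (\<pi> a) \<xi>) ` A) \<subseteq> {y. cinner y z = 0}" by (rule closure_minimal[rotated])
  then have "z \<in> {y. cinner y z = 0}" unfolding \<xi>(2) by blast
  then show ?thesis by simp
qed

text \<open>The unitary of the argument sends \<open>b \<xi> \<otimes> \<eta>\<close> to \<open>\<delta> b (J \<eta>)\<close>.\<close>

lemma action_spatial:
  fixes J :: "('q, 'r) hom"
  assumes hom: "unital_star_hom M N \<delta>" and nor: "normal_on M \<delta>" and N: "N \<subseteq> clin" and J: "J \<in> clin"
    and gram: "\<And>b. b \<in> B \<Longrightarrow> adj J \<cdot> \<delta> b \<cdot> J = cinner \<xi> (b \<xi>) *\<^sub>C \<one>"
    and tot: "\<And>z. (\<And>b \<eta>. b \<in> B \<Longrightarrow> cinner (\<delta> b (J \<eta>)) z = 0) \<Longrightarrow> z = 0"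
  shows "\<exists>S\<in>(clin :: ('j \<times> 'q, 'r) hom set). \<forall>a\<in>M. \<delta> a = S \<cdot> (a \<otimes> \<one>) \<cdot> adj S"
proof -
  \<comment> \<open>Pairs whose operator lies outside of \<open>B\<close> are sent to zero, so that
    the families \<open>s\<close> and \<open>t\<close> are defined on a whole type as
    \<open>isometry_extension\<close> requires.\<close>
  define \<beta> where "\<beta> p = (if fst p \<in> B then fst p else 0)" for p :: "'j op \<times> 'q ell2"
  define s where "s p = \<beta> p \<xi> \<otimes>\<^sub>v snd p" for p
  define t where "t p = \<delta> (\<beta> p) (J (snd p))" for p
  have \<beta>: "\<beta> p \<in> B" for p by (simp add: \<beta>_def B_star)
  have dc: "\<delta> b \<in> clin" if "b \<in> B" for b using homD(6)[OF hom B_M[OF that]] N by auto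
  have ta: "cinner (\<delta> a (J \<eta>)) (\<delta> b (J \<eta>')) = cinner (a \<xi> \<otimes>\<^sub>v \<eta>) (b \<xi> \<otimes>\<^sub>v \<eta>')" if a: "a \<in> B" and b: "b \<in> B" for a b \<eta> \<eta>'
  proof -
    have m: "adj a \<cdot> b \<in> B" using a b by (intro B_star)
    have "cinner (\<delta> a (J \<eta>)) (\<delta> b (J \<eta>')) = cinner \<eta> ((adj J \<cdot> (adj (\<delta> a) \<cdot> \<delta> b) \<cdot> J) \<eta>')"
      using J dc[OF a] by (simp add: cinner_adj_right)
    also have "adj (\<delta> a) \<cdot> \<delta> b = \<delta> (adj a \<cdot> b)"
      using homD(4,5)[OF hom] B_M a b B_star(2)[OF a] by simp
    also have "cinner \<eta> ((adj J \<cdot> \<delta> (adj a \<cdot> b) \<cdot> J) \<eta>') = cinner (a \<xi> \<otimes>\<^sub>v \<eta>) (b \<xi> \<otimes>\<^sub>v \<eta>')"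
      unfolding gram[OF m] using B_clin[OF a] by (simp add: cinner_adj_right)
    finally show ?thesis .
  qed
  have tots: "z = 0" if z: "\<And>p. cinner (s p) z = 0" for z
  proof (rule tensor_orthogonal_zero)
    fix u :: "'j ell2" and \<eta> :: "'q ell2"
    have "adj (rvec \<eta>) z = 0"
    proof (rule cyclic)
      fix b assume "b \<in> B"
      then show "cinner (b \<xi>) (adj (rvec \<eta>) z) = 0" using z[of "(b, \<eta>)"] by (simp add: s_def \<beta>_def cinner_adj_right)
    qed
    then have "cinner u (adj (rvec \<eta>) z) = 0" by simp
    then show "cinner (u \<otimes>\<^sub>v \<eta>) z = 0" by (simp add: cinner_adj_right)
  qed
  have "\<exists>S\<in>clin. (\<forall>p. blinfun_apply S (s p) = t p) \<and> adj S \<cdot> S = \<one>"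
    by (rule isometry_extension[OF _ tots]) (simp_all add: s_def t_def ta[OF \<beta> \<beta>])
  then obtain S where S: "S \<in> clin" "\<forall>p. S (s p) = t p" "adj S \<cdot> S = \<one>" by (elim bexE conjE)
  have SS: "S \<cdot> adj S = \<one>"
  proof (rule isometry_surj_unitary[OF S(1,3), where s=s])
    fix z assume z: "\<And>p. cinner (S (s p)) z = 0"
    show "z = 0"
    proof (rule tot)
      fix b \<eta> assume "b \<in> B"
      then show "cinner (\<delta> b (J \<eta>)) z = 0" using z[of "(b, \<eta>)"] S(2) by (simp add: t_def \<beta>_def)
    qed
  qed
  have onB: "\<delta> a = S \<cdot> (a \<otimes> \<one>) \<cdot> adj S" if a: "a \<in> B" for a
  proof -
    have "\<delta> a \<cdot> S = S \<cdot> (a \<otimes> \<one>)"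
    proof (rule total_eqI[OF _ _ tots])
      show "\<delta> a \<cdot> S \<in> clin" "S \<cdot> (a \<otimes> \<one>) \<in> clin" using S(1) dc[OF a] B_clin[OF a] by simp_all
      fix p
      have "\<beta> (a \<cdot> \<beta> p, snd p) = a \<cdot> \<beta> p" using B_star(1)[OF a \<beta>] by (simp add: \<beta>_def[of "(_, _)"])
      then have "S ((a \<otimes> \<one>) (s p)) = t (a \<cdot> \<beta> p, snd p)"
        using S(2)[rule_format, of "(a \<cdot> \<beta> p, snd p)"] B_clin[OF a] by (simp add: s_def)
      also have "\<dots> = \<delta> a (t p)" using \<open>\<beta> (a \<cdot> \<beta> p, snd p) = a \<cdot> \<beta> p\<close> homD(4)[OF hom B_M[OF a] B_M[OF \<beta>]] by (simp add: t_def)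
      finally show "(\<delta> a \<cdot> S) (s p) = (S \<cdot> (a \<otimes> \<one>)) (s p)" using spec[OF S(2), of p] by simp
    qed
    then have "\<delta> a \<cdot> (S \<cdot> adj S) = S \<cdot> (a \<otimes> \<one>) \<cdot> adj S" by (simp only: compose_assoc[symmetric])
    then show ?thesis by (simp add: SS)
  qed
  have "\<delta> a = S \<cdot> (a \<otimes> \<one>) \<cdot> adj S" if a: "a \<in> M" for a
  proof (rule normal_eq_bicommutant[OF B, where F=\<delta> and G="\<lambda>a. S \<cdot> (a \<otimes> \<one>) \<cdot> adj S", folded M_alt, OF nor _ onB a])
    show "normal_on M (\<lambda>a. S \<cdot> (a \<otimes> \<one>) \<cdot> adj S)"
      by (rule normal_spatial_left[OF star_algebraD(1)[OF M_star] S(1) refl adj_clin[OF S(1)]])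
  qed
  then show ?thesis using S(1) by blast
qed

text \<open>The adjoints of the entries span \<open>B\<close> too; this is the form in which
  totality is checked for the first action.\<close>

lemma B_adj_expand: assumes b: "b \<in> B" shows "b = (\<Sum>p | cf (adj b) p \<noteq> 0. cnj (cf (adj b) p) *\<^sub>C adj (x (fst p) (snd p)))"
proof -
  have "adj (adj b) = adj (\<Sum>p | cf (adj b) p \<noteq> 0. cf (adj b) p *\<^sub>C x (fst p) (snd p))"
    by (rule arg_cong[OF B_expand[OF B_star(2)[OF b]]])
  then show ?thesis using B_clin[OF b] by (simp add: adj_sum)
qed

text \<open>Here \<open>J\<close> appends the cyclic vector of the link algebra, and the Gram
  condition is invariance of the state in the form
  \<open>(id \<otimes> \<omega>) \<delta>1 = \<omega>\<close>. The spatial form is what allows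
  \<open>id \<otimes> \<delta>1\<close> to be evaluated block by block.\<close>

lemma \<delta>1_spatial: "\<exists>S\<in>(clin :: ('j \<times> 'i1, 'i1 \<times> 'j) hom set). \<forall>a\<in>M. \<delta>1 a = S \<cdot> (a \<otimes> \<one>) \<cdot> adj S"
proof (rule action_spatial[OF \<delta>1_hom \<delta>1_normal _ rvec_clin])
  show "Linf G1 \<otimes>\<^sub>v\<^sub>N M \<subseteq> clin" by (rule vn_tensor_clin)
  fix b assume b: "b \<in> B"
  have "rs \<xi> \<xi> (\<delta>1 b) = cinner \<xi> (b \<xi>) *\<^sub>C \<one>"
  proof (rule B_op_eq[OF _ _ b])
    show "rs \<xi> \<xi> (\<delta>1 (x a c)) = cinner \<xi> (x a c \<xi>) *\<^sub>C \<one>" for a c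
    proof (cases "G1.l a = triv G1")
      case True
      obtain e where e: "fib G1 (triv G1) = {e}" "coef G1 e e = \<one>" using G1.triv by (elim exE conjE)
      have "e = a" using G1.fib_triv[OF True] e(1) by simp
      then have "G1.gU a a = \<one>" using e(2) homD(3)[OF G1.\<pi>_hom] by (simp add: G1.gU_def)
      then show ?thesis unfolding \<delta>1_x slice_sum True G1.fib_triv[OF True] by simp
    next
      case False
      then have z: "cinner \<xi> (x d c \<xi>) = 0" if "G1.l d = G1.l a" for d
        using that state_x[of c d] x_zero[of d c] by (cases "G1.l d = \<phi>l c") (simp_all)
      show ?thesis unfolding \<delta>1_x slice_sum using z by simp
    qed
  qed (simp_all add: \<delta>_lin slice_linear)
  then show "adj (rvec \<xi>) \<cdot> \<delta>1 b \<cdot> rvec \<xi> = cinner \<xi> (b \<xi>) *\<^sub>C \<one>" by (simp add: rs_def)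
next
  fix z :: "('i1 \<times> 'j) ell2" assume z: "\<And>b \<eta>. b \<in> B \<Longrightarrow> cinner (\<delta>1 b (rvec \<xi> \<eta>)) z = 0"
  \<comment> \<open>The column relation of \<open>gU\<close> inverts the action: a finite sum of
    vectors in its range is the elementary tensor \<open>\<eta> \<otimes> adj (x d c) \<xi>\<close>.
    Unitarity thus does the work of an antipode.\<close>
  have o: "cinner (\<eta> \<otimes>\<^sub>v adj (x d c) \<xi>) z = 0" for \<eta> d c
  proof -
    let ?I = "G1.cls d"
    have "(\<Sum>a\<in>?I. \<delta>1 (adj (x a c)) (G1.gU a d \<eta> \<otimes>\<^sub>v \<xi>)) = (\<Sum>a\<in>?I. \<Sum>d'\<in>?I. (adj (G1.gU a d') \<cdot> G1.gU a d) \<eta> \<otimes>\<^sub>v adj (x d' c) \<xi>)" (is "sum ?f _ = sum ?g _")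
    proof (rule sum.cong[OF refl])
      fix a assume a: "a \<in> ?I"
      show "?f a = ?g a"
        unfolding homD(5)[OF \<delta>1_hom B_M[OF x_B]] \<delta>1_x using a by (subst adj_sum) (auto simp: op_tensor_simps(5) sum_apply)
    qed
    also have "\<dots> = (\<Sum>d'\<in>?I. (\<Sum>a\<in>?I. adj (G1.gU a d') \<cdot> G1.gU a d) \<eta> \<otimes>\<^sub>v adj (x d' c) \<xi>)"
      unfolding sum_apply vec_tensor.sum_left by (rule sum.swap)
    also have "\<dots> = (\<Sum>d'\<in>?I. if d' = d then \<eta> \<otimes>\<^sub>v adj (x d c) \<xi> else 0)" (is "sum ?f _ = sum ?g _")
    proof (rule sum.cong[OF refl])
      fix d' assume "d' \<in> ?I"
      then show "?f d' = ?g d'"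
        using G1.V.cols[of d' d] by (simp add: fib_def)
    qed
    also have "\<dots> = \<eta> \<otimes>\<^sub>v adj (x d c) \<xi>" by simp
    finally have eq: "\<eta> \<otimes>\<^sub>v adj (x d c) \<xi> = (\<Sum>a\<in>?I. \<delta>1 (adj (x a c)) (rvec \<xi> (G1.gU a d \<eta>)))" by simp
    show ?thesis unfolding eq cinner.sum_left by (intro sum.neutral ballI z B_star x_B)
  qed
  show "z = 0"
  proof (rule tensor_orthogonal_zero)
    fix \<eta> :: "'i1 ell2" and u :: "'j ell2"
    have "adj (lvec \<eta>) z = 0"
    proof (rule cyclic)
      fix b assume b: "b \<in> B"
      have "cinner (adj (x a c) \<xi>) (adj (lvec \<eta>) z) = 0" for a c using o[of \<eta> a c] by (simp add: cinner_adj_right)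
      then show "cinner (b \<xi>) (adj (lvec \<eta>) z) = 0"
        by (subst B_adj_expand[OF b]) (simp add: sum_apply cinner.sum_left)
    qed
    then have "cinner u (adj (lvec \<eta>) z) = 0" by simp
    then show "cinner (\<eta> \<otimes>\<^sub>v u) z = 0" by (simp add: cinner_adj_right)
  qed
qed

text \<open>The mirror image for the right action: the cyclic vector is prepended, and the row
  relation of \<open>G2.gU\<close> provides totality from the entries themselves instead of their
  adjoints.\<close>

lemma \<delta>2_spatial: "\<exists>S\<in>(clin :: ('j \<times> 'i2, 'j \<times> 'i2) hom set). \<forall>a\<in>M. \<delta>2 a = S \<cdot> (a \<otimes> \<one>) \<cdot> adj S"
proof (rule action_spatial[OF \<delta>2_hom \<delta>2_normal _ lvec_clin])
  show "M \<otimes>\<^sub>v\<^sub>N Linf G2 \<subseteq> clin" by (rule vn_tensor_clin)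
  fix b assume b: "b \<in> B"
  have "ls \<xi> \<xi> (\<delta>2 b) = cinner \<xi> (b \<xi>) *\<^sub>C \<one>"
  proof (rule B_op_eq[OF _ _ b])
    show "ls \<xi> \<xi> (\<delta>2 (x a c)) = cinner \<xi> (x a c \<xi>) *\<^sub>C \<one>" for a c
    proof (cases "G2.l c = triv G2")
      case True
      obtain e where e: "fib G2 (triv G2) = {e}" "coef G2 e e = \<one>" using G2.triv by (elim exE conjE)
      have "e = c" using G2.fib_triv[OF True] e(1) by simp
      then have "G2.gU c c = \<one>" using e(2) homD(3)[OF G2.\<pi>_hom] by (simp add: G2.gU_def)
      then show ?thesis unfolding \<delta>2_x slice_sum True G2.fib_triv[OF True] by simp
    next
      case False
      then have "\<phi>l d \<noteq> triv G1" if "G2.l d = G2.l c" for d using that by (simp flip: triv)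
      then show ?thesis unfolding \<delta>2_x slice_sum using False by (simp add: state_x flip: triv)
    qed
  qed (simp_all add: \<delta>_lin slice_linear)
  then show "adj (lvec \<xi>) \<cdot> \<delta>2 b \<cdot> lvec \<xi> = cinner \<xi> (b \<xi>) *\<^sub>C \<one>" by (simp add: ls_def)
next
  fix z :: "('j \<times> 'i2) ell2" assume z: "\<And>b \<eta>. b \<in> B \<Longrightarrow> cinner (\<delta>2 b (lvec \<xi> \<eta>)) z = 0"
  have o: "cinner (x a d \<xi> \<otimes>\<^sub>v \<eta>) z = 0" for \<eta> a d
  proof -
    let ?I = "G2.cls d"
    have "(\<Sum>c\<in>?I. \<delta>2 (x a c) (\<xi> \<otimes>\<^sub>v adj (G2.gU d c) \<eta>)) = (\<Sum>c\<in>?I. \<Sum>d'\<in>?I. x a d' \<xi> \<otimes>\<^sub>v (G2.gU d' c \<cdot> adj (G2.gU d c)) \<eta>)"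
      unfolding \<delta>2_x by (intro sum.cong refl) (simp add: sum_apply)
    also have "\<dots> = (\<Sum>d'\<in>?I. x a d' \<xi> \<otimes>\<^sub>v (\<Sum>c\<in>?I. G2.gU d' c \<cdot> adj (G2.gU d c)) \<eta>)"
      unfolding sum_apply vec_tensor.sum_right by (rule sum.swap)
    also have "\<dots> = (\<Sum>d'\<in>?I. if d' = d then x a d \<xi> \<otimes>\<^sub>v \<eta> else 0)" (is "sum ?f _ = sum ?g _")
    proof (rule sum.cong[OF refl])
      fix d' assume "d' \<in> ?I"
      then show "?f d' = ?g d'"
        using G2.V.rows[of d' d] by (simp add: fib_def)
    qed
    also have "\<dots> = x a d \<xi> \<otimes>\<^sub>v \<eta>" by simp
    finally have eq: "x a d \<xi> \<otimes>\<^sub>v \<eta> = (\<Sum>c\<in>?I. \<delta>2 (x a c) (lvec \<xi> (adj (G2.gU d c) \<eta>)))" by simp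
    show ?thesis unfolding eq cinner.sum_left by (intro sum.neutral ballI z x_B)
  qed
  show "z = 0"
  proof (rule tensor_orthogonal_zero)
    fix u :: "'j ell2" and \<eta> :: "'i2 ell2"
    have "adj (rvec \<eta>) z = 0"
    proof (rule cyclic)
      fix b assume b: "b \<in> B"
      have "cinner (x a c \<xi>) (adj (rvec \<eta>) z) = 0" for a c using o[of a c \<eta>] by (simp add: cinner_adj_right)
      then show "cinner (b \<xi>) (adj (rvec \<eta>) z) = 0"
        by (subst B_expand[OF b]) (simp add: sum_apply cinner.sum_left)
    qed
    then have "cinner u (adj (rvec \<eta>) z) = 0" by simp
    then show "cinner (u \<otimes>\<^sub>v \<eta>) z = 0" by (simp add: cinner_adj_right)
  qed
qed

text \<open>Both sides of \<open>h1\<close> are normal, the left one by the spatial form of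
  \<open>\<delta>1\<close>, so \<open>h1\<close> extends from \<open>B\<close> to the von Neumann
  algebra. On an element fixed by the action, averaging does nothing.\<close>

lemma ergodic: assumes T: "T \<in> M" and eq: "\<delta>1 T = \<one> \<otimes> T" shows "T = cinner \<xi> (T \<xi>) *\<^sub>C \<one>"
proof -
  obtain S :: "('j \<times> 'i1, 'i1 \<times> 'j) hom" where S: "S \<in> clin" "\<forall>a\<in>M. \<delta>1 a = S \<cdot> (a \<otimes> \<one>) \<cdot> adj S" using \<delta>1_spatial by (elim bexE)
  note Mc = star_algebraD(1)[OF M_star]
  have n1: "normal_on M (\<lambda>T. ls G1.\<xi> G1.\<xi> (\<delta>1 T))"
  proof (rule normal_spatial_left[OF Mc])
    show "adj (lvec G1.\<xi>) \<cdot> S \<in> clin" "adj S \<cdot> lvec G1.\<xi> \<in> clin" using S(1) by simp_all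
    show "ls G1.\<xi> G1.\<xi> (\<delta>1 T) = (adj (lvec G1.\<xi>) \<cdot> S) \<cdot> (T \<otimes> \<one>) \<cdot> (adj S \<cdot> lvec G1.\<xi>)" if "T \<in> M" for T
      using S(2) that by (simp add: ls_def compose_assoc)
  qed
  have n2: "normal_on M (\<lambda>T. cinner \<xi> (T \<xi>) *\<^sub>C (\<one> :: 'j op))"
  proof (rule normal_spatial_left[OF Mc, where P="adj (lvec \<xi>)" and Q="lvec \<xi>"])
    show "cinner \<xi> (T \<xi>) *\<^sub>C (\<one> :: 'j op) = adj (lvec \<xi>) \<cdot> (T \<otimes> (\<one> :: 'j op)) \<cdot> lvec \<xi>" if "T \<in> M" for T
      using subsetD[OF Mc that] slice_tensor(1)[of T "\<one> :: 'j op" \<xi> \<xi>] by (simp add: ls_def)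
  qed simp_all
  have "ls G1.\<xi> G1.\<xi> (\<delta>1 T) = cinner \<xi> (T \<xi>) *\<^sub>C \<one>"
    by (rule normal_eq_bicommutant[OF B n1[unfolded M_alt] n2[unfolded M_alt] h1 T[unfolded M_alt]])
  then show ?thesis using subsetD[OF Mc T] by (simp add: eq G1.\<xi>_norm)
qed

section \<open>Equivariance in terms of blocks\<close>

lemma action_tensor:
  assumes S: "\<exists>S\<in>(clin :: ('j \<times> 'q, 'r) hom set). \<forall>a\<in>M. \<delta> a = S \<cdot> (a \<otimes> \<one>) \<cdot> adj S" and a: "a \<in> linf G1 \<otimes>\<^sub>v\<^sub>N M"
  shows "tensor_map (linf G1) M (\<lambda>b. b) \<delta> a \<in> clin" "blk p q (tensor_map (linf G1) M (\<lambda>b. b) \<delta> a) = \<delta> (blk p q a)"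
proof -
  obtain S :: "('j \<times> 'q, 'r) hom" where S: "S \<in> clin" "\<forall>a\<in>M. \<delta> a = S \<cdot> (a \<otimes> \<one>) \<cdot> adj S" using assms(1) by (elim bexE)
  note t = tensor_map_right[OF linf_star[of G1] M_star S(1) adj_clin[OF S(1)] _ a, of \<delta>]
  show "tensor_map (linf G1) M (\<lambda>b. b) \<delta> a \<in> clin" using S(2) by (intro t) simp
  have "blk p q a \<in> M"
    using a star_algebraD(7)[OF M_star] by (cases "G1.l p = G1.l q") (auto simp: linf_tensor_iff[OF M_star M_bicommutant])
  then show "blk p q (tensor_map (linf G1) M (\<lambda>b. b) \<delta> a) = \<delta> (blk p q a)" using S(2) by (subst t) simp_all
qed

lemmas \<delta>1_tensor = action_tensor[OF \<delta>1_spatial] and \<delta>2_tensor = action_tensor[OF \<delta>2_spatial]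

lemma rs_amp_blk:
  assumes a: "a \<in> linf G1 \<otimes>\<^sub>v\<^sub>N M"
  shows "assoc_op (tensor_map (linf G1) M (adjoint_action G1) (\<lambda>b. b) a) \<in> clin"
    "blk p q (assoc_op (tensor_map (linf G1) M (adjoint_action G1) (\<lambda>b. b) a)) =
      (\<Sum>f\<in>G1.cls p. \<Sum>f'\<in>G1.cls q. (G1.gU p f \<cdot> adj (G1.gU q f')) \<otimes> blk f f' a)"
proof -
  note t = tensor_map_left[OF linf_star[of G1] M_star G1.V_clin adj_clin[OF G1.V_clin] _ a, of "adjoint_action G1"]
  have ac: "a \<in> clin" using a by (simp add: linf_tensor_iff[OF M_star M_bicommutant])
  have c: "tensor_map (linf G1) M (adjoint_action G1) (\<lambda>b. b) a \<in> clin" by (rule t) (simp add: adjoint_action_def)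
  then show "assoc_op (tensor_map (linf G1) M (adjoint_action G1) (\<lambda>b. b) a) \<in> clin" by (simp add: assoc_op_passoc)
  show "blk p q (assoc_op (tensor_map (linf G1) M (adjoint_action G1) (\<lambda>b. b) a)) =
      (\<Sum>f\<in>G1.cls p. \<Sum>f'\<in>G1.cls q. (G1.gU p f \<cdot> adj (G1.gU q f')) \<otimes> blk f f' a)"
  proof (rule slice_eqI(2))
    fix u v
    have "rs u v (blk p q (assoc_op (tensor_map (linf G1) M (adjoint_action G1) (\<lambda>b. b) a))) = blk p q (adjoint_action G1 (rs u v a))"
      unfolding assoc_op_passoc rs_blk_passoc by (subst t(2)) (simp_all add: adjoint_action_def)
    also have "\<dots> = (\<Sum>f\<in>G1.cls p. \<Sum>f'\<in>G1.cls q. cinner u (blk f f' a v) *\<^sub>C (G1.gU p f \<cdot> adj (G1.gU q f')))"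
      using ac by (simp add: G1.adjoint_action_blk entry_rs)
    finally show "rs u v (blk p q (assoc_op (tensor_map (linf G1) M (adjoint_action G1) (\<lambda>b. b) a))) =
        rs u v (\<Sum>f\<in>G1.cls p. \<Sum>f'\<in>G1.cls q. (G1.gU p f \<cdot> adj (G1.gU q f')) \<otimes> blk f f' a)"
      using ac by (simp add: slice_sum)
  qed (use c ac in \<open>simp_all add: assoc_op_passoc\<close>)
qed

text \<open>Turns an equality of operators on a triple tensor product into finite identities for
  single blocks, which can be multiplied with entries of \<open>X\<close> inside the homomorphism
  \<open>\<delta>1\<close>.\<close>

lemma equivariant_iff:
  assumes a: "a \<in> linf G1 \<otimes>\<^sub>v\<^sub>N M"
  shows "assoc_op (tensor_map (linf G1) M (adjoint_action G1) (\<lambda>b. b) a) = tensor_map (linf G1) M (\<lambda>b. b) \<delta>1 a \<longleftrightarrow>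
    (\<forall>p q. \<delta>1 (blk p q a) = (\<Sum>f\<in>G1.cls p. \<Sum>f'\<in>G1.cls q. (G1.gU p f \<cdot> adj (G1.gU q f')) \<otimes> blk f f' a))"
    (is "?l = ?r \<longleftrightarrow> (\<forall>p q. _ = ?s p q)")
proof (intro iffI allI)
  fix p q assume "?l = ?r"
  then have "blk p q ?l = blk p q ?r" by simp
  then show "\<delta>1 (blk p q a) = ?s p q" unfolding rs_amp_blk[OF a] \<delta>1_tensor[OF a] by (rule sym)
next
  assume e: "\<forall>p q. \<delta>1 (blk p q a) = ?s p q"
  show "?l = ?r"
  proof (rule blk_eqI[OF rs_amp_blk(1)[OF a] \<delta>1_tensor(1)[OF a]])
    fix p q show "blk p q ?l = blk p q ?r"
      unfolding rs_amp_blk[OF a] \<delta>1_tensor[OF a] by (rule e[rule_format, symmetric])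
  qed
qed

lemma \<delta>1_blk_\<rho>:
  assumes b: "b \<in> clin"
  shows "\<delta>1 (blk p q (\<rho> b)) = (\<Sum>f\<in>G1.cls p. \<Sum>f'\<in>G1.cls q. (G1.gU p f \<cdot> adj (G1.gU q f')) \<otimes> blk f f' (\<rho> b))"
proof -
  let ?P = "{c. \<phi>l c = G1.l p}" and ?Q = "{c. \<phi>l c = G1.l q}" and ?F = "G1.cls p" and ?F' = "G1.cls q"
  have m: "x p c \<cdot> adj (x q c') \<in> B" for c c' by (intro B_star x_B)
  have d: "\<delta>1 (x p c \<cdot> adj (x q c')) = (\<Sum>f\<in>?F. \<Sum>f'\<in>?F'. (G1.gU p f \<cdot> adj (G1.gU q f')) \<otimes> (x f c \<cdot> adj (x f' c')))" for c c'
    unfolding homD(4)[OF \<delta>1_hom B_M[OF x_B] B_M[OF B_star(2)[OF x_B]]] homD(5)[OF \<delta>1_hom B_M[OF x_B]] \<delta>1_x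
    by (subst adj_sum, simp, simp add: op_tensor_simps(5) compose_sum op_tensor_compose, rule sum.swap)
  have "\<delta>1 (blk p q (\<rho> b)) = (\<Sum>c\<in>?P. \<Sum>c'\<in>?Q. ent b c c' *\<^sub>C \<delta>1 (x p c \<cdot> adj (x q c')))"
    unfolding blk_\<rho>[OF b] by (subst \<delta>_sum(1), intro star_algebra_sum[OF B] B_star m, subst \<delta>_sum(1), intro B_star m, subst homD(2)[OF \<delta>1_hom B_M[OF m]], rule refl)
  also have "\<dots> = (\<Sum>c\<in>?P. \<Sum>c'\<in>?Q. \<Sum>f\<in>?F. \<Sum>f'\<in>?F'. (G1.gU p f \<cdot> adj (G1.gU q f')) \<otimes> (ent b c c' *\<^sub>C (x f c \<cdot> adj (x f' c'))))"
    unfolding d by (simp add: scaleC_sum op_tensor_simps(4))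
  also have "\<dots> = (\<Sum>f\<in>?F. \<Sum>f'\<in>?F'. \<Sum>c\<in>?P. \<Sum>c'\<in>?Q. (G1.gU p f \<cdot> adj (G1.gU q f')) \<otimes> (ent b c c' *\<^sub>C (x f c \<cdot> adj (x f' c'))))"
    by (rule trans, rule sum.cong[OF refl], rule sum_swap2, rule sum_swap2)
  also have "\<dots> = (\<Sum>f\<in>?F. \<Sum>f'\<in>?F'. (G1.gU p f \<cdot> adj (G1.gU q f')) \<otimes> blk f f' (\<rho> b))" (is "(\<Sum>f\<in>_. \<Sum>f'\<in>_. ?f f f') = (\<Sum>f\<in>_. \<Sum>f'\<in>_. ?g f f')")
  proof (intro sum.cong refl)
    fix f f' assume f: "f \<in> ?F" "f' \<in> ?F'"
    have ts: "R \<otimes> (\<Sum>i\<in>I. T i) = (\<Sum>i\<in>I. R \<otimes> T i)" if "R \<in> clin" "\<And>i. T i \<in> clin" for R :: "'i1 op" and I and T :: "'e2 \<Rightarrow> 'j op"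
      by (induction I rule: infinite_finite_induct) (use that in \<open>auto simp: op_tensor_simps(2)\<close>)
    show "?f f f' = ?g f f'"
      unfolding blk_\<rho>[OF b] using f by (simp add: ts)
  qed
  finally show ?thesis .
qed

lemma \<rho>_onto:
  assumes a: "a \<in> linf G1 \<otimes>\<^sub>v\<^sub>N M"
    and eq: "\<And>p q. \<delta>1 (blk p q a) = (\<Sum>f\<in>G1.cls p. \<Sum>f'\<in>G1.cls q. (G1.gU p f \<cdot> adj (G1.gU q f')) \<otimes> blk f f' a)"
  shows "\<exists>b\<in>linf G2. \<rho> b = a"
proof -
  note a' = a[unfolded linf_tensor_iff[OF M_star M_bicommutant]]
  have ac: "a \<in> clin" by (rule conjunct1[OF a'])
  have a0: "blk p q a = 0" if "G1.l p \<noteq> G1.l q" for p q using spec[OF spec[OF conjunct2[OF a']], of p q] that by simp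
  have am: "blk p q a \<in> M" for p q
    using spec[OF spec[OF conjunct2[OF a']], of p q] a0[of p q] star_algebraD(7)[OF M_star] by (cases "G1.l p = G1.l q") simp_all
  \<comment> \<open>For \<open>a = \<rho> b\<close> this would be \<open>b \<otimes> \<one>\<close>;
    the aim is to show that all blocks of \<open>C\<close> are scalars.\<close>
  define C where "C = adj W \<cdot> a \<cdot> W"
  have Cc: "C \<in> clin" using ac by (simp add: C_def W_unitary)
  let ?P = "\<lambda>c. {p. G1.l p = \<phi>l c}"
  have Cb: "blk c c' C = (\<Sum>p\<in>?P c. \<Sum>q\<in>?P c'. adj (x p c) \<cdot> (blk p q a \<cdot> x q c'))" for c c'
  proof (rule hom_eqI)
    fix u v
    have "cinner u (blk c c' C v) = cinner (W (basis_vec c \<otimes>\<^sub>v u)) (a (W (basis_vec c' \<otimes>\<^sub>v v)))"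
      using W_unitary(1) by (simp add: C_def cinner_ls cinner_adj_right)
    also have "\<dots> = (\<Sum>q\<in>?P c'. \<Sum>p\<in>?P c. cinner (x p c u) (blk p q a (x q c' v)))"
      unfolding W X.block_op_spec(2) blinfun.sum_right cinner.sum_right cinner.sum_left cinner_ls ..
    also have "\<dots> = (\<Sum>p\<in>?P c. \<Sum>q\<in>?P c'. cinner (x p c u) (blk p q a (x q c' v)))" by (rule sum.swap)
    finally show "cinner u (blk c c' C v) = cinner u ((\<Sum>p\<in>?P c. \<Sum>q\<in>?P c'. adj (x p c) \<cdot> (blk p q a \<cdot> x q c')) v)"
      by (simp add: sum_apply cinner.sum_right cinner_adj_right)
  qed
  have m: "adj (x p c) \<cdot> (blk p q a \<cdot> x q c') \<in> M" for p q c c'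
    by (intro star_algebraD(4,5)[OF M_star] am B_M x_B)
  have CM: "blk c c' C \<in> M" for c c' unfolding Cb by (intro star_algebra_sum[OF M_star] m)
  have C0: "blk c c' C = 0" if "G2.l c \<noteq> G2.l c'" for c c'
    unfolding Cb using that by (intro sum.neutral ballI) (auto simp: a0)
  \<comment> \<open>The matrices \<open>gU\<close> coming from the entries of \<open>X\<close> on
    either side meet those coming from the equivariance of \<open>a\<close> in pairs
    \<open>adj (gU p d) \<cdot> gU p f\<close>. The sums over \<open>p\<close> and \<open>q\<close>
    collapse these pairs by the column relations.\<close>
  have "\<delta>1 (blk c c' C) = \<one> \<otimes> blk c c' C" for c c'
  proof (rule slice_eqI(1))
    have dc: "\<delta>1 T \<in> clin" if "T \<in> M" for T using homD(6)[OF \<delta>1_hom that] vn_tensor_clin by auto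
    show "\<delta>1 (blk c c' C) \<in> clin" "\<one> \<otimes> blk c c' C \<in> clin" using dc[OF CM] Cc by simp_all
    let ?T = "\<lambda>d f f' d'. adj (x d c) \<cdot> (blk f f' a \<cdot> x d' c')"
    let ?g = "\<lambda>p q d f f' d'. adj (G1.gU p d) \<cdot> G1.gU p f \<cdot> (adj (G1.gU q f') \<cdot> G1.gU q d')"
    have inv: "\<delta>1 (adj (x p c) \<cdot> (blk p q a \<cdot> x q c')) =
        (\<Sum>d\<in>?P c. \<Sum>f\<in>?P c. \<Sum>f'\<in>?P c'. \<Sum>d'\<in>?P c'. ?g p q d f f' d' \<otimes> ?T d f f' d')"
      if pq: "p \<in> ?P c" "q \<in> ?P c'" for p q
    proof -
      have P: "G1.cls p = ?P c" "G1.cls q = ?P c'" using pq by auto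
      have "\<delta>1 (adj (x p c) \<cdot> (blk p q a \<cdot> x q c')) = adj (\<delta>1 (x p c)) \<cdot> (\<delta>1 (blk p q a) \<cdot> \<delta>1 (x q c'))"
        by (simp add: homD(4,5)[OF \<delta>1_hom] B_M B_star am star_algebraD(4)[OF M_star])
      also have "\<dots> = (\<Sum>d\<in>?P c. adj (G1.gU p d) \<otimes> adj (x d c)) \<cdot> ((\<Sum>f\<in>?P c. \<Sum>f'\<in>?P c'. (G1.gU p f \<cdot> adj (G1.gU q f')) \<otimes> blk f f' a) \<cdot> (\<Sum>d'\<in>?P c'. G1.gU q d' \<otimes> x d' c'))"
        unfolding eq \<delta>1_x P by (subst adj_sum) (simp_all add: op_tensor_simps(5))
      also have "\<dots> = (\<Sum>d\<in>?P c. \<Sum>f\<in>?P c. \<Sum>f'\<in>?P c'. \<Sum>d'\<in>?P c'. ?g p q d f f' d' \<otimes> ?T d f f' d')"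
        using ac by (simp only: compose_sum_left, intro sum.cong[OF refl], simp only: compose_sum_right, simp add: op_tensor_compose compose_assoc)
      finally show ?thesis .
    qed
    fix u v
    let ?s = "\<lambda>p q d f f' d'. cinner u (?g p q d f f' d' v)"
    have "ls u v (\<delta>1 (blk c c' C)) = (\<Sum>p\<in>?P c. \<Sum>q\<in>?P c'. ls u v (\<delta>1 (adj (x p c) \<cdot> (blk p q a \<cdot> x q c'))))"
      unfolding Cb by (subst linear_map_on_sum[OF homD(7)[OF \<delta>1_hom] M_star], intro star_algebra_sum[OF M_star] m,
          subst linear_map_on_sum[OF homD(7)[OF \<delta>1_hom] M_star], rule m, simp only: slice_sum)
    also have "\<dots> = (\<Sum>p\<in>?P c. \<Sum>q\<in>?P c'. \<Sum>d\<in>?P c. \<Sum>f\<in>?P c. \<Sum>f'\<in>?P c'. \<Sum>d'\<in>?P c'. ?s p q d f f' d' *\<^sub>C ?T d f f' d')"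
      using ac by (intro sum.cong refl) (simp only: inv slice_sum, simp)
    also have "\<dots> = (\<Sum>d\<in>?P c. \<Sum>f\<in>?P c. \<Sum>f'\<in>?P c'. \<Sum>d'\<in>?P c'. \<Sum>p\<in>?P c. \<Sum>q\<in>?P c'. ?s p q d f f' d' *\<^sub>C ?T d f f' d')"
    proof -
      have swap: "(\<Sum>a\<in>R. \<Sum>r\<in>X. \<Sum>w\<in>Y. \<Sum>r'\<in>Z. \<Sum>s\<in>U. H a r w r' s) = (\<Sum>r\<in>X. \<Sum>w\<in>Y. \<Sum>r'\<in>Z. \<Sum>s\<in>U. \<Sum>a\<in>R. H a r w r' s)"
        for H :: "'e1 \<Rightarrow> 'e1 \<Rightarrow> 'e1 \<Rightarrow> 'e1 \<Rightarrow> 'e1 \<Rightarrow> 'j op" and R X Y Z U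
        by (rule trans[OF sum_swap2], rule sum.cong[OF refl], rule sum.cong[OF refl], rule sum_swap2)
      show ?thesis by (rule trans, rule sum.cong[OF refl], rule swap, rule swap)
    qed
    also have "\<dots> = (\<Sum>d\<in>?P c. \<Sum>f\<in>?P c. \<Sum>f'\<in>?P c'. \<Sum>d'\<in>?P c'. if f = d then if d' = f' then cinner u v *\<^sub>C ?T d d f' f' else 0 else 0)"
    proof (intro sum.cong refl)
      fix d f f' d' assume l: "d \<in> ?P c" "f \<in> ?P c" "f' \<in> ?P c'" "d' \<in> ?P c'"
      have "(\<Sum>p\<in>?P c. \<Sum>q\<in>?P c'. ?s p q d f f' d')
          = cinner u ((\<Sum>p\<in>?P c. adj (G1.gU p d) \<cdot> G1.gU p f) ((\<Sum>q\<in>?P c'. adj (G1.gU q f') \<cdot> G1.gU q d') v))"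
        by (simp add: sum_apply blinfun.sum_right cinner.sum_right) (rule sum.swap)?
      also have "\<dots> = (if f = d then if d' = f' then cinner u v else 0 else 0)"
        using l G1.V.cols[of d f] G1.V.cols[of f' d'] by auto
      finally have e: "(\<Sum>p\<in>?P c. \<Sum>q\<in>?P c'. ?s p q d f f' d') = (if f = d then if d' = f' then cinner u v else 0 else 0)" .
      show "(\<Sum>p\<in>?P c. \<Sum>q\<in>?P c'. ?s p q d f f' d' *\<^sub>C ?T d f f' d') = (if f = d then if d' = f' then cinner u v *\<^sub>C ?T d d f' f' else 0 else 0)"
        unfolding scaleC_sum(2)[symmetric] e by simp
    qed
    also have "\<dots> = (\<Sum>d\<in>?P c. \<Sum>f'\<in>?P c'. cinner u v *\<^sub>C ?T d d f' f')" (is "sum ?f _ = sum ?g _")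
    proof (rule sum.cong[OF refl])
      fix d assume d: "d \<in> ?P c"
      have "?f d = (\<Sum>f\<in>?P c. if f = d then \<Sum>f'\<in>?P c'. \<Sum>d'\<in>?P c'. if d' = f' then cinner u v *\<^sub>C ?T d d f' f' else 0 else 0)"
        by (intro sum.cong refl) simp
      also have "\<dots> = (\<Sum>f'\<in>?P c'. \<Sum>d'\<in>?P c'. if d' = f' then cinner u v *\<^sub>C ?T d d f' f' else 0)" using d X.fin(1) by simp
      also have "\<dots> = (\<Sum>f'\<in>?P c'. cinner u v *\<^sub>C ?T d d f' f')" using X.fin(1) by (intro sum.cong refl) simp
      finally show "?f d = ?g d" .
    qed
    also have "\<dots> = ls u v (\<one> \<otimes> blk c c' C)"
    proof -
      have "ls u v (\<one> \<otimes> blk c c' C) = cinner u v *\<^sub>C blk c c' C" using Cc by simp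
      then show ?thesis by (simp only: Cb scaleC_sum)
    qed
    finally show "ls u v (\<delta>1 (blk c c' C)) = ls u v (\<one> \<otimes> blk c c' C)" .
  qed
  then have sc: "blk c c' C = cinner \<xi> (blk c c' C \<xi>) *\<^sub>C \<one>" for c c' by (intro ergodic[OF CM])
  \<comment> \<open>Since the blocks are scalar multiples of the unit, slicing the second leg by the
    unit vector \<open>\<xi>\<close> recovers the operator on the first leg.\<close>
  let ?b = "rs \<xi> \<xi> C"
  have bl: "?b \<in> linf G2" using Cc C0 by (auto simp: linf_iff entry_rs)
  have "C = ?b \<otimes> \<one>"
  proof (rule blk_eqI[OF Cc])
    show "?b \<otimes> \<one> \<in> clin" using Cc by simp
    fix c c' show "blk c c' C = blk c c' (?b \<otimes> \<one>)" using Cc by (subst sc) (simp add: entry_rs)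
  qed
  then have "\<rho> ?b = (W \<cdot> adj W) \<cdot> a \<cdot> (W \<cdot> adj W)" by (simp add: \<rho>_def C_def compose_assoc)
  then have "\<rho> ?b = a" by (simp add: W_unitary)
  then show ?thesis using bl by blast
qed

text \<open>On blocks both sides are combinations of \<open>x p d \<cdot> adj (x q d')\<close>,
  weighted by entries of \<open>b\<close> and by coefficients of the second group. They differ only
  in the order of summation.\<close>

lemma \<delta>2_intertwines:
  assumes b: "b \<in> linf G2"
  shows "tensor_map (linf G1) M (\<lambda>a. a) \<delta>2 (\<rho> b) = assoc_op (tensor_map (linf G2) (Linf G2) \<rho> (\<lambda>c. c) (adjoint_action G2 b))"
proof -
  have bc: "b \<in> clin" using b by (simp add: linf_iff)
  note ad = G2.adjoint_action_mem[OF b]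
  have ac: "adjoint_action G2 b \<in> clin" using bc by (simp add: adjoint_action_def)
  note t = tensor_map_left[OF linf_star[of G2] G2.Linf_star W_unitary(1) adj_clin[OF W_unitary(1)] _ ad, of \<rho>, OF \<rho>_def]
  show ?thesis
  proof (rule blk_eqI)
    show "tensor_map (linf G1) M (\<lambda>a. a) \<delta>2 (\<rho> b) \<in> clin" by (rule \<delta>2_tensor[OF \<rho>_mem[OF b]])
    show c: "assoc_op (tensor_map (linf G2) (Linf G2) \<rho> (\<lambda>c. c) (adjoint_action G2 b)) \<in> clin" using t(1) by (simp add: assoc_op_passoc)
    fix p q
    let ?P = "{c. \<phi>l c = G1.l p}" and ?Q = "{c. \<phi>l c = G1.l q}"
    have m: "x p c \<cdot> adj (x q c') \<in> B" for c c' by (intro B_star x_B)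
    have f: "G2.cls c = ?P" if "c \<in> ?P" for c using that by (auto simp flip: \<phi>_eq)
    have f': "G2.cls c = ?Q" if "c \<in> ?Q" for c using that by (auto simp flip: \<phi>_eq)
    have d: "\<delta>2 (x p c \<cdot> adj (x q c')) = (\<Sum>d\<in>?P. \<Sum>d'\<in>?Q. (x p d \<cdot> adj (x q d')) \<otimes> (G2.gU d c \<cdot> adj (G2.gU d' c')))" if "c \<in> ?P" "c' \<in> ?Q" for c c'
      unfolding homD(4)[OF \<delta>2_hom B_M[OF x_B] B_M[OF B_star(2)[OF x_B]]] homD(5)[OF \<delta>2_hom B_M[OF x_B]] \<delta>2_x f[OF that(1)] f'[OF that(2)]
      by (subst adj_sum, simp, simp add: op_tensor_simps(5) compose_sum op_tensor_compose, rule sum.swap)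
    have e: "\<delta>2 (blk p q (\<rho> b)) = (\<Sum>c\<in>?P. \<Sum>c'\<in>?Q. ent b c c' *\<^sub>C \<delta>2 (x p c \<cdot> adj (x q c')))"
      unfolding blk_\<rho>[OF bc] by (subst \<delta>_sum(2), intro star_algebra_sum[OF B] B_star m, subst \<delta>_sum(2), intro B_star m, subst homD(2)[OF \<delta>2_hom B_M[OF m]], rule refl)
    show "blk p q (tensor_map (linf G1) M (\<lambda>a. a) \<delta>2 (\<rho> b)) = blk p q (assoc_op (tensor_map (linf G2) (Linf G2) \<rho> (\<lambda>c. c) (adjoint_action G2 b)))"
    proof (rule slice_eqI(2))
      show "blk p q (tensor_map (linf G1) M (\<lambda>a. a) \<delta>2 (\<rho> b)) \<in> clin" by (rule slice_clin[OF \<delta>2_tensor(1)[OF \<rho>_mem[OF b]]])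
      show "blk p q (assoc_op (tensor_map (linf G2) (Linf G2) \<rho> (\<lambda>c. c) (adjoint_action G2 b))) \<in> clin" by (rule slice_clin[OF c])
      fix u v
      have "rs u v (blk p q (tensor_map (linf G1) M (\<lambda>a. a) \<delta>2 (\<rho> b)))
          = (\<Sum>c\<in>?P. \<Sum>c'\<in>?Q. \<Sum>d\<in>?P. \<Sum>d'\<in>?Q. (ent b c c' * cinner u (G2.gU d c (adj (G2.gU d' c') v))) *\<^sub>C (x p d \<cdot> adj (x q d')))"
        unfolding \<delta>2_tensor[OF \<rho>_mem[OF b]] e slice_sum slice_linear by (intro sum.cong refl) (simp add: d slice_sum scaleC_sum)
      also have "\<dots> = (\<Sum>d\<in>?P. \<Sum>d'\<in>?Q. \<Sum>c\<in>?P. \<Sum>c'\<in>?Q. (ent b c c' * cinner u (G2.gU d c (adj (G2.gU d' c') v))) *\<^sub>C (x p d \<cdot> adj (x q d')))"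
        by (rule trans, rule sum.cong[OF refl], rule sum_swap2, rule sum_swap2)
      also have "\<dots> = (\<Sum>d\<in>?P. \<Sum>d'\<in>?Q. cinner u (blk d d' (adjoint_action G2 b) v) *\<^sub>C (x p d \<cdot> adj (x q d')))"
        unfolding G2.adjoint_action_blk[OF bc] by (intro sum.cong refl) (simp add: f f' sum_apply cinner.sum_right scaleC_sum)
      also have "\<dots> = blk p q (\<rho> (rs u v (adjoint_action G2 b)))" using ac by (simp add: blk_\<rho> entry_rs)
      also have "\<dots> = rs u v (blk p q (assoc_op (tensor_map (linf G2) (Linf G2) \<rho> (\<lambda>c. c) (adjoint_action G2 b))))"
        unfolding assoc_op_passoc rs_blk_passoc t(2) \<rho>_def ..
      finally show "rs u v (blk p q (tensor_map (linf G1) M (\<lambda>a. a) \<delta>2 (\<rho> b))) = rs u v (blk p q (assoc_op (tensor_map (linf G2) (Linf G2) \<rho> (\<lambda>c. c) (adjoint_action G2 b))))" .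
    qed
  qed
qed

end

section \<open>The product on the Poisson boundary\<close>

lemma adj_swap: "adj (basis_map prod.swap) = basis_map prod.swap"
  by (simp add: adj_basis_map inv_equality[of prod.swap prod.swap])

lemma amp_swap:
  assumes T: "T \<in> clin"
  shows "(T \<otimes> \<one>) Y = basis_map prod.swap ((\<one> \<otimes> T) (basis_map prod.swap Y))"
    "cinner X ((T \<otimes> \<one>) Y) = cinner (basis_map prod.swap X) ((\<one> \<otimes> T) (basis_map prod.swap Y))"
proof -
  show e: "(T \<otimes> \<one>) Y = basis_map prod.swap ((\<one> \<otimes> T) (basis_map prod.swap Y))"
    using swap_conj[OF T] by (metis blinfun_apply_blinfun_compose)
  show "cinner X ((T \<otimes> \<one>) Y) = cinner (basis_map prod.swap X) ((\<one> \<otimes> T) (basis_map prod.swap Y))"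
    unfolding e using cinner_adj_right[of "basis_map prod.swap" X "(\<one> \<otimes> T) (basis_map prod.swap Y)"] by (simp add: adj_swap)
qed

lemma amp_rows: "T \<in> clin \<Longrightarrow> ((\<lambda>r. cinner (row r X) (T (row r Y))) has_sum cinner X ((\<one> \<otimes> T) Y)) UNIV"
  using cinner_rows[of X "(\<one> \<otimes> T) Y"] by simp

lemma amp_positive:
  assumes T: "T \<in> clin" and pos: "\<And>x. 0 \<le> Re (cinner x (T x))" shows "0 \<le> Re (cinner X ((T \<otimes> \<one>) X))"
  unfolding amp_swap(2)[OF T] by (rule has_sum_nonneg[OF has_sum_Re[OF amp_rows[OF T]]]) (rule pos)

lemma amp_norm: assumes T: "T \<in> clin" shows "norm ((T \<otimes> \<one>) X) \<le> norm T * norm X"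
proof -
  have "norm ((\<one> \<otimes> T) Y) \<le> norm T * norm Y" for Y
  proof (rule power2_le_imp_le)
    show "(norm ((\<one> \<otimes> T) Y))\<^sup>2 \<le> (norm T * norm Y)\<^sup>2"
    proof (rule has_sum_mono)
      show "((\<lambda>r. (norm (T (row r Y)))\<^sup>2) has_sum (norm ((\<one> \<otimes> T) Y))\<^sup>2) UNIV" using row_norms[of "(\<one> \<otimes> T) Y"] T by simp
      show "((\<lambda>r. (norm T)\<^sup>2 * (norm (row r Y))\<^sup>2) has_sum (norm T * norm Y)\<^sup>2) UNIV"
        unfolding power_mult_distrib by (rule has_sum_cmult_right[OF row_norms])
      show "(norm (T (row r Y)))\<^sup>2 \<le> (norm T)\<^sup>2 * (norm (row r Y))\<^sup>2" for r
        using power_mono[OF norm_blinfun[of T "row r Y"], of 2] by (simp add: power_mult_distrib)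
    qed
  qed simp
  from this[of "basis_map prod.swap X"] show ?thesis unfolding amp_swap(1)[OF T] by (simp add: basis_map_apply(3))
qed

lemma cesaro:
  fixes z :: "nat \<Rightarrow> complex"
  assumes z: "z \<longlonglongrightarrow> L" shows "(\<lambda>n. (1 / of_nat n) * (\<Sum>k = 1..n. z k)) \<longlonglongrightarrow> L"
proof (rule LIMSEQ_I)
  fix e :: real assume e: "0 < e"
  obtain N where N: "\<And>n. n \<ge> N \<Longrightarrow> norm (z n - L) < e / 2" using LIMSEQ_D[OF z, of "e / 2"] e by auto
  define C where "C = (\<Sum>k = 1..N. norm (z k - L))"
  obtain m where m: "real m > 2 * C / e" using reals_Archimedean2 by blast
  have "norm ((1 / of_nat n) * (\<Sum>k = 1..n. z k) - L) < e" if n: "n \<ge> max (N + 1) m" for n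
  proof -
    have n0: "real n > 0" using n by simp
    have "(\<Sum>k = 1..n. z k - L) = (\<Sum>k = 1..n. z k) - of_nat n * L" by (simp add: sum_subtractf)
    then have "(1 / of_nat n) * (\<Sum>k = 1..n. z k) - L = (1 / of_nat n) * (\<Sum>k = 1..n. z k - L)" using n0 by (simp add: field_simps)
    then have "norm ((1 / of_nat n) * (\<Sum>k = 1..n. z k) - L) = norm (\<Sum>k = 1..n. z k - L) / real n" by (simp add: norm_mult norm_divide)
    also have "norm (\<Sum>k = 1..n. z k - L) \<le> (\<Sum>k = 1..n. norm (z k - L))" by (rule norm_sum)
    also have "(\<Sum>k = 1..n. norm (z k - L)) = C + (\<Sum>k = N + 1..n. norm (z k - L))"
    proof -
      have "{1..n} = {1..N} \<union> {N + 1..n}" using n by auto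
      then show ?thesis unfolding C_def by (simp add: sum.union_disjoint)
    qed
    also have "(\<Sum>k = N + 1..n. norm (z k - L)) \<le> (\<Sum>k = N + 1..n. e / 2)" by (intro sum_mono) (use N in \<open>auto intro: less_imp_le\<close>)
    also have "\<dots> \<le> real n * (e / 2)" using e by (simp add: mult_right_mono)
    finally have "norm ((1 / of_nat n) * (\<Sum>k = 1..n. z k) - L) \<le> (C + real n * (e / 2)) / real n" using n0 by (simp add: divide_right_mono)
    also have "C < real n * (e / 2)"
    proof -
      have "e * real m \<le> e * real n" using e n by (intro mult_left_mono) auto
      moreover have "2 * C < e * real m" using m e by (simp add: field_simps)
      ultimately show ?thesis by (simp add: field_simps)
    qed
    finally show ?thesis using n0 by (simp add: field_simps)
  qed
  then show "\<exists>no. \<forall>n\<ge>no. norm ((1 / of_nat n) * (\<Sum>k = 1..n. z k) - L) < e" by (intro exI[of _ "max (N + 1) m"]) simp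
qed

text \<open>For a bounded sequence, weak convergence is already sigma-weak: the series over rows is
  dominated by \<open>C\<close> times the squared norms of the rows, and the limit passes through
  it. Averages of a convergent scalar sequence keep its limit.\<close>

lemma cesaro_sigma_weak:
  fixes T :: "nat \<Rightarrow> 'i op"
  assumes T: "\<And>k. T k \<in> clin" "\<And>k. norm (T k) \<le> C" and S: "S \<in> clin" and conv: "\<And>x y. (\<lambda>k. cinner x (T k y)) \<longlonglongrightarrow> cinner x (S y)"
  shows "limitin sigma_weak (\<lambda>n. (1 / real n) *\<^sub>R (\<Sum>k = 1..n. T k)) S sequentially"
proof (rule limitin_sigma_weakI)
  fix w :: "'i op \<Rightarrow> complex" assume "w \<in> sigma_weak_functionals"
  then obtain X Y :: "(nat \<times> 'i) ell2" where w: "\<forall>T\<in>clin. w T = cinner X ((\<one> \<otimes> T) Y)" using functional_amp by blast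
  have C: "0 \<le> C" using order_trans[OF norm_ge_zero T(2)] .
  have su: "cinner X ((\<one> \<otimes> R) Y) = (\<Sum>r. cinner (row r X) (R (row r Y)))" if "R \<in> clin" for R
    by (rule sums_unique[OF has_sum_imp_sums[OF amp_rows[OF that]]])
  have "(\<lambda>n. \<Sum>r. cinner (row r X) (T n (row r Y))) \<longlonglongrightarrow> (\<Sum>r. cinner (row r X) (S (row r Y)))"
  proof (rule conjunct2[OF conjunct2[OF tannerys_theorem[where M="\<lambda>r. C * ((norm (row r X))\<^sup>2 + (norm (row r Y))\<^sup>2)"]]])
    show "(\<lambda>n. cinner (row r X) (T n (row r Y))) \<longlonglongrightarrow> cinner (row r X) (S (row r Y))" for r by (rule conv)
    have "norm (cinner (row r X) (T n (row r Y))) \<le> C * ((norm (row r X))\<^sup>2 + (norm (row r Y))\<^sup>2)" for r n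
    proof -
      have "norm (cinner (row r X) (T n (row r Y))) \<le> norm (row r X) * (C * norm (row r Y))"
        using cinner_bound[of "row r X" "T n (row r Y)"] norm_blinfun[of "T n" "row r Y"] T(2)[of n]
        by (smt (verit) mult_left_mono mult_right_mono norm_ge_zero)
      also have "\<dots> = C * (norm (row r X) * norm (row r Y))" by simp
      also have "\<dots> \<le> C * ((norm (row r X))\<^sup>2 + (norm (row r Y))\<^sup>2)"
      proof (rule mult_left_mono[OF _ C])
        have "0 \<le> norm (row r X) * norm (row r Y)" by simp
        then show "norm (row r X) * norm (row r Y) \<le> (norm (row r X))\<^sup>2 + (norm (row r Y))\<^sup>2"
          using sum_squares_bound[of "norm (row r X)" "norm (row r Y)"] by linarith
      qed
      finally show ?thesis .
    qed
    then show "eventually (\<lambda>(r, n). norm (cinner (row r X) (T n (row r Y))) \<le> C * ((norm (row r X))\<^sup>2 + (norm (row r Y))\<^sup>2)) (at_top \<times>\<^sub>F sequentially)"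
      by (intro always_eventually) auto
    show "summable (\<lambda>r. C * ((norm (row r X))\<^sup>2 + (norm (row r Y))\<^sup>2))"
      by (intro summable_mult summable_add sums_summable[OF has_sum_imp_sums[OF row_norms]])
  qed simp
  then have "(\<lambda>n. w (T n)) \<longlonglongrightarrow> w S" using w T(1) S by (simp add: su)
  then have "(\<lambda>n. (1 / of_nat n) * (\<Sum>k = 1..n. w (T k))) \<longlonglongrightarrow> w S" by (rule cesaro)
  moreover have "w ((1 / real n) *\<^sub>R (\<Sum>k = 1..n. T k)) = (1 / of_nat n) * (\<Sum>k = 1..n. w (T k))" for n
  proof -
    have add: "w (R + R') = w R + w R'" if "R \<in> clin" "R' \<in> clin" for R R'
      using that w by (simp add: op_tensor_simps(2) blinfun.add_left cinner.add_right)
    have sum: "w (\<Sum>k\<in>F. T k) = (\<Sum>k\<in>F. w (T k))" for F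
    proof (induction F rule: infinite_finite_induct)
      case (insert k F)
      then show ?case using add[of "T k" "sum T F"] T(1) by simp
    qed (use add[of 0 0] in simp_all)
    have sc: "w (c *\<^sub>C R) = c * w R" if "R \<in> clin" for c R using that w by (simp add: op_tensor_simps(4))
    have "w (r *\<^sub>R R) = of_real r * w R" if "R \<in> clin" for r R unfolding scaleC_simps(5)[symmetric] by (rule sc[OF that])
    from this[of "\<Sum>k = 1..n. T k" "1 / real n"] show ?thesis using T(1) by (simp add: sum)
  qed
  ultimately show "(\<lambda>n. w ((1 / real n) *\<^sub>R (\<Sum>k = 1..n. T k))) \<longlonglongrightarrow> w S" by simp
qed

lemma polarization:
  assumes "S \<in> clin"
  shows "4 * cinner x (S y) = (\<Sum>c\<in>{1, -1, \<i>, -\<i>}. cnj c * cinner (x + cscale c y) (S (x + cscale c y)))"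
  using assms by (simp add: blinfun.add_right cinner.add_left cinner.add_right clinD algebra_simps complex_eq_iff)

lemma op_polarization:
  assumes "a \<in> clin" "b \<in> clin"
  shows "4 *\<^sub>C (adj a \<cdot> b) = (\<Sum>c\<in>{1, -1, \<i>, -\<i>}. cnj c *\<^sub>C (adj (a + c *\<^sub>C b) \<cdot> (a + c *\<^sub>C b)))"
proof (rule hom_eqI)
  fix x y
  have "4 * cinner (a x) (b y) = (\<Sum>c\<in>{1, -1, \<i>, -\<i>}. cnj c * cinner (a x + cscale c (b x)) (a y + cscale c (b y)))"
    by (simp add: cinner.add_left cinner.add_right algebra_simps complex_eq_iff)
  then show "cinner x ((4 *\<^sub>C (adj a \<cdot> b)) y) = cinner x ((\<Sum>c\<in>{1, -1, \<i>, -\<i>}. cnj c *\<^sub>C (adj (a + c *\<^sub>C b) \<cdot> (a + c *\<^sub>C b))) y)"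
    using assms unfolding sum_apply cinner.sum_right by (simp add: cinner_adj_right blinfun.add_left del: adj_add adj_scaleC)
qed

text \<open>For a fixed point \<open>a\<close> the sequence \<open>P\<^sup>k (a\<^sup>* a)\<close> increases; the general case follows by polarization.\<close>

locale markov_map =
  fixes N :: "'i op set" and P :: "'i op \<Rightarrow> 'i op" and Z :: "('i, 'i \<times> 'r) hom"
  assumes N: "unital_star_algebra N" and Z: "Z \<in> clin" "norm (Z x) \<le> norm x"
    and P: "a \<in> N \<Longrightarrow> P a = adj Z \<cdot> (a \<otimes> \<one>) \<cdot> Z" and P_mem: "a \<in> N \<Longrightarrow> P a \<in> N"
begin

lemmas N' = star_algebraD[OF N]

lemma Nc: "a \<in> N \<Longrightarrow> a \<in> clin" using N'(1) by auto

lemma Pk_mem: "a \<in> N \<Longrightarrow> (P ^^ k) a \<in> N"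
  by (induction k) (auto intro: P_mem)

lemma P_lin: "a \<in> N \<Longrightarrow> b \<in> N \<Longrightarrow> P (c *\<^sub>C a + b) = c *\<^sub>C P a + P b"
  using Z(1) by (simp add: P N' Nc op_tensor_simps(1,3) blinfun_compose.add_left blinfun_compose.add_right)

lemma Pk_lin: "a \<in> N \<Longrightarrow> b \<in> N \<Longrightarrow> (P ^^ k) (c *\<^sub>C a + b) = c *\<^sub>C (P ^^ k) a + (P ^^ k) b"
  by (induction k) (auto simp: P_lin Pk_mem)

lemma P_adj: "a \<in> N \<Longrightarrow> P (adj a) = adj (P a)"
  using Z(1) by (simp add: P N' Nc op_tensor_simps(5) compose_assoc)

lemma Pk_adj: "a \<in> N \<Longrightarrow> (P ^^ k) (adj a) = adj ((P ^^ k) a)"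
  by (induction k) (auto simp: P_adj Pk_mem)

lemma norm_adj_Z: "norm (adj Z X) \<le> norm X"
proof (rule norm_le_cinnerI)
  show "cmod (cinner z (adj Z X)) \<le> norm X * norm z" for z
    using Z(1) order_trans[OF cinner_bound[of "Z z" X] mult_right_mono[OF Z(2)[of z] norm_ge_zero[of X]]] by (simp add: cinner_adj_right mult.commute)
qed simp

lemma P_norm: assumes a: "a \<in> N" shows "norm (P a) \<le> norm a"
proof (rule norm_blinfun_bound)
  fix x
  have "norm (P a x) \<le> norm ((a \<otimes> \<one>) (Z x))" using norm_adj_Z by (simp add: P a)
  also have "\<dots> \<le> norm a * norm (Z x)" by (rule amp_norm[OF Nc[OF a]])
  also have "\<dots> \<le> norm a * norm x" by (intro mult_left_mono Z) simp
  finally show "norm (P a x) \<le> norm a * norm x" .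
qed simp

lemma Pk_norm: "a \<in> N \<Longrightarrow> norm ((P ^^ k) a) \<le> norm a"
proof (induction k)
  case (Suc k)
  then show ?case using order_trans[OF P_norm[OF Pk_mem[OF Suc.prems, of k]] Suc.IH] by simp
qed simp

lemma Pk_pos: "a \<in> N \<Longrightarrow> (\<And>x. 0 \<le> Re (cinner x (a x))) \<Longrightarrow> 0 \<le> Re (cinner x ((P ^^ k) a x))"
proof (induction k arbitrary: x)
  case (Suc k)
  have "0 \<le> Re (cinner (Z x) (((P ^^ k) a \<otimes> \<one>) (Z x)))"
    by (rule amp_positive[OF Nc[OF Pk_mem[OF Suc.prems(1)]] Suc.IH[OF Suc.prems]])
  then show ?case using Z(1) Suc.prems(1) by (simp add: P Pk_mem cinner_adj_right)
qed simp

lemma square_converges: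
  assumes a: "a \<in> N" and fixed: "P a = a" shows "convergent (\<lambda>k. cinner x ((P ^^ k) (adj a \<cdot> a) x))"
proof -
  let ?T = "adj a \<cdot> a"
  have T: "?T \<in> N" using a by (intro N')
  have ac: "a \<in> clin" by (rule Nc[OF a])
  \<comment> \<open>The Kadison--Schwarz inequality at a fixed point: from
    \<open>a = adj Z \<cdot> (a \<otimes> \<one>) \<cdot> Z\<close> and contractivity of
    \<open>adj Z\<close>, the norm of \<open>a y\<close> is at most that of
    \<open>(a \<otimes> \<one>) (Z y)\<close>, whose square is the quadratic form of
    \<open>P (adj a \<cdot> a)\<close>.\<close>
  have "0 \<le> Re (cinner y ((P ?T - ?T) y))" for y
  proof -
    have "norm (a y) \<le> norm ((a \<otimes> \<one>) (Z y))"
    proof -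
      have "a y = adj Z ((a \<otimes> \<one>) (Z y))" using arg_cong[OF fixed, of "\<lambda>X. X y"] by (simp add: P[OF a])
      then show ?thesis using norm_adj_Z by simp
    qed
    then have "(norm (a y))\<^sup>2 \<le> (norm ((a \<otimes> \<one>) (Z y)))\<^sup>2" by (rule power_mono) simp
    moreover have "cinner y (P ?T y) = cinner ((a \<otimes> \<one>) (Z y)) ((a \<otimes> \<one>) (Z y))"
    proof -
      have "?T \<otimes> (\<one> :: 'r op) = adj (a \<otimes> \<one>) \<cdot> (a \<otimes> \<one>)" using ac by (simp add: op_tensor_simps(5) op_tensor_compose)
      then show ?thesis using Z(1) ac by (simp add: P[OF T] cinner_adj_right)
    qed
    ultimately show ?thesis using ac by (simp add: blinfun.diff_left cinner.diff_right cinner_adj_right cinner_self)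
  qed
  then have pos: "0 \<le> Re (cinner x ((P ^^ k) (P ?T - ?T) x))" for k
    by (intro Pk_pos N' P_mem T)
  have step: "Re (cinner x ((P ^^ k) ?T x)) \<le> Re (cinner x ((P ^^ Suc k) ?T x))" for k
  proof -
    have "(P ^^ k) ((- 1) *\<^sub>C ?T + P ?T) = (- 1) *\<^sub>C (P ^^ k) ?T + (P ^^ k) (P ?T)" by (rule Pk_lin[OF T P_mem[OF T]])
    then have "(P ^^ k) (P ?T - ?T) = (P ^^ Suc k) ?T - (P ^^ k) ?T" by (simp add: funpow_swap1)
    then show ?thesis using pos[of k] by (simp add: blinfun.diff_left cinner.diff_right)
  qed
  have bd: "Re (cinner x ((P ^^ k) ?T x)) \<le> norm x * (norm ?T * norm x)" for k
  proof -
    have "Re (cinner x ((P ^^ k) ?T x)) \<le> norm x * norm ((P ^^ k) ?T x)" using complex_Re_le_cmod cinner_bound order_trans by blast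
    also have "\<dots> \<le> norm x * (norm ?T * norm x)"
      by (intro mult_left_mono order_trans[OF norm_blinfun] mult_right_mono Pk_norm[OF T]) simp_all
    finally show ?thesis .
  qed
  have "incseq (\<lambda>k. Re (cinner x ((P ^^ k) ?T x)))" by (rule incseq_SucI) (rule step)
  then obtain r where r: "(\<lambda>k. Re (cinner x ((P ^^ k) ?T x))) \<longlonglongrightarrow> r" using incseq_convergent bd by blast
  have "cinner x ((P ^^ k) ?T x) = of_real (Re (cinner x ((P ^^ k) ?T x)))" for k
  proof -
    have sa: "adj ((P ^^ k) ?T) = (P ^^ k) ?T" using Pk_adj[OF T, of k] ac by simp
    have "cnj (cinner x ((P ^^ k) ?T x)) = cinner x (adj ((P ^^ k) ?T) x)" using Nc[OF Pk_mem[OF T]] by (simp add: cinner_cnj cinner_adj_right)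
    then have "cnj (cinner x ((P ^^ k) ?T x)) = cinner x ((P ^^ k) ?T x)" unfolding sa .
    then show ?thesis by (metis Reals_cnj_iff of_real_Re)
  qed
  then have "(\<lambda>k. cinner x ((P ^^ k) ?T x)) \<longlonglongrightarrow> of_real r" using tendsto_of_real[OF r, where 'a=complex] by simp
  then show ?thesis by (rule convergentI)
qed

lemma product_converges:
  assumes a: "a \<in> N" "P a = a" and b: "b \<in> N" "P b = b" shows "convergent (\<lambda>k. cinner x ((P ^^ k) (adj a \<cdot> b) y))"
proof -
  let ?C = "{1, -1, \<i>, -\<i>}" and ?h = "\<lambda>c. a + c *\<^sub>C b"
  have hN: "?h c \<in> N" for c using a b by (intro N')
  have hP: "P (?h c) = ?h c" for c using P_lin[OF b(1) a(1), of c] a b by (simp add: add.commute)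
  have hh: "adj (?h c) \<cdot> ?h c \<in> N" for c by (intro N' hN)
  have s: "(P ^^ k) (\<Sum>c\<in>F. g c *\<^sub>C T c) = (\<Sum>c\<in>F. g c *\<^sub>C (P ^^ k) (T c))" if "\<And>c. T c \<in> N" for F T and g :: "complex \<Rightarrow> complex" and k
  proof (induction F rule: infinite_finite_induct)
    case (insert c F)
    have "(\<Sum>c\<in>F. g c *\<^sub>C T c) \<in> N" by (intro star_algebra_sum[OF N] N' that)
    then show ?case using insert by (simp add: Pk_lin that)
  qed (use Pk_lin[of 0 0 k "- 1"] N'(7) in simp_all)
  have "adj a \<cdot> b \<in> N" using a b by (intro N')
  then have "4 *\<^sub>C (P ^^ k) (adj a \<cdot> b) = (P ^^ k) (4 *\<^sub>C (adj a \<cdot> b))" for k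
    using s[of "\<lambda>_. adj a \<cdot> b" k "\<lambda>_. 4" "{0}"] by simp
  then have e: "4 *\<^sub>C (P ^^ k) (adj a \<cdot> b) = (\<Sum>c\<in>?C. cnj c *\<^sub>C (P ^^ k) (adj (?h c) \<cdot> ?h c))" for k
    unfolding op_polarization[OF Nc[OF a(1)] Nc[OF b(1)]] s[OF hh] .
  \<comment> \<open>Polarization is used twice, once for the pair of operators and once for the pair
    of vectors; each use contributes a factor 4.\<close>
  have "cinner x ((P ^^ k) (adj a \<cdot> b) y) = (1 / 16) * (\<Sum>c\<in>?C. cnj c * (\<Sum>d\<in>?C. cnj d * cinner (x + cscale d y) ((P ^^ k) (adj (?h c) \<cdot> ?h c) (x + cscale d y))))" for k
  proof -
    have "16 * cinner x ((P ^^ k) (adj a \<cdot> b) y) = 4 * cinner x ((4 *\<^sub>C (P ^^ k) (adj a \<cdot> b)) y)" by simp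
    also have "\<dots> = (\<Sum>c\<in>?C. cnj c * (4 * cinner x ((P ^^ k) (adj (?h c) \<cdot> ?h c) y)))"
      unfolding e sum_apply cinner.sum_right sum_distrib_left by (intro sum.cong refl) simp
    finally have f: "16 * cinner x ((P ^^ k) (adj a \<cdot> b) y) = (\<Sum>c\<in>?C. cnj c * (\<Sum>d\<in>?C. cnj d * cinner (x + cscale d y) ((P ^^ k) (adj (?h c) \<cdot> ?h c) (x + cscale d y))))"
      unfolding polarization[OF Nc[OF Pk_mem[OF hh]]] .
    show ?thesis unfolding f[symmetric] by simp
  qed
  moreover have "convergent (\<lambda>k. (1 / 16) * (\<Sum>c\<in>?C. cnj c * (\<Sum>d\<in>?C. cnj d * cinner (x + cscale d y) ((P ^^ k) (adj (?h c) \<cdot> ?h c) (x + cscale d y)))))"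
  proof -
    have "\<forall>c d. \<exists>l. (\<lambda>k. cinner (x + cscale d y) ((P ^^ k) (adj (?h c) \<cdot> ?h c) (x + cscale d y))) \<longlonglongrightarrow> l"
      using square_converges[OF hN hP] unfolding convergent_def by blast
    then obtain l where l: "\<And>c d. (\<lambda>k. cinner (x + cscale d y) ((P ^^ k) (adj (?h c) \<cdot> ?h c) (x + cscale d y))) \<longlonglongrightarrow> l c d" by metis
    have "(\<lambda>k. (1 / 16) * (\<Sum>c\<in>?C. cnj c * (\<Sum>d\<in>?C. cnj d * cinner (x + cscale d y) ((P ^^ k) (adj (?h c) \<cdot> ?h c) (x + cscale d y)))))
      \<longlonglongrightarrow> (1 / 16) * (\<Sum>c\<in>?C. cnj c * (\<Sum>d\<in>?C. cnj d * l c d))"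
      by (intro tendsto_mult_left tendsto_sum l)
    then show ?thesis by (rule convergentI)
  qed
  ultimately show ?thesis by (simp only:)
qed

text \<open>Existence of the limit, without which the definite description of the product carries no
  information. The form of pointwise limits is bounded by the uniform norm bound on the iterates, so
  it is represented by an operator.\<close>

lemma product_limit:
  assumes a: "a \<in> N" "P a = a" and b: "b \<in> N" "P b = b"
  shows "\<exists>c\<in>clin. limitin sigma_weak (\<lambda>n. (1 / real n) *\<^sub>R (\<Sum>k = 1..n. (P ^^ k) (a \<cdot> b))) c sequentially"
proof -
  \<comment> \<open>Convergence was shown for products \<open>adj a \<cdot> b\<close>, so it is
    applied to \<open>adj a\<close>, which is again a fixed point.\<close>
  have aa: "adj a \<in> N" "P (adj a) = adj a" "adj (adj a) = a" using a N'(5) P_adj Nc by simp_all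
  let ?T = "\<lambda>k. (P ^^ k) (a \<cdot> b)"
  have ab: "a \<cdot> b \<in> N" using a b by (intro N')
  have Tc: "?T k \<in> clin" for k by (rule Nc[OF Pk_mem[OF ab]])
  define Q where "Q x y = lim (\<lambda>k. cinner x (?T k y))" for x y
  have Q: "(\<lambda>k. cinner x (?T k y)) \<longlonglongrightarrow> Q x y" for x y
    using product_converges[OF aa(1,2) b, of x y] unfolding aa(3) Q_def by (rule convergent_LIMSEQ_iff[THEN iffD1])
  have uniq: "Q x y = z" if "(\<lambda>k. cinner x (?T k y)) \<longlonglongrightarrow> z" for x y z by (rule LIMSEQ_unique[OF Q that])
  have "\<exists>c\<in>clin. \<forall>x y. cinner x (blinfun_apply c y) = Q x y"
  proof (rule form_op)
    show "bounded_bilinear Q"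
    proof
      show "Q (x + x') y = Q x y + Q x' y" for x x' y by (rule uniq) (simp add: cinner.add_left tendsto_add Q)
      show "Q x (y + y') = Q x y + Q x y'" for x y y' by (rule uniq) (simp add: cinner.add_right blinfun.add_right tendsto_add Q)
      show "Q (r *\<^sub>R x) y = r *\<^sub>R Q x y" for r x y by (rule uniq) (simp add: cinner.scaleR_left tendsto_scaleR Q)
      show "Q x (r *\<^sub>R y) = r *\<^sub>R Q x y" for r x y by (rule uniq) (simp add: cinner.scaleR_right blinfun.scaleR_right tendsto_scaleR Q)
      have "norm (Q x y) \<le> norm x * norm y * norm (a \<cdot> b)" for x y
      proof (rule LIMSEQ_le_const2[OF tendsto_norm[OF Q]])
        have "norm (cinner x (?T k y)) \<le> norm x * norm y * norm (a \<cdot> b)" for k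
        proof -
          have "norm (?T k y) \<le> norm (a \<cdot> b) * norm y"
            by (rule order_trans[OF norm_blinfun mult_right_mono[OF Pk_norm[OF ab]]]) simp
          from order_trans[OF cinner_bound mult_left_mono[OF this norm_ge_zero]] show ?thesis by (simp add: mult_ac)
        qed
        then show "\<exists>N. \<forall>k\<ge>N. norm (cinner x (?T k y)) \<le> norm x * norm y * norm (a \<cdot> b)" by blast
      qed
      then show "\<exists>K. \<forall>x y. norm (Q x y) \<le> norm x * norm y * K" by blast
    qed
    show "Q (cscale c x) y = cnj c * Q x y" for c x y by (rule uniq) (simp add: tendsto_mult_left Q)
    show "Q x (cscale c y) = c * Q x y" for c x y by (rule uniq) (simp add: clinD[OF Tc] tendsto_mult_left Q)
  qed
  then obtain c where c: "c \<in> clin" "\<forall>x y. cinner x (blinfun_apply c y) = Q x y" by (elim bexE)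
  have "limitin sigma_weak (\<lambda>n. (1 / real n) *\<^sub>R (\<Sum>k = 1..n. ?T k)) c sequentially"
    by (rule cesaro_sigma_weak[OF Tc Pk_norm[OF ab] c(1)]) (simp only: c(2) Q)
  then show ?thesis using c(1) by blast
qed

end

lemma poisson_prod_eqI:
  "limitin sigma_weak (\<lambda>n. (1 / real n) *\<^sub>R (\<Sum>k = 1..n. (P ^^ k) (a \<cdot> b))) c sequentially \<Longrightarrow> poisson_prod P a b = c"
  unfolding poisson_prod_def
  by (rule the_equality, assumption, rule limitin_Hausdorff_unique[OF _ _ trivial_limit_sequentially Hausdorff_sigma_weak])

section \<open>The product and the fixed points under \<rho>\<close>

context linking
begin

lemma markov_map_G2: "markov_map (linf G2) (markov G2 \<mu>) (D2.Z \<mu>)"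
  by (unfold_locales, rule linf_star, rule D2.Z_clin, rule D2.norm_Z, rule D2.markov_spatial, assumption, rule D2.markov_linf)

lemma Pk_\<rho>:
  assumes b: "b \<in> linf G2"
  shows "(markov_amp G1 \<mu> M ^^ k) (\<rho> b) = \<rho> ((markov G2 (map_pmf (inv \<phi>) \<mu>) ^^ k) b)"
  by (induction k) (simp_all add: markov_\<rho> markov_map.Pk_mem[OF markov_map_G2 b])

text \<open>The limit is constructed for the second group only. The map \<open>\<rho>\<close> is
  normal and turns each average there into the corresponding average on the other side, so it
  carries the limit along.\<close>

lemma poisson_prod_\<rho>:
  fixes \<mu> defines "\<mu>2 \<equiv> map_pmf (inv \<phi>) \<mu>"
  assumes a: "a \<in> poisson_boundary G2 \<mu>2" and b: "b \<in> poisson_boundary G2 \<mu>2"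
  shows "\<rho> (poisson_prod (markov G2 \<mu>2) a b) = poisson_prod (markov_amp G1 \<mu> M) (\<rho> a) (\<rho> b)"
proof -
  interpret P: markov_map "linf G2" "markov G2 \<mu>2" "D2.Z \<mu>2" by (rule markov_map_G2)
  have ab: "a \<in> linf G2" "b \<in> linf G2" "markov G2 \<mu>2 a = a" "markov G2 \<mu>2 b = b" using a b by (simp_all add: poisson_boundary_def)
  let ?A = "\<lambda>n. (1 / real n) *\<^sub>R (\<Sum>k = 1..n. (markov G2 \<mu>2 ^^ k) (a \<cdot> b))"
  obtain c where c: "c \<in> clin" "limitin sigma_weak ?A c sequentially"
    using P.product_limit[OF ab(1,3,2,4)] by (elim bexE)
  have m: "(markov G2 \<mu>2 ^^ k) (a \<cdot> b) \<in> linf G2" for k using ab by (intro P.Pk_mem P.N')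
  have Ac: "?A n \<in> clin" for n using P.Nc[OF m] by simp
  have n: "normal_on clin \<rho>"
    by (rule normal_spatial_left[OF subset_refl W_unitary(1) _ adj_clin[OF W_unitary(1)]]) (rule \<rho>_def)
  have "limitin (subtopology sigma_weak clin) ?A c sequentially"
    using c Ac by (simp add: limitin_subtopology)
  then have "limitin sigma_weak (\<rho> \<circ> ?A) (\<rho> c) sequentially" by (rule continuous_map_limit[OF n[unfolded normal_on_def]])
  moreover have "\<rho> (?A n) = (1 / real n) *\<^sub>R (\<Sum>k = 1..n. (markov_amp G1 \<mu> M ^^ k) (\<rho> a \<cdot> \<rho> b))" for n
  proof -
    have rr: "\<rho> (r *\<^sub>R T) = r *\<^sub>R \<rho> T" if "T \<in> linf G2" for r T
      unfolding scaleC_simps(5)[symmetric] using \<rho>_linear that unfolding linear_map_on_def by blast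
    have "\<rho> (?A n) = (1 / real n) *\<^sub>R \<rho> (\<Sum>k = 1..n. (markov G2 \<mu>2 ^^ k) (a \<cdot> b))"
      by (rule rr[OF star_algebra_sum[OF linf_star m]])
    also have "\<rho> (\<Sum>k = 1..n. (markov G2 \<mu>2 ^^ k) (a \<cdot> b)) = (\<Sum>k = 1..n. \<rho> ((markov G2 \<mu>2 ^^ k) (a \<cdot> b)))"
      by (rule linear_map_on_sum[OF \<rho>_linear linf_star m])
    also have "\<dots> = (\<Sum>k = 1..n. (markov_amp G1 \<mu> M ^^ k) (\<rho> a \<cdot> \<rho> b))"
      using ab P.Nc star_algebraD(4)[OF linf_star ab(1,2)] by (simp add: Pk_\<rho> \<mu>2_def flip: \<rho>_mult)
    finally show ?thesis .
  qed
  ultimately have "limitin sigma_weak (\<lambda>n. (1 / real n) *\<^sub>R (\<Sum>k = 1..n. (markov_amp G1 \<mu> M ^^ k) (\<rho> a \<cdot> \<rho> b))) (\<rho> c) sequentially"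
    by (simp only: o_def)
  then show ?thesis unfolding poisson_prod_eqI[OF c(2)] by (rule poisson_prod_eqI[symmetric])
qed

lemma \<rho>_bij:
  fixes \<mu> defines "\<mu>2 \<equiv> map_pmf (inv \<phi>) \<mu>"
  shows "bij_betw \<rho> (poisson_boundary G2 \<mu>2) (poisson_boxtimes G1 \<mu> M \<delta>1)"
  unfolding bij_betw_def
proof (intro conjI set_eqI iffI inj_onI)
  fix a b assume "a \<in> poisson_boundary G2 \<mu>2" "b \<in> poisson_boundary G2 \<mu>2" "\<rho> a = \<rho> b"
  then show "a = b" by (intro \<rho>_inject) (auto simp: poisson_boundary_def linf_iff)
next
  fix t assume "t \<in> \<rho> ` poisson_boundary G2 \<mu>2"
  then obtain b where b: "b \<in> linf G2" "markov G2 \<mu>2 b = b" "t = \<rho> b" by (auto simp: poisson_boundary_def)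
  have bc: "b \<in> clin" using b(1) by (simp add: linf_iff)
  have "markov_amp G1 \<mu> M (\<rho> b) = \<rho> b" using markov_\<rho>[OF b(1), of \<mu>] b(2) by (simp add: \<mu>2_def)
  then show "t \<in> poisson_boxtimes G1 \<mu> M \<delta>1"
    using \<rho>_mem[OF b(1)] equivariant_iff[OF \<rho>_mem[OF b(1)], THEN iffD2] \<delta>1_blk_\<rho>[OF bc]
    by (simp add: b(3) poisson_boxtimes_def poisson_tensor_def)
next
  fix t assume t: "t \<in> poisson_boxtimes G1 \<mu> M \<delta>1"
  then have tm: "t \<in> linf G1 \<otimes>\<^sub>v\<^sub>N M" and tf: "markov_amp G1 \<mu> M t = t" by (simp_all add: poisson_boxtimes_def poisson_tensor_def)
  have "\<exists>b\<in>linf G2. \<rho> b = t"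
  proof (rule \<rho>_onto[OF tm])
    fix p q
    show "\<delta>1 (blk p q t) = (\<Sum>f\<in>G1.cls p. \<Sum>f'\<in>G1.cls q. (G1.gU p f \<cdot> adj (G1.gU q f')) \<otimes> blk f f' t)"
      using t by (intro equivariant_iff[OF tm, THEN iffD1, rule_format]) (simp add: poisson_boxtimes_def)
  qed
  then obtain b where b: "b \<in> linf G2" "\<rho> b = t" by (elim bexE)
  have m: "markov G2 \<mu>2 b \<in> linf G2" by (rule D2.markov_linf[OF b(1)])
  \<comment> \<open>Invariance of the preimage under its own Markov operator follows because
    \<open>\<rho>\<close> is injective on bounded operators.\<close>
  have "\<rho> (markov G2 \<mu>2 b) = \<rho> b" using markov_\<rho>[OF b(1), of \<mu>] b(2) tf by (simp add: \<mu>2_def)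
  then have "markov G2 \<mu>2 b = b" using m b(1) by (intro \<rho>_inject) (auto simp: linf_iff)
  then show "t \<in> \<rho> ` poisson_boundary G2 \<mu>2" using b by (intro image_eqI[of _ _ b]) (simp_all add: poisson_boundary_def)
qed

end

theorem theorem8p2:
  fixes G1 :: "('k1, 'x1, 'e1, 'i1) cqg_reps"
    and G2 :: "('k2, 'x2, 'e2, 'i2) cqg_reps"
    and \<phi> :: "'x2 \<Rightarrow> 'x1"
    and \<Phi> :: "'x2 list \<Rightarrow> 'x2 list \<Rightarrow> ('e2 list, 'e2 list) mat \<Rightarrow> ('e1 list, 'e1 list) mat"
    and L :: "('b, 'j, 'e1, 'e2) link"
    and \<delta>1 :: "'j op \<Rightarrow> ('i1 \<times> 'j) op"
    and \<delta>2 :: "'j op \<Rightarrow> ('j \<times> 'i2) op"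
    and \<mu> :: "'x1 pmf"
  assumes "cqg_with_reps G1" and "cqg_with_reps G2"
    and "monoidal_equivalence G2 G1 \<phi> \<Phi>"
    and "link_algebra G1 G2 \<phi> \<Phi> L"
    and "link_action1 G1 G2 \<phi> L \<delta>1" and "link_action2 G1 G2 \<phi> L \<delta>2"
    and "generating G1 \<mu>"
  defines "B \<equiv> link_vn L"
    and "\<mu>2 \<equiv> map_pmf (inv \<phi>) \<mu>"
  defines "\<rho> \<equiv> \<lambda>b. link_unitary G1 G2 \<phi> L o\<^sub>L (b \<otimes>\<^sub>o id_blinfun) o\<^sub>L adj (link_unitary G1 G2 \<phi> L)"
  shows "bij_betw \<rho> (poisson_boundary G2 \<mu>2) (poisson_boxtimes G1 \<mu> B \<delta>1)
    \<and> linear_map_on (poisson_boundary G2 \<mu>2) \<rho>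
    \<and> (\<forall>a\<in>poisson_boundary G2 \<mu>2. \<forall>b\<in>poisson_boundary G2 \<mu>2.
         \<rho> (poisson_prod (markov G2 \<mu>2) a b) = poisson_prod (markov_amp G1 \<mu> B) (\<rho> a) (\<rho> b))
    \<and> (\<forall>b\<in>poisson_boundary G2 \<mu>2. \<rho> (adj b) = adj (\<rho> b))
    \<and> (\<forall>b\<in>poisson_boundary G2 \<mu>2.
         tensor_map (linf G1) B (\<lambda>a. a) \<delta>2 (\<rho> b) =
           assoc_op (tensor_map (linf G2) (Linf G2) \<rho> (\<lambda>c. c) (adjoint_action G2 b)))"
proof -
  interpret K: linking G1 G2 \<phi> \<Phi> L \<delta>1 \<delta>2
    using assms(1-6) by unfold_locales (simp_all add: monoidal_equivalence_def)
  have \<rho>: "\<rho> = K.\<rho>" by (simp add: fun_eq_iff \<rho>_def K.\<rho>_def)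
  have sub: "poisson_boundary G2 \<mu>2 \<subseteq> linf G2" by (auto simp: poisson_boundary_def)
  show ?thesis unfolding \<rho> B_def \<mu>2_def
  proof (intro conjI ballI)
    show "bij_betw K.\<rho> (poisson_boundary G2 (map_pmf (inv \<phi>) \<mu>)) (poisson_boxtimes G1 \<mu> (link_vn L) \<delta>1)"
      by (rule K.\<rho>_bij)
    show "linear_map_on (poisson_boundary G2 (map_pmf (inv \<phi>) \<mu>)) K.\<rho>"
      using K.\<rho>_linear sub unfolding linear_map_on_def \<mu>2_def by blast
    fix b assume b: "b \<in> poisson_boundary G2 (map_pmf (inv \<phi>) \<mu>)"
    then have bl: "b \<in> linf G2" using sub unfolding \<mu>2_def by blast
    show "K.\<rho> (adj b) = adj (K.\<rho> b)" using bl by (intro K.\<rho>_adj) (simp add: linf_iff)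
    show "tensor_map (linf G1) (link_vn L) (\<lambda>a. a) \<delta>2 (K.\<rho> b) = assoc_op (tensor_map (linf G2) (Linf G2) K.\<rho> (\<lambda>c. c) (adjoint_action G2 b))"
      by (rule K.\<delta>2_intertwines[OF bl])
  qed (rule K.poisson_prod_\<rho>)
qed

end
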